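(* In the setting of the context, assume that the driving Volterra Gaussian process satisfies (Cov), (CM) and (Filt), and that $f\in C_b^2(\mathbb R^{d_X}\times\mathbb R^{d_Y},\mathbb R^{d_Y})$, $\sigma\in C_b^{\kappa+1}(\mathbb R^{d_X}\times\mathbb R^{d_Y},\mathrm{Hom}(\mathbb R^{d_B},\mathbb R^{d_X}))$ with $\kappa=\lfloor p\rfloor$. Then, for every bounded measurable $\phi:\mathbb R^{d_X}\to\mathbb R$ and every $t\in[0,T]$, $$\pi_t(\phi):=\mathbb E^{\mathbb P}[\phi(X_t)\mid\mathcal Y_t]=\frac{\mathbb E^{\mathbb Q}[\phi(X_t)\Lambda_t\mid\mathcal Y]}{\mathbb E^{\mathbb Q}[\Lambda_t\mid\mathcal Y]}\qquad\mathbb Q\text{-a.s.}$$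
   Context: **Volterra Gaussian processes.** Fix $T>0$ and $K\in L^2([0,T]^2)$ with $K(t,s)=0$ for $s>t$. An $\mathbb R^d$-valued centred continuous Gaussian process $I$ is a Volterra Gaussian process with kernel $K$ if $\mathbb E[I^k_sI^j_t]=\delta_{kj}C(s,t)$, $C(s,t)=\int_0^{s\wedge t}K(t,r)K(s,r)\,dr$. Write $(Kh)(t)=\int_0^tK(t,s)h_s\,ds$. $\mathfrak H^d$ is the Cameron--Martin space of $I$; $\mathfrak H^d_1$ is the completion of the span of $1^k_{[0,s]}:=1_{[0,s]}e_k$ under $\langle 1^k_{[0,s]},1^j_{[0,t]}\rangle=\delta_{kj}C(s,t)$; $h\mapsto I(h)$ is the isonormal process on $\mathfrak H_1^d$ with $I(1^k_{[0,t]})=I^k_t$; $K^*:\mathfrak H_1^d\to L^2([0,T],\mathbb R^d)$ is the linear isometry with $K^*1^k_{[0,t]}=K(t,\cdot)e_k$. **Conditions.** (Cov): either (A) for some $p\in[1,2)$, a.s. $I$ is in the $p$-variation closure of the bounded-variation paths (then its lift $\mathbf I$ is $I$ itself); or (B) for some $\rho\in[1,2)$, $C$ has finite two-dimensional $\rho$-variation on $[0,T]^2$ (then $p\in(2\rho,4)$ is fixed and $\mathbf I$ is the canonical Gaussian geometric $p$-rough path lift). (CM): there are $q\ge1$, $c>0$ with $\frac1p+\frac1q>1$ and $\|h\|_{q\text{-var};[0,T]}\le c\|h\|_{\mathfrak H^d}$ for $h\in\mathfrak H^d$. (Filt): $1_{[0,t]}\in\mathrm{Range}(K^* )$ for all $t$;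 then $V^k_t=I((K^* )^{-1}1^k_{[0,t]})$ is a Brownian motion with $I_t=\int_0^tK(t,s)dV_s$ generating the same completed filtration as $I$, called the Brownian motion associated to $I$. **Signal and observation.** On $(\Omega,\mathcal F,\mathbb P)$, $(B,U)$ is a Volterra Gaussian process with kernel $K$ valued in $\mathbb R^{d_B}\times\mathbb R^{d_Y}$ (all components i.i.d.), independent of $x_0\in\bigcap_{r\ge1}L^r(\Omega,\mathbb R^{d_X})$; $(\mathcal F_t)$ is the usual augmentation of the filtration generated by $x_0,B,U$. $(X,Y)$ is the $(\mathcal F_t)$-adapted solution, unique path by path, of $$X_t=x_0+\int_0^t\sigma(X,Y)_s\,d\mathbf B_s,\qquad Y_t=\int_0^tK(t,s)f(X_s,Y_s)\,ds+U_t,$$ understood as a rough differential equation driven by the joint lift of $(B,U)$ in the sense of controlled rough paths (Gubinelli derivative $\mathrm{diag}(\sigma(X,Y),\mathrm{Id})$, higher derivatives by composition, the Volterra drift having finite $q$-variation and entering only the remainder). **Reference measure.** Let $V^U$ be the $\mathbb P$-Brownian motion associated to $U$ and $W_t=V^U_t+\int_0^tf(X_s,Y_s)\,ds$. $\mathbb Q\sim\mathbb P$ is defined by $\frac{d\mathbb P}{d\mathbb Q}\big|_{\mathcal F_t}=\Lambda_t:=\exp\big(\sum_{j=1}^{d_Y}\int_0^tf_j(X_s,Y_s)\,dW^j_s-\frac12\sum_{j=1}^{d_Y}\int_0^tf_j(X_s,Y_s)^2\,ds\big)$ (Itô integrals). Under $\mathbb Q$, $(B,Y)$ is a Volterra Gaussian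 process with kernel $K$ and $W^i_t=Y((K^* )^{-1}1^i_{[0,t]})$ is the Brownian motion associated to $Y$. **Filtrations.** $\mathcal Y_t=\sigma(Y_s:0\le s\le t)\vee\mathscr Z$, $\mathcal Y=\sigma(Y_s:0\le s\le T)\vee\mathscr Z$, with $\mathscr Z$ the $\mathbb P$-null sets. *)

theory Defs
  imports "HOL-Probability.Probability" "HOL-Library.Poly_Mapping"
begin

section \<open>Partitions, variation, function spaces\<close>

definition partition_of :: "real \<Rightarrow> real \<Rightarrow> real list \<Rightarrow> bool" where
  "partition_of a b ts \<longleftrightarrow> ts \<noteq> [] \<and> hd ts = a \<and> last ts = b \<and> sorted_wrt (<) ts"

definition mesh_less :: "real \<Rightarrow> real list \<Rightarrow> bool" where
  "mesh_less \<delta> ts \<longleftrightarrow> (\<forall>i<length ts - 1. ts ! Suc i - ts ! i < \<delta>)"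

definition pvar2 :: "real \<Rightarrow> real \<Rightarrow> real \<Rightarrow> (real \<Rightarrow> real \<Rightarrow> 'a::real_normed_vector) \<Rightarrow> ennreal" where
  "pvar2 r a b A = (SUP ts\<in>{ts. partition_of a b ts}.
     ennreal ((\<Sum>i<length ts - 1. norm (A (ts ! i) (ts ! Suc i)) powr r) powr (1 / r)))"

definition pvar :: "real \<Rightarrow> real \<Rightarrow> real \<Rightarrow> (real \<Rightarrow> 'a::real_normed_vector) \<Rightarrow> ennreal" where
  "pvar r a b x = pvar2 r a b (\<lambda>s t. x t - x s)"

text \<open>Two-dimensional variation of a function on a square, over grid-like partitions.\<close>

definition rhovar2d :: "real \<Rightarrow> real \<Rightarrow> real \<Rightarrow> (real \<Rightarrow> real \<Rightarrow> real) \<Rightarrow> ennreal" where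
  "rhovar2d \<rho> a b C = (SUP (ts, us)\<in>{ts. partition_of a b ts} \<times> {us. partition_of a b us}.
     ennreal ((\<Sum>i<length ts - 1. \<Sum>j<length us - 1.
        \<bar>C (ts ! Suc i) (us ! Suc j) - C (ts ! Suc i) (us ! j)
          - C (ts ! i) (us ! Suc j) + C (ts ! i) (us ! j)\<bar> powr \<rho>) powr (1 / \<rho>)))"

text \<open>\<open>Cb k f\<close>: all partial derivatives of \<open>f\<close> of order at most \<open>k\<close> (order 0 included)
  exist, are continuous and bounded.\<close>

fun Cb :: "nat \<Rightarrow> ('a::euclidean_space \<Rightarrow> 'b::euclidean_space) \<Rightarrow> bool" where
  "Cb 0 f \<longleftrightarrow> continuous_on UNIV f \<and> bounded (range f)"
| "Cb (Suc k) f \<longleftrightarrow> continuous_on UNIV f \<and> bounded (range f) \<and> (\<forall>x. f differentiable (at x)) \<and>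
     (\<forall>b\<in>Basis. Cb k (\<lambda>x. frechet_derivative f (at x) b))"


section \<open>Modes of convergence\<close>

text \<open>Convergence to zero in probability. The exceptional events are covered by measurable sets,
  so that no measurability of the suprema over partitions is presupposed.\<close>

definition tends_in_prob0 :: "'w measure \<Rightarrow> (nat \<Rightarrow> 'w \<Rightarrow> ennreal) \<Rightarrow> bool" where
  "tends_in_prob0 M D \<longleftrightarrow> (\<forall>\<epsilon>>0. \<exists>A. (\<forall>n. A n \<in> sets M \<and> {\<omega>\<in>space M. ennreal \<epsilon> < D n \<omega>} \<subseteq> A n)
     \<and> (\<lambda>n. measure M (A n)) \<longlonglongrightarrow> 0)"

definition square_integrable :: "'w measure \<Rightarrow> ('w \<Rightarrow> 'a::euclidean_space) \<Rightarrow> bool" where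
  "square_integrable M Z \<longleftrightarrow> Z \<in> borel_measurable M \<and> integrable M (\<lambda>\<omega>. (norm (Z \<omega>))\<^sup>2)"

definition L2_tendsto :: "'w measure \<Rightarrow> (nat \<Rightarrow> 'w \<Rightarrow> 'a::euclidean_space) \<Rightarrow> ('w \<Rightarrow> 'a) \<Rightarrow> bool" where
  "L2_tendsto M F Z \<longleftrightarrow> (\<forall>n. square_integrable M (F n)) \<and> square_integrable M Z \<and>
     (\<lambda>n. \<integral>\<omega>. (norm (F n \<omega> - Z \<omega>))\<^sup>2 \<partial>M) \<longlonglongrightarrow> 0"


section \<open>Volterra Gaussian processes\<close>

text \<open>Square integrability of \<open>K t\<close> for every (not only almost every) \<open>t\<close> is what makes the
  covariance function below finite.\<close>

definition volterra_kernel :: "real \<Rightarrow> (real \<Rightarrow> real \<Rightarrow> real) \<Rightarrow> bool" where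
  "volterra_kernel T K \<longleftrightarrow>
     square_integrable (restrict_space (lborel \<Otimes>\<^sub>M lborel) ({0..T} \<times> {0..T})) (\<lambda>(t, s). K t s) \<and>
     (\<forall>t\<in>{0..T}. square_integrable (restrict_space lborel {0..T}) (K t)) \<and>
     (\<forall>t\<in>{0..T}. \<forall>s\<in>{0..T}. t < s \<longrightarrow> K t s = 0)"

definition volterra_cov :: "(real \<Rightarrow> real \<Rightarrow> real) \<Rightarrow> real \<Rightarrow> real \<Rightarrow> real" where
  "volterra_cov K s t = (LINT r:{0..min s t}|lborel. K t r * K s r)"

definition volterra_op :: "(real \<Rightarrow> real \<Rightarrow> real) \<Rightarrow> (real \<Rightarrow> 'a::euclidean_space) \<Rightarrow> real \<Rightarrow> 'a" where
  "volterra_op K h t = (LINT s:{0..t}|lborel. K t s *\<^sub>R h s)"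

text \<open>The span of the symbols \<open>1\<^sup>k\<^bsub>[0,s]\<^esub>\<close>, as the free vector space on the pairs \<open>(k, s)\<close>.\<close>

type_synonym 'n step = "('n \<times> real) \<Rightarrow>\<^sub>0 real"

definition steps :: "real \<Rightarrow> 'n step set" where
  "steps T = {a. Poly_Mapping.keys a \<subseteq> UNIV \<times> {0..T}}"

definition step_apply :: "(real \<Rightarrow> 'w \<Rightarrow> real^'n) \<Rightarrow> 'n step \<Rightarrow> 'w \<Rightarrow> real" where
  "step_apply I a \<omega> = (\<Sum>(k, s)\<in>Poly_Mapping.keys a. Poly_Mapping.lookup a (k, s) * I s \<omega> $ k)"

definition centred_normal :: "'w measure \<Rightarrow> ('w \<Rightarrow> real) \<Rightarrow> bool" where
  "centred_normal M Z \<longleftrightarrow> Z \<in> borel_measurable M \<and>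
     ((AE \<omega> in M. Z \<omega> = 0) \<or> (\<exists>\<sigma>>0. distributed M lborel Z (normal_density 0 \<sigma>)))"

definition volterra_gaussian ::
    "'w measure \<Rightarrow> real \<Rightarrow> (real \<Rightarrow> real \<Rightarrow> real) \<Rightarrow> (real \<Rightarrow> 'w \<Rightarrow> real^'n) \<Rightarrow> bool" where
  "volterra_gaussian M T K I \<longleftrightarrow>
     (\<forall>t\<in>{0..T}. I t \<in> borel_measurable M) \<and>
     (\<forall>\<omega>\<in>space M. continuous_on {0..T} (\<lambda>t. I t \<omega>)) \<and>
     (\<forall>a\<in>steps T. centred_normal M (step_apply I a)) \<and>
     (\<forall>s\<in>{0..T}. \<forall>t\<in>{0..T}. \<forall>k j.
        (\<integral>\<omega>. I s \<omega> $ k * I t \<omega> $ j \<partial>M) = (if k = j then volterra_cov K s t else 0))"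


subsection \<open>Cameron--Martin space\<close>

definition first_chaos :: "'w measure \<Rightarrow> real \<Rightarrow> (real \<Rightarrow> 'w \<Rightarrow> real^'n) \<Rightarrow> ('w \<Rightarrow> real) set" where
  "first_chaos M T I = {Z. \<exists>a. (\<forall>n. a n \<in> steps T) \<and> L2_tendsto M (\<lambda>n. step_apply I (a n)) Z}"

text \<open>\<open>h\<close> lies in the Cameron--Martin space of \<open>I\<close> and has norm \<open>r\<close> there.\<close>

definition cameron_martin ::
    "'w measure \<Rightarrow> real \<Rightarrow> (real \<Rightarrow> 'w \<Rightarrow> real^'n) \<Rightarrow> (real \<Rightarrow> real^'n) \<Rightarrow> real \<Rightarrow> bool" where
  "cameron_martin M T I h r \<longleftrightarrow> (\<exists>Z\<in>first_chaos M T I.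
     (\<forall>t\<in>{0..T}. h t = (\<integral>\<omega>. Z \<omega> *\<^sub>R I t \<omega> \<partial>M)) \<and> r = sqrt (\<integral>\<omega>. (Z \<omega>)\<^sup>2 \<partial>M))"

definition cond_CM ::
    "'w measure \<Rightarrow> real \<Rightarrow> (real \<Rightarrow> 'w \<Rightarrow> real^'n) \<Rightarrow> real \<Rightarrow> real \<Rightarrow> real \<Rightarrow> bool" where
  "cond_CM M T I p q c \<longleftrightarrow> q \<ge> 1 \<and> c > 0 \<and> 1 / p + 1 / q > 1 \<and>
     (\<forall>h r. cameron_martin M T I h r \<longrightarrow> pvar q 0 T h \<le> ennreal (c * r))"


subsection \<open>The space of integrands, the isonormal process and the associated Brownian motion\<close>

text \<open>Elements of the completion \<open>\<HH>\<^sub>1\<close> of the span of the \<open>1\<^sup>k\<^bsub>[0,s]\<^esub>\<close> are represented by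
  Cauchy sequences in that span.\<close>

definition h1_inner :: "(real \<Rightarrow> real \<Rightarrow> real) \<Rightarrow> 'n step \<Rightarrow> 'n step \<Rightarrow> real" where
  "h1_inner K a b = (\<Sum>(k, s)\<in>Poly_Mapping.keys a. \<Sum>(j, t)\<in>Poly_Mapping.keys b.
     Poly_Mapping.lookup a (k, s) * Poly_Mapping.lookup b (j, t) *
     (if k = j then volterra_cov K s t else 0))"

definition h1_point :: "(real \<Rightarrow> real \<Rightarrow> real) \<Rightarrow> real \<Rightarrow> (nat \<Rightarrow> 'n step) \<Rightarrow> bool" where
  "h1_point K T a \<longleftrightarrow> (\<forall>n. a n \<in> steps T) \<and>
     (\<forall>\<epsilon>>0. \<exists>N. \<forall>m\<ge>N. \<forall>n\<ge>N. sqrt (h1_inner K (a m - a n) (a m - a n)) < \<epsilon>)"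

definition Kstar_step :: "(real \<Rightarrow> real \<Rightarrow> real) \<Rightarrow> 'n::finite step \<Rightarrow> real \<Rightarrow> real^'n" where
  "Kstar_step K a r = (\<Sum>(k, s)\<in>Poly_Mapping.keys a.
     (Poly_Mapping.lookup a (k, s) * K s r) *\<^sub>R axis k 1)"

text \<open>\<open>Kstar K T a g\<close>: the point of \<open>\<HH>\<^sub>1\<close> represented by \<open>a\<close> is mapped to \<open>g\<close> by \<open>K\<^sup>*\<close>.\<close>

definition Kstar ::
    "(real \<Rightarrow> real \<Rightarrow> real) \<Rightarrow> real \<Rightarrow> (nat \<Rightarrow> 'n::finite step) \<Rightarrow> (real \<Rightarrow> real^'n) \<Rightarrow> bool" where
  "Kstar K T a g \<longleftrightarrow> h1_point K T a \<and>
     L2_tendsto (restrict_space lborel {0..T}) (\<lambda>n. Kstar_step K (a n)) g"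

text \<open>\<open>isonormal M K T I a Z\<close>: \<open>Z = I(h)\<close> almost surely, \<open>h\<close> being represented by \<open>a\<close>.\<close>

definition isonormal :: "'w measure \<Rightarrow> (real \<Rightarrow> real \<Rightarrow> real) \<Rightarrow> real \<Rightarrow> (real \<Rightarrow> 'w \<Rightarrow> real^'n) \<Rightarrow>
    (nat \<Rightarrow> 'n step) \<Rightarrow> ('w \<Rightarrow> real) \<Rightarrow> bool" where
  "isonormal M K T I a Z \<longleftrightarrow> h1_point K T a \<and> L2_tendsto M (\<lambda>n. step_apply I (a n)) Z"

definition ind_upto :: "'n::finite \<Rightarrow> real \<Rightarrow> real \<Rightarrow> real^'n" where
  "ind_upto k t r = indicator {0..t} r *\<^sub>R axis k 1"

text \<open>A continuous version of \<open>V\<^sup>k\<^sub>t = I((K\<^sup>*)\<^sup>-\<^sup>1 1\<^sup>k\<^bsub>[0,t]\<^esub>)\<close>.\<close>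

definition associated_bm :: "'w measure \<Rightarrow> real \<Rightarrow> (real \<Rightarrow> real \<Rightarrow> real) \<Rightarrow>
    (real \<Rightarrow> 'w \<Rightarrow> real^'n::finite) \<Rightarrow> (real \<Rightarrow> 'w \<Rightarrow> real^'n) \<Rightarrow> bool" where
  "associated_bm M T K I V \<longleftrightarrow>
     (\<forall>t\<in>{0..T}. V t \<in> borel_measurable M) \<and>
     (\<forall>\<omega>\<in>space M. continuous_on {0..T} (\<lambda>t. V t \<omega>)) \<and>
     (\<forall>t\<in>{0..T}. \<forall>k. \<exists>a. Kstar K T a (ind_upto k t) \<and> isonormal M K T I a (\<lambda>\<omega>. V t \<omega> $ k))"


section \<open>Filtrations\<close>

definition gen_events :: "'w measure \<Rightarrow> ('w \<Rightarrow> 'a::topological_space) \<Rightarrow> 'w set set" where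
  "gen_events M Z = {Z -` A \<inter> space M |A. A \<in> sets borel}"

definition past_events :: "'w measure \<Rightarrow> (real \<Rightarrow> 'w \<Rightarrow> 'a::topological_space) \<Rightarrow> real \<Rightarrow> 'w set set" where
  "past_events M Z t = (\<Union>s\<in>{0..t}. gen_events M (Z s))"

definition completed_past :: "'w measure \<Rightarrow> (real \<Rightarrow> 'w \<Rightarrow> 'a::topological_space) \<Rightarrow> real \<Rightarrow> 'w measure" where
  "completed_past M Z t = sigma (space M) (past_events M Z t \<union> null_sets M)"

text \<open>Usual augmentation (null sets, right limits) of the filtration generated by an initial
  value and a process on \<open>[0,T]\<close>, frozen after time \<open>T\<close>.\<close>

definition usual_augmentation ::
    "'w measure \<Rightarrow> real \<Rightarrow> ('w \<Rightarrow> 'b::topological_space) \<Rightarrow> (real \<Rightarrow> 'w \<Rightarrow> 'a::topological_space) \<Rightarrow>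
     real \<Rightarrow> 'w measure" where
  "usual_augmentation M T x0 Z t = sigma (space M)
     (\<Inter>s\<in>{t<..}. sigma_sets (space M) (gen_events M x0 \<union> past_events M Z (min s T) \<union> null_sets M))"

text \<open>The kernel condition \<open>1\<^bsub>[0,t]\<^esub> \<in> Range K\<^sup>*\<close> alone does not force \<open>V\<close> to be adapted to the
  filtration of \<open>I\<close>: the preimage of \<open>1\<^bsub>[0,t]\<^esub>\<close> may involve times later than \<open>t\<close>. Equality of the
  completed filtrations is therefore part of the condition.\<close>

definition cond_Filt :: "'w measure \<Rightarrow> real \<Rightarrow> (real \<Rightarrow> real \<Rightarrow> real) \<Rightarrow>
    (real \<Rightarrow> 'w \<Rightarrow> real^'n::finite) \<Rightarrow> bool" where
  "cond_Filt M T K I \<longleftrightarrow>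
     (\<forall>t\<in>{0..T}. \<forall>k::'n. \<exists>a. Kstar K T a (ind_upto k t)) \<and>
     (\<exists>V. associated_bm M T K I V \<and>
       (\<forall>t\<in>{0..T}. sets (completed_past M V t) = sets (completed_past M I t)))"


section \<open>Rough paths\<close>

text \<open>A two-parameter family of tensors truncated at level \<open>nat \<lfloor>p\<rfloor>\<close> is given by its coordinates,
  indexed by words in the coordinate directions: \<open>R s t [i, j]\<close> plays the role of
  \<open>\<integral>\<^bsub>s<u<v<t\<^esub> dx\<^sup>i\<^sub>u dx\<^sup>j\<^sub>v\<close>.\<close>

type_synonym 'n tensor_path = "real \<Rightarrow> real \<Rightarrow> 'n list \<Rightarrow> real"

abbreviation level :: "real \<Rightarrow> nat" where
  "level p \<equiv> nat \<lfloor>p\<rfloor>"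

text \<open>Iterated integrals of a piecewise smooth path; the word is in reversed order.\<close>

fun iter_int :: "(real \<Rightarrow> real^'n) \<Rightarrow> real \<Rightarrow> 'n list \<Rightarrow> real \<Rightarrow> real" where
  "iter_int x s [] t = 1"
| "iter_int x s (i # w) t =
     (LINT r:{s..t}|lborel. iter_int x s w r * vector_derivative x (at r) $ i)"

definition signature :: "(real \<Rightarrow> real^'n) \<Rightarrow> 'n tensor_path" where
  "signature x s t w = iter_int x s (rev w) t"

fun pl_interp :: "real list \<Rightarrow> (real \<Rightarrow> 'a::real_vector) \<Rightarrow> real \<Rightarrow> 'a" where
  "pl_interp (s # t # ts) x r =
     (if r \<le> t then x s + ((r - s) / (t - s)) *\<^sub>R (x t - x s) else pl_interp (t # ts) x r)"
| "pl_interp [s] x r = x s"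
| "pl_interp [] x r = 0"

definition rp_dist :: "real \<Rightarrow> real \<Rightarrow> 'n tensor_path \<Rightarrow> 'n tensor_path \<Rightarrow> ennreal" where
  "rp_dist p T R R' = (\<Sum>w\<in>{w. 1 \<le> length w \<and> length w \<le> level p}.
     pvar2 (p / length w) 0 T (\<lambda>s t. R s t w - R' s t w))"

text \<open>The canonical lift is the limit in probability, in \<open>p\<close>-variation rough path distance, of the
  lifts of piecewise linear approximations. Being such a limit, it is almost surely a geometric
  rough path.\<close>

definition canonical_lift ::
    "'w measure \<Rightarrow> real \<Rightarrow> real \<Rightarrow> (real \<Rightarrow> 'w \<Rightarrow> real^'n) \<Rightarrow> ('w \<Rightarrow> 'n tensor_path) \<Rightarrow> bool" where
  "canonical_lift M T p I R \<longleftrightarrow>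
     (AE \<omega> in M. \<forall>s t. 0 \<le> s \<and> s \<le> t \<and> t \<le> T \<longrightarrow> R \<omega> s t [] = 1) \<and>
     (\<forall>D. (\<forall>n. partition_of 0 T (D n)) \<and> (\<forall>\<delta>>0. eventually (\<lambda>n. mesh_less \<delta> (D n)) sequentially) \<longrightarrow>
        tends_in_prob0 M (\<lambda>n \<omega>. rp_dist p T (signature (pl_interp (D n) (\<lambda>t. I t \<omega>))) (R \<omega>)))"

definition in_BV_closure :: "real \<Rightarrow> real \<Rightarrow> (real \<Rightarrow> 'a::real_normed_vector) \<Rightarrow> bool" where
  "in_BV_closure p T x \<longleftrightarrow> (\<exists>xs. (\<forall>n. continuous_on {0..T} (xs n) \<and> pvar 1 0 T (xs n) < \<infinity> \<and> xs n 0 = x 0) \<and>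
     (\<lambda>n. pvar p 0 T (\<lambda>t. xs n t - x t)) \<longlonglongrightarrow> 0)"

text \<open>The process satisfies one of the two alternatives, with regularity exponent \<open>p\<close>, and \<open>R\<close> is
  its lift.\<close>

definition cond_Cov :: "'w measure \<Rightarrow> real \<Rightarrow> (real \<Rightarrow> real \<Rightarrow> real) \<Rightarrow> (real \<Rightarrow> 'w \<Rightarrow> real^'n) \<Rightarrow>
    real \<Rightarrow> ('w \<Rightarrow> 'n tensor_path) \<Rightarrow> bool" where
  "cond_Cov M T K I p R \<longleftrightarrow>
     (1 \<le> p \<and> p < 2 \<and> (AE \<omega> in M. in_BV_closure p T (\<lambda>t. I t \<omega>)) \<and>
        (AE \<omega> in M. \<forall>s t. 0 \<le> s \<and> s \<le> t \<and> t \<le> T \<longrightarrow>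
           R \<omega> s t [] = 1 \<and> (\<forall>i. R \<omega> s t [i] = I t \<omega> $ i - I s \<omega> $ i)))
     \<or> (\<exists>\<rho>. 1 \<le> \<rho> \<and> \<rho> < 2 \<and> rhovar2d \<rho> 0 T (volterra_cov K) < \<infinity> \<and> 2 * \<rho> < p \<and> p < 4 \<and>
        canonical_lift M T p I R)"


subsection \<open>Controlled paths, rough integrals and the equation\<close>

text \<open>A controlled path is a family \<open>G\<close> of paths indexed by words, \<open>G []\<close> being the path itself and
  \<open>G w\<close> its Gubinelli derivatives. A component of finite \<open>q\<close>-variation is admitted in the
  remainders.\<close>

definition controlled :: "real \<Rightarrow> real \<Rightarrow> real \<Rightarrow> 'n tensor_path \<Rightarrow>
    ('n list \<Rightarrow> real \<Rightarrow> 'a::real_normed_vector) \<Rightarrow> bool" where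
  "controlled p q T R G \<longleftrightarrow> (\<forall>w. length w < level p \<longrightarrow>
     pvar2 (max q (p / (level p - length w))) 0 T
       (\<lambda>s t. G w t - (\<Sum>v\<in>{v. length v < level p - length w}. R s t v *\<^sub>R G (v @ w) s)) < \<infinity>)"

text \<open>\<open>J\<close> is the integral over \<open>[a,b]\<close> of the controlled path with components \<open>G i\<close>:
  the limit of compensated Riemann sums as the mesh tends to zero.\<close>

definition rough_integral :: "real \<Rightarrow> 'n::finite tensor_path \<Rightarrow>
    ('n \<Rightarrow> 'n list \<Rightarrow> real \<Rightarrow> 'a::real_normed_vector) \<Rightarrow> real \<Rightarrow> real \<Rightarrow> 'a \<Rightarrow> bool" where
  "rough_integral p R G a b J \<longleftrightarrow> (\<forall>\<epsilon>>0. \<exists>\<delta>>0. \<forall>ts. partition_of a b ts \<and> mesh_less \<delta> ts \<longrightarrow>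
     norm ((\<Sum>l<length ts - 1. \<Sum>i\<in>UNIV. \<Sum>w\<in>{w. length w < level p}.
        R (ts ! l) (ts ! Suc l) (w @ [i]) *\<^sub>R G i w (ts ! l)) - J) < \<epsilon>)"

text \<open>Vector fields of the joint equation for \<open>(X, Y)\<close>, that is, the columns of
  \<open>diag (\<sigma>, Id)\<close>, and their iterates \<open>V\<^bsub>j1\<^esub> (V\<^bsub>j2\<^esub> (\<dots> id))\<close> as differential operators, which are the
  Gubinelli derivatives of a solution obtained by composition.\<close>

definition joint_field :: "((real^'x) \<times> (real^'y) \<Rightarrow> real^'b^'x) \<Rightarrow> 'b + 'y \<Rightarrow>
    (real^'x) \<times> (real^'y) \<Rightarrow> (real^'x) \<times> (real^'y)" where
  "joint_field \<sigma> i z = (case i of Inl k \<Rightarrow> (column k (\<sigma> z), 0) | Inr j \<Rightarrow> (0, axis j 1))"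

fun iter_field :: "('n \<Rightarrow> 'a::real_normed_vector \<Rightarrow> 'a) \<Rightarrow> 'n list \<Rightarrow> 'a \<Rightarrow> 'a" where
  "iter_field V [] z = z"
| "iter_field V (j # w) z = frechet_derivative (iter_field V w) (at z) (V j z)"

text \<open>The equation for one sample: \<open>R\<close> is the joint rough path, \<open>u\<close> the path of the observation
  noise.\<close>

definition rde_solution :: "real \<Rightarrow> (real \<Rightarrow> real \<Rightarrow> real) \<Rightarrow> real \<Rightarrow> real \<Rightarrow>
    ((real^'x) \<times> (real^'y) \<Rightarrow> real^'y) \<Rightarrow> ((real^'x) \<times> (real^'y) \<Rightarrow> real^'b^'x) \<Rightarrow>
    ('b::finite + 'y::finite) tensor_path \<Rightarrow> (real \<Rightarrow> real^'y) \<Rightarrow> real^'x \<Rightarrow>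
    (real \<Rightarrow> real^'x) \<Rightarrow> (real \<Rightarrow> real^'y) \<Rightarrow> bool" where
  "rde_solution T K p q f \<sigma> R u x0 x y \<longleftrightarrow>
     (let z = (\<lambda>t. (x t, y t)); drift = volterra_op K (\<lambda>s. f (z s));
          G = (\<lambda>w t. iter_field (joint_field \<sigma>) w (z t))
      in continuous_on {0..T} z \<and> pvar q 0 T drift < \<infinity> \<and> controlled p q T R G \<and>
         (\<forall>t\<in>{0..T}. rough_integral p R (\<lambda>i w s. fst (G (w @ [i]) s)) 0 t (x t - x0) \<and>
            y t = drift t + u t))"


section \<open>Stochastic integral and change of measure\<close>

definition simple_process :: "(real \<Rightarrow> 'w measure) \<Rightarrow> real \<Rightarrow> real list \<Rightarrow> (nat \<Rightarrow> 'w \<Rightarrow> real) \<Rightarrow> bool" where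
  "simple_process F T ts \<xi> \<longleftrightarrow> partition_of 0 T ts \<and>
     (\<forall>i<length ts - 1. \<xi> i \<in> borel_measurable (F (ts ! i)) \<and> bounded (\<xi> i ` space (F (ts ! i))))"

definition simple_value :: "real list \<Rightarrow> (nat \<Rightarrow> 'w \<Rightarrow> real) \<Rightarrow> real \<Rightarrow> 'w \<Rightarrow> real" where
  "simple_value ts \<xi> s \<omega> = (\<Sum>i<length ts - 1. \<xi> i \<omega> * indicator {ts ! i <.. ts ! Suc i} s)"

definition simple_integral ::
    "real list \<Rightarrow> (nat \<Rightarrow> 'w \<Rightarrow> real) \<Rightarrow> (real \<Rightarrow> 'w \<Rightarrow> real) \<Rightarrow> real \<Rightarrow> 'w \<Rightarrow> real" where
  "simple_integral ts \<xi> W t \<omega> =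
     (\<Sum>i<length ts - 1. \<xi> i \<omega> * (W (min t (ts ! Suc i)) \<omega> - W (min t (ts ! i)) \<omega>))"

text \<open>\<open>J t = \<integral>\<^sub>0\<^sup>t H dW\<close>. Convergence in probability makes the notion invariant under passing to an
  equivalent measure; \<open>W\<close> is a Brownian motion for some measure equivalent to \<open>M\<close>.\<close>

definition ito_integral :: "'w measure \<Rightarrow> (real \<Rightarrow> 'w measure) \<Rightarrow> real \<Rightarrow> (real \<Rightarrow> 'w \<Rightarrow> real) \<Rightarrow>
    (real \<Rightarrow> 'w \<Rightarrow> real) \<Rightarrow> (real \<Rightarrow> 'w \<Rightarrow> real) \<Rightarrow> bool" where
  "ito_integral M F T H W J \<longleftrightarrow>
     (\<forall>t\<in>{0..T}. J t \<in> borel_measurable (F t)) \<and>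
     (\<forall>\<omega>\<in>space M. continuous_on {0..T} (\<lambda>t. J t \<omega>)) \<and>
     (\<exists>ts \<xi>. (\<forall>n. simple_process F T (ts n) (\<xi> n)) \<and>
        tends_in_prob0 M (\<lambda>n \<omega>. \<integral>\<^sup>+s\<in>{0..T}. ennreal ((simple_value (ts n) (\<xi> n) s \<omega> - H s \<omega>)\<^sup>2) \<partial>lborel) \<and>
        (\<forall>t\<in>{0..T}. tends_in_prob0 M (\<lambda>n \<omega>. ennreal \<bar>simple_integral (ts n) (\<xi> n) W t \<omega> - J t \<omega>\<bar>)))"

definition joint_process ::
    "(real \<Rightarrow> 'w \<Rightarrow> real^'b) \<Rightarrow> (real \<Rightarrow> 'w \<Rightarrow> real^'y) \<Rightarrow> real \<Rightarrow> 'w \<Rightarrow> real^('b + 'y)" where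
  "joint_process B U t \<omega> = (\<chi> i. case i of Inl k \<Rightarrow> B t \<omega> $ k | Inr j \<Rightarrow> U t \<omega> $ j)"

definition observation_bm :: "((real^'x) \<times> (real^'y) \<Rightarrow> real^'y) \<Rightarrow> (real \<Rightarrow> 'w \<Rightarrow> real^'x) \<Rightarrow>
    (real \<Rightarrow> 'w \<Rightarrow> real^'y) \<Rightarrow> (real \<Rightarrow> 'w \<Rightarrow> real^'y) \<Rightarrow> real \<Rightarrow> 'w \<Rightarrow> real^'y" where
  "observation_bm f X Y VU t \<omega> = VU t \<omega> + (LINT s:{0..t}|lborel. f (X s \<omega>, Y s \<omega>))"

text \<open>\<open>J j\<close> stands for the stochastic integral of \<open>f\<^sub>j(X, Y)\<close> against \<open>W\<^sup>j\<close>.\<close>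

definition likelihood :: "((real^'x) \<times> (real^'y) \<Rightarrow> real^'y) \<Rightarrow> (real \<Rightarrow> 'w \<Rightarrow> real^'x) \<Rightarrow>
    (real \<Rightarrow> 'w \<Rightarrow> real^'y) \<Rightarrow> ('y \<Rightarrow> real \<Rightarrow> 'w \<Rightarrow> real) \<Rightarrow> real \<Rightarrow> 'w \<Rightarrow> real" where
  "likelihood f X Y J t \<omega> = exp ((\<Sum>j\<in>UNIV. J j t \<omega>)
     - 1 / 2 * (\<Sum>j\<in>UNIV. LINT s:{0..t}|lborel. (f (X s \<omega>, Y s \<omega>) $ j)\<^sup>2))"

end

theory Submission
  imports Defs
begin

text \<open>The formula is Bayes' rule for the change of measure from \<open>Q\<close> to \<open>P\<close>, combined with the fact that under
  \<open>Q\<close> the observation after time \<open>t\<close> carries no information about what has happened up to time \<open>t\<close> beyond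
  that in the observation up to time \<open>t\<close>.

  Bayes' rule alone gives the quotient of conditional expectations under \<open>Q\<close> given \<open>\<Y>\<^sub>t\<close>, because \<open>\<Lambda>\<^sub>t\<close> is the
  density of \<open>P\<close> on \<open>\<F>\<^sub>t\<close>. What has to be shown is that \<open>\<Y>\<^sub>t\<close> may be replaced by the larger \<open>\<Y>\<close>: for
  every \<open>Q\<close>-integrable \<open>\<F>\<^sub>t\<close>-measurable \<open>H\<close>, \<open>E[H | \<Y>] = E[H | \<Y>\<^sub>t]\<close> (lemma \<open>cond_exp_no_future\<close>). The
  increments of \<open>Y\<close> are in general dependent, so this is not visible on \<open>Y\<close> itself. It becomes visible on the
  Brownian motion \<open>W\<close> behind \<open>Y\<close>, in two steps.

  First, the increments of \<open>W\<close> after \<open>t\<close> are independent of \<open>\<F>\<^sub>t\<close> under \<open>Q\<close> (\<open>girsanov_Q\<close>). This is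
  Girsanov's theorem, proved here through characteristic functions. On a time grid the increments of the
  Brownian motion \<open>V\<^sup>U\<close> given the past are independent Gaussian, so that complex
  exponentials with predictable exponents have constant expectation (\<open>exp_chain\<close>); the exponent
  \<open>i\<gamma> - \<xi>\<close> encodes simultaneously the density and the Fourier factor (\<open>girsanov_discrete\<close>). The
  Ito integral in the density is a limit of simple ones, and Scheffe's lemma passes to that limit, the
  total mass one of the limiting density being exactly the assumption that \<open>Q\<close> is a probability measure
  (\<open>girsanov\<close>).

  Second, every linear functional of \<open>Y\<close> on \<open>[0,T]\<close> is a limit of sums of a functional of \<open>Y\<close> on \<open>[0,t]\<close> and
  a functional of the increments of \<open>W\<close> after \<open>t\<close> (\<open>kernel_split_approx\<close>). In terms of kernels this is a
  statement in \<open>L\<^sup>2[0,T]\<close>: the functions \<open>1\<^bsub>[0,r]\<^esub>\<close> with \<open>r \<le> t\<close> are limits of kernels of functionals of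
  \<open>Y\<close> up to \<open>t\<close>, and together with \<open>1\<^bsub>(t,r]\<^esub>\<close> they span \<open>L\<^sup>2\<close>. The first half is where the condition on the
  filtrations enters (\<open>VU_adapted_approx\<close>): without it the preimage of \<open>1\<^bsub>[0,r]\<^esub>\<close> under \<open>K\<^sup>*\<close> could need times
  later than \<open>r\<close>.

  If now \<open>Z\<close> is \<open>\<F>\<^sub>t\<close>-measurable and orthogonal to \<open>\<Y>\<^sub>t\<close>, then \<open>Z\<close> is orthogonal to \<open>e\<^sup>i\<^sup>S\<close> for every
  linear functional \<open>S\<close> of \<open>Y\<close>: the later increments factor out of the expectation and the earlier part is
  \<open>\<Y>\<^sub>t\<close>-measurable (\<open>exp_observation_orthogonal\<close>). By uniqueness of Fourier transforms
  (\<open>fourier_zero\<close>) \<open>Z\<close> is orthogonal to all of \<open>\<Y>\<close>; apply this to \<open>Z = H - E[H | \<Y>\<^sub>t]\<close>.\<close>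

section \<open>Linear extension from generators\<close>

text \<open>Random step functionals and their kernels are both linear in the coefficients of a finitely
  supported combination; one linear-extension operator serves for the two of them.\<close>

definition lin :: "('k \<Rightarrow> 'a::real_vector) \<Rightarrow> ('k \<Rightarrow>\<^sub>0 real) \<Rightarrow> 'a" where
  "lin \<phi> a = (\<Sum>x\<in>Poly_Mapping.keys a. Poly_Mapping.lookup a x *\<^sub>R \<phi> x)"

definition pm_scale :: "real \<Rightarrow> ('k \<Rightarrow>\<^sub>0 real) \<Rightarrow> ('k \<Rightarrow>\<^sub>0 real)" where
  "pm_scale c a = Poly_Mapping.map ((*) c) a"

lemma lookup_pm_scale [simp]: "Poly_Mapping.lookup (pm_scale c a) k = c * Poly_Mapping.lookup a k"
  unfolding pm_scale_def by transfer (auto simp: when_def)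

lemma lin_superset:
  assumes "finite S" "Poly_Mapping.keys a \<subseteq> S"
  shows "lin \<phi> a = (\<Sum>x\<in>S. Poly_Mapping.lookup a x *\<^sub>R \<phi> x)"
  unfolding lin_def
  by (rule sum.mono_neutral_left) (use assms in \<open>auto simp: in_keys_iff\<close>)

lemma lin_add: "lin \<phi> (a + b) = lin \<phi> a + lin \<phi> b"
proof -
  let ?S = "Poly_Mapping.keys a \<union> Poly_Mapping.keys b"
  have "lin \<phi> (a + b) = (\<Sum>x\<in>?S. Poly_Mapping.lookup (a + b) x *\<^sub>R \<phi> x)"
    using Poly_Mapping.keys_add[of a b] by (intro lin_superset) auto
  also have "\<dots> = (\<Sum>x\<in>?S. Poly_Mapping.lookup a x *\<^sub>R \<phi> x) + (\<Sum>x\<in>?S. Poly_Mapping.lookup b x *\<^sub>R \<phi> x)"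
    by (simp add: lookup_add scaleR_add_left sum.distrib)
  also have "\<dots> = lin \<phi> a + lin \<phi> b"
    by (simp add: lin_superset[of ?S a] lin_superset[of ?S b])
  finally show ?thesis .
qed

lemma lin_scale: "lin \<phi> (pm_scale c a) = c *\<^sub>R lin \<phi> a"
proof -
  have "lin \<phi> (pm_scale c a) = (\<Sum>x\<in>Poly_Mapping.keys a. Poly_Mapping.lookup (pm_scale c a) x *\<^sub>R \<phi> x)"
    by (rule lin_superset) (auto simp: in_keys_iff)
  then show ?thesis by (simp add: lin_def scaleR_sum_right)
qed

lemma lin_single [simp]: "lin \<phi> (Poly_Mapping.single x c) = c *\<^sub>R \<phi> x"
proof -
  have "lin \<phi> (Poly_Mapping.single x c) = (\<Sum>y\<in>{x}. Poly_Mapping.lookup (Poly_Mapping.single x c) y *\<^sub>R \<phi> y)"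
    by (rule lin_superset) auto
  then show ?thesis by simp
qed

lemma lin_zero [simp]: "lin \<phi> 0 = 0"
  by (simp add: lin_def)

lemma lin_cong: "(\<And>x. x \<in> Poly_Mapping.keys a \<Longrightarrow> \<phi> x = \<psi> x) \<Longrightarrow> lin \<phi> a = lin \<psi> a"
  by (simp add: lin_def)

lemma step_apply_lin: "step_apply I a \<omega> = lin (\<lambda>(k, s). I s \<omega> $ k) a"
  by (simp add: step_apply_def lin_def split_beta)

lemma Kstar_step_lin: "Kstar_step K a r = lin (\<lambda>(k, s). K s r *\<^sub>R axis k 1) a"
  by (simp add: Kstar_step_def lin_def split_beta)

lemma steps_add: "a \<in> steps T \<Longrightarrow> b \<in> steps T \<Longrightarrow> a + b \<in> steps T"
  unfolding steps_def using Poly_Mapping.keys_add[of a b] by blast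

lemma steps_scale: "a \<in> steps T \<Longrightarrow> pm_scale c a \<in> steps T"
  unfolding steps_def by (auto simp: in_keys_iff)

lemma steps_single: "s \<in> {0..T} \<Longrightarrow> Poly_Mapping.single (k, s) c \<in> steps T"
  unfolding steps_def by auto

lemma steps_zero [simp]: "0 \<in> steps T"
  unfolding steps_def by auto

lemma steps_mono: "s \<le> t \<Longrightarrow> steps s \<subseteq> steps t"
  unfolding steps_def by force

lemma step_apply_add: "step_apply I (a + b) \<omega> = step_apply I a \<omega> + step_apply I b \<omega>"
  by (simp add: step_apply_lin lin_add)

lemma step_apply_scale: "step_apply I (pm_scale c a) \<omega> = c * step_apply I a \<omega>"
  by (simp add: step_apply_lin lin_scale)

lemma step_apply_single [simp]: "step_apply I (Poly_Mapping.single (k, s) c) \<omega> = c * I s \<omega> $ k"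
  by (simp add: step_apply_lin)

lemma step_apply_zero [simp]: "step_apply I 0 \<omega> = 0"
  by (simp add: step_apply_lin)

lemma Kstar_step_add: "Kstar_step K (a + b) r = Kstar_step K a r + Kstar_step K b r"
  by (simp add: Kstar_step_lin lin_add)

lemma Kstar_step_scale: "Kstar_step K (pm_scale c a) r = c *\<^sub>R Kstar_step K a r"
  by (simp add: Kstar_step_lin lin_scale)

lemma Kstar_step_single [simp]: "Kstar_step K (Poly_Mapping.single (k, s) c) r = (c * K s r) *\<^sub>R axis k 1"
  by (simp add: Kstar_step_lin)

lemma measurable_component:
  fixes Z :: "'w \<Rightarrow> real^'n"
  assumes "Z \<in> borel_measurable M"
  shows "(\<lambda>\<omega>. Z \<omega> $ k) \<in> borel_measurable M"
proof -
  have "(\<lambda>\<omega>. Z \<omega> \<bullet> axis k 1) \<in> borel_measurable M" using assms by simp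
  then show ?thesis by (simp add: inner_axis)
qed

lemma step_apply_measurable:
  assumes "\<And>s. s \<in> {0..t} \<Longrightarrow> Z s \<in> borel_measurable M" "a \<in> steps t"
  shows "step_apply Z a \<in> borel_measurable M"
proof -
  have "(\<lambda>\<omega>. \<Sum>x\<in>Poly_Mapping.keys a. Poly_Mapping.lookup a x *\<^sub>R (Z (snd x) \<omega> $ fst x)) \<in> borel_measurable M"
  proof (rule borel_measurable_sum)
    fix x assume "x \<in> Poly_Mapping.keys a"
    then have "snd x \<in> {0..t}" using assms(2) by (auto simp: steps_def)
    then show "(\<lambda>\<omega>. Poly_Mapping.lookup a x *\<^sub>R (Z (snd x) \<omega> $ fst x)) \<in> borel_measurable M"
      using measurable_component[OF assms(1)[of "snd x"]] by simp
  qed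
  then show ?thesis by (simp add: step_apply_lin[abs_def] lin_def split_beta)
qed

section \<open>Square integrable functions\<close>

definition l2 :: "'w measure \<Rightarrow> ('w \<Rightarrow> 'a::euclidean_space) \<Rightarrow> real" where
  "l2 M f = sqrt (\<integral>\<omega>. (norm (f \<omega>))\<^sup>2 \<partial>M)"

lemma l2_nonneg [simp]: "0 \<le> l2 M f"
  by (simp add: l2_def)

lemma l2_sq: "(l2 M f)\<^sup>2 = (\<integral>\<omega>. (norm (f \<omega>))\<^sup>2 \<partial>M)"
  by (simp add: l2_def)

lemma sqi_measurable: "square_integrable M f \<Longrightarrow> f \<in> borel_measurable M"
  by (simp add: square_integrable_def)

lemma sqi_scale: "square_integrable M f \<Longrightarrow> square_integrable M (\<lambda>\<omega>. c *\<^sub>R f \<omega>)"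
  by (auto simp: square_integrable_def power_mult_distrib)

lemma sqi_add:
  assumes "square_integrable M f" "square_integrable M g"
  shows "square_integrable M (\<lambda>\<omega>. f \<omega> + g \<omega>)"
proof -
  have [measurable]: "f \<in> borel_measurable M" "g \<in> borel_measurable M"
    using assms by (auto simp: square_integrable_def)
  have "integrable M (\<lambda>\<omega>. (norm (f \<omega> + g \<omega>))\<^sup>2)"
  proof (rule Bochner_Integration.integrable_bound)
    show "integrable M (\<lambda>\<omega>. 2 * (norm (f \<omega>))\<^sup>2 + 2 * (norm (g \<omega>))\<^sup>2)"
      using assms by (auto simp: square_integrable_def)
    show "AE \<omega> in M. norm ((norm (f \<omega> + g \<omega>))\<^sup>2) \<le> norm (2 * (norm (f \<omega>))\<^sup>2 + 2 * (norm (g \<omega>))\<^sup>2)"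
    proof (rule AE_I2)
      fix \<omega>
      have "(norm (f \<omega> + g \<omega>))\<^sup>2 \<le> (norm (f \<omega>) + norm (g \<omega>))\<^sup>2"
        by (simp add: norm_triangle_ineq power_mono)
      also have "\<dots> \<le> 2 * (norm (f \<omega>))\<^sup>2 + 2 * (norm (g \<omega>))\<^sup>2"
        using sum_squares_bound[of "norm (f \<omega>)" "norm (g \<omega>)"] by (simp add: power2_sum)
      finally show "norm ((norm (f \<omega> + g \<omega>))\<^sup>2) \<le> norm (2 * (norm (f \<omega>))\<^sup>2 + 2 * (norm (g \<omega>))\<^sup>2)"
        by simp
    qed
  qed simp
  then show ?thesis by (simp add: square_integrable_def)
qed

lemma sqi_diff:
  assumes "square_integrable M f" "square_integrable M g"
  shows "square_integrable M (\<lambda>\<omega>. f \<omega> - g \<omega>)"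
  using sqi_add[OF assms(1) sqi_scale[OF assms(2), of "-1"]] by simp

lemma sqi_zero [simp]: "square_integrable M (\<lambda>\<omega>. 0)"
  by (simp add: square_integrable_def)

lemma sqi_inner:
  assumes "square_integrable M f" "square_integrable M g"
  shows "integrable M (\<lambda>\<omega>. f \<omega> \<bullet> g \<omega>)"
proof (rule Bochner_Integration.integrable_bound)
  have [measurable]: "f \<in> borel_measurable M" "g \<in> borel_measurable M"
    using assms by (auto simp: square_integrable_def)
  show "(\<lambda>\<omega>. f \<omega> \<bullet> g \<omega>) \<in> borel_measurable M" by simp
  show "integrable M (\<lambda>\<omega>. (norm (f \<omega>))\<^sup>2 + (norm (g \<omega>))\<^sup>2)"
    using assms by (auto simp: square_integrable_def)
  show "AE \<omega> in M. norm (f \<omega> \<bullet> g \<omega>) \<le> norm ((norm (f \<omega>))\<^sup>2 + (norm (g \<omega>))\<^sup>2)"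
  proof (rule AE_I2)
    fix \<omega>
    have "norm (f \<omega> \<bullet> g \<omega>) \<le> norm (f \<omega>) * norm (g \<omega>)" by (simp add: Cauchy_Schwarz_ineq2)
    also have "\<dots> \<le> (norm (f \<omega>))\<^sup>2 + (norm (g \<omega>))\<^sup>2"
      using sum_squares_bound[of "norm (f \<omega>)" "norm (g \<omega>)"]
        mult_nonneg_nonneg[OF norm_ge_zero[of "f \<omega>"] norm_ge_zero[of "g \<omega>"]] by linarith
    finally show "norm (f \<omega> \<bullet> g \<omega>) \<le> norm ((norm (f \<omega>))\<^sup>2 + (norm (g \<omega>))\<^sup>2)" by simp
  qed
qed

lemma integral_norm_sq_add:
  assumes "square_integrable M f" "square_integrable M g"
  shows "(\<integral>\<omega>. (norm (f \<omega> + c *\<^sub>R g \<omega>))\<^sup>2 \<partial>M) =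
     (\<integral>\<omega>. (norm (f \<omega>))\<^sup>2 \<partial>M) + 2 * c * (\<integral>\<omega>. f \<omega> \<bullet> g \<omega> \<partial>M) + c\<^sup>2 * (\<integral>\<omega>. (norm (g \<omega>))\<^sup>2 \<partial>M)"
proof -
  have i: "integrable M (\<lambda>\<omega>. (norm (f \<omega>))\<^sup>2)" "integrable M (\<lambda>\<omega>. (norm (g \<omega>))\<^sup>2)" "integrable M (\<lambda>\<omega>. f \<omega> \<bullet> g \<omega>)"
    using assms sqi_inner[OF assms] by (auto simp: square_integrable_def)
  have "(\<integral>\<omega>. (norm (f \<omega> + c *\<^sub>R g \<omega>))\<^sup>2 \<partial>M) =
      (\<integral>\<omega>. (norm (f \<omega>))\<^sup>2 + 2 * c * (f \<omega> \<bullet> g \<omega>) + c\<^sup>2 * (norm (g \<omega>))\<^sup>2 \<partial>M)"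
    by (intro Bochner_Integration.integral_cong refl, unfold power2_norm_eq_inner)
       (simp add: inner_commute algebra_simps power2_eq_square)
  then show ?thesis using i by simp
qed

text \<open>The discriminant of the nonnegative quadratic \<open>c \<mapsto> \<parallel>f + c g\<parallel>\<^sup>2\<close> is not positive.\<close>

lemma l2_cauchy_schwarz:
  assumes "square_integrable M f" "square_integrable M g"
  shows "\<bar>\<integral>\<omega>. f \<omega> \<bullet> g \<omega> \<partial>M\<bar> \<le> l2 M f * l2 M g"
proof -
  define A where "A = (\<integral>\<omega>. (norm (f \<omega>))\<^sup>2 \<partial>M)"
  define D where "D = (\<integral>\<omega>. (norm (g \<omega>))\<^sup>2 \<partial>M)"
  define E where "E = (\<integral>\<omega>. f \<omega> \<bullet> g \<omega> \<partial>M)"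
  have q: "0 \<le> A + 2 * c * E + c\<^sup>2 * D" for c
  proof -
    have "0 \<le> (\<integral>\<omega>. (norm (f \<omega> + c *\<^sub>R g \<omega>))\<^sup>2 \<partial>M)" by simp
    then show ?thesis unfolding integral_norm_sq_add[OF assms] A_def D_def E_def .
  qed
  have AD: "0 \<le> A" "0 \<le> D" unfolding A_def D_def by simp_all
  have "E\<^sup>2 \<le> A * D"
  proof (cases "D = 0")
    case True
    have "E = 0"
    proof (rule ccontr)
      assume "E \<noteq> 0"
      then show False using q[of "- (A + 1) / (2 * E)"] True AD by (simp add: field_simps)
    qed
    then show ?thesis using True by simp
  next
    case False
    then have "0 \<le> (A + 2 * (- E / D) * E + (- E / D)\<^sup>2 * D) * D"
      using q[of "- E / D"] AD by (intro mult_nonneg_nonneg) auto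
    also have "\<dots> = A * D - E\<^sup>2" using False by (simp add: field_simps power2_eq_square)
    finally show ?thesis by simp
  qed
  then have "sqrt (E\<^sup>2) \<le> sqrt (A * D)" by (rule real_sqrt_le_mono)
  then show ?thesis by (simp add: l2_def A_def D_def E_def real_sqrt_mult)
qed

lemma l2_triangle:
  assumes "square_integrable M f" "square_integrable M g"
  shows "l2 M (\<lambda>\<omega>. f \<omega> + g \<omega>) \<le> l2 M f + l2 M g"
proof -
  have "(l2 M (\<lambda>\<omega>. f \<omega> + g \<omega>))\<^sup>2 = (l2 M f)\<^sup>2 + 2 * (\<integral>\<omega>. f \<omega> \<bullet> g \<omega> \<partial>M) + (l2 M g)\<^sup>2"
    using integral_norm_sq_add[OF assms, of 1] unfolding l2_sq by simp
  also have "\<dots> \<le> (l2 M f + l2 M g)\<^sup>2"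
    using l2_cauchy_schwarz[OF assms] unfolding power2_sum by linarith
  finally show ?thesis by (rule power2_le_imp_le) simp
qed

lemma l2_scale: "l2 M (\<lambda>\<omega>. c *\<^sub>R f \<omega>) = \<bar>c\<bar> * l2 M f"
  by (simp add: l2_def power_mult_distrib real_sqrt_mult)

lemma l2_minus_commute: "l2 M (\<lambda>\<omega>. f \<omega> - g \<omega>) = l2 M (\<lambda>\<omega>. g \<omega> - f \<omega>)"
  by (simp add: l2_def norm_minus_commute)

lemma l2_triangle_diff:
  assumes "square_integrable M f" "square_integrable M g" "square_integrable M h"
  shows "l2 M (\<lambda>\<omega>. f \<omega> - h \<omega>) \<le> l2 M (\<lambda>\<omega>. f \<omega> - g \<omega>) + l2 M (\<lambda>\<omega>. g \<omega> - h \<omega>)"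
  using l2_triangle[OF sqi_diff[OF assms(1,2)] sqi_diff[OF assms(2,3)]] by simp

lemma (in finite_measure) sqi_integrable:
  assumes "square_integrable M f"
  shows "integrable M f"
proof (rule Bochner_Integration.integrable_bound)
  show "integrable M (\<lambda>\<omega>. 1 + (norm (f \<omega>))\<^sup>2)" using assms by (auto simp: square_integrable_def)
  show "f \<in> borel_measurable M" using assms by (auto simp: square_integrable_def)
  show "AE \<omega> in M. norm (f \<omega>) \<le> norm (1 + (norm (f \<omega>))\<^sup>2)"
  proof (rule AE_I2)
    fix \<omega>
    have "2 * norm (f \<omega>) \<le> 1 + (norm (f \<omega>))\<^sup>2"
      using sum_squares_bound[of 1 "norm (f \<omega>)"] by simp
    then show "norm (f \<omega>) \<le> norm (1 + (norm (f \<omega>))\<^sup>2)"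
      using norm_ge_zero[of "f \<omega>"] abs_ge_self[of "1 + (norm (f \<omega>))\<^sup>2"] unfolding real_norm_def by linarith
  qed
qed

lemma (in finite_measure) l1_le_l2:
  assumes "square_integrable M f"
  shows "(\<integral>\<omega>. norm (f \<omega>) \<partial>M) \<le> sqrt (measure M (space M)) * l2 M f"
proof -
  have "square_integrable M (\<lambda>\<omega>. norm (f \<omega>))"
    using assms by (auto simp: square_integrable_def)
  moreover have "square_integrable M (\<lambda>\<omega>. 1::real)" by (simp add: square_integrable_def)
  ultimately have "\<bar>\<integral>\<omega>. 1 \<bullet> norm (f \<omega>) \<partial>M\<bar> \<le> l2 M (\<lambda>\<omega>. 1::real) * l2 M (\<lambda>\<omega>. norm (f \<omega>))"
    by (intro l2_cauchy_schwarz)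
  then show ?thesis by (simp add: l2_def)
qed

lemma L2_tendsto_iff:
  "L2_tendsto M F Z \<longleftrightarrow> (\<forall>n. square_integrable M (F n)) \<and> square_integrable M Z \<and>
     (\<lambda>n. l2 M (\<lambda>\<omega>. F n \<omega> - Z \<omega>)) \<longlonglongrightarrow> 0"
proof -
  have "(\<lambda>n. (l2 M (\<lambda>\<omega>. F n \<omega> - Z \<omega>))\<^sup>2) \<longlonglongrightarrow> 0 \<longleftrightarrow> (\<lambda>n. l2 M (\<lambda>\<omega>. F n \<omega> - Z \<omega>)) \<longlonglongrightarrow> 0"
  proof
    assume "(\<lambda>n. (l2 M (\<lambda>\<omega>. F n \<omega> - Z \<omega>))\<^sup>2) \<longlonglongrightarrow> 0"
    then have "(\<lambda>n. sqrt ((l2 M (\<lambda>\<omega>. F n \<omega> - Z \<omega>))\<^sup>2)) \<longlonglongrightarrow> sqrt 0" by (rule tendsto_real_sqrt)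
    then show "(\<lambda>n. l2 M (\<lambda>\<omega>. F n \<omega> - Z \<omega>)) \<longlonglongrightarrow> 0" by simp
  next
    assume "(\<lambda>n. l2 M (\<lambda>\<omega>. F n \<omega> - Z \<omega>)) \<longlonglongrightarrow> 0"
    then show "(\<lambda>n. (l2 M (\<lambda>\<omega>. F n \<omega> - Z \<omega>))\<^sup>2) \<longlonglongrightarrow> 0"
      using tendsto_power[of _ 0 sequentially 2] by simp
  qed
  then show ?thesis by (simp add: L2_tendsto_def l2_sq)
qed

lemma L2_tendsto_const: "square_integrable M Z \<Longrightarrow> L2_tendsto M (\<lambda>n. Z) Z"
  by (simp add: L2_tendsto_def)

lemma L2_tendsto_add:
  assumes "L2_tendsto M F Z" "L2_tendsto M G Y"
  shows "L2_tendsto M (\<lambda>n \<omega>. F n \<omega> + G n \<omega>) (\<lambda>\<omega>. Z \<omega> + Y \<omega>)"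
proof -
  have s: "square_integrable M (F n)" "square_integrable M (G n)" "square_integrable M Z" "square_integrable M Y" for n
    using assms by (auto simp: L2_tendsto_iff)
  have "(\<lambda>n. l2 M (\<lambda>\<omega>. F n \<omega> + G n \<omega> - (Z \<omega> + Y \<omega>))) \<longlonglongrightarrow> 0"
  proof (rule tendsto_sandwich[OF _ _ tendsto_const])
    show "\<forall>\<^sub>F n in sequentially. 0 \<le> l2 M (\<lambda>\<omega>. F n \<omega> + G n \<omega> - (Z \<omega> + Y \<omega>))" by simp
    show "(\<lambda>n. l2 M (\<lambda>\<omega>. F n \<omega> - Z \<omega>) + l2 M (\<lambda>\<omega>. G n \<omega> - Y \<omega>)) \<longlonglongrightarrow> 0"
      using assms by (intro tendsto_add_zero) (auto simp: L2_tendsto_iff)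
    have "l2 M (\<lambda>\<omega>. F n \<omega> + G n \<omega> - (Z \<omega> + Y \<omega>)) \<le> l2 M (\<lambda>\<omega>. F n \<omega> - Z \<omega>) + l2 M (\<lambda>\<omega>. G n \<omega> - Y \<omega>)" for n
      using l2_triangle[OF sqi_diff[OF s(1) s(3)] sqi_diff[OF s(2) s(4)]] by (simp add: algebra_simps)
    then show "\<forall>\<^sub>F n in sequentially. l2 M (\<lambda>\<omega>. F n \<omega> + G n \<omega> - (Z \<omega> + Y \<omega>))
        \<le> l2 M (\<lambda>\<omega>. F n \<omega> - Z \<omega>) + l2 M (\<lambda>\<omega>. G n \<omega> - Y \<omega>)" by simp
  qed
  with s show ?thesis by (auto simp: L2_tendsto_iff intro: sqi_add)
qed

lemma L2_tendsto_scale: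
  assumes "L2_tendsto M F Z"
  shows "L2_tendsto M (\<lambda>n \<omega>. c *\<^sub>R F n \<omega>) (\<lambda>\<omega>. c *\<^sub>R Z \<omega>)"
proof -
  have "l2 M (\<lambda>\<omega>. c *\<^sub>R F n \<omega> - c *\<^sub>R Z \<omega>) = \<bar>c\<bar> * l2 M (\<lambda>\<omega>. F n \<omega> - Z \<omega>)" for n
    using l2_scale[of M c "\<lambda>\<omega>. F n \<omega> - Z \<omega>"] by (simp add: scaleR_diff_right)
  moreover have "(\<lambda>n. \<bar>c\<bar> * l2 M (\<lambda>\<omega>. F n \<omega> - Z \<omega>)) \<longlonglongrightarrow> 0"
    using tendsto_mult_right_zero assms by (auto simp: L2_tendsto_iff)
  ultimately show ?thesis using assms by (simp add: L2_tendsto_iff sqi_scale)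
qed

lemma L2_tendsto_inner:
  assumes "L2_tendsto M F Z" "L2_tendsto M G Y"
  shows "(\<lambda>n. \<integral>\<omega>. F n \<omega> \<bullet> G n \<omega> \<partial>M) \<longlonglongrightarrow> (\<integral>\<omega>. Z \<omega> \<bullet> Y \<omega> \<partial>M)"
proof -
  have s: "square_integrable M (F n)" "square_integrable M (G n)" "square_integrable M Z" "square_integrable M Y" for n
    using assms by (auto simp: L2_tendsto_iff)
  let ?a = "\<lambda>n. l2 M (\<lambda>\<omega>. F n \<omega> - Z \<omega>)" and ?b = "\<lambda>n. l2 M (\<lambda>\<omega>. G n \<omega> - Y \<omega>)"
  have ab: "?a \<longlonglongrightarrow> 0" "?b \<longlonglongrightarrow> 0" using assms by (auto simp: L2_tendsto_iff)
  have bd: "norm ((\<integral>\<omega>. F n \<omega> \<bullet> G n \<omega> \<partial>M) - (\<integral>\<omega>. Z \<omega> \<bullet> Y \<omega> \<partial>M)) \<le> ?a n * ?b n + ?a n * l2 M Y + l2 M Z * ?b n" for n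
  proof -
    note d = sqi_diff[OF s(1)[of n] s(3)] sqi_diff[OF s(2)[of n] s(4)]
    have "(\<integral>\<omega>. F n \<omega> \<bullet> G n \<omega> \<partial>M) - (\<integral>\<omega>. Z \<omega> \<bullet> Y \<omega> \<partial>M) =
       (\<integral>\<omega>. F n \<omega> \<bullet> G n \<omega> - Z \<omega> \<bullet> Y \<omega> \<partial>M)"
      using s by (simp add: sqi_inner)
    also have "\<dots> = (\<integral>\<omega>. (F n \<omega> - Z \<omega>) \<bullet> (G n \<omega> - Y \<omega>) + (F n \<omega> - Z \<omega>) \<bullet> Y \<omega> + Z \<omega> \<bullet> (G n \<omega> - Y \<omega>) \<partial>M)"
      by (simp add: inner_diff_left inner_diff_right)
    also have "\<dots> = (\<integral>\<omega>. (F n \<omega> - Z \<omega>) \<bullet> (G n \<omega> - Y \<omega>) \<partial>M) + (\<integral>\<omega>. (F n \<omega> - Z \<omega>) \<bullet> Y \<omega> \<partial>M) + (\<integral>\<omega>. Z \<omega> \<bullet> (G n \<omega> - Y \<omega>) \<partial>M)"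
      using s d by (simp add: sqi_inner)
    finally show ?thesis
      using l2_cauchy_schwarz[OF d] l2_cauchy_schwarz[OF d(1) s(4)] l2_cauchy_schwarz[OF s(3) d(2)]
      by simp
  qed
  have "(\<lambda>n. ?a n * ?b n + ?a n * l2 M Y + l2 M Z * ?b n) \<longlonglongrightarrow> 0 * 0 + 0 * l2 M Y + l2 M Z * 0"
    by (intro tendsto_intros ab)
  then have "(\<lambda>n. ?a n * ?b n + ?a n * l2 M Y + l2 M Z * ?b n) \<longlonglongrightarrow> 0" by simp
  then have "(\<lambda>n. (\<integral>\<omega>. F n \<omega> \<bullet> G n \<omega> \<partial>M) - (\<integral>\<omega>. Z \<omega> \<bullet> Y \<omega> \<partial>M)) \<longlonglongrightarrow> 0"
    by (rule Lim_null_comparison[rotated]) (rule always_eventually, rule allI, rule bd)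
  then show ?thesis by (rule LIM_zero_cancel)
qed

lemma (in finite_measure) L2_tendsto_L1:
  assumes "L2_tendsto M F Z"
  shows "(\<lambda>n. \<integral>\<omega>. norm (F n \<omega> - Z \<omega>) \<partial>M) \<longlonglongrightarrow> 0"
proof (rule tendsto_sandwich[OF _ _ tendsto_const])
  have s: "square_integrable M (\<lambda>\<omega>. F n \<omega> - Z \<omega>)" for n
    using assms by (auto simp: L2_tendsto_iff intro: sqi_diff)
  show "(\<lambda>n. sqrt (measure M (space M)) * l2 M (\<lambda>\<omega>. F n \<omega> - Z \<omega>)) \<longlonglongrightarrow> 0"
    using tendsto_mult_right_zero assms by (auto simp: L2_tendsto_iff)
  show "\<forall>\<^sub>F n in sequentially. (\<integral>\<omega>. norm (F n \<omega> - Z \<omega>) \<partial>M) \<le> sqrt (measure M (space M)) * l2 M (\<lambda>\<omega>. F n \<omega> - Z \<omega>)"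
    using l1_le_l2[OF s] by simp
qed simp

text \<open>Completeness of \<open>L\<^sup>2\<close>: a Cauchy sequence has an almost everywhere convergent subsequence,
  and Fatou's lemma turns its limit into an \<open>L\<^sup>2\<close> limit of the whole sequence.\<close>

lemma (in finite_measure) L2_complete:
  fixes F :: "nat \<Rightarrow> 'a \<Rightarrow> 'b::euclidean_space"
  assumes s: "\<And>n. square_integrable M (F n)"
    and C: "\<And>e. 0 < e \<Longrightarrow> \<exists>N. \<forall>i\<ge>N. \<forall>j\<ge>N. l2 M (\<lambda>\<omega>. F i \<omega> - F j \<omega>) < e"
  obtains Z where "L2_tendsto M F Z"
proof -
  have [measurable]: "F n \<in> borel_measurable M" for n using s by (rule sqi_measurable)
  define m where "m = sqrt (measure M (space M)) + 1"
  have m: "0 < m" by (simp add: m_def add_nonneg_pos)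
  have "\<exists>N. \<forall>i\<ge>N. \<forall>j\<ge>N. (\<integral>\<omega>. norm (F i \<omega> - F j \<omega>) \<partial>M) < e" if "0 < e" for e
  proof -
    obtain N where N: "l2 M (\<lambda>\<omega>. F i \<omega> - F j \<omega>) < e / m" if "i \<ge> N" "j \<ge> N" for i j
      using C[of "e / m"] \<open>0 < e\<close> m by (meson divide_pos_pos)
    have "(\<integral>\<omega>. norm (F i \<omega> - F j \<omega>) \<partial>M) < e" if "i \<ge> N" "j \<ge> N" for i j
    proof -
      have "(\<integral>\<omega>. norm (F i \<omega> - F j \<omega>) \<partial>M) \<le> sqrt (measure M (space M)) * l2 M (\<lambda>\<omega>. F i \<omega> - F j \<omega>)"
        by (intro l1_le_l2 sqi_diff s)
      also have "\<dots> \<le> m * l2 M (\<lambda>\<omega>. F i \<omega> - F j \<omega>)" by (intro mult_right_mono) (auto simp: m_def)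
      also have "\<dots> < e" using N[OF that] m by (simp add: field_simps)
      finally show ?thesis .
    qed
    then show ?thesis by blast
  qed
  then obtain r where r: "strict_mono r" "AE \<omega> in M. Cauchy (\<lambda>i. F (r i) \<omega>)"
    using cauchy_L1_AE_cauchy_subseq[of M F] sqi_integrable[OF s] by blast
  define Z where "Z = (\<lambda>\<omega>. lim (\<lambda>i. F (r i) \<omega>))"
  have [measurable]: "Z \<in> borel_measurable M" unfolding Z_def by (rule borel_measurable_lim_metric) simp
  have lim: "AE \<omega> in M. (\<lambda>i. F (r i) \<omega>) \<longlonglongrightarrow> Z \<omega>"
    using r(2) unfolding Z_def by eventually_elim (simp add: Cauchy_convergent_iff convergent_LIMSEQ_iff)
  have fatou: "(\<integral>\<^sup>+\<omega>. ennreal ((norm (F n \<omega> - Z \<omega>))\<^sup>2) \<partial>M) \<le> ennreal (e\<^sup>2)"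
    if N: "\<And>i j. i \<ge> N \<Longrightarrow> j \<ge> N \<Longrightarrow> l2 M (\<lambda>\<omega>. F i \<omega> - F j \<omega>) < e" and n: "n \<ge> N" for n N e
  proof -
    have "(\<integral>\<^sup>+\<omega>. ennreal ((norm (F n \<omega> - Z \<omega>))\<^sup>2) \<partial>M) =
        (\<integral>\<^sup>+\<omega>. liminf (\<lambda>i. ennreal ((norm (F n \<omega> - F (r i) \<omega>))\<^sup>2)) \<partial>M)"
    proof (rule nn_integral_cong_AE)
      show "AE \<omega> in M. ennreal ((norm (F n \<omega> - Z \<omega>))\<^sup>2) = liminf (\<lambda>i. ennreal ((norm (F n \<omega> - F (r i) \<omega>))\<^sup>2))"
        using lim
      proof eventually_elim
        fix \<omega> assume "(\<lambda>i. F (r i) \<omega>) \<longlonglongrightarrow> Z \<omega>"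
        then have "(\<lambda>i. ennreal ((norm (F n \<omega> - F (r i) \<omega>))\<^sup>2)) \<longlonglongrightarrow> ennreal ((norm (F n \<omega> - Z \<omega>))\<^sup>2)"
          by (intro tendsto_intros)
        then show "ennreal ((norm (F n \<omega> - Z \<omega>))\<^sup>2) = liminf (\<lambda>i. ennreal ((norm (F n \<omega> - F (r i) \<omega>))\<^sup>2))"
          by (intro lim_imp_Liminf[symmetric]) auto
      qed
    qed
    also have "\<dots> \<le> liminf (\<lambda>i. \<integral>\<^sup>+\<omega>. ennreal ((norm (F n \<omega> - F (r i) \<omega>))\<^sup>2) \<partial>M)"
      by (rule nn_integral_liminf) simp
    also have "\<dots> \<le> limsup (\<lambda>i. \<integral>\<^sup>+\<omega>. ennreal ((norm (F n \<omega> - F (r i) \<omega>))\<^sup>2) \<partial>M)"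
      by (rule Liminf_le_Limsup) simp
    also have "\<dots> \<le> ennreal (e\<^sup>2)"
    proof (rule Limsup_bounded)
      show "\<forall>\<^sub>F i in sequentially. (\<integral>\<^sup>+\<omega>. ennreal ((norm (F n \<omega> - F (r i) \<omega>))\<^sup>2) \<partial>M) \<le> ennreal (e\<^sup>2)"
        unfolding eventually_sequentially
      proof (intro exI allI impI)
        fix i assume "N \<le> i"
        then have "r i \<ge> N" using seq_suble[OF r(1), of i] by simp
        then have "(l2 M (\<lambda>\<omega>. F n \<omega> - F (r i) \<omega>))\<^sup>2 \<le> e\<^sup>2"
          using N[OF n] by (intro power_mono) (auto intro: less_imp_le)
        moreover have "integrable M (\<lambda>\<omega>. (norm (F n \<omega> - F (r i) \<omega>))\<^sup>2)"
          using sqi_diff[OF s s] by (simp add: square_integrable_def)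
        ultimately show "(\<integral>\<^sup>+\<omega>. ennreal ((norm (F n \<omega> - F (r i) \<omega>))\<^sup>2) \<partial>M) \<le> ennreal (e\<^sup>2)"
          by (subst nn_integral_eq_integral) (auto simp: l2_sq intro!: ennreal_leI)
      qed
    qed
    finally show ?thesis .
  qed
  have Zs: "square_integrable M Z"
  proof -
    obtain N where "\<And>i j. i \<ge> N \<Longrightarrow> j \<ge> N \<Longrightarrow> l2 M (\<lambda>\<omega>. F i \<omega> - F j \<omega>) < 1"
      using C[of 1] by auto
    then have "(\<integral>\<^sup>+\<omega>. ennreal ((norm (F N \<omega> - Z \<omega>))\<^sup>2) \<partial>M) \<le> ennreal 1"
      using fatou[of N 1 N] by simp
    then have "integrable M (\<lambda>\<omega>. (norm (F N \<omega> - Z \<omega>))\<^sup>2)"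
      by (intro integrableI_bounded) (auto simp: top_unique order_le_less_trans)
    then have "square_integrable M (\<lambda>\<omega>. F N \<omega> - Z \<omega>)" by (simp add: square_integrable_def)
    from sqi_diff[OF s[of N] this] show ?thesis by simp
  qed
  have "(\<lambda>n. l2 M (\<lambda>\<omega>. F n \<omega> - Z \<omega>)) \<longlonglongrightarrow> 0"
  proof (rule LIMSEQ_I)
    fix e :: real assume "0 < e"
    then obtain N where N: "\<And>i j. i \<ge> N \<Longrightarrow> j \<ge> N \<Longrightarrow> l2 M (\<lambda>\<omega>. F i \<omega> - F j \<omega>) < e / 2"
      using C[of "e / 2"] by auto
    have "l2 M (\<lambda>\<omega>. F n \<omega> - Z \<omega>) < e" if "n \<ge> N" for n
    proof -
      have "integrable M (\<lambda>\<omega>. (norm (F n \<omega> - Z \<omega>))\<^sup>2)"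
        using sqi_diff[OF s Zs] by (simp add: square_integrable_def)
      then have "ennreal ((l2 M (\<lambda>\<omega>. F n \<omega> - Z \<omega>))\<^sup>2) \<le> ennreal ((e / 2)\<^sup>2)"
        using fatou[OF N that] by (simp add: l2_sq nn_integral_eq_integral)
      then have "(l2 M (\<lambda>\<omega>. F n \<omega> - Z \<omega>))\<^sup>2 \<le> (e / 2)\<^sup>2" by (subst (asm) ennreal_le_iff) (rule zero_le_power2)
      then have "l2 M (\<lambda>\<omega>. F n \<omega> - Z \<omega>) \<le> e / 2" by (rule power2_le_imp_le) (use \<open>0 < e\<close> in simp)
      then show ?thesis using \<open>0 < e\<close> by simp
    qed
    then show "\<exists>N. \<forall>n\<ge>N. norm (l2 M (\<lambda>\<omega>. F n \<omega> - Z \<omega>) - 0) < e" by (auto intro!: exI[of _ N])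
  qed
  with s Zs that show ?thesis by (auto simp: L2_tendsto_iff)
qed

text \<open>The first-order condition at a minimum: a quadratic that is nonnegative and vanishes at \<open>x = 0\<close> has no
  linear term. In the projection below, it is the increase of the squared distance along a direction of \<open>C\<close>.\<close>

lemma linear_term_zero:
  fixes E D :: real
  assumes q: "\<And>x. 0 \<le> 2 * x * E + x\<^sup>2 * D" and D: "0 \<le> D"
  shows "E = 0"
proof (rule ccontr)
  assume E: "E \<noteq> 0"
  define x where "x = - E / (D + 1)"
  have xD: "x * (D + 1) = - E" using D by (simp add: x_def)
  have "2 * x * E + x\<^sup>2 * D = 2 * x * E + x * (x * (D + 1)) - x\<^sup>2"
    by (simp add: power2_eq_square algebra_simps)
  also have "\<dots> = x * E - x\<^sup>2" unfolding xD by simp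
  also have "\<dots> < 0"
  proof -
    have "x * E = - (E\<^sup>2) / (D + 1)" by (simp add: x_def power2_eq_square)
    then have "x * E < 0" using E D by (simp add: divide_neg_pos)
    moreover have "0 \<le> x\<^sup>2" by simp
    ultimately show ?thesis by linarith
  qed
  finally show False using q[of x] by simp
qed

text \<open>Orthogonal projection onto the closure of a linear space \<open>C\<close> of functions. A minimizing sequence
  is Cauchy by the parallelogram identity.\<close>

lemma (in finite_measure) L2_projection:
  fixes f :: "'a \<Rightarrow> 'b::euclidean_space"
  assumes f: "square_integrable M f"
    and C: "\<And>c. c \<in> C \<Longrightarrow> square_integrable M c" and ne: "C \<noteq> {}"
    and lin: "\<And>c d x y. c \<in> C \<Longrightarrow> d \<in> C \<Longrightarrow> (\<lambda>\<omega>. x *\<^sub>R c \<omega> + y *\<^sub>R d \<omega>) \<in> C"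
  obtains c p where "\<And>n. c n \<in> C" "L2_tendsto M c p" "\<And>d. d \<in> C \<Longrightarrow> (\<integral>\<omega>. (f \<omega> - p \<omega>) \<bullet> d \<omega> \<partial>M) = 0"
proof -
  define \<delta> where "\<delta> = (INF c\<in>C. l2 M (\<lambda>\<omega>. f \<omega> - c \<omega>))"
  have bdd: "bdd_below ((\<lambda>c. l2 M (\<lambda>\<omega>. f \<omega> - c \<omega>)) ` C)" by (rule bdd_belowI[of _ 0]) auto
  have \<delta>le: "\<delta> \<le> l2 M (\<lambda>\<omega>. f \<omega> - c \<omega>)" if "c \<in> C" for c
    unfolding \<delta>_def using bdd that by (rule cINF_lower)
  have \<delta>0: "0 \<le> \<delta>" unfolding \<delta>_def using ne by (intro cINF_greatest) auto
  have "\<exists>c\<in>C. l2 M (\<lambda>\<omega>. f \<omega> - c \<omega>) < \<delta> + 1 / Suc n" for n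
    using cINF_less_iff[OF ne bdd, of "\<delta> + 1 / Suc n"] unfolding \<delta>_def by simp
  then obtain c where c: "\<And>n. c n \<in> C" "\<And>n. l2 M (\<lambda>\<omega>. f \<omega> - c n \<omega>) < \<delta> + 1 / Suc n"
    by metis
  have cs: "square_integrable M (c n)" for n using C c by blast
  have fc: "square_integrable M (\<lambda>\<omega>. f \<omega> - c n \<omega>)" for n using sqi_diff[OF f cs] .
  have para: "(l2 M (\<lambda>\<omega>. c i \<omega> - c j \<omega>))\<^sup>2 \<le> 2 * ((\<delta> + 1 / Suc i)\<^sup>2 - \<delta>\<^sup>2) + 2 * ((\<delta> + 1 / Suc j)\<^sup>2 - \<delta>\<^sup>2)" for i j
  proof -
    let ?h = "\<lambda>\<omega>. (1/2) *\<^sub>R c i \<omega> + (1/2) *\<^sub>R c j \<omega>"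
    have p: "(norm (c i \<omega> - c j \<omega>))\<^sup>2 = 2 * (norm (f \<omega> - c i \<omega>))\<^sup>2 + 2 * (norm (f \<omega> - c j \<omega>))\<^sup>2 - 4 * (norm (f \<omega> - ?h \<omega>))\<^sup>2" for \<omega>
    proof -
      have "4 * (norm (f \<omega> - ?h \<omega>))\<^sup>2 = (norm (2 *\<^sub>R (f \<omega> - ?h \<omega>)))\<^sup>2" by (simp add: power_mult_distrib)
      also have "2 *\<^sub>R (f \<omega> - ?h \<omega>) = (f \<omega> - c i \<omega>) + (f \<omega> - c j \<omega>)"
        by (simp add: scaleR_diff_right scaleR_add_right scaleR_2)
      finally have e: "4 * (norm (f \<omega> - ?h \<omega>))\<^sup>2 = (norm ((f \<omega> - c i \<omega>) + (f \<omega> - c j \<omega>)))\<^sup>2" .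
      have "c i \<omega> - c j \<omega> = (f \<omega> - c j \<omega>) - (f \<omega> - c i \<omega>)" by simp
      then show ?thesis unfolding e
        by (simp only: power2_norm_eq_inner inner_add_left inner_add_right inner_diff_left inner_diff_right inner_commute)
          (simp add: inner_commute)
    qed
    have hC: "?h \<in> C" using lin[OF c(1) c(1)] .
    have i: "integrable M (\<lambda>\<omega>. (norm (f \<omega> - c i \<omega>))\<^sup>2)" "integrable M (\<lambda>\<omega>. (norm (f \<omega> - c j \<omega>))\<^sup>2)"
        "integrable M (\<lambda>\<omega>. (norm (f \<omega> - ?h \<omega>))\<^sup>2)"
      using fc sqi_diff[OF f C[OF hC]] by (auto simp: square_integrable_def)
    have "(l2 M (\<lambda>\<omega>. c i \<omega> - c j \<omega>))\<^sup>2 = 2 * (l2 M (\<lambda>\<omega>. f \<omega> - c i \<omega>))\<^sup>2 + 2 * (l2 M (\<lambda>\<omega>. f \<omega> - c j \<omega>))\<^sup>2 - 4 * (l2 M (\<lambda>\<omega>. f \<omega> - ?h \<omega>))\<^sup>2"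
      unfolding l2_sq p using i by simp
    moreover have "\<delta>\<^sup>2 \<le> (l2 M (\<lambda>\<omega>. f \<omega> - ?h \<omega>))\<^sup>2" using \<delta>le[OF hC] \<delta>0 by (simp add: power_mono)
    moreover have "(l2 M (\<lambda>\<omega>. f \<omega> - c i \<omega>))\<^sup>2 \<le> (\<delta> + 1 / Suc i)\<^sup>2" "(l2 M (\<lambda>\<omega>. f \<omega> - c j \<omega>))\<^sup>2 \<le> (\<delta> + 1 / Suc j)\<^sup>2"
      by (rule power_mono[OF less_imp_le[OF c(2)]], simp)+
    ultimately show ?thesis by (simp add: algebra_simps)
  qed
  have dz: "(\<lambda>n. 2 * ((\<delta> + 1 / Suc n)\<^sup>2 - \<delta>\<^sup>2)) \<longlonglongrightarrow> 0"
  proof -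
    have "(\<lambda>n. 2 * ((\<delta> + 1 / Suc n)\<^sup>2 - \<delta>\<^sup>2)) \<longlonglongrightarrow> 2 * ((\<delta> + 0)\<^sup>2 - \<delta>\<^sup>2)"
      by (intro tendsto_intros LIMSEQ_inverse_real_of_nat[unfolded inverse_eq_divide])
    then show ?thesis by simp
  qed
  have cauchy: "\<exists>N. \<forall>i\<ge>N. \<forall>j\<ge>N. l2 M (\<lambda>\<omega>. c i \<omega> - c j \<omega>) < e" if "0 < e" for e
  proof -
    have "\<forall>\<^sub>F n in sequentially. 2 * ((\<delta> + 1 / Suc n)\<^sup>2 - \<delta>\<^sup>2) < e\<^sup>2 / 2"
      using order_tendstoD(2)[OF dz, of "e\<^sup>2 / 2"] \<open>0 < e\<close> by simp
    then obtain N where N: "\<And>n. n \<ge> N \<Longrightarrow> 2 * ((\<delta> + 1 / Suc n)\<^sup>2 - \<delta>\<^sup>2) < e\<^sup>2 / 2"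
      unfolding eventually_sequentially by blast
    have "l2 M (\<lambda>\<omega>. c i \<omega> - c j \<omega>) < e" if "i \<ge> N" "j \<ge> N" for i j
    proof (rule power2_less_imp_less)
      show "(l2 M (\<lambda>\<omega>. c i \<omega> - c j \<omega>))\<^sup>2 < e\<^sup>2"
        using para[of i j] N[OF that(1)] N[OF that(2)] by linarith
    qed (use \<open>0 < e\<close> in simp)
    then show ?thesis by blast
  qed
  obtain p where p: "L2_tendsto M c p" by (rule L2_complete[OF cs cauchy])
  have ps: "square_integrable M p" using p by (simp add: L2_tendsto_iff)
  have fp: "square_integrable M (\<lambda>\<omega>. f \<omega> - p \<omega>)" using sqi_diff[OF f ps] .
  have "l2 M (\<lambda>\<omega>. f \<omega> - p \<omega>) \<le> \<delta>"
  proof (rule LIMSEQ_le_const)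
    have "(\<lambda>n. (\<delta> + 1 / Suc n) + l2 M (\<lambda>\<omega>. c n \<omega> - p \<omega>)) \<longlonglongrightarrow> (\<delta> + 0) + 0"
      using p by (intro tendsto_intros LIMSEQ_inverse_real_of_nat[unfolded inverse_eq_divide]) (simp add: L2_tendsto_iff)
    then show "(\<lambda>n. (\<delta> + 1 / Suc n) + l2 M (\<lambda>\<omega>. c n \<omega> - p \<omega>)) \<longlonglongrightarrow> \<delta>" by simp
    have "l2 M (\<lambda>\<omega>. f \<omega> - p \<omega>) \<le> (\<delta> + 1 / Suc n) + l2 M (\<lambda>\<omega>. c n \<omega> - p \<omega>)" for n
      using l2_triangle_diff[OF f cs ps, of n] c(2)[of n] by simp
    then show "\<exists>N. \<forall>n\<ge>N. l2 M (\<lambda>\<omega>. f \<omega> - p \<omega>) \<le> (\<delta> + 1 / Suc n) + l2 M (\<lambda>\<omega>. c n \<omega> - p \<omega>)" by blast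
  qed
  then have le: "(l2 M (\<lambda>\<omega>. f \<omega> - p \<omega>))\<^sup>2 \<le> \<delta>\<^sup>2" by (simp add: power_mono)
  have ge: "\<delta>\<^sup>2 \<le> (l2 M (\<lambda>\<omega>. f \<omega> - p \<omega> + x *\<^sub>R d \<omega>))\<^sup>2" if d: "d \<in> C" for d x
  proof -
    have ds: "square_integrable M (\<lambda>\<omega>. x *\<^sub>R d \<omega>)" using C[OF d] by (rule sqi_scale)
    have "\<delta> \<le> l2 M (\<lambda>\<omega>. f \<omega> - p \<omega> + x *\<^sub>R d \<omega>)"
    proof (rule LIMSEQ_le_const)
      have "(\<lambda>n. l2 M (\<lambda>\<omega>. f \<omega> - p \<omega> + x *\<^sub>R d \<omega>) + l2 M (\<lambda>\<omega>. c n \<omega> - p \<omega>)) \<longlonglongrightarrow> l2 M (\<lambda>\<omega>. f \<omega> - p \<omega> + x *\<^sub>R d \<omega>) + 0"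
        using p by (intro tendsto_intros) (auto simp: L2_tendsto_iff)
      then show "(\<lambda>n. l2 M (\<lambda>\<omega>. f \<omega> - p \<omega> + x *\<^sub>R d \<omega>) + l2 M (\<lambda>\<omega>. c n \<omega> - p \<omega>)) \<longlonglongrightarrow> l2 M (\<lambda>\<omega>. f \<omega> - p \<omega> + x *\<^sub>R d \<omega>)" by simp
      have "\<delta> \<le> l2 M (\<lambda>\<omega>. f \<omega> - p \<omega> + x *\<^sub>R d \<omega>) + l2 M (\<lambda>\<omega>. c n \<omega> - p \<omega>)" for n
      proof -
        have "(\<lambda>\<omega>. 1 *\<^sub>R c n \<omega> + (- x) *\<^sub>R d \<omega>) \<in> C" using lin[OF c(1) d] .
        then have "\<delta> \<le> l2 M (\<lambda>\<omega>. f \<omega> - (1 *\<^sub>R c n \<omega> + (- x) *\<^sub>R d \<omega>))" by (rule \<delta>le)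
        also have "\<dots> = l2 M (\<lambda>\<omega>. (f \<omega> - p \<omega> + x *\<^sub>R d \<omega>) + (p \<omega> - c n \<omega>))" by (simp add: algebra_simps)
        also have "\<dots> \<le> l2 M (\<lambda>\<omega>. f \<omega> - p \<omega> + x *\<^sub>R d \<omega>) + l2 M (\<lambda>\<omega>. p \<omega> - c n \<omega>)"
          by (intro l2_triangle sqi_add fp ds sqi_diff ps cs)
        finally show ?thesis by (simp add: l2_minus_commute[of M p])
      qed
      then show "\<exists>N. \<forall>n\<ge>N. \<delta> \<le> l2 M (\<lambda>\<omega>. f \<omega> - p \<omega> + x *\<^sub>R d \<omega>) + l2 M (\<lambda>\<omega>. c n \<omega> - p \<omega>)" by blast
    qed
    then show ?thesis using \<delta>0 by (simp add: power_mono)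
  qed
  have "(\<integral>\<omega>. (f \<omega> - p \<omega>) \<bullet> d \<omega> \<partial>M) = 0" if d: "d \<in> C" for d
  proof -
    let ?E = "\<integral>\<omega>. (f \<omega> - p \<omega>) \<bullet> d \<omega> \<partial>M" and ?D = "\<integral>\<omega>. (norm (d \<omega>))\<^sup>2 \<partial>M"
    have q: "0 \<le> 2 * x * ?E + x\<^sup>2 * ?D" for x
      using ge[OF d, of x] le unfolding l2_sq integral_norm_sq_add[OF fp C[OF d]] by simp
    show ?thesis by (rule linear_term_zero[OF q]) simp
  qed
  with c(1) p that show ?thesis by blast
qed

section \<open>Detecting vanishing conditional expectations by Fourier transforms\<close>

abbreviation sint :: "'a measure \<Rightarrow> 'a set \<Rightarrow> ('a \<Rightarrow> complex) \<Rightarrow> complex" where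
  "sint M A g \<equiv> (\<integral>\<omega>. indicat_real A \<omega> *\<^sub>R g \<omega> \<partial>M)"

lemma integrable_indicator_scale:
  assumes "integrable M (g :: 'a \<Rightarrow> complex)" "A \<in> sets M"
  shows "integrable M (\<lambda>\<omega>. indicat_real A \<omega> *\<^sub>R g \<omega>)"
  using integrable_mult_indicator[OF assms(2,1)] .

lemma integrable_unimodular:
  assumes "integrable M (g :: 'a \<Rightarrow> complex)" "S \<in> borel_measurable M"
  shows "integrable M (\<lambda>\<omega>. g \<omega> * iexp (S \<omega>))"
proof (rule Bochner_Integration.integrable_bound[OF assms(1)])
  show "(\<lambda>\<omega>. g \<omega> * iexp (S \<omega>)) \<in> borel_measurable M" using assms by measurable
  show "AE \<omega> in M. norm (g \<omega> * iexp (S \<omega>)) \<le> norm (g \<omega>)" by (simp add: norm_mult)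
qed

text \<open>The sets over which \<open>g\<close> integrates to zero form a Dynkin system.\<close>

lemma dynkin_zero:
  assumes g: "integrable M (g :: 'a \<Rightarrow> complex)" and E: "Int_stable E" "E \<subseteq> sets M"
    and tot: "(\<integral>\<omega>. g \<omega> \<partial>M) = 0" and gen: "\<And>A. A \<in> E \<Longrightarrow> sint M A g = 0"
    and A: "A \<in> sigma_sets (space M) E"
  shows "sint M A g = 0"
proof -
  have EP: "E \<subseteq> Pow (space M)" using E(2) sets.sets_into_space by blast
  have sm: "A \<in> sets M" if "A \<in> sigma_sets (space M) E" for A
    using that E(2) by (meson sets.sigma_sets_subset subsetD)
  from E(1) EP A show ?thesis
  proof (induct rule: sigma_sets_induct_disjoint)
    case (basic A) then show ?case by (rule gen)
  next
    case empty show ?case by simp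
  next
    case (compl A)
    have "sint M (space M - A) g = (\<integral>\<omega>. g \<omega> - indicat_real A \<omega> *\<^sub>R g \<omega> \<partial>M)"
      by (intro Bochner_Integration.integral_cong) (auto simp: indicator_def)
    also have "\<dots> = 0"
      using integrable_indicator_scale[OF g sm[OF compl(1)]] g tot compl(2) by simp
    finally show ?case .
  next
    case (union A)
    have "(LINT x:(\<Union>i. A i)|M. g x) = suminf (\<lambda>i. (LINT x:(A i)|M. g x))"
    proof (rule lebesgue_integral_countable_add)
      show Am: "A i \<in> sets M" for i using union(2) sm by blast
      show "A i \<inter> A j = {}" if "i \<noteq> j" for i j using union(1) that by (auto simp: disjoint_family_on_def)
      show "set_integrable M (\<Union>i. A i) g" unfolding set_integrable_def
        by (rule integrable_indicator_scale[OF g]) (use Am in blast)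
    qed
    then show ?case using union(3) by (simp add: set_lebesgue_integral_def)
  qed
qed

text \<open>The intersections of events from the two families form a generator of the joint \<open>\<sigma>\<close>-algebra that is stable
  under intersection.\<close>

lemma dynkin_zero_joint:
  assumes g: "integrable M (g :: 'a \<Rightarrow> complex)"
    and A: "Int_stable \<A>" "\<A> \<subseteq> sets M" "space M \<in> \<A>"
    and C: "Int_stable \<C>" "\<C> \<subseteq> sets M" "space M \<in> \<C>"
    and z: "\<And>A C. A \<in> \<A> \<Longrightarrow> C \<in> \<C> \<Longrightarrow> sint M (A \<inter> C) g = 0"
    and D: "D \<in> sigma_sets (space M) (\<A> \<union> \<C>)"
  shows "sint M D g = 0"
proof (rule dynkin_zero[OF g])
  let ?E = "{A \<inter> C | A C. A \<in> \<A> \<and> C \<in> \<C>}"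
  show "Int_stable ?E"
  proof (rule Int_stableI)
    fix a b assume "a \<in> ?E" "b \<in> ?E"
    then obtain A1 C1 A2 C2 where *: "a = A1 \<inter> C1" "b = A2 \<inter> C2" "A1 \<in> \<A>" "A2 \<in> \<A>" "C1 \<in> \<C>" "C2 \<in> \<C>" by blast
    then have "a \<inter> b = (A1 \<inter> A2) \<inter> (C1 \<inter> C2)" by blast
    moreover have "A1 \<inter> A2 \<in> \<A>" "C1 \<inter> C2 \<in> \<C>" using * A(1) C(1) by (auto dest: Int_stableD)
    ultimately show "a \<inter> b \<in> ?E" by blast
  qed
  show "?E \<subseteq> sets M" using A(2) C(2) by blast
  have "sint M (space M \<inter> space M) g = 0" using z A(3) C(3) by blast
  moreover have "sint M (space M) g = (\<integral>\<omega>. g \<omega> \<partial>M)"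
    by (intro Bochner_Integration.integral_cong) auto
  ultimately show "(\<integral>\<omega>. g \<omega> \<partial>M) = 0" by simp
  show "\<And>A. A \<in> ?E \<Longrightarrow> sint M A g = 0" using z by blast
  have "\<A> \<union> \<C> \<subseteq> ?E"
  proof
    fix x assume "x \<in> \<A> \<union> \<C>"
    then show "x \<in> ?E"
    proof
      assume x: "x \<in> \<A>"
      then have "x = x \<inter> space M" using A(2) sets.sets_into_space by blast
      then show ?thesis using x C(3) by blast
    next
      assume x: "x \<in> \<C>"
      then have "x = space M \<inter> x" using C(2) sets.sets_into_space by blast
      then show ?thesis using x A(3) by blast
    qed
  qed
  then show "D \<in> sigma_sets (space M) ?E" using D sigma_sets_mono'[of "\<A> \<union> \<C>" ?E] by blast
qed

text \<open>A signed density whose Fourier transform along \<open>X\<close> vanishes has vanishing integral over every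
  event of \<open>X\<close>: its positive and negative parts have the same mass, and after normalization the
  distributions of \<open>X\<close> under the two agree by Levy's uniqueness theorem.\<close>

lemma char_zero_real:
  assumes h: "integrable M (h :: 'a \<Rightarrow> real)" and X[measurable]: "X \<in> borel_measurable M"
    and z: "\<And>l. (\<integral>\<omega>. complex_of_real (h \<omega>) * iexp (l * X \<omega>) \<partial>M) = 0" and C: "C \<in> sets borel"
  shows "(\<integral>\<omega>. indicat_real C (X \<omega>) * h \<omega> \<partial>M) = 0"
proof -
  have hm[measurable]: "h \<in> borel_measurable M" using h by simp
  define p where "p = (\<lambda>\<omega>. max 0 (h \<omega>))"
  define n where "n = (\<lambda>\<omega>. max 0 (- h \<omega>))"
  have pn[measurable]: "p \<in> borel_measurable M" "n \<in> borel_measurable M" by (auto simp: p_def n_def)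
  have hpn: "h \<omega> = p \<omega> - n \<omega>" for \<omega> by (auto simp: p_def n_def)
  have nn: "0 \<le> p \<omega>" "0 \<le> n \<omega>" for \<omega> by (auto simp: p_def n_def)
  have ip: "integrable M p" "integrable M n" using h by (auto simp: p_def n_def)
  define m where "m = (\<integral>\<omega>. p \<omega> \<partial>M)"
  have "complex_of_real (\<integral>\<omega>. h \<omega> \<partial>M) = 0" using z[of 0] by simp
  then have "(\<integral>\<omega>. h \<omega> \<partial>M) = 0" by simp
  then have mn: "m = (\<integral>\<omega>. n \<omega> \<partial>M)" unfolding m_def hpn using ip by simp
  have i2: "integrable M (\<lambda>\<omega>. indicat_real C (X \<omega>) * p \<omega>)" "integrable M (\<lambda>\<omega>. indicat_real C (X \<omega>) * n \<omega>)"
    using C by (intro Bochner_Integration.integrable_bound[OF ip(1)], auto simp: indicator_def)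
      (use C in \<open>intro Bochner_Integration.integrable_bound[OF ip(2)], auto simp: indicator_def\<close>)
  show ?thesis
  proof (cases "m = 0")
    case True
    then have "AE \<omega> in M. p \<omega> = 0" "AE \<omega> in M. n \<omega> = 0"
      using integral_nonneg_eq_0_iff_AE[OF ip(1)] integral_nonneg_eq_0_iff_AE[OF ip(2)] nn mn by (auto simp: m_def)
    then have "AE \<omega> in M. indicat_real C (X \<omega>) * h \<omega> = 0" by eventually_elim (simp add: hpn)
    then show ?thesis by (simp add: integral_eq_zero_AE)
  next
    case False
    then have m0: "0 < m" using nn by (simp add: m_def order_less_le)
    define N where "N k = distr (density M (\<lambda>\<omega>. ennreal (k \<omega> / m))) borel X" for k
    have int: "integral\<^sup>L (N k) f = (\<integral>\<omega>. (k \<omega> / m) *\<^sub>R f (X \<omega>) \<partial>M)"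
      if "k \<in> borel_measurable M" "\<And>\<omega>. 0 \<le> k \<omega>" "f \<in> borel_measurable borel"
      for k and f :: "real \<Rightarrow> 'c::{banach, second_countable_topology}"
      unfolding N_def using that m0 by (subst integral_distr) (auto simp: integral_density)
    have rd: "real_distribution (N k)" if "integrable M k" "(\<integral>\<omega>. k \<omega> \<partial>M) = m" "\<And>\<omega>. 0 \<le> k \<omega>" for k
    proof -
      have [measurable]: "k \<in> borel_measurable M" using that by simp
      have "emeasure (density M (\<lambda>\<omega>. ennreal (k \<omega> / m))) (space M) = (\<integral>\<^sup>+\<omega>. ennreal (k \<omega> / m) \<partial>M)"
        by (subst emeasure_density) (auto intro!: nn_integral_cong)
      also have "\<dots> = ennreal (\<integral>\<omega>. k \<omega> / m \<partial>M)"
        using that m0 by (intro nn_integral_eq_integral) auto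
      also have "\<dots> = 1" using that m0 by simp
      finally have "prob_space (density M (\<lambda>\<omega>. ennreal (k \<omega> / m)))" by (intro prob_spaceI) simp
      then interpret d: prob_space "density M (\<lambda>\<omega>. ennreal (k \<omega> / m))" .
      show ?thesis unfolding N_def by (rule d.real_distribution_distr) simp
    qed
    have "N p = N n"
    proof (rule Levy_uniqueness)
      show "real_distribution (N p)" "real_distribution (N n)" using rd ip nn mn m_def by auto
      show "char (N p) = char (N n)"
      proof
        fix l
        have ii: "integrable M (\<lambda>\<omega>. complex_of_real (p \<omega>) * iexp (l * X \<omega>))"
          "integrable M (\<lambda>\<omega>. complex_of_real (n \<omega>) * iexp (l * X \<omega>))"
          using integrable_unimodular[of M "\<lambda>\<omega>. complex_of_real (p \<omega>)" "\<lambda>\<omega>. l * X \<omega>"]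
            integrable_unimodular[of M "\<lambda>\<omega>. complex_of_real (n \<omega>)" "\<lambda>\<omega>. l * X \<omega>"] ip by simp_all
        have "0 = (\<integral>\<omega>. complex_of_real (p \<omega>) * iexp (l * X \<omega>) - complex_of_real (n \<omega>) * iexp (l * X \<omega>) \<partial>M)"
          unfolding z[of l, symmetric] by (simp add: hpn algebra_simps)
        also have "\<dots> = (\<integral>\<omega>. complex_of_real (p \<omega>) * iexp (l * X \<omega>) \<partial>M) - (\<integral>\<omega>. complex_of_real (n \<omega>) * iexp (l * X \<omega>) \<partial>M)"
          using ii by simp
        finally have e: "(\<integral>\<omega>. complex_of_real (p \<omega>) * iexp (l * X \<omega>) \<partial>M) = (\<integral>\<omega>. complex_of_real (n \<omega>) * iexp (l * X \<omega>) \<partial>M)"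
          by simp
        have s: "(\<integral>\<omega>. (k \<omega> / m) *\<^sub>R iexp (l * X \<omega>) \<partial>M) = (\<integral>\<omega>. complex_of_real (k \<omega>) * iexp (l * X \<omega>) \<partial>M) / m" for k
          by (simp add: scaleR_conv_of_real)
        have "char (N k) l = (\<integral>\<omega>. (k \<omega> / m) *\<^sub>R iexp (l * X \<omega>) \<partial>M)" if "k \<in> borel_measurable M" "\<And>\<omega>. 0 \<le> k \<omega>" for k
          unfolding char_def using that by (intro int) auto
        then show "char (N p) l = char (N n) l" using nn s e by simp
      qed
    qed
    then have "(\<integral>x. indicat_real C x \<partial>N p) = (\<integral>x. indicat_real C x \<partial>N n)" by simp
    then have "(\<integral>\<omega>. indicat_real C (X \<omega>) * p \<omega> \<partial>M) = (\<integral>\<omega>. indicat_real C (X \<omega>) * n \<omega> \<partial>M)"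
      using int[of p "indicat_real C"] int[of n "indicat_real C"] nn C m0 by (simp add: mult.commute)
    then show ?thesis using i2 by (simp add: hpn right_diff_distrib)
  qed
qed

lemma char_zero:
  assumes g: "integrable M (g :: 'a \<Rightarrow> complex)" and X[measurable]: "X \<in> borel_measurable M"
    and z: "\<And>l. (\<integral>\<omega>. g \<omega> * iexp (l * X \<omega>) \<partial>M) = 0" and C: "C \<in> sets borel"
  shows "(\<integral>\<omega>. indicat_real C (X \<omega>) *\<^sub>R g \<omega> \<partial>M) = 0"
proof -
  have ii: "integrable M (\<lambda>\<omega>. g \<omega> * iexp (l * X \<omega>))" "integrable M (\<lambda>\<omega>. cnj (g \<omega>) * iexp (l * X \<omega>))" for l
    using integrable_unimodular[OF g, of "\<lambda>\<omega>. l * X \<omega>"]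
      integrable_unimodular[of M "\<lambda>\<omega>. cnj (g \<omega>)" "\<lambda>\<omega>. l * X \<omega>"] g by simp_all
  have z': "(\<integral>\<omega>. cnj (g \<omega>) * iexp (l * X \<omega>) \<partial>M) = 0" for l
  proof -
    have "(\<integral>\<omega>. cnj (g \<omega>) * iexp (l * X \<omega>) \<partial>M) = (\<integral>\<omega>. cnj (g \<omega> * iexp (- l * X \<omega>)) \<partial>M)"
      by (simp add: exp_cnj)
    also have "\<dots> = cnj (\<integral>\<omega>. g \<omega> * iexp (- l * X \<omega>) \<partial>M)" by (rule Bochner_Integration.integral_cnj)
    finally show ?thesis using z[of "- l"] by simp
  qed
  have re: "(\<integral>\<omega>. indicat_real C (X \<omega>) * Re (g \<omega>) \<partial>M) = 0"
  proof (rule char_zero_real[OF _ X _ C])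
    show "integrable M (\<lambda>\<omega>. Re (g \<omega>))" using g by simp
    fix l
    have e: "complex_of_real (Re (g \<omega>)) * iexp (l * X \<omega>) = (g \<omega> * iexp (l * X \<omega>) + cnj (g \<omega>) * iexp (l * X \<omega>)) / 2" for \<omega>
      by (simp add: complex_eq_iff algebra_simps)
    show "(\<integral>\<omega>. complex_of_real (Re (g \<omega>)) * iexp (l * X \<omega>) \<partial>M) = 0"
      unfolding e using ii[of l] z[of l] z'[of l] by simp
  qed
  have im: "(\<integral>\<omega>. indicat_real C (X \<omega>) * Im (g \<omega>) \<partial>M) = 0"
  proof (rule char_zero_real[OF _ X _ C])
    show "integrable M (\<lambda>\<omega>. Im (g \<omega>))" using g by simp
    fix l
    have e: "complex_of_real (Im (g \<omega>)) * iexp (l * X \<omega>) = (- \<i> / 2) * (g \<omega> * iexp (l * X \<omega>) - cnj (g \<omega>) * iexp (l * X \<omega>))" for \<omega>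
    proof -
      have "complex_of_real (Im (g \<omega>)) = (- \<i> / 2) * (g \<omega> - cnj (g \<omega>))" by (simp add: complex_eq_iff)
      then show ?thesis by (simp only: left_diff_distrib right_diff_distrib mult.assoc)
    qed
    show "(\<integral>\<omega>. complex_of_real (Im (g \<omega>)) * iexp (l * X \<omega>) \<partial>M) = 0"
      unfolding e using ii[of l] z[of l] z'[of l] by simp
  qed
  have i: "integrable M (\<lambda>\<omega>. indicat_real C (X \<omega>) *\<^sub>R g \<omega>)"
  proof -
    have "integrable M (\<lambda>\<omega>. indicat_real (X -` C \<inter> space M) \<omega> *\<^sub>R g \<omega>)"
      by (rule integrable_indicator_scale[OF g]) (use C X in \<open>auto intro: measurable_sets\<close>)
    then show ?thesis by (rule Bochner_Integration.integrable_cong[THEN iffD1, OF refl, rotated]) (auto simp: indicator_def)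
  qed
  have "Re (\<integral>\<omega>. indicat_real C (X \<omega>) *\<^sub>R g \<omega> \<partial>M) = 0" "Im (\<integral>\<omega>. indicat_real C (X \<omega>) *\<^sub>R g \<omega> \<partial>M) = 0"
    using re im Bochner_Integration.integral_Re[OF i] Bochner_Integration.integral_Im[OF i] by simp_all
  then show ?thesis by (simp add: complex_eq_iff)
qed

text \<open>If \<open>g\<close> is orthogonal to all exponentials \<open>e\<^sup>i\<^sup>S\<close> for \<open>S\<close> in a class stable under adding multiples of
  the \<open>X i\<close>, then exponents can be traded for events one coordinate at a time, so \<open>g\<close> is orthogonal
  to the \<open>\<sigma>\<close>-algebra of the \<open>X i\<close>. Null sets can be adjoined because they are negligible and form a
  class stable under intersection with anything.\<close>

lemma fourier_zero:
  fixes X :: "'i \<Rightarrow> 'a \<Rightarrow> real"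
  assumes g: "integrable M (g :: 'a \<Rightarrow> complex)"
    and X: "\<And>i. i \<in> I \<Longrightarrow> X i \<in> borel_measurable M"
    and L: "\<And>S. S \<in> L \<Longrightarrow> S \<in> borel_measurable M" "(\<lambda>\<omega>. 0) \<in> L"
      "\<And>S i c. S \<in> L \<Longrightarrow> i \<in> I \<Longrightarrow> (\<lambda>\<omega>. S \<omega> + c * X i \<omega>) \<in> L"
    and z: "\<And>S. S \<in> L \<Longrightarrow> (\<integral>\<omega>. g \<omega> * iexp (S \<omega>) \<partial>M) = 0"
    and A: "A \<in> sigma_sets (space M) ((\<Union>i\<in>I. {X i -` C \<inter> space M | C. C \<in> sets borel}) \<union> null_sets M)"
  shows "sint M A g = 0"
proof -
  define cyl where "cyl F C = {\<omega> \<in> space M. \<forall>i\<in>F. X i \<omega> \<in> C i}" for F C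
  have cylM: "cyl F C \<in> sets M" if "finite F" "F \<subseteq> I" "\<And>i. C i \<in> sets borel" for F C
    unfolding cyl_def
  proof (rule sets.sets_Collect_finite_All[OF _ that(1)])
    fix i assume "i \<in> F"
    then have "X i -` C i \<inter> space M \<in> sets M" using that X by (intro measurable_sets[of _ _ borel]) auto
    then show "{\<omega> \<in> space M. X i \<omega> \<in> C i} \<in> sets M" by (simp add: vimage_def Int_def conj_commute)
  qed
  have step: "(\<integral>\<omega>. indicat_real (cyl F C) \<omega> *\<^sub>R (g \<omega> * iexp (S \<omega>)) \<partial>M) = 0"
    if "finite F" "F \<subseteq> I" "\<And>i. C i \<in> sets borel" "S \<in> L" for F C S
    using that(1,2,4)
  proof (induction F arbitrary: S)
    case empty
    have "(\<integral>\<omega>. indicat_real (cyl {} C) \<omega> *\<^sub>R (g \<omega> * iexp (S \<omega>)) \<partial>M) = (\<integral>\<omega>. g \<omega> * iexp (S \<omega>) \<partial>M)"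
      by (intro Bochner_Integration.integral_cong) (auto simp: cyl_def)
    then show ?case using z empty by simp
  next
    case (insert i F)
    let ?g = "\<lambda>\<omega>. indicat_real (cyl F C) \<omega> *\<^sub>R (g \<omega> * iexp (S \<omega>))"
    have [measurable]: "S \<in> borel_measurable M" "X i \<in> borel_measurable M" using L(1) X insert by auto
    have cF: "cyl F C \<in> sets M" using cylM insert that(3) by auto
    have gi: "integrable M ?g"
      by (intro integrable_indicator_scale integrable_unimodular g cF) simp
    have "(\<integral>\<omega>. indicat_real (C i) (X i \<omega>) *\<^sub>R ?g \<omega> \<partial>M) = 0"
    proof (rule char_zero[OF gi])
      fix l
      have "(\<lambda>\<omega>. S \<omega> + l * X i \<omega>) \<in> L" using L(3) insert by simp
      then have "(\<integral>\<omega>. indicat_real (cyl F C) \<omega> *\<^sub>R (g \<omega> * iexp (S \<omega> + l * X i \<omega>)) \<partial>M) = 0"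
        using insert.IH insert.prems by blast
      then show "(\<integral>\<omega>. ?g \<omega> * iexp (l * X i \<omega>) \<partial>M) = 0"
        by (simp add: distrib_left exp_add mult.assoc)
    qed (use that(3) in auto)
    moreover have "indicat_real (cyl (insert i F) C) \<omega> = indicat_real (C i) (X i \<omega>) * indicat_real (cyl F C) \<omega>" for \<omega>
      by (auto simp: cyl_def indicator_def)
    ultimately show ?case by (simp add: mult.assoc)
  qed
  let ?E = "{cyl F C | F C. finite F \<and> F \<subseteq> I \<and> (\<forall>i. C i \<in> sets borel)} \<union> null_sets M"
  have EM: "?E \<subseteq> sets M" using cylM by auto
  show ?thesis
  proof (rule dynkin_zero[OF g _ EM])
    show "Int_stable ?E"
    proof (rule Int_stableI)
      fix a b assume ab: "a \<in> ?E" "b \<in> ?E"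
      show "a \<inter> b \<in> ?E"
      proof (cases "a \<in> null_sets M \<or> b \<in> null_sets M")
        case True
        moreover have "a \<in> sets M" "b \<in> sets M" using ab EM by blast+
        ultimately have "a \<inter> b \<in> null_sets M" using null_set_Int1 null_set_Int2 by metis
        then show ?thesis by blast
      next
        case False
        then obtain F1 C1 F2 C2 where *: "a = cyl F1 C1" "finite F1" "F1 \<subseteq> I" "\<And>i. C1 i \<in> sets borel"
            "b = cyl F2 C2" "finite F2" "F2 \<subseteq> I" "\<And>i. C2 i \<in> sets borel"
          using ab by blast
        define C where "C i = (if i \<in> F1 then C1 i else UNIV) \<inter> (if i \<in> F2 then C2 i else UNIV)" for i
        have "a \<inter> b = cyl (F1 \<union> F2) C" unfolding * cyl_def C_def by (auto split: if_splits)
        moreover have "\<forall>i. C i \<in> sets borel" using * by (auto simp: C_def)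
        ultimately show ?thesis using * by blast
      qed
    qed
    have "(\<integral>\<omega>. g \<omega> * iexp 0 \<partial>M) = 0" using z[OF L(2)] .
    then show "(\<integral>\<omega>. g \<omega> \<partial>M) = 0" by simp
    fix B assume "B \<in> ?E"
    then show "sint M B g = 0"
    proof
      assume "B \<in> null_sets M"
      then have "AE \<omega> in M. indicat_real B \<omega> *\<^sub>R g \<omega> = 0"
        by (auto dest!: AE_not_in elim!: eventually_mono)
      then show ?thesis by (simp add: integral_eq_zero_AE)
    next
      assume "B \<in> {cyl F C | F C. finite F \<and> F \<subseteq> I \<and> (\<forall>i. C i \<in> sets borel)}"
      then obtain F C where "B = cyl F C" "finite F" "F \<subseteq> I" "\<And>i. C i \<in> sets borel" by blast
      then show ?thesis using step[of F C "\<lambda>\<omega>. 0"] L(2) by simp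
    qed
  next
    have "(\<Union>i\<in>I. {X i -` C \<inter> space M | C. C \<in> sets borel}) \<union> null_sets M \<subseteq> ?E"
    proof
      fix B assume "B \<in> (\<Union>i\<in>I. {X i -` C \<inter> space M | C. C \<in> sets borel}) \<union> null_sets M"
      then show "B \<in> ?E"
      proof
        assume "B \<in> (\<Union>i\<in>I. {X i -` C \<inter> space M | C. C \<in> sets borel})"
        then obtain i C where "i \<in> I" "C \<in> sets borel" "B = X i -` C \<inter> space M" by blast
        moreover from this have "B = cyl {i} (\<lambda>_. C)" by (auto simp: cyl_def)
        ultimately show ?thesis by (intro UnI1 CollectI exI[of _ "{i}"] exI[of _ "\<lambda>_. C"]) simp
      qed (rule UnI2)
    qed
    from subsetD[OF sigma_sets_mono'[OF this] A] show "A \<in> sigma_sets (space M) ?E" .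
  qed
qed

lemma zero_on_subalgebra_real:
  assumes fin: "finite_measure M" and sub: "subalgebra M G" and h: "integrable M (h :: 'a \<Rightarrow> real)"
    and z: "\<And>A. A \<in> sets G \<Longrightarrow> (\<integral>\<omega>. indicat_real A \<omega> * h \<omega> \<partial>M) = 0"
    and Z: "Z \<in> borel_measurable G" "integrable M (\<lambda>\<omega>. Z \<omega> * h \<omega>)"
  shows "(\<integral>\<omega>. Z \<omega> * h \<omega> \<partial>M) = 0"
proof -
  interpret finite_measure_subalgebra M G
    by (simp add: finite_measure_subalgebra_def finite_measure_subalgebra_axioms_def fin sub)
  interpret sigma_finite_subalgebra M G
    by (rule finite_measure_subalgebra_is_sigma_finite) unfold_locales
  have ae: "AE x in M. real_cond_exp M G h x = 0"
    by (rule real_cond_exp_charact) (use z h in \<open>auto simp: set_lebesgue_integral_def\<close>)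
  have "(\<integral>\<omega>. Z \<omega> * h \<omega> \<partial>M) = (\<integral>\<omega>. Z \<omega> * real_cond_exp M G h \<omega> \<partial>M)"
    using real_cond_exp_intg(2)[OF Z(2,1)] h by simp
  also have "\<dots> = 0" by (rule integral_eq_zero_AE) (use ae in \<open>eventually_elim, simp\<close>)
  finally show ?thesis .
qed

text \<open>The conditional expectation of \<open>g\<close> given \<open>G\<close> vanishes, and a \<open>G\<close>-measurable factor can be pulled out of it.\<close>

lemma zero_on_subalgebra:
  assumes fin: "finite_measure M" and sub: "subalgebra M G" and g: "integrable M (g :: 'a \<Rightarrow> complex)"
    and z: "\<And>A. A \<in> sets G \<Longrightarrow> sint M A g = 0"
    and Z: "Z \<in> borel_measurable G" "integrable M (\<lambda>\<omega>. Z \<omega> * g \<omega>)"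
  shows "(\<integral>\<omega>. Z \<omega> * g \<omega> \<partial>M) = 0"
proof -
  have ZM[measurable]: "Z \<in> borel_measurable M" "g \<in> borel_measurable M"
    using Z sub g by (auto intro: measurable_from_subalg)
  have gi: "integrable M (\<lambda>\<omega>. indicat_real A \<omega> *\<^sub>R g \<omega>)" if "A \<in> sets G" for A
    using that sub g by (intro integrable_indicator_scale) (auto simp: subalgebra_def)
  have zr: "(\<integral>\<omega>. indicat_real A \<omega> * Re (g \<omega>) \<partial>M) = 0" "(\<integral>\<omega>. indicat_real A \<omega> * Im (g \<omega>) \<partial>M) = 0"
    if "A \<in> sets G" for A
    using z[OF that] Bochner_Integration.integral_Re[OF gi[OF that]] Bochner_Integration.integral_Im[OF gi[OF that]] by simp_all
  have GZ[measurable]: "(\<lambda>\<omega>. Re (Z \<omega>)) \<in> borel_measurable G" "(\<lambda>\<omega>. Im (Z \<omega>)) \<in> borel_measurable G"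
    using Z by simp_all
  have b: "\<bar>Re (Z \<omega>)\<bar> * \<bar>Re (g \<omega>)\<bar> \<le> norm (Z \<omega> * g \<omega>)" "\<bar>Re (Z \<omega>)\<bar> * \<bar>Im (g \<omega>)\<bar> \<le> norm (Z \<omega> * g \<omega>)"
     "\<bar>Im (Z \<omega>)\<bar> * \<bar>Re (g \<omega>)\<bar> \<le> norm (Z \<omega> * g \<omega>)" "\<bar>Im (Z \<omega>)\<bar> * \<bar>Im (g \<omega>)\<bar> \<le> norm (Z \<omega> * g \<omega>)" for \<omega>
    unfolding norm_mult by (intro mult_mono abs_Re_le_cmod abs_Im_le_cmod; simp)+
  have I: "integrable M (\<lambda>\<omega>. Re (Z \<omega>) * Re (g \<omega>))" "integrable M (\<lambda>\<omega>. Re (Z \<omega>) * Im (g \<omega>))"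
     "integrable M (\<lambda>\<omega>. Im (Z \<omega>) * Re (g \<omega>))" "integrable M (\<lambda>\<omega>. Im (Z \<omega>) * Im (g \<omega>))"
    by (rule Bochner_Integration.integrable_bound[OF Z(2)]; (use b in \<open>simp add: abs_mult\<close>)?; measurable)+
  have r: "integrable M (\<lambda>\<omega>. Re (g \<omega>))" "integrable M (\<lambda>\<omega>. Im (g \<omega>))" using g by simp_all
  note zz = zero_on_subalgebra_real[OF fin sub]
  have 0: "(\<integral>\<omega>. Re (Z \<omega>) * Re (g \<omega>) \<partial>M) = 0" "(\<integral>\<omega>. Re (Z \<omega>) * Im (g \<omega>) \<partial>M) = 0"
    "(\<integral>\<omega>. Im (Z \<omega>) * Re (g \<omega>) \<partial>M) = 0" "(\<integral>\<omega>. Im (Z \<omega>) * Im (g \<omega>) \<partial>M) = 0"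
    by (rule zz[OF r(1) zr(1) GZ(1) I(1)] zz[OF r(2) zr(2) GZ(1) I(2)]
       zz[OF r(1) zr(1) GZ(2) I(3)] zz[OF r(2) zr(2) GZ(2) I(4)], assumption)+
  have "Re (\<integral>\<omega>. Z \<omega> * g \<omega> \<partial>M) = 0" "Im (\<integral>\<omega>. Z \<omega> * g \<omega> \<partial>M) = 0"
    unfolding Bochner_Integration.integral_Re[OF Z(2), symmetric] Bochner_Integration.integral_Im[OF Z(2), symmetric]
    using I 0 by simp_all
  then show ?thesis by (simp add: complex_eq_iff)
qed

section \<open>Conditionally Gaussian variables and complex exponentials\<close>

definition gauss :: "real \<Rightarrow> real measure" where
  "gauss \<tau> = density lborel (\<lambda>x. ennreal (normal_density 0 (sqrt \<tau>) x))"

lemma prob_space_gauss: "0 < \<tau> \<Longrightarrow> prob_space (gauss \<tau>)"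
  unfolding gauss_def by (rule prob_space_normal_density) simp

lemma sets_gauss [simp, measurable_cong]: "sets (gauss \<tau>) = sets borel"
  by (simp add: gauss_def)

lemma space_gauss [simp]: "space (gauss \<tau>) = UNIV"
  by (simp add: gauss_def)

lemma normal_density_exp_shift:
  assumes "0 < \<tau>"
  shows "normal_density 0 (sqrt \<tau>) x * exp (a * x) = exp (a\<^sup>2 * \<tau> / 2) * normal_density (a * \<tau>) (sqrt \<tau>) x"
proof -
  have e: "- (x\<^sup>2) / (2 * \<tau>) + a * x = a\<^sup>2 * \<tau> / 2 - (x - a * \<tau>)\<^sup>2 / (2 * \<tau>)"
    using assms by (simp add: field_simps power2_eq_square)
  have "normal_density 0 (sqrt \<tau>) x * exp (a * x) = 1 / sqrt (2 * pi * \<tau>) * exp (- (x\<^sup>2) / (2 * \<tau>) + a * x)"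
    using assms by (simp add: normal_density_def mult_exp_exp)
  also have "\<dots> = exp (a\<^sup>2 * \<tau> / 2) * (1 / sqrt (2 * pi * \<tau>) * exp (- ((x - a * \<tau>)\<^sup>2) / (2 * \<tau>)))"
    unfolding e diff_conv_add_uminus exp_add by simp
  also have "\<dots> = exp (a\<^sup>2 * \<tau> / 2) * normal_density (a * \<tau>) (sqrt \<tau>) x"
    using assms by (simp add: normal_density_def)
  finally show ?thesis .
qed

lemma normal_density_iexp:
  assumes "0 < s"
  shows "(\<integral>x. normal_density \<mu> s x *\<^sub>R iexp (b * x) \<partial>lborel) = exp (\<i> * b * \<mu> - b\<^sup>2 * s\<^sup>2 / 2)"
proof -
  have d: "normal_density \<mu> s (\<mu> + s * y) = std_normal_density y / s" for y
    using assms by (simp add: normal_density_def power_mult_distrib real_sqrt_mult field_simps)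
  have "(\<integral>x. normal_density \<mu> s x *\<^sub>R iexp (b * x) \<partial>lborel) =
      \<bar>s\<bar> *\<^sub>R (\<integral>y. normal_density \<mu> s (\<mu> + s * y) *\<^sub>R iexp (b * (\<mu> + s * y)) \<partial>lborel)"
    using assms by (intro lborel_integral_real_affine) simp
  also have "\<dots> = s *\<^sub>R (\<integral>y. (1 / s) *\<^sub>R (iexp (b * \<mu>) * (std_normal_density y *\<^sub>R iexp ((b * s) * y))) \<partial>lborel)"
    unfolding d using assms by (simp add: distrib_left exp_add mult.assoc scaleR_conv_of_real mult.left_commute)
  also have "\<dots> = iexp (b * \<mu>) * (\<integral>y. std_normal_density y *\<^sub>R iexp ((b * s) * y) \<partial>lborel)"
    unfolding integral_scaleR_right integral_mult_right_zero using assms by simp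
  also have "(\<integral>y. std_normal_density y *\<^sub>R iexp ((b * s) * y) \<partial>lborel) = char std_normal_distribution (b * s)"
    unfolding char_def by (subst integral_density) (auto simp: normal_density_nonneg)
  also have "\<dots> = exp (- (b\<^sup>2 * s\<^sup>2 / 2))"
    unfolding char_std_normal_distribution by (simp add: exp_of_real[symmetric] power_mult_distrib)
  also have "iexp (b * \<mu>) * complex_of_real (exp (- (b\<^sup>2 * s\<^sup>2 / 2))) = exp (\<i> * b * \<mu> - b\<^sup>2 * s\<^sup>2 / 2)"
    by (simp add: mult_exp_exp mult.assoc flip: exp_of_real)
  finally show ?thesis .
qed

text \<open>The real part of \<open>\<zeta>\<close> shifts the mean of the Gaussian density, up to a constant factor; the imaginary part
  is then a characteristic function of the shifted law.\<close>

lemma gauss_cexp: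
  assumes "0 < \<tau>"
  shows "integrable (gauss \<tau>) (\<lambda>x. exp (\<zeta> * complex_of_real x))"
    and "(\<integral>x. exp (\<zeta> * complex_of_real x) \<partial>gauss \<tau>) = exp (\<zeta>\<^sup>2 * \<tau> / 2)"
    and "(\<integral>x. norm (exp (\<zeta> * complex_of_real x)) \<partial>gauss \<tau>) = exp ((Re \<zeta>)\<^sup>2 * \<tau> / 2)"
proof -
  let ?a = "Re \<zeta>" and ?b = "Im \<zeta>"
  have nexp: "norm (exp (\<zeta> * complex_of_real x)) = exp (?a * x)" for x by simp
  have sh: "normal_density 0 (sqrt \<tau>) x * exp (?a * x) = exp (?a\<^sup>2 * \<tau> / 2) * normal_density (?a * \<tau>) (sqrt \<tau>) x" for x
    by (rule normal_density_exp_shift[OF assms])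
  have spl: "exp (\<zeta> * complex_of_real x) = exp (?a * x) *\<^sub>R iexp (?b * x)" for x
  proof -
    have "\<zeta> * complex_of_real x = complex_of_real (?a * x) + \<i> * complex_of_real (?b * x)"
      by (simp add: complex_eq_iff)
    then show ?thesis by (simp add: exp_add scaleR_conv_of_real flip: exp_of_real)
  qed
  have int1: "integrable (gauss \<tau>) (\<lambda>x. exp (?a * x))"
    unfolding gauss_def using assms
    by (subst integrable_density) (auto simp: sh)
  show int: "integrable (gauss \<tau>) (\<lambda>x. exp (\<zeta> * complex_of_real x))"
    by (rule Bochner_Integration.integrable_bound[OF int1]) (auto simp: gauss_def)
  show "(\<integral>x. norm (exp (\<zeta> * complex_of_real x)) \<partial>gauss \<tau>) = exp (?a\<^sup>2 * \<tau> / 2)"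
    unfolding nexp gauss_def using assms
    by (subst integral_density) (auto simp: sh)
  have "(\<integral>x. exp (\<zeta> * complex_of_real x) \<partial>gauss \<tau>) =
      (\<integral>x. normal_density 0 (sqrt \<tau>) x *\<^sub>R (exp (?a * x) *\<^sub>R iexp (?b * x)) \<partial>lborel)"
    unfolding gauss_def spl by (subst integral_density) auto
  also have "\<dots> = (\<integral>x. exp (?a\<^sup>2 * \<tau> / 2) *\<^sub>R (normal_density (?a * \<tau>) (sqrt \<tau>) x *\<^sub>R iexp (?b * x)) \<partial>lborel)"
    by (simp only: scaleR_scaleR sh)
  also have "\<dots> = exp (?a\<^sup>2 * \<tau> / 2) *\<^sub>R exp (\<i> * ?b * (?a * \<tau>) - ?b\<^sup>2 * (sqrt \<tau>)\<^sup>2 / 2)"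
    by (subst integral_scaleR_right, subst normal_density_iexp) (use assms in simp_all)
  also have "\<dots> = exp (complex_of_real (?a\<^sup>2 * \<tau> / 2) + (\<i> * ?b * (?a * \<tau>) - ?b\<^sup>2 * (sqrt \<tau>)\<^sup>2 / 2))"
    by (simp add: scaleR_conv_of_real exp_add flip: exp_of_real)
  also have "complex_of_real (?a\<^sup>2 * \<tau> / 2) + (\<i> * ?b * (?a * \<tau>) - ?b\<^sup>2 * (sqrt \<tau>)\<^sup>2 / 2) = \<zeta>\<^sup>2 * \<tau> / 2"
    using assms by (simp add: complex_eq_iff power2_eq_square algebra_simps)
  finally show "(\<integral>x. exp (\<zeta> * complex_of_real x) \<partial>gauss \<tau>) = exp (\<zeta>\<^sup>2 * \<tau> / 2)" .
qed

text \<open>If \<open>X\<close> is \<open>N(0, \<tau>)\<close> and independent of \<open>G\<close>, then freezing the \<open>G\<close>-measurable exponent \<open>\<zeta>\<close> turns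
  \<open>E[exp (\<zeta> X - \<zeta>\<^sup>2 \<tau> / 2) | G] = 1\<close> into the Gaussian exponential moment, complex exponents included.
  Independence enters through its Fourier form, which identifies the joint law of \<open>(\<omega>, X \<omega>)\<close> on
  \<open>G \<otimes> borel\<close> as a product.\<close>

lemma gauss_exp_step:
  fixes X :: "'a \<Rightarrow> real" and Z \<zeta> :: "'a \<Rightarrow> complex"
  assumes P: "prob_space M" and sub: "subalgebra M G" and X: "X \<in> borel_measurable M" and \<tau>: "0 < \<tau>"
    and ch: "\<And>A l. A \<in> sets G \<Longrightarrow> sint M A (\<lambda>\<omega>. iexp (l * X \<omega>)) = measure M A *\<^sub>R complex_of_real (exp (- (l\<^sup>2 * \<tau> / 2)))"
    and Z: "Z \<in> borel_measurable G" "integrable M Z"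
    and \<zeta>: "\<zeta> \<in> borel_measurable G" "\<And>\<omega>. \<omega> \<in> space M \<Longrightarrow> norm (\<zeta> \<omega>) \<le> c"
  shows "integrable M (\<lambda>\<omega>. Z \<omega> * exp (\<zeta> \<omega> * X \<omega> - (\<zeta> \<omega>)\<^sup>2 * \<tau> / 2))"
    and "(\<integral>\<omega>. Z \<omega> * exp (\<zeta> \<omega> * X \<omega> - (\<zeta> \<omega>)\<^sup>2 * \<tau> / 2) \<partial>M) = (\<integral>\<omega>. Z \<omega> \<partial>M)"
proof -
  interpret prob_space M by (rule P)
  have sp: "space G = space M" using sub by (simp add: subalgebra_def)
  define M1 where "M1 = restr_to_subalg M G"
  interpret M1: prob_space M1 unfolding M1_def by (rule prob_space_restr_to_subalg[OF sub P])
  interpret N: prob_space "gauss \<tau>" by (rule prob_space_gauss[OF \<tau>])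
  interpret pair_sigma_finite M1 "gauss \<tau>" ..
  have sM1: "sets M1 = sets G" unfolding M1_def by (rule sets_restr_to_subalg[OF sub])
  have spM1: "space M1 = space M" unfolding M1_def by (rule space_restr_to_subalg)
  have id: "(\<lambda>\<omega>. \<omega>) \<in> measurable M G" using sub by (auto simp: subalgebra_def measurable_def)
  have pm: "(\<lambda>\<omega>. (\<omega>, X \<omega>)) \<in> measurable M (G \<Otimes>\<^sub>M borel)" using id X by (rule measurable_Pair)
  \<comment> \<open>Normalize \<open>M\<close> on \<open>A\<close>: by Levy's uniqueness theorem \<open>X\<close> still has the law \<open>N(0, \<tau>)\<close> there.\<close>
  have law: "measure M (A \<inter> (X -` C \<inter> space M)) = measure M A * measure (gauss \<tau>) C"
    if A: "A \<in> sets G" and C: "C \<in> sets borel" for A C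
  proof (cases "measure M A = 0")
    case True
    have AM: "A \<in> sets M" using A sub by (auto simp: subalgebra_def)
    have "measure M (A \<inter> (X -` C \<inter> space M)) \<le> measure M A"
      by (rule finite_measure_mono) (use AM in auto)
    then show ?thesis using True by (simp add: measure_le_0_iff)
  next
    case False
    have AM[measurable]: "A \<in> sets M" using A sub by (auto simp: subalgebra_def)
    define m where "m = measure M A"
    have m0: "0 < m" using False by (simp add: m_def zero_less_measure_iff)
    let ?D = "density M (\<lambda>\<omega>. ennreal (indicat_real A \<omega> / m))"
    have "emeasure ?D (space M) = (\<integral>\<^sup>+\<omega>. ennreal (indicat_real A \<omega> / m) \<partial>M)"
      by (subst emeasure_density) (auto intro!: nn_integral_cong)
    also have "\<dots> = ennreal (\<integral>\<omega>. indicat_real A \<omega> / m \<partial>M)"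
    proof (intro nn_integral_eq_integral)
      have "integrable M (indicat_real A)"
        using AM by (intro integrable_real_indicator) (auto simp: less_top[symmetric])
      then show "integrable M (\<lambda>\<omega>. indicat_real A \<omega> / m)" by simp
    qed (use m0 in simp)
    also have "\<dots> = 1" using m0 by (simp add: m_def)
    finally have "prob_space ?D" by (intro prob_spaceI) simp
    then interpret D: prob_space ?D .
    have int: "integral\<^sup>L (distr ?D borel X) f = (\<integral>\<omega>. (indicat_real A \<omega> / m) *\<^sub>R f (X \<omega>) \<partial>M)"
      if "f \<in> borel_measurable borel" for f :: "real \<Rightarrow> 'c::{banach, second_countable_topology}"
      using that X m0 by (subst integral_distr) (auto simp: integral_density)
    have "distr ?D borel X = gauss \<tau>"
    proof (rule Levy_uniqueness)
      show "real_distribution (distr ?D borel X)" by (rule D.real_distribution_distr) (use X in simp)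
      show "real_distribution (gauss \<tau>)" by unfold_locales simp
      show "char (distr ?D borel X) = char (gauss \<tau>)"
      proof
        fix l
        have "char (distr ?D borel X) l = (\<integral>\<omega>. (indicat_real A \<omega> / m) *\<^sub>R iexp (l * X \<omega>) \<partial>M)"
          unfolding char_def by (rule int) simp
        also have "\<dots> = (\<integral>\<omega>. (1 / m) *\<^sub>R (indicat_real A \<omega> *\<^sub>R iexp (l * X \<omega>)) \<partial>M)" by simp
        also have "\<dots> = (1 / m) *\<^sub>R (m *\<^sub>R complex_of_real (exp (- (l\<^sup>2 * \<tau> / 2))))"
          using ch[OF A, of l] by (subst integral_scaleR_right) (simp add: m_def)
        also have "\<dots> = exp ((\<i> * complex_of_real l)\<^sup>2 * \<tau> / 2)"
          using m0 by (simp add: power_mult_distrib exp_of_real[symmetric])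
        also have "\<dots> = char (gauss \<tau>) l"
          unfolding char_def using gauss_cexp(2)[OF \<tau>, of "\<i> * complex_of_real l"] by (simp add: mult.assoc)
        finally show "char (distr ?D borel X) l = char (gauss \<tau>) l" .
      qed
    qed
    then have "measure (gauss \<tau>) C = (\<integral>x. indicat_real C x \<partial>distr ?D borel X)" using C by simp
    also have "\<dots> = (\<integral>\<omega>. (indicat_real A \<omega> / m) *\<^sub>R indicat_real C (X \<omega>) \<partial>M)"
      by (rule int) (use C in simp)
    also have "\<dots> = (\<integral>\<omega>. indicat_real (A \<inter> (X -` C \<inter> space M)) \<omega> / m \<partial>M)"
      by (intro Bochner_Integration.integral_cong) (auto simp: indicator_def)
    also have "\<dots> = measure M (A \<inter> (X -` C \<inter> space M)) / m"
      using C X by (simp add: inf.absorb1 Int_assoc)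
    finally show ?thesis using m0 by (simp add: m_def)
  qed
  have prodeq: "M1 \<Otimes>\<^sub>M gauss \<tau> = distr M (G \<Otimes>\<^sub>M borel) (\<lambda>\<omega>. (\<omega>, X \<omega>))"
  proof (rule pair_measure_eqI)
    show "sigma_finite_measure M1" "sigma_finite_measure (gauss \<tau>)" by unfold_locales
    show "sets (M1 \<Otimes>\<^sub>M gauss \<tau>) = sets (distr M (G \<Otimes>\<^sub>M borel) (\<lambda>\<omega>. (\<omega>, X \<omega>)))"
      by (simp add: sM1 cong: sets_pair_measure_cong)
    fix A C assume A: "A \<in> sets M1" and C: "C \<in> sets (gauss \<tau>)"
    have AG: "A \<in> sets G" and CB: "C \<in> sets borel" using A C sM1 by auto
    have "emeasure (distr M (G \<Otimes>\<^sub>M borel) (\<lambda>\<omega>. (\<omega>, X \<omega>))) (A \<times> C) =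
        emeasure M ((\<lambda>\<omega>. (\<omega>, X \<omega>)) -` (A \<times> C) \<inter> space M)"
      by (rule emeasure_distr[OF pm]) (use AG CB in simp)
    also have "(\<lambda>\<omega>. (\<omega>, X \<omega>)) -` (A \<times> C) \<inter> space M = A \<inter> (X -` C \<inter> space M)" by auto
    also have "emeasure M \<dots> = ennreal (measure M A * measure (gauss \<tau>) C)"
      by (simp add: emeasure_eq_measure law[OF AG CB])
    also have "\<dots> = emeasure M1 A * emeasure (gauss \<tau>) C"
      using emeasure_restr_to_subalg[OF sub AG]
      by (simp add: M1_def emeasure_eq_measure N.emeasure_eq_measure ennreal_mult)
    finally show "emeasure M1 A * emeasure (gauss \<tau>) C = emeasure (distr M (G \<Otimes>\<^sub>M borel) (\<lambda>\<omega>. (\<omega>, X \<omega>))) (A \<times> C)" ..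
  qed
  define h where "h = (\<lambda>(\<omega>, x). Z \<omega> * exp (\<zeta> \<omega> * complex_of_real x - (\<zeta> \<omega>)\<^sup>2 * \<tau> / 2))"
  have ZG: "(\<lambda>z. Z (fst z)) \<in> borel_measurable (G \<Otimes>\<^sub>M borel)" "(\<lambda>z. \<zeta> (fst z)) \<in> borel_measurable (G \<Otimes>\<^sub>M (borel :: real measure))"
    using Z(1) \<zeta>(1) by (auto intro: measurable_compose[OF measurable_fst])
  have hG: "h \<in> borel_measurable (G \<Otimes>\<^sub>M borel)"
  proof -
    have "(\<lambda>z. Z (fst z) * exp (\<zeta> (fst z) * complex_of_real (snd z) - (\<zeta> (fst z))\<^sup>2 * \<tau> / 2)) \<in> borel_measurable (G \<Otimes>\<^sub>M borel)"
      using ZG by measurable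
    then show ?thesis by (simp add: h_def split_beta')
  qed
  have hM1: "h \<in> borel_measurable (M1 \<Otimes>\<^sub>M gauss \<tau>)"
    unfolding prodeq using hG by simp
  have Z1: "integrable M1 Z" unfolding M1_def using integrable_in_subalg[OF sub Z(1,2)] .
  have hx: "integrable (gauss \<tau>) (\<lambda>x. h (\<omega>, x))" for \<omega>
    unfolding h_def using gauss_cexp(1)[OF \<tau>, of "\<zeta> \<omega>"] by (simp add: exp_diff)
  have hin: "(\<integral>x. h (\<omega>, x) \<partial>gauss \<tau>) = Z \<omega>" for \<omega>
  proof -
    have "(\<integral>x. h (\<omega>, x) \<partial>gauss \<tau>) = (\<integral>x. (Z \<omega> * exp (- ((\<zeta> \<omega>)\<^sup>2 * \<tau> / 2))) * exp (\<zeta> \<omega> * complex_of_real x) \<partial>gauss \<tau>)"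
      by (simp only: h_def prod.case diff_conv_add_uminus exp_add mult.assoc mult.commute mult.left_commute)
    also have "\<dots> = (Z \<omega> * exp (- ((\<zeta> \<omega>)\<^sup>2 * \<tau> / 2))) * exp ((\<zeta> \<omega>)\<^sup>2 * \<tau> / 2)"
      by (simp only: integral_mult_right_zero gauss_cexp(2)[OF \<tau>])
    also have "\<dots> = Z \<omega>" by (simp add: exp_minus)
    finally show ?thesis .
  qed
  have hn: "(\<integral>x. norm (h (\<omega>, x)) \<partial>gauss \<tau>) \<le> norm (Z \<omega>) * exp (c\<^sup>2 * \<tau> / 2)" if "\<omega> \<in> space M" for \<omega>
  proof -
    have "(\<integral>x. norm (h (\<omega>, x)) \<partial>gauss \<tau>) = (\<integral>x. (norm (Z \<omega>) * norm (exp (- ((\<zeta> \<omega>)\<^sup>2 * \<tau> / 2)))) * norm (exp (\<zeta> \<omega> * complex_of_real x)) \<partial>gauss \<tau>)"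
      unfolding h_def prod.case norm_mult[symmetric]
      by (simp only: diff_conv_add_uminus exp_add mult.assoc mult.commute mult.left_commute)
    also have "\<dots> = (norm (Z \<omega>) * norm (exp (- ((\<zeta> \<omega>)\<^sup>2 * \<tau> / 2)))) * exp ((Re (\<zeta> \<omega>))\<^sup>2 * \<tau> / 2)"
      by (simp only: integral_mult_right_zero gauss_cexp(3)[OF \<tau>])
    also have "\<dots> = norm (Z \<omega>) * exp ((Im (\<zeta> \<omega>))\<^sup>2 * \<tau> / 2)"
    proof -
      have "norm (exp (- ((\<zeta> \<omega>)\<^sup>2 * \<tau> / 2))) * exp ((Re (\<zeta> \<omega>))\<^sup>2 * \<tau> / 2) = exp (- (((Re (\<zeta> \<omega>))\<^sup>2 - (Im (\<zeta> \<omega>))\<^sup>2) * \<tau> / 2) + (Re (\<zeta> \<omega>))\<^sup>2 * \<tau> / 2)"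
        by (simp add: mult_exp_exp Re_power2)
      also have "- (((Re (\<zeta> \<omega>))\<^sup>2 - (Im (\<zeta> \<omega>))\<^sup>2) * \<tau> / 2) + (Re (\<zeta> \<omega>))\<^sup>2 * \<tau> / 2 = (Im (\<zeta> \<omega>))\<^sup>2 * \<tau> / 2"
        by (simp add: field_simps)
      finally show ?thesis by (simp only: mult.assoc)
    qed
    also have "\<dots> \<le> norm (Z \<omega>) * exp (c\<^sup>2 * \<tau> / 2)"
    proof -
      have "\<bar>Im (\<zeta> \<omega>)\<bar> \<le> c" using \<zeta>(2)[OF that] abs_Im_le_cmod[of "\<zeta> \<omega>"] by linarith
      then have "(Im (\<zeta> \<omega>))\<^sup>2 \<le> c\<^sup>2" using abs_le_square_iff[of "Im (\<zeta> \<omega>)" c] by linarith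
      then have "(Im (\<zeta> \<omega>))\<^sup>2 * \<tau> / 2 \<le> c\<^sup>2 * \<tau> / 2" using \<tau> by (simp add: mult_right_mono)
      then show ?thesis by (intro mult_left_mono) auto
    qed
    finally show ?thesis .
  qed
  have hint: "integrable (M1 \<Otimes>\<^sub>M gauss \<tau>) h"
  proof (rule Fubini_integrable[OF hM1])
    show "AE \<omega> in M1. integrable (gauss \<tau>) (\<lambda>x. h (\<omega>, x))" using hx by simp
    show "integrable M1 (\<lambda>\<omega>. \<integral>x. norm (h (\<omega>, x)) \<partial>gauss \<tau>)"
    proof (rule Bochner_Integration.integrable_bound)
      show "integrable M1 (\<lambda>\<omega>. norm (Z \<omega>) * exp (c\<^sup>2 * \<tau> / 2))" using Z1 by simp
      show "(\<lambda>\<omega>. \<integral>x. norm (h (\<omega>, x)) \<partial>gauss \<tau>) \<in> borel_measurable M1"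
        by (rule N.borel_measurable_lebesgue_integral) (use hM1 in simp)
      show "AE \<omega> in M1. norm (\<integral>x. norm (h (\<omega>, x)) \<partial>gauss \<tau>) \<le> norm (norm (Z \<omega>) * exp (c\<^sup>2 * \<tau> / 2))"
        by (rule AE_I2) (use hn spM1 in simp)
    qed
  qed
  have comp: "h (\<omega>, X \<omega>) = Z \<omega> * exp (\<zeta> \<omega> * X \<omega> - (\<zeta> \<omega>)\<^sup>2 * \<tau> / 2)" for \<omega> by (simp add: h_def)
  have "integrable M (\<lambda>\<omega>. h (\<omega>, X \<omega>))"
    using hint unfolding prodeq by (subst (asm) integrable_distr_eq[OF pm hG])
  then show "integrable M (\<lambda>\<omega>. Z \<omega> * exp (\<zeta> \<omega> * X \<omega> - (\<zeta> \<omega>)\<^sup>2 * \<tau> / 2))" unfolding comp .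
  have "(\<integral>\<omega>. h (\<omega>, X \<omega>) \<partial>M) = integral\<^sup>L (M1 \<Otimes>\<^sub>M gauss \<tau>) h"
    unfolding prodeq by (rule integral_distr[OF pm hG, symmetric])
  also have "\<dots> = (\<integral>\<omega>. (\<integral>x. h (\<omega>, x) \<partial>gauss \<tau>) \<partial>M1)" by (rule integral_fst'[OF hint, symmetric])
  also have "\<dots> = (\<integral>\<omega>. Z \<omega> \<partial>M1)" by (simp add: hin)
  also have "\<dots> = (\<integral>\<omega>. Z \<omega> \<partial>M)" unfolding M1_def by (rule integral_subalgebra2[OF sub Z(1)])
  finally show "(\<integral>\<omega>. Z \<omega> * exp (\<zeta> \<omega> * X \<omega> - (\<zeta> \<omega>)\<^sup>2 * \<tau> / 2) \<partial>M) = (\<integral>\<omega>. Z \<omega> \<partial>M)" unfolding comp .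
qed

section \<open>The first chaos of a Gaussian process\<close>

lemma iexp_lipschitz: "norm (iexp x - iexp y) \<le> \<bar>x - y\<bar>"
proof -
  have "iexp x - iexp y = iexp y * (iexp (x - y) - 1)"
    by (simp add: right_diff_distrib mult_exp_exp algebra_simps)
  then have "norm (iexp x - iexp y) = norm (iexp (x - y) - 1)" by (simp add: norm_mult)
  also have "\<dots> \<le> \<bar>x - y\<bar>" using iexp_approx1[of "x - y" 0] by simp
  finally show ?thesis .
qed

text \<open>Bounded weights pass \<open>L\<^sup>1\<close> convergence of exponents to integrals.\<close>

lemma (in prob_space) iexp_L1_tendsto:
  fixes g :: "'a \<Rightarrow> complex"
  assumes F: "\<And>n. integrable M (F n)" and Z: "integrable M Z"
    and L: "(\<lambda>n. \<integral>\<omega>. \<bar>F n \<omega> - Z \<omega>\<bar> \<partial>M) \<longlonglongrightarrow> 0"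
    and g: "g \<in> borel_measurable M" "\<And>\<omega>. \<omega> \<in> space M \<Longrightarrow> norm (g \<omega>) \<le> c"
  shows "(\<lambda>n. \<integral>\<omega>. g \<omega> * iexp (F n \<omega>) \<partial>M) \<longlonglongrightarrow> (\<integral>\<omega>. g \<omega> * iexp (Z \<omega>) \<partial>M)"
proof -
  have [measurable]: "F n \<in> borel_measurable M" "Z \<in> borel_measurable M" "g \<in> borel_measurable M" for n
    using F Z g by auto
  have gi: "integrable M g" by (rule integrable_const_bound[of _ c]) (use g in auto)
  have i: "integrable M (\<lambda>\<omega>. g \<omega> * iexp (F n \<omega>))" "integrable M (\<lambda>\<omega>. g \<omega> * iexp (Z \<omega>))" for n
    by (intro integrable_unimodular gi; simp)+
  have c0: "0 \<le> c" using g(2) not_empty norm_ge_zero order_trans by blast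
  have bd: "norm ((\<integral>\<omega>. g \<omega> * iexp (F n \<omega>) \<partial>M) - (\<integral>\<omega>. g \<omega> * iexp (Z \<omega>) \<partial>M)) \<le> c * (\<integral>\<omega>. \<bar>F n \<omega> - Z \<omega>\<bar> \<partial>M)" for n
  proof -
    have d: "integrable M (\<lambda>\<omega>. \<bar>F n \<omega> - Z \<omega>\<bar>)" using F Z by simp
    have "norm ((\<integral>\<omega>. g \<omega> * iexp (F n \<omega>) \<partial>M) - (\<integral>\<omega>. g \<omega> * iexp (Z \<omega>) \<partial>M)) =
        norm (\<integral>\<omega>. g \<omega> * iexp (F n \<omega>) - g \<omega> * iexp (Z \<omega>) \<partial>M)" using i by simp
    also have "\<dots> \<le> (\<integral>\<omega>. norm (g \<omega> * iexp (F n \<omega>) - g \<omega> * iexp (Z \<omega>)) \<partial>M)" by (rule integral_norm_bound)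
    also have "\<dots> \<le> (\<integral>\<omega>. c * \<bar>F n \<omega> - Z \<omega>\<bar> \<partial>M)"
    proof (rule integral_mono)
      show "integrable M (\<lambda>\<omega>. norm (g \<omega> * iexp (F n \<omega>) - g \<omega> * iexp (Z \<omega>)))" using i by simp
      show "integrable M (\<lambda>\<omega>. c * \<bar>F n \<omega> - Z \<omega>\<bar>)" using d by simp
      fix \<omega> assume "\<omega> \<in> space M"
      then show "norm (g \<omega> * iexp (F n \<omega>) - g \<omega> * iexp (Z \<omega>)) \<le> c * \<bar>F n \<omega> - Z \<omega>\<bar>"
        unfolding right_diff_distrib[symmetric] norm_mult using g(2) c0 iexp_lipschitz by (intro mult_mono) auto
    qed
    finally show ?thesis by simp
  qed
  have "(\<lambda>n. c * (\<integral>\<omega>. \<bar>F n \<omega> - Z \<omega>\<bar> \<partial>M)) \<longlonglongrightarrow> 0" using tendsto_mult_right_zero[OF L] by simp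
  then have "(\<lambda>n. (\<integral>\<omega>. g \<omega> * iexp (F n \<omega>) \<partial>M) - (\<integral>\<omega>. g \<omega> * iexp (Z \<omega>) \<partial>M)) \<longlonglongrightarrow> 0"
    by (rule Lim_null_comparison[rotated]) (rule always_eventually, rule allI, rule bd)
  then show ?thesis by (rule LIM_zero_cancel)
qed

lemma (in prob_space) iexp_L2_tendsto:
  fixes g :: "'a \<Rightarrow> complex" and Z :: "'a \<Rightarrow> real"
  assumes L: "L2_tendsto M F Z" and g: "g \<in> borel_measurable M" "\<And>\<omega>. \<omega> \<in> space M \<Longrightarrow> norm (g \<omega>) \<le> c"
  shows "(\<lambda>n. \<integral>\<omega>. g \<omega> * iexp (F n \<omega>) \<partial>M) \<longlonglongrightarrow> (\<integral>\<omega>. g \<omega> * iexp (Z \<omega>) \<partial>M)"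
proof (rule iexp_L1_tendsto[OF _ _ _ g])
  show "integrable M (F n)" "integrable M Z" for n
    using L by (auto simp: L2_tendsto_iff intro!: sqi_integrable)
  show "(\<lambda>n. \<integral>\<omega>. \<bar>F n \<omega> - Z \<omega>\<bar> \<partial>M) \<longlonglongrightarrow> 0" using L2_tendsto_L1[OF L] by simp
qed

lemma centred_normal_char:
  assumes "prob_space M" and c: "centred_normal M Z"
  shows "square_integrable M Z" and "(\<integral>\<omega>. iexp (Z \<omega>) \<partial>M) = exp (- ((\<integral>\<omega>. (Z \<omega>)\<^sup>2 \<partial>M) / 2))"
proof -
  interpret prob_space M by fact
  have [measurable]: "Z \<in> borel_measurable M" using c by (simp add: centred_normal_def)
  have "square_integrable M Z \<and> (\<integral>\<omega>. iexp (Z \<omega>) \<partial>M) = exp (- ((\<integral>\<omega>. (Z \<omega>)\<^sup>2 \<partial>M) / 2))"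
  proof (cases "AE \<omega> in M. Z \<omega> = 0")
    case True
    have a: "AE \<omega> in M. (norm (Z \<omega>))\<^sup>2 = 0" using True by eventually_elim simp
    have "integrable M (\<lambda>\<omega>. (norm (Z \<omega>))\<^sup>2) = integrable M (\<lambda>\<omega>. 0 :: real)"
      by (rule integrable_cong_AE) (use a in simp_all)
    moreover have "(\<integral>\<omega>. (Z \<omega>)\<^sup>2 \<partial>M) = 0" by (rule integral_eq_zero_AE) (use a in simp)
    moreover have "(\<integral>\<omega>. iexp (Z \<omega>) \<partial>M) = (\<integral>\<omega>. 1 \<partial>M)"
      by (rule integral_cong_AE) (use True in \<open>auto elim!: eventually_mono\<close>)
    ultimately show ?thesis by (simp add: square_integrable_def prob_space)
  next
    case False
    then obtain s where s: "0 < s" and D: "distributed M lborel Z (normal_density 0 s)"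
      using c by (auto simp: centred_normal_def)
    have sq: "sqrt (s\<^sup>2) = s" using s by simp
    have law: "distr M lborel Z = gauss (s\<^sup>2)"
      unfolding gauss_def sq using distributed_distr_eq_density[OF D] .
    have Zm: "Z \<in> measurable M lborel" by simp
    have dens: "integrable (gauss (s\<^sup>2)) (\<lambda>x. x\<^sup>2)"
      unfolding gauss_def sq using integrable_normal_moment[OF s, of 0 2] by (subst integrable_density) auto
    have mom: "(\<integral>x. x\<^sup>2 \<partial>gauss (s\<^sup>2)) = s\<^sup>2"
      unfolding gauss_def sq using integral_normal_moment_even[OF s, of 0 1] s
      by (subst integral_density) (auto simp: power2_eq_square mult_ac)
    have "integrable M (\<lambda>\<omega>. (Z \<omega>)\<^sup>2)"
      using dens unfolding law[symmetric] by (subst (asm) integrable_distr_eq[OF Zm]) auto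
    moreover have "(\<integral>\<omega>. (Z \<omega>)\<^sup>2 \<partial>M) = s\<^sup>2"
      using mom unfolding law[symmetric] by (subst (asm) integral_distr[OF Zm]) auto
    moreover have "(\<integral>\<omega>. iexp (Z \<omega>) \<partial>M) = (\<integral>x. iexp x \<partial>gauss (s\<^sup>2))"
      unfolding law[symmetric] by (subst integral_distr[OF Zm]) auto
    moreover have "\<dots> = exp (- (s\<^sup>2 / 2))"
      using gauss_cexp(2)[of "s\<^sup>2" \<i>] s by (simp flip: exp_of_real)
    ultimately show ?thesis by (simp add: square_integrable_def)
  qed
  then show "square_integrable M Z" "(\<integral>\<omega>. iexp (Z \<omega>) \<partial>M) = exp (- ((\<integral>\<omega>. (Z \<omega>)\<^sup>2 \<partial>M) / 2))" by auto
qed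

locale gaussian_process = prob_space M for M :: "'w measure" +
  fixes T :: real and K :: "real \<Rightarrow> real \<Rightarrow> real" and I :: "real \<Rightarrow> 'w \<Rightarrow> real^'n::finite"
  assumes gp: "volterra_gaussian M T K I"
begin

lemma I_measurable: "s \<in> {0..T} \<Longrightarrow> I s \<in> borel_measurable M"
  using gp by (simp add: volterra_gaussian_def)

lemma step_sqi: "a \<in> steps T \<Longrightarrow> square_integrable M (step_apply I a)"
  using gp centred_normal_char(1)[OF prob_space_axioms] by (auto simp: volterra_gaussian_def)

lemma component_sqi:
  assumes "s \<in> {0..T}" shows "square_integrable M (\<lambda>\<omega>. I s \<omega> $ k)"
proof -
  have "step_apply I (Poly_Mapping.single (k, s) 1) = (\<lambda>\<omega>. I s \<omega> $ k)" by (rule ext) simp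
  then show ?thesis using step_sqi[OF steps_single[OF assms, of k 1]] by simp
qed

lemma chaos_sqi: "Z \<in> first_chaos M T I \<Longrightarrow> square_integrable M Z"
  by (auto simp: first_chaos_def L2_tendsto_def)

lemma chaos_step: "a \<in> steps T \<Longrightarrow> step_apply I a \<in> first_chaos M T I"
  unfolding first_chaos_def
  by (intro CollectI exI[of _ "\<lambda>_. a"] conjI allI L2_tendsto_const step_sqi)

lemma chaos_lincomb:
  assumes "Z \<in> first_chaos M T I" "Y \<in> first_chaos M T I"
  shows "(\<lambda>\<omega>. x * Z \<omega> + y * Y \<omega>) \<in> first_chaos M T I"
proof -
  obtain a b where a: "\<And>n. a n \<in> steps T" "L2_tendsto M (\<lambda>n. step_apply I (a n)) Z"
    and b: "\<And>n. b n \<in> steps T" "L2_tendsto M (\<lambda>n. step_apply I (b n)) Y"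
    using assms unfolding first_chaos_def by blast
  let ?c = "\<lambda>n. pm_scale x (a n) + pm_scale y (b n)"
  have "\<And>n. ?c n \<in> steps T" using a b by (intro steps_add steps_scale)
  moreover have "L2_tendsto M (\<lambda>n. step_apply I (?c n)) (\<lambda>\<omega>. x * Z \<omega> + y * Y \<omega>)"
    using L2_tendsto_add[OF L2_tendsto_scale[OF a(2), of x] L2_tendsto_scale[OF b(2), of y]]
    by (simp add: step_apply_add[abs_def] step_apply_scale)
  ultimately show ?thesis unfolding first_chaos_def by (intro CollectI exI[of _ ?c] conjI allI)
qed

text \<open>Characteristic functions and variances both pass to limits in \<open>L\<^sup>2\<close>, so the first chaos stays Gaussian.\<close>

lemma chaos_char:
  assumes "Z \<in> first_chaos M T I"
  shows "(\<integral>\<omega>. iexp (Z \<omega>) \<partial>M) = exp (- ((\<integral>\<omega>. (Z \<omega>)\<^sup>2 \<partial>M) / 2))"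
proof -
  obtain a where a: "\<And>n. a n \<in> steps T" "L2_tendsto M (\<lambda>n. step_apply I (a n)) Z"
    using assms unfolding first_chaos_def by blast
  have "centred_normal M (step_apply I (a n))" for n using gp a(1) by (auto simp: volterra_gaussian_def)
  then have c: "(\<integral>\<omega>. iexp (step_apply I (a n) \<omega>) \<partial>M) = complex_of_real (exp (- ((\<integral>\<omega>. (step_apply I (a n) \<omega>)\<^sup>2 \<partial>M) / 2)))" for n
    by (rule centred_normal_char(2)[OF prob_space_axioms])
  have 1: "(\<lambda>n. \<integral>\<omega>. iexp (step_apply I (a n) \<omega>) \<partial>M) \<longlonglongrightarrow> (\<integral>\<omega>. iexp (Z \<omega>) \<partial>M)"
    using iexp_L2_tendsto[OF a(2), of "\<lambda>_. 1" 1] by simp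
  have "(\<lambda>n. \<integral>\<omega>. (step_apply I (a n) \<omega>)\<^sup>2 \<partial>M) \<longlonglongrightarrow> (\<integral>\<omega>. (Z \<omega>)\<^sup>2 \<partial>M)"
    using L2_tendsto_inner[OF a(2) a(2)] by (simp add: power2_eq_square)
  then have "(\<lambda>n. complex_of_real (exp (- ((\<integral>\<omega>. (step_apply I (a n) \<omega>)\<^sup>2 \<partial>M) / 2)))) \<longlonglongrightarrow> exp (- ((\<integral>\<omega>. (Z \<omega>)\<^sup>2 \<partial>M) / 2))"
    by (intro tendsto_intros) simp_all
  with 1 show ?thesis unfolding c by (rule LIMSEQ_unique)
qed

text \<open>For jointly Gaussian variables orthogonality factorizes the characteristic function.\<close>

lemma chaos_orthogonal_char:
  assumes Z: "Z \<in> first_chaos M T I" and S: "S \<in> first_chaos M T I" and o: "(\<integral>\<omega>. Z \<omega> * S \<omega> \<partial>M) = 0"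
  shows "(\<integral>\<omega>. iexp (Z \<omega> + S \<omega>) \<partial>M) = (\<integral>\<omega>. iexp (Z \<omega>) \<partial>M) * (\<integral>\<omega>. iexp (S \<omega>) \<partial>M)"
proof -
  have ZS: "(\<lambda>\<omega>. Z \<omega> + S \<omega>) \<in> first_chaos M T I" using chaos_lincomb[OF Z S, of 1 1] by simp
  have "(\<integral>\<omega>. (Z \<omega> + S \<omega>)\<^sup>2 \<partial>M) = (\<integral>\<omega>. (Z \<omega>)\<^sup>2 \<partial>M) + (\<integral>\<omega>. (S \<omega>)\<^sup>2 \<partial>M)"
    using integral_norm_sq_add[OF chaos_sqi[OF Z] chaos_sqi[OF S], of 1] o by simp
  then show ?thesis
    unfolding chaos_char[OF ZS] chaos_char[OF Z] chaos_char[OF S]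
    by (simp add: add_divide_distrib exp_add[symmetric] flip: of_real_mult)
qed

end

text \<open>The past is generated by real random variables, the form in which Fourier transforms can test it.\<close>

lemma past_events_components:
  fixes Z :: "real \<Rightarrow> 'w \<Rightarrow> real^'n::finite"
  shows "sigma_sets (space M) (past_events M Z t \<union> null_sets M) \<subseteq> sigma_sets (space M)
    ((\<Union>i\<in>UNIV \<times> {0..t}. {(\<lambda>\<omega>. Z (snd i) \<omega> $ fst i) -` C \<inter> space M | C. C \<in> sets borel}) \<union> null_sets M)"
    (is "_ \<subseteq> sigma_sets _ ?E")
proof -
  have EP: "?E \<subseteq> Pow (space M)" using sets.sets_into_space by auto
  let ?S = "sigma (space M) ?E"
  have Z: "Z s \<in> borel_measurable ?S" if s: "s \<in> {0..t}" for s
  proof (subst borel_measurable_euclidean_space, rule ballI)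
    fix b :: "real^'n" assume "b \<in> Basis"
    then obtain k where b: "b = axis k 1" by (auto simp: Basis_vec_def)
    have "(\<lambda>\<omega>. Z s \<omega> $ k) \<in> borel_measurable ?S"
    proof (rule measurableI)
      fix C :: "real set" assume "C \<in> sets borel"
      then have "(\<lambda>\<omega>. Z s \<omega> $ k) -` C \<inter> space M \<in> ?E" using s by (intro UnI1 UN_I[of "(k, s)"]) auto
      then show "(\<lambda>\<omega>. Z s \<omega> $ k) -` C \<inter> space ?S \<in> sets ?S"
        using EP by (simp add: space_measure_of_conv sets_measure_of)
    qed simp
    then show "(\<lambda>\<omega>. Z s \<omega> \<bullet> b) \<in> borel_measurable ?S" by (simp add: b inner_axis)
  qed
  have "past_events M Z t \<union> null_sets M \<subseteq> sigma_sets (space M) ?E"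
  proof
    fix A assume "A \<in> past_events M Z t \<union> null_sets M"
    then show "A \<in> sigma_sets (space M) ?E"
    proof
      assume "A \<in> past_events M Z t"
      then obtain s B where s: "s \<in> {0..t}" "B \<in> sets borel" "A = Z s -` B \<inter> space M"
        by (auto simp: past_events_def gen_events_def)
      have "Z s -` B \<inter> space ?S \<in> sets ?S" using measurable_sets[OF Z[OF s(1)] s(2)] .
      then show ?thesis using s(3) EP by (simp add: space_measure_of_conv sets_measure_of)
    next
      assume "A \<in> null_sets M" then show ?thesis by (intro sigma_sets.Basic) auto
    qed
  qed
  then show ?thesis by (rule sigma_sets_mono)
qed

lemma sets_completed_past:
  assumes "\<And>s. s \<in> {0..t} \<Longrightarrow> Z s \<in> borel_measurable M"
  shows "past_events M Z t \<subseteq> sets M"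
    and "sets (completed_past M Z t) = sigma_sets (space M) (past_events M Z t \<union> null_sets M)"
    and "space (completed_past M Z t) = space M" and "subalgebra M (completed_past M Z t)"
proof -
  show 1: "past_events M Z t \<subseteq> sets M"
    using assms by (auto simp: past_events_def gen_events_def intro: measurable_sets)
  then have P: "past_events M Z t \<union> null_sets M \<subseteq> Pow (space M)" using sets.sets_into_space by auto
  show 2: "sets (completed_past M Z t) = sigma_sets (space M) (past_events M Z t \<union> null_sets M)"
    unfolding completed_past_def by (rule sets_measure_of[OF P])
  show 3: "space (completed_past M Z t) = space M"
    unfolding completed_past_def by (rule space_measure_of[OF P])
  have "sigma_sets (space M) (past_events M Z t \<union> null_sets M) \<subseteq> sets M"
    by (rule sets.sigma_sets_subset) (use 1 in auto)
  then show "subalgebra M (completed_past M Z t)" by (simp add: subalgebra_def 2 3)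
qed

lemma completed_past_measurable:
  assumes "\<And>s. s \<in> {0..t} \<Longrightarrow> Z s \<in> borel_measurable M" "s \<in> {0..t}"
  shows "Z s \<in> borel_measurable (completed_past M Z t)"
proof (rule measurableI)
  fix B :: "'b set" assume "B \<in> sets borel"
  then have "Z s -` B \<inter> space M \<in> past_events M Z t"
    using assms(2) unfolding past_events_def gen_events_def by blast
  then show "Z s -` B \<inter> space (completed_past M Z t) \<in> sets (completed_past M Z t)"
    using sets_completed_past(2,3)[OF assms(1)] by auto
qed simp

lemma Int_stable_gen_events: "Int_stable (gen_events M Z)"
proof (rule Int_stableI)
  fix a b assume "a \<in> gen_events M Z" "b \<in> gen_events M Z"
  then obtain A B where "A \<in> sets borel" "B \<in> sets borel" "a = Z -` A \<inter> space M" "b = Z -` B \<inter> space M"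
    by (auto simp: gen_events_def)
  then have "A \<inter> B \<in> sets borel" "a \<inter> b = Z -` (A \<inter> B) \<inter> space M" by auto
  then show "a \<inter> b \<in> gen_events M Z" unfolding gen_events_def by blast
qed

lemma space_in_gen_events: "space M \<in> gen_events M Z"
  unfolding gen_events_def by (intro CollectI exI[of _ UNIV]) simp

text \<open>The filtration before taking right limits: initial value, driving path up to \<open>s\<close>, null sets.\<close>

definition raw_past ::
    "'w measure \<Rightarrow> ('w \<Rightarrow> 'b::topological_space) \<Rightarrow> (real \<Rightarrow> 'w \<Rightarrow> 'a::topological_space) \<Rightarrow> real \<Rightarrow> 'w set set" where
  "raw_past M x0 Z s = sigma_sets (space M) (gen_events M x0 \<union> past_events M Z s \<union> null_sets M)"

locale gaussian_driver = gaussian_process M T K I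
  for M :: "'w measure" and T K and I :: "real \<Rightarrow> 'w \<Rightarrow> real^'n::finite" +
  fixes x0 :: "'w \<Rightarrow> real^'x::finite"
  assumes x0: "x0 \<in> borel_measurable M"
    and indep: "indep_set (sigma_sets (space M) (gen_events M x0)) (sigma_sets (space M) (past_events M I T))"
begin

lemma gen_x0_sets: "gen_events M x0 \<subseteq> sets M"
  using x0 by (auto simp: gen_events_def intro: measurable_sets)

lemma chaos_x0_indep:
  assumes A: "A \<in> gen_events M x0" and Z: "Z \<in> first_chaos M T I"
  shows "sint M A (\<lambda>\<omega>. iexp (Z \<omega>)) = prob A * (\<integral>\<omega>. iexp (Z \<omega>) \<partial>M)"
proof -
  have AM[measurable]: "A \<in> sets M" using A gen_x0_sets by blast
  define G where "G = sigma (space M) (past_events M I T)"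
  have pe: "past_events M I T \<subseteq> sets M" using sets_completed_past(1)[OF I_measurable] .
  then have peP: "past_events M I T \<subseteq> Pow (space M)" using sets.sets_into_space by auto
  have G: "sets G = sigma_sets (space M) (past_events M I T)" "space G = space M"
    unfolding G_def by (rule sets_measure_of[OF peP], rule space_measure_of[OF peP])
  have sub: "subalgebra M G" using sets.sigma_sets_subset[OF pe] by (simp add: subalgebra_def G)
  have IG: "I s \<in> borel_measurable G" if "s \<in> {0..T}" for s
  proof (rule measurableI)
    fix B :: "(real^'n) set" assume "B \<in> sets borel"
    then have "I s -` B \<inter> space M \<in> past_events M I T" using that unfolding past_events_def gen_events_def by blast
    then show "I s -` B \<inter> space G \<in> sets G" by (auto simp: G)
  qed simp
  define g where "g = (\<lambda>\<omega>. complex_of_real (indicat_real A \<omega> - prob A))"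
  have gb: "norm (g \<omega>) \<le> 1" for \<omega>
    unfolding g_def norm_of_real using prob_le_1[of A] measure_nonneg[of M A] by (simp add: indicator_def)
  have gm: "g \<in> borel_measurable M" unfolding g_def by measurable
  have gi: "integrable M g" by (rule integrable_const_bound[of _ 1]) (use gb gm in auto)
  have z: "sint M C g = 0" if C: "C \<in> sets G" for C
  proof -
    have CM[measurable]: "C \<in> sets M" using C sub by (auto simp: subalgebra_def)
    have "sint M C g = complex_of_real (\<integral>\<omega>. indicat_real (A \<inter> C) \<omega> - prob A * indicat_real C \<omega> \<partial>M)"
      unfolding integral_complex_of_real[symmetric]
      by (intro Bochner_Integration.integral_cong) (auto simp: g_def indicator_def scaleR_conv_of_real)
    also have "(\<integral>\<omega>. indicat_real (A \<inter> C) \<omega> - prob A * indicat_real C \<omega> \<partial>M) = prob (A \<inter> C) - prob A * prob C"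
      by (subst Bochner_Integration.integral_diff)
         (auto simp: less_top[symmetric] sets.Int_space_eq2)
    also have "\<dots> = 0"
      using indep_setD[OF indep, of A C] A C G(1) by auto
    finally show ?thesis by simp
  qed
  obtain a where a: "\<And>n. a n \<in> steps T" "L2_tendsto M (\<lambda>n. step_apply I (a n)) Z"
    using Z unfolding first_chaos_def by blast
  have "(\<integral>\<omega>. g \<omega> * iexp (step_apply I (a n) \<omega>) \<partial>M) = 0" for n
  proof -
    have m: "step_apply I (a n) \<in> borel_measurable G" by (rule step_apply_measurable[OF IG a(1)])
    have "(\<integral>\<omega>. iexp (step_apply I (a n) \<omega>) * g \<omega> \<partial>M) = 0"
    proof (rule zero_on_subalgebra[OF finite_measure_axioms sub gi z])
      show "(\<lambda>\<omega>. iexp (step_apply I (a n) \<omega>)) \<in> borel_measurable G" using m by measurable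
      have "step_apply I (a n) \<in> borel_measurable M" using m sub by (rule measurable_from_subalg[rotated])
      then show "integrable M (\<lambda>\<omega>. iexp (step_apply I (a n) \<omega>) * g \<omega>)"
        using integrable_unimodular[OF gi] by (simp add: mult.commute)
    qed
    then show ?thesis by (simp add: mult.commute)
  qed
  moreover have "(\<lambda>n. \<integral>\<omega>. g \<omega> * iexp (step_apply I (a n) \<omega>) \<partial>M) \<longlonglongrightarrow> (\<integral>\<omega>. g \<omega> * iexp (Z \<omega>) \<partial>M)"
    by (rule iexp_L2_tendsto[OF a(2) gm gb])
  ultimately have "(\<integral>\<omega>. g \<omega> * iexp (Z \<omega>) \<partial>M) = 0" by (simp add: LIMSEQ_const_iff)
  moreover have Zm: "Z \<in> borel_measurable M" using chaos_sqi[OF Z] by (rule sqi_measurable)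
  moreover have i: "integrable M (\<lambda>\<omega>. iexp (Z \<omega>))"
    by (rule integrable_const_bound[of _ 1]) (use Zm in auto)
  moreover have "(\<integral>\<omega>. g \<omega> * iexp (Z \<omega>) \<partial>M) = sint M A (\<lambda>\<omega>. iexp (Z \<omega>)) - prob A * (\<integral>\<omega>. iexp (Z \<omega>) \<partial>M)"
    unfolding integral_mult_right_zero[symmetric]
    using integrable_indicator_scale[OF i AM] i
    by (subst Bochner_Integration.integral_diff[symmetric])
       (auto simp: g_def left_diff_distrib scaleR_conv_of_real)
  ultimately show ?thesis by simp
qed

text \<open>A chaos element orthogonal to the driving path up to time \<open>s\<close> is independent of the whole past,
  since the initial value is independent of the driving path.\<close>

lemma chaos_indep_past:
  assumes D: "D \<in> first_chaos M T I" and s: "s \<in> {0..T}"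
    and o: "\<And>u k. u \<in> {0..s} \<Longrightarrow> (\<integral>\<omega>. D \<omega> * I u \<omega> $ k \<partial>M) = 0"
    and A: "A \<in> raw_past M x0 I s"
  shows "sint M A (\<lambda>\<omega>. iexp (D \<omega>)) = prob A * (\<integral>\<omega>. iexp (D \<omega>) \<partial>M)"
proof -
  define c where "c = (\<integral>\<omega>. iexp (D \<omega>) \<partial>M)"
  define g where "g = (\<lambda>\<omega>. iexp (D \<omega>) - c)"
  have Dm[measurable]: "D \<in> borel_measurable M" using chaos_sqi[OF D] by (rule sqi_measurable)
  have ie: "integrable M (\<lambda>\<omega>. iexp (D \<omega>))" by (rule integrable_const_bound[of _ 1]) auto
  then have gi: "integrable M g" by (simp add: g_def)
  have Im: "\<And>u. u \<in> {0..s} \<Longrightarrow> I u \<in> borel_measurable M" using I_measurable s by auto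
  note cp = sets_completed_past[where Z = I and t = s, OF Im]
  let ?L = "{step_apply I a | a. a \<in> steps s}"
  have sT: "steps s \<subseteq> (steps T :: 'n step set)" using s by (intro steps_mono) auto
  have oS: "(\<integral>\<omega>. D \<omega> * step_apply I a \<omega> \<partial>M) = 0" if a: "a \<in> steps s" for a
  proof -
    have i: "integrable M (\<lambda>\<omega>. D \<omega> * I (snd x) \<omega> $ fst x)" if "x \<in> Poly_Mapping.keys a" for x
    proof -
      have "snd x \<in> {0..T}" using that a s by (auto simp: steps_def)
      then show ?thesis using sqi_inner[OF chaos_sqi[OF D] component_sqi, of "snd x" "fst x"] by simp
    qed
    have "(\<integral>\<omega>. D \<omega> * step_apply I a \<omega> \<partial>M) =
      (\<integral>\<omega>. (\<Sum>x\<in>Poly_Mapping.keys a. Poly_Mapping.lookup a x * (D \<omega> * I (snd x) \<omega> $ fst x)) \<partial>M)"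
      by (intro Bochner_Integration.integral_cong)
         (auto simp: step_apply_lin lin_def split_beta sum_distrib_left mult_ac)
    also have "\<dots> = (\<Sum>x\<in>Poly_Mapping.keys a. Poly_Mapping.lookup a x * (\<integral>\<omega>. D \<omega> * I (snd x) \<omega> $ fst x \<partial>M))"
      using i by (subst Bochner_Integration.integral_sum) auto
    also have "\<dots> = 0"
    proof (rule sum.neutral, rule ballI)
      fix x assume "x \<in> Poly_Mapping.keys a"
      then have "snd x \<in> {0..s}" using a by (auto simp: steps_def)
      then show "Poly_Mapping.lookup a x * (\<integral>\<omega>. D \<omega> * I (snd x) \<omega> $ fst x \<partial>M) = 0" using o by simp
    qed
    finally show ?thesis .
  qed
  have main: "sint M (B \<inter> C) g = 0" if B: "B \<in> gen_events M x0" and C: "C \<in> sets (completed_past M I s)" for B C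
  proof -
    have BM[measurable]: "B \<in> sets M" using B gen_x0_sets by blast
    define gB where "gB = (\<lambda>\<omega>. indicat_real B \<omega> *\<^sub>R g \<omega>)"
    have gBi: "integrable M gB" unfolding gB_def by (rule integrable_indicator_scale[OF gi BM])
    have "sint M C gB = 0"
    proof (rule fourier_zero[where I = "UNIV \<times> {0..s}" and X = "\<lambda>i \<omega>. I (snd i) \<omega> $ fst i" and L = ?L, OF gBi])
      show "(\<lambda>\<omega>. I (snd i) \<omega> $ fst i) \<in> borel_measurable M" if "i \<in> UNIV \<times> {0..s}" for i
        using that by (intro measurable_component Im) auto
      show "S \<in> borel_measurable M" if S: "S \<in> ?L" for S
      proof -
        obtain a where "a \<in> steps s" "S = step_apply I a" using S by blast
        then show ?thesis using step_apply_measurable[OF Im] by simp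
      qed
      show "(\<lambda>\<omega>. 0) \<in> ?L" using steps_zero by (intro CollectI exI[of _ 0]) auto
      show "(\<lambda>\<omega>. S \<omega> + c * (I (snd i) \<omega> $ fst i)) \<in> ?L" if S: "S \<in> ?L" and i: "i \<in> UNIV \<times> {0..s}" for S i c
      proof -
        obtain a where a: "a \<in> steps s" "S = step_apply I a" using S by blast
        have "a + Poly_Mapping.single (fst i, snd i) c \<in> steps s"
          using i by (intro steps_add a steps_single) auto
        moreover have "(\<lambda>\<omega>. S \<omega> + c * (I (snd i) \<omega> $ fst i)) = step_apply I (a + Poly_Mapping.single (fst i, snd i) c)"
          unfolding a(2) by (rule ext) (simp only: step_apply_add step_apply_single)
        ultimately show ?thesis by blast
      qed
      show "C \<in> sigma_sets (space M) ((\<Union>i\<in>UNIV \<times> {0..s}. {(\<lambda>\<omega>. I (snd i) \<omega> $ fst i) -` C \<inter> space M | C. C \<in> sets borel}) \<union> null_sets M)"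
        by (rule subsetD[OF past_events_components]) (use C cp(2) in simp)
      fix S assume "S \<in> ?L"
      then obtain a where a: "a \<in> steps s" "S = step_apply I a" by blast
      have S: "S \<in> first_chaos M T I" unfolding a(2) by (rule chaos_step[OF subsetD[OF sT a(1)]])
      have DS: "(\<lambda>\<omega>. D \<omega> + S \<omega>) \<in> first_chaos M T I" using chaos_lincomb[OF D S, of 1 1] by simp
      have Sm[measurable]: "S \<in> borel_measurable M" using chaos_sqi[OF S] by (rule sqi_measurable)
      have i1: "integrable M (\<lambda>\<omega>. iexp (D \<omega> + S \<omega>))" "integrable M (\<lambda>\<omega>. iexp (S \<omega>))"
        by (rule integrable_const_bound[of _ 1]; simp)+
      have "(\<integral>\<omega>. gB \<omega> * iexp (S \<omega>) \<partial>M) = (\<integral>\<omega>. indicat_real B \<omega> *\<^sub>R iexp (D \<omega> + S \<omega>) - c * (indicat_real B \<omega> *\<^sub>R iexp (S \<omega>)) \<partial>M)"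
        by (intro Bochner_Integration.integral_cong)
           (auto simp: gB_def g_def left_diff_distrib scaleR_diff_right distrib_left mult_exp_exp)
      also have "\<dots> = sint M B (\<lambda>\<omega>. iexp (D \<omega> + S \<omega>)) - c * sint M B (\<lambda>\<omega>. iexp (S \<omega>))"
        using i1[THEN integrable_indicator_scale[OF _ BM]]
        by (subst Bochner_Integration.integral_diff) (simp_all only: integral_mult_right_zero integrable_mult_right)
      also have "\<dots> = prob B * (\<integral>\<omega>. iexp (D \<omega> + S \<omega>) \<partial>M) - c * (prob B * (\<integral>\<omega>. iexp (S \<omega>) \<partial>M))"
        by (simp only: chaos_x0_indep[OF B DS] chaos_x0_indep[OF B S])
      also have "\<dots> = 0"
        unfolding chaos_orthogonal_char[OF D S oS[OF a(1), folded a(2)]] c_def by simp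
      finally show "(\<integral>\<omega>. gB \<omega> * iexp (S \<omega>) \<partial>M) = 0" .
    qed
    moreover have "sint M (B \<inter> C) g = sint M C gB"
      by (intro Bochner_Integration.integral_cong) (auto simp: gB_def indicator_def)
    ultimately show ?thesis by simp
  qed
  have "sint M A g = 0"
  proof (rule dynkin_zero_joint[OF gi _ gen_x0_sets space_in_gen_events _ _ _ main])
    show "Int_stable (gen_events M x0)" by (rule Int_stable_gen_events)
    show "Int_stable (sets (completed_past M I s))" by (auto simp: Int_stable_def)
    show "sets (completed_past M I s) \<subseteq> sets M" using cp(4) by (simp add: subalgebra_def)
    show "space M \<in> sets (completed_past M I s)"
      by (metis cp(3) sets.top)
    have "gen_events M x0 \<union> past_events M I s \<union> null_sets M \<subseteq> gen_events M x0 \<union> sets (completed_past M I s)"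
    proof -
      have e: "sets (completed_past M I s) = sigma_sets (space M) (past_events M I s \<union> null_sets M)"
        by (rule sets_completed_past(2)) (rule Im)
      show ?thesis unfolding e Un_assoc by (rule Un_mono[OF order_refl sigma_sets_superset_generator])
    qed
    from subsetD[OF sigma_sets_mono'[OF this] A[unfolded raw_past_def]]
    show "A \<in> sigma_sets (space M) (gen_events M x0 \<union> sets (completed_past M I s))" .
  qed
  moreover have AM[measurable]: "A \<in> sets M"
  proof -
    have "gen_events M x0 \<union> past_events M I s \<union> null_sets M \<subseteq> sets M"
      by (intro Un_least gen_x0_sets cp(1)) auto
    from subsetD[OF sets.sigma_sets_subset[OF this] A[unfolded raw_past_def]] show ?thesis .
  qed
  moreover have "sint M A g = sint M A (\<lambda>\<omega>. iexp (D \<omega>)) - prob A * c"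
  proof -
    have "sint M A g = (\<integral>\<omega>. indicat_real A \<omega> *\<^sub>R iexp (D \<omega>) - indicat_real A \<omega> *\<^sub>R c \<partial>M)"
      by (simp add: g_def scaleR_diff_right)
    also have "\<dots> = sint M A (\<lambda>\<omega>. iexp (D \<omega>)) - (\<integral>\<omega>. indicat_real A \<omega> *\<^sub>R c \<partial>M)"
      using integrable_indicator_scale[OF ie AM] integrable_indicator_scale[of M "\<lambda>_. c", OF _ AM] by simp
    also have "(\<integral>\<omega>. indicat_real A \<omega> *\<^sub>R c \<partial>M) = prob A * c" by (simp add: scaleR_conv_of_real)
    finally show ?thesis .
  qed
  ultimately show ?thesis by (simp add: c_def)
qed

end

section \<open>Wiener integrals with respect to the associated Brownian motion\<close>

lemma lin_sum: "lin \<phi> (\<Sum>x\<in>A. f x) = (\<Sum>x\<in>A. lin \<phi> (f x))"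
  by (induction A rule: infinite_finite_induct) (auto simp: lin_add)

lemma steps_sum: "(\<And>x. x \<in> A \<Longrightarrow> f x \<in> steps T) \<Longrightarrow> (\<Sum>x\<in>A. f x) \<in> steps T"
  by (induction A rule: infinite_finite_induct) (auto intro: steps_add)

lemma sqi_sum: "(\<And>x. x \<in> A \<Longrightarrow> square_integrable M (f x)) \<Longrightarrow> square_integrable M (\<lambda>\<omega>. \<Sum>x\<in>A. f x \<omega>)"
  by (induction A rule: infinite_finite_induct) (auto intro: sqi_add)

lemma sqi_lin:
  assumes "\<And>x. x \<in> Poly_Mapping.keys a \<Longrightarrow> square_integrable M (\<phi> x)"
  shows "square_integrable M (\<lambda>\<omega>. lin (\<lambda>x. \<phi> x \<omega>) a)"
  unfolding lin_def by (intro sqi_sum sqi_scale assms)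

lemma lin_inner_integral:
  fixes \<phi> :: "'k \<Rightarrow> 'w \<Rightarrow> 'a::euclidean_space"
  assumes "\<And>x. x \<in> Poly_Mapping.keys a \<Longrightarrow> square_integrable M (\<phi> x)"
    and "\<And>y. y \<in> Poly_Mapping.keys b \<Longrightarrow> square_integrable M (\<psi> y)"
  shows "(\<integral>\<omega>. lin (\<lambda>x. \<phi> x \<omega>) a \<bullet> lin (\<lambda>y. \<psi> y \<omega>) b \<partial>M) =
    lin (\<lambda>x. lin (\<lambda>y. \<integral>\<omega>. \<phi> x \<omega> \<bullet> \<psi> y \<omega> \<partial>M) b) a"
proof -
  have i: "integrable M (\<lambda>\<omega>. \<phi> x \<omega> \<bullet> \<psi> y \<omega>)" if "x \<in> Poly_Mapping.keys a" "y \<in> Poly_Mapping.keys b" for x y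
    using that assms by (intro sqi_inner)
  have "(\<integral>\<omega>. lin (\<lambda>x. \<phi> x \<omega>) a \<bullet> lin (\<lambda>y. \<psi> y \<omega>) b \<partial>M) =
    (\<integral>\<omega>. (\<Sum>x\<in>Poly_Mapping.keys a. \<Sum>y\<in>Poly_Mapping.keys b.
       (Poly_Mapping.lookup a x * Poly_Mapping.lookup b y) * (\<phi> x \<omega> \<bullet> \<psi> y \<omega>)) \<partial>M)"
    unfolding lin_def inner_sum_left inner_sum_right
    by (intro Bochner_Integration.integral_cong refl, subst sum.swap) (simp add: mult_ac)
  also have "\<dots> = (\<Sum>x\<in>Poly_Mapping.keys a. \<Sum>y\<in>Poly_Mapping.keys b.
       (Poly_Mapping.lookup a x * Poly_Mapping.lookup b y) * (\<integral>\<omega>. \<phi> x \<omega> \<bullet> \<psi> y \<omega> \<partial>M))"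
    using i by (subst Bochner_Integration.integral_sum, auto)+
  also have "\<dots> = lin (\<lambda>x. lin (\<lambda>y. \<integral>\<omega>. \<phi> x \<omega> \<bullet> \<psi> y \<omega> \<partial>M) b) a"
    unfolding lin_def by (simp add: sum_distrib_left mult_ac)
  finally show ?thesis .
qed

lemma measurable_vec:
  fixes Z :: "'w \<Rightarrow> real^'n::finite"
  assumes "\<And>k. (\<lambda>\<omega>. Z \<omega> $ k) \<in> borel_measurable M"
  shows "Z \<in> borel_measurable M"
proof (subst borel_measurable_euclidean_space, rule ballI)
  fix b :: "real^'n" assume "b \<in> Basis"
  then obtain k where "b = axis k 1" by (auto simp: Basis_vec_def)
  then show "(\<lambda>\<omega>. Z \<omega> \<bullet> b) \<in> borel_measurable M" using assms[of k] by (simp add: inner_axis)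
qed

text \<open>A \<open>\<sigma>\<close>-algebra containing the null sets does not distinguish between almost surely equal versions. This lets
  adaptedness be transferred from one version of an \<open>L\<^sup>2\<close> limit to another.\<close>

lemma measurable_AE_modification:
  assumes sub: "subalgebra M G" and null: "null_sets M \<subseteq> sets G"
    and f: "f \<in> borel_measurable M" and g: "g \<in> borel_measurable G" and ae: "AE \<omega> in M. f \<omega> = g \<omega>"
  shows "(f :: 'a \<Rightarrow> real) \<in> borel_measurable G"
proof (rule measurableI)
  have sp: "space G = space M" using sub by (simp add: subalgebra_def)
  have gM: "g \<in> borel_measurable M" by (rule measurable_from_subalg[OF sub g])
  define N where "N = {\<omega> \<in> space M. f \<omega> \<noteq> g \<omega>}"
  have "N \<in> sets M" unfolding N_def using f gM by measurable
  then have N: "N \<in> null_sets M" using ae by (simp add: AE_iff_null N_def)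
  fix C :: "real set" assume C: "C \<in> sets borel"
  have "f -` C \<inter> space M \<in> sets M" using f C by (rule measurable_sets)
  then have 1: "(f -` C \<inter> space M) \<inter> N \<in> sets G" using null_set_Int1[OF N] null by auto
  have 2: "(g -` C \<inter> space G) - N \<in> sets G" using measurable_sets[OF g C] N null by auto
  have "f -` C \<inter> space G = ((f -` C \<inter> space M) \<inter> N) \<union> ((g -` C \<inter> space G) - N)"
    by (auto simp: sp N_def)
  then show "f -` C \<inter> space G \<in> sets G" using sets.Un[OF 1 2] by simp
qed simp

abbreviation leb :: "real \<Rightarrow> real measure" where "leb T \<equiv> restrict_space lborel {0..T}"

lemma finite_measure_leb: "finite_measure (leb T)"
  by (rule finite_measureI) (simp add: emeasure_restrict_space emeasure_lborel_Icc_eq)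

lemma space_leb: "space (leb T) = {0..T}" by (simp add: space_restrict_space)

lemma integral_leb:
  fixes h :: "real \<Rightarrow> 'z::{banach, second_countable_topology}"
  shows "(\<integral>r. h r \<partial>leb T) = (\<integral>r. indicat_real {0..T} r *\<^sub>R h r \<partial>lborel)"
  by (subst integral_restrict_space) auto

lemma keys_time: "a \<in> steps s \<Longrightarrow> x \<in> Poly_Mapping.keys a \<Longrightarrow> snd x \<in> {0..s}"
  by (auto simp: steps_def)

locale volterra_process = gaussian_process M T K I
  for M :: "'w measure" and T K and I :: "real \<Rightarrow> 'w \<Rightarrow> real^'n::finite" +
  assumes T_pos: "0 < T" and kernel: "volterra_kernel T K"
begin

lemma kernel_sqi: "t \<in> {0..T} \<Longrightarrow> square_integrable (leb T) (K t)"
  using kernel by (simp add: volterra_kernel_def)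

lemma kernel_zero: "t \<in> {0..T} \<Longrightarrow> r \<in> {0..T} \<Longrightarrow> t < r \<Longrightarrow> K t r = 0"
  using kernel by (auto simp: volterra_kernel_def)

lemma volterra_cov_leb:
  assumes "s \<in> {0..T}" "t \<in> {0..T}"
  shows "volterra_cov K s t = (\<integral>r. K s r * K t r \<partial>leb T)"
  unfolding volterra_cov_def set_lebesgue_integral_def integral_leb
proof (intro Bochner_Integration.integral_cong refl)
  fix r
  show "indicat_real {0..min s t} r *\<^sub>R (K t r * K s r) = indicat_real {0..T} r *\<^sub>R (K s r * K t r)"
    using kernel_zero[OF assms(1), of r] kernel_zero[OF assms(2), of r] assms
    by (cases "r \<in> {0..T}"; cases "r \<le> s"; cases "r \<le> t") (auto simp: indicator_def)
qed

lemma axis_kernel_sqi: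
  assumes "s \<in> {0..T}" shows "square_integrable (leb T) (\<lambda>r. K s r *\<^sub>R (axis k 1 :: real^'n))"
  using kernel_sqi[OF assms] by (auto simp: square_integrable_def power_mult_distrib)

lemma process_kernel_cov:
  assumes "s \<in> {0..T}" "t \<in> {0..T}"
  shows "(\<integral>\<omega>. I s \<omega> $ k * I t \<omega> $ j \<partial>M) = (\<integral>r. (K s r *\<^sub>R axis k 1) \<bullet> (K t r *\<^sub>R (axis j 1 :: real^'n)) \<partial>leb T)"
proof -
  have *: "(\<integral>\<omega>. I s \<omega> $ k * I t \<omega> $ j \<partial>M) = (if k = j then volterra_cov K s t else 0)"
    using gp assms unfolding volterra_gaussian_def by blast
  show ?thesis
  proof (cases "k = j")
    case True
    then show ?thesis using * volterra_cov_leb[OF assms] by (simp add: inner_axis_axis mult.commute)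
  next
    case False
    then show ?thesis using * by (simp add: inner_axis_axis)
  qed
qed

lemma Kstar_step_sqi:
  assumes "a \<in> steps T" shows "square_integrable (leb T) (Kstar_step K a :: real \<Rightarrow> real^'n)"
  unfolding Kstar_step_lin[abs_def] case_prod_unfold
  by (rule sqi_lin) (rule axis_kernel_sqi, rule keys_time[OF assms])

text \<open>On step functionals, \<open>K\<^sup>*\<close> is isometric because it is so on the generators.\<close>

lemma step_isometry:
  assumes a: "a \<in> steps T" and b: "b \<in> steps T"
  shows "(\<integral>\<omega>. step_apply I a \<omega> * step_apply I b \<omega> \<partial>M) = (\<integral>r. Kstar_step K a r \<bullet> Kstar_step K b r \<partial>leb T)"
proof -
  have "(\<integral>\<omega>. step_apply I a \<omega> * step_apply I b \<omega> \<partial>M) =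
      (\<integral>\<omega>. lin (\<lambda>x. I (snd x) \<omega> $ fst x) a \<bullet> lin (\<lambda>x. I (snd x) \<omega> $ fst x) b \<partial>M)"
    by (simp add: step_apply_lin case_prod_unfold)
  also have "\<dots> = lin (\<lambda>x. lin (\<lambda>y. \<integral>\<omega>. I (snd x) \<omega> $ fst x \<bullet> I (snd y) \<omega> $ fst y \<partial>M) b) a"
    by (rule lin_inner_integral, rule component_sqi, erule keys_time[OF a], rule component_sqi, erule keys_time[OF b])
  also have "\<dots> = lin (\<lambda>x. lin (\<lambda>y. \<integral>r. (K (snd x) r *\<^sub>R axis (fst x) 1) \<bullet> (K (snd y) r *\<^sub>R axis (fst y) 1 :: real^'n) \<partial>leb T) b) a"
    using process_kernel_cov keys_time[OF a] keys_time[OF b] by (intro lin_cong) (simp del: inner_scaleR_left inner_scaleR_right)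
  also have "\<dots> = (\<integral>r. lin (\<lambda>x. K (snd x) r *\<^sub>R (axis (fst x) 1 :: real^'n)) a \<bullet> lin (\<lambda>x. K (snd x) r *\<^sub>R axis (fst x) 1) b \<partial>leb T)"
    by (rule lin_inner_integral[where \<phi> = "\<lambda>x r. K (snd x) r *\<^sub>R axis (fst x) 1"
        and \<psi> = "\<lambda>x r. K (snd x) r *\<^sub>R axis (fst x) 1", symmetric], rule axis_kernel_sqi, erule keys_time[OF a],
        rule axis_kernel_sqi, erule keys_time[OF b])
  also have "\<dots> = (\<integral>r. Kstar_step K a r \<bullet> Kstar_step K b r \<partial>leb T)"
    by (simp add: Kstar_step_lin case_prod_unfold)
  finally show ?thesis .
qed

text \<open>\<open>wiener g Z\<close> says that \<open>Z\<close> is the Wiener integral of \<open>g\<close> against the associated Brownian motion: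
  both are limits of the same step functionals, on the side of kernels and on the side of the process.\<close>

definition wiener :: "(real \<Rightarrow> real^'n) \<Rightarrow> ('w \<Rightarrow> real) \<Rightarrow> bool" where
  "wiener g Z \<longleftrightarrow> (\<exists>a. (\<forall>n. a n \<in> steps T) \<and> L2_tendsto (leb T) (\<lambda>n. Kstar_step K (a n)) g \<and>
     L2_tendsto M (\<lambda>n. step_apply I (a n)) Z)"

lemma wiener_sqi: "wiener g Z \<Longrightarrow> square_integrable (leb T) g" "wiener g Z \<Longrightarrow> square_integrable M Z"
  by (auto simp: wiener_def L2_tendsto_def)

lemma wiener_step: "a \<in> steps T \<Longrightarrow> wiener (Kstar_step K a) (step_apply I a)"
  unfolding wiener_def by (intro exI[of _ "\<lambda>_. a"] conjI allI L2_tendsto_const Kstar_step_sqi step_sqi)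

lemma wiener_lincomb:
  assumes "wiener g Z" "wiener h Y"
  shows "wiener (\<lambda>r. x *\<^sub>R g r + y *\<^sub>R h r) (\<lambda>\<omega>. x * Z \<omega> + y * Y \<omega>)"
proof -
  obtain a where a: "\<forall>n. a n \<in> steps T" "L2_tendsto (leb T) (\<lambda>n. Kstar_step K (a n)) g" "L2_tendsto M (\<lambda>n. step_apply I (a n)) Z"
    using assms(1) unfolding wiener_def by blast
  obtain b where b: "\<forall>n. b n \<in> steps T" "L2_tendsto (leb T) (\<lambda>n. Kstar_step K (b n)) h" "L2_tendsto M (\<lambda>n. step_apply I (b n)) Y"
    using assms(2) unfolding wiener_def by blast
  let ?c = "\<lambda>n. pm_scale x (a n) + pm_scale y (b n)"
  have "\<forall>n. ?c n \<in> steps T" using a(1) b(1) by (intro allI steps_add steps_scale) auto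
  moreover have "L2_tendsto (leb T) (\<lambda>n. Kstar_step K (?c n)) (\<lambda>r. x *\<^sub>R g r + y *\<^sub>R h r)"
    using L2_tendsto_add[OF L2_tendsto_scale[OF a(2), of x] L2_tendsto_scale[OF b(2), of y]]
    by (simp add: Kstar_step_add[abs_def] Kstar_step_scale)
  moreover have "L2_tendsto M (\<lambda>n. step_apply I (?c n)) (\<lambda>\<omega>. x * Z \<omega> + y * Y \<omega>)"
    using L2_tendsto_add[OF L2_tendsto_scale[OF a(3), of x] L2_tendsto_scale[OF b(3), of y]]
    by (simp add: step_apply_add[abs_def] step_apply_scale)
  ultimately show ?thesis unfolding wiener_def by (intro exI[of _ ?c] conjI)
qed

lemma wiener_zero: "wiener (\<lambda>r. 0) (\<lambda>\<omega>. 0)"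
  using wiener_lincomb[OF wiener_step[OF steps_zero] wiener_step[OF steps_zero], of 0 0] by simp

lemma wiener_sum:
  assumes "\<And>i. i \<in> A \<Longrightarrow> wiener (g i) (Z i)"
  shows "wiener (\<lambda>r. \<Sum>i\<in>A. x i *\<^sub>R g i r) (\<lambda>\<omega>. \<Sum>i\<in>A. x i * Z i \<omega>)"
  using assms
proof (induction A rule: infinite_finite_induct)
  case (insert i A)
  have "wiener (\<lambda>r. x i *\<^sub>R g i r + 1 *\<^sub>R (\<Sum>i\<in>A. x i *\<^sub>R g i r)) (\<lambda>\<omega>. x i * Z i \<omega> + 1 * (\<Sum>i\<in>A. x i * Z i \<omega>))"
    using insert by (intro wiener_lincomb) auto
  then show ?case using insert by simp
qed (auto intro: wiener_zero)

lemma wiener_inner: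
  assumes "wiener g Z" "wiener h Y"
  shows "(\<integral>\<omega>. Z \<omega> * Y \<omega> \<partial>M) = (\<integral>r. g r \<bullet> h r \<partial>leb T)"
proof -
  obtain a where a: "\<forall>n. a n \<in> steps T" "L2_tendsto (leb T) (\<lambda>n. Kstar_step K (a n)) g" "L2_tendsto M (\<lambda>n. step_apply I (a n)) Z"
    using assms(1) unfolding wiener_def by blast
  obtain b where b: "\<forall>n. b n \<in> steps T" "L2_tendsto (leb T) (\<lambda>n. Kstar_step K (b n)) h" "L2_tendsto M (\<lambda>n. step_apply I (b n)) Y"
    using assms(2) unfolding wiener_def by blast
  have "(\<lambda>n. \<integral>\<omega>. step_apply I (a n) \<omega> * step_apply I (b n) \<omega> \<partial>M) \<longlonglongrightarrow> (\<integral>\<omega>. Z \<omega> * Y \<omega> \<partial>M)"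
    using L2_tendsto_inner[OF a(3) b(3)] by simp
  moreover have "(\<lambda>n. \<integral>\<omega>. step_apply I (a n) \<omega> * step_apply I (b n) \<omega> \<partial>M) \<longlonglongrightarrow> (\<integral>r. g r \<bullet> h r \<partial>leb T)"
    using L2_tendsto_inner[OF a(2) b(2)] step_isometry a(1) b(1) by simp
  ultimately show ?thesis by (rule LIMSEQ_unique)
qed

lemma wiener_l2: "wiener g Z \<Longrightarrow> l2 M Z = l2 (leb T) g"
  unfolding l2_def power2_norm_eq_inner using wiener_inner[of g Z g Z] by simp

text \<open>The difference has kernel \<open>0\<close>, hence variance \<open>0\<close> by the isometry.\<close>

lemma wiener_unique:
  assumes "wiener g Z" "wiener g Y"
  shows "AE \<omega> in M. Z \<omega> = Y \<omega>"
proof -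
  have w: "wiener (\<lambda>r. 0) (\<lambda>\<omega>. Z \<omega> - Y \<omega>)" using wiener_lincomb[OF assms, of 1 "-1"] by simp
  have "(\<integral>\<omega>. (Z \<omega> - Y \<omega>) * (Z \<omega> - Y \<omega>) \<partial>M) = 0" using wiener_inner[OF w w] by simp
  moreover have "integrable M (\<lambda>\<omega>. (Z \<omega> - Y \<omega>) * (Z \<omega> - Y \<omega>))"
    using wiener_sqi(2)[OF w] by (simp add: square_integrable_def power2_eq_square)
  ultimately have "AE \<omega> in M. (Z \<omega> - Y \<omega>) * (Z \<omega> - Y \<omega>) = 0"
    by (subst (asm) integral_nonneg_eq_0_iff_AE) auto
  then show ?thesis by eventually_elim simp
qed

lemma wiener_chaos: "wiener g Z \<Longrightarrow> Z \<in> first_chaos M T I"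
  unfolding wiener_def first_chaos_def by blast

lemma wiener_process: "t \<in> {0..T} \<Longrightarrow> wiener (\<lambda>r. K t r *\<^sub>R axis k 1) (\<lambda>\<omega>. I t \<omega> $ k)"
proof -
  assume t: "t \<in> {0..T}"
  have "Kstar_step K (Poly_Mapping.single (k, t) 1) = (\<lambda>r. K t r *\<^sub>R axis k 1)"
    "step_apply I (Poly_Mapping.single (k, t) 1) = (\<lambda>\<omega>. I t \<omega> $ k)" by (rule ext, simp)+
  then show ?thesis using wiener_step[OF steps_single[OF t, of k 1]] by simp
qed

lemma wiener_associated_bm:
  assumes "associated_bm M T K I V" "r \<in> {0..T}"
  shows "wiener (ind_upto k r) (\<lambda>\<omega>. V r \<omega> $ k)"
proof -
  obtain a where "Kstar K T a (ind_upto k r)" "isonormal M K T I a (\<lambda>\<omega>. V r \<omega> $ k)"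
    using assms unfolding associated_bm_def by blast
  then show ?thesis unfolding wiener_def Kstar_def isonormal_def h1_point_def by (intro exI[of _ a]) auto
qed

end

section \<open>The observation noise inside the driving process\<close>

locale observation = gaussian_driver P T K "joint_process B U" x0 +
    joint: volterra_process P T K "joint_process B U"
  for P :: "'w measure" and T and K :: "real \<Rightarrow> real \<Rightarrow> real" and B :: "real \<Rightarrow> 'w \<Rightarrow> real^'b::finite"
    and U :: "real \<Rightarrow> 'w \<Rightarrow> real^'y::finite" and x0 :: "'w \<Rightarrow> real^'x::finite" +
  fixes VU :: "real \<Rightarrow> 'w \<Rightarrow> real^'y"
  assumes VU: "associated_bm P T K U VU" and filt: "cond_Filt P T K (joint_process B U)"
begin

abbreviation BU :: "real \<Rightarrow> 'w \<Rightarrow> real^('b + 'y)" where "BU \<equiv> joint_process B U"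

lemma BU_component: "BU s \<omega> $ Inr k = U s \<omega> $ k" "BU s \<omega> $ Inl j = B s \<omega> $ j"
  by (simp_all add: joint_process_def)

text \<open>Kernels for \<open>U\<close> become kernels for \<open>(B, U)\<close> by extension with zero in the components of \<open>B\<close>.\<close>

definition emb :: "real^'y \<Rightarrow> real^('b + 'y)" where
  "emb v = (\<chi> i. case i of Inl _ \<Rightarrow> 0 | Inr k \<Rightarrow> v $ k)"

lemma emb_components [simp]: "emb v $ Inr k = v $ k" "emb v $ Inl j = 0"
  by (simp_all add: emb_def)

lemma vec_sum_eqI:
  fixes v w :: "real^('b + 'y)"
  assumes "\<And>j. v $ Inl j = w $ Inl j" "\<And>k. v $ Inr k = w $ Inr k"
  shows "v = w"
  unfolding vec_eq_iff using assms by (metis sum.exhaust)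

lemma linear_emb: "linear emb"
  by (rule linearI) (rule vec_sum_eqI, simp, simp)+

lemma emb_axis: "emb (axis k 1) = axis (Inr k) 1"
  by (rule vec_sum_eqI) (auto simp: axis_def)

lemma norm_emb [simp]: "norm (emb v) = norm v"
proof -
  have "emb v \<bullet> emb v = v \<bullet> v"
  proof -
    have "emb v \<bullet> emb v = (\<Sum>i\<in>range Inl \<union> range Inr. emb v $ i \<bullet> emb v $ i)"
      unfolding inner_vec_def by (rule sum.cong[OF UNIV_sum refl])
    also have "\<dots> = (\<Sum>i\<in>range Inl. emb v $ i \<bullet> emb v $ i) + (\<Sum>i\<in>range Inr. emb v $ i \<bullet> emb v $ i)"
      by (rule sum.union_disjoint) auto
    also have "\<dots> = v \<bullet> v"
      unfolding inner_vec_def by (simp add: sum.reindex)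
    finally show ?thesis .
  qed
  then show ?thesis by (simp add: norm_eq_sqrt_inner)
qed

lemma L2_tendsto_emb:
  assumes "L2_tendsto M F g"
  shows "L2_tendsto M (\<lambda>n r. emb (F n r)) (\<lambda>r. emb (g r))"
proof -
  have s: "square_integrable M (\<lambda>r. emb (h r))" if "square_integrable M h" for h
    using that measurable_compose[OF _ borel_measurable_continuous_onI[OF linear_continuous_on[OF linear_conv_bounded_linear[THEN iffD1, OF linear_emb]]], of h M]
    by (simp add: square_integrable_def)
  have "emb (F n r) - emb (g r) = emb (F n r - g r)" for n r by (simp add: linear_diff[OF linear_emb])
  then show ?thesis using assms s by (simp add: L2_tendsto_def)
qed

text \<open>A functional of \<open>U\<close> is a functional of \<open>(B, U)\<close>, with kernel supported on the last components.\<close>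

lemma step_U_as_BU:
  assumes "a \<in> steps s"
  obtains b where "b \<in> steps s" "step_apply BU b = step_apply U a" "Kstar_step K b = (\<lambda>r. emb (Kstar_step K a r))"
proof
  let ?b = "\<Sum>x\<in>Poly_Mapping.keys a. Poly_Mapping.single (Inr (fst x), snd x) (Poly_Mapping.lookup a x) :: ('b + 'y) step"
  show "?b \<in> steps s" by (intro steps_sum steps_single keys_time[OF assms])
  show "step_apply BU ?b = step_apply U a"
    by (rule ext) (simp add: step_apply_lin lin_sum BU_component, simp add: lin_def case_prod_unfold)
  show "Kstar_step K ?b = (\<lambda>r. emb (Kstar_step K a r))"
    by (rule ext) (simp add: Kstar_step_lin lin_sum, simp add: lin_def case_prod_unfold
      linear_sum[OF linear_emb] linear_cmul[OF linear_emb] emb_axis)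
qed

lemma volterra_gaussian_U: "volterra_gaussian P T K U"
  unfolding volterra_gaussian_def
proof (intro conjI ballI allI)
  fix t assume t: "t \<in> {0..T}"
  show "U t \<in> borel_measurable P"
  proof (rule measurable_vec)
    fix k
    have "(\<lambda>\<omega>. BU t \<omega> $ Inr k) \<in> borel_measurable P" by (rule measurable_component[OF I_measurable[OF t]])
    then show "(\<lambda>\<omega>. U t \<omega> $ k) \<in> borel_measurable P" by (simp only: BU_component)
  qed
next
  fix \<omega> assume "\<omega> \<in> space P"
  then have "continuous_on {0..T} (\<lambda>t. BU t \<omega>)" using gp by (simp add: volterra_gaussian_def)
  then have "continuous_on {0..T} (\<lambda>t. BU t \<omega> $ Inr k)" for k by (intro continuous_intros)
  then show "continuous_on {0..T} (\<lambda>t. U t \<omega>)"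
    unfolding BU_component by (subst continuous_on_componentwise) (auto simp: Basis_vec_def inner_axis)
next
  fix a :: "'y step" assume a: "a \<in> steps T"
  obtain b where "b \<in> steps T" "step_apply BU b = step_apply U a" using step_U_as_BU[OF a] .
  then show "centred_normal P (step_apply U a)" using gp unfolding volterra_gaussian_def by metis
next
  fix s t k j assume st: "s \<in> {0..T}" "t \<in> {0..T}"
  have "(\<integral>\<omega>. BU s \<omega> $ Inr k * BU t \<omega> $ Inr j \<partial>P) = (if Inr k = (Inr j :: 'b + 'y) then volterra_cov K s t else 0)"
    using gp st unfolding volterra_gaussian_def by blast
  then show "(\<integral>\<omega>. U s \<omega> $ k * U t \<omega> $ j \<partial>P) = (if k = j then volterra_cov K s t else 0)"
    by (simp add: BU_component)
qed

sublocale U: volterra_process P T K U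
  by unfold_locales (rule volterra_gaussian_U joint.T_pos joint.kernel)+

lemmas kernel_zero = joint.kernel_zero and T_pos = joint.T_pos

lemma wiener_emb:
  assumes "U.wiener g Z" shows "joint.wiener (\<lambda>r. emb (g r)) Z"
proof -
  obtain a where a: "\<forall>n. a n \<in> steps T" "L2_tendsto (leb T) (\<lambda>n. Kstar_step K (a n)) g" "L2_tendsto P (\<lambda>n. step_apply U (a n)) Z"
    using assms unfolding U.wiener_def by blast
  have "\<forall>n. \<exists>b. b \<in> steps T \<and> step_apply BU b = step_apply U (a n) \<and> Kstar_step K b = (\<lambda>r. emb (Kstar_step K (a n) r))"
  proof
    fix n
    obtain b where "b \<in> steps T" "step_apply BU b = step_apply U (a n)" "Kstar_step K b = (\<lambda>r. emb (Kstar_step K (a n) r))"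
      by (rule step_U_as_BU[OF a(1)[rule_format]])
    then show "\<exists>b. b \<in> steps T \<and> step_apply BU b = step_apply U (a n) \<and> Kstar_step K b = (\<lambda>r. emb (Kstar_step K (a n) r))"
      by (intro exI[of _ b] conjI)
  qed
  from choice[OF this] obtain b where b: "\<forall>n. b n \<in> steps T" "\<And>n. step_apply BU (b n) = step_apply U (a n)"
    "\<And>n. Kstar_step K (b n) = (\<lambda>r. emb (Kstar_step K (a n) r))" by auto
  have "L2_tendsto P (\<lambda>n. step_apply BU (b n)) Z" using a(3) by (simp add: b(2))
  moreover have "L2_tendsto (leb T) (\<lambda>n. Kstar_step K (b n)) (\<lambda>r. emb (g r))"
    using L2_tendsto_emb[OF a(2)] by (simp add: b(3))
  ultimately show ?thesis unfolding joint.wiener_def using b(1) by (intro exI[of _ b] conjI)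
qed

lemma wiener_chaos: "U.wiener g Z \<Longrightarrow> Z \<in> first_chaos P T BU"
  using joint.wiener_chaos[OF wiener_emb] .

lemma wiener_orthogonal_B:
  assumes "U.wiener g Z" and t: "t \<in> {0..T}"
  shows "(\<integral>\<omega>. Z \<omega> * B t \<omega> $ j \<partial>P) = 0"
proof -
  have "(\<integral>\<omega>. Z \<omega> * BU t \<omega> $ Inl j \<partial>P) = (\<integral>r. emb (g r) \<bullet> (K t r *\<^sub>R axis (Inl j) 1) \<partial>leb T)"
    by (rule joint.wiener_inner[OF wiener_emb[OF assms(1)] joint.wiener_process[OF t]])
  then show ?thesis by (simp add: inner_axis BU_component)
qed

lemmas wiener_VU = U.wiener_associated_bm[OF VU]

lemma VU_measurable: "r \<in> {0..T} \<Longrightarrow> VU r \<in> borel_measurable P"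
  using VU by (simp add: associated_bm_def)

lemma VU_continuous: "\<omega> \<in> space P \<Longrightarrow> continuous_on {0..T} (\<lambda>r. VU r \<omega>)"
  using VU by (simp add: associated_bm_def)

lemma wiener_VU_increment:
  assumes "s \<in> {0..T}" "r \<in> {0..T}"
  shows "U.wiener (\<lambda>u. \<Sum>j\<in>UNIV. l j *\<^sub>R (ind_upto j r u - ind_upto j s u)) (\<lambda>\<omega>. \<Sum>j\<in>UNIV. l j * (VU r \<omega> $ j - VU s \<omega> $ j))"
proof (rule U.wiener_sum)
  fix j
  show "U.wiener (\<lambda>u. ind_upto j r u - ind_upto j s u) (\<lambda>\<omega>. VU r \<omega> $ j - VU s \<omega> $ j)"
    using U.wiener_lincomb[OF wiener_VU[OF assms(2), of j] wiener_VU[OF assms(1), of j], of 1 "-1"] by simp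
qed

lemma increment_kernel:
  fixes l :: "'y \<Rightarrow> real"
  assumes "0 \<le> s" "s \<le> r"
  shows "(\<Sum>j\<in>UNIV. l j *\<^sub>R (ind_upto j r u - ind_upto j s u)) = indicat_real {s<..r} u *\<^sub>R (\<chi> j. l j)"
proof -
  have "ind_upto j r u - ind_upto j s u = indicat_real {s<..r} u *\<^sub>R axis j 1" for j :: 'y
    using assms by (auto simp: ind_upto_def indicator_def)
  then have "(\<Sum>j\<in>UNIV. l j *\<^sub>R (ind_upto j r u - ind_upto j s u)) = indicat_real {s<..r} u *\<^sub>R (\<Sum>j\<in>UNIV. l j *\<^sub>R (axis j 1 :: real^'y))"
    by (simp add: scaleR_sum_right mult.commute)
  also have "(\<Sum>j\<in>UNIV. l j *\<^sub>R (axis j 1 :: real^'y)) = (\<chi> j. l j)"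
    using basis_expansion[of "\<chi> j. l j"] by (simp add: scalar_mult_eq_scaleR)
  finally show ?thesis .
qed

section \<open>Increments of the associated Brownian motion are independent of the past\<close>

definition Fil :: "real \<Rightarrow> 'w measure" where "Fil = usual_augmentation P T x0 BU"

lemma raw_past_sets:
  assumes "s \<in> {0..T}" shows "raw_past P x0 BU s \<subseteq> sets P"
proof -
  have "past_events P BU s \<subseteq> sets P"
    by (rule sets_completed_past(1)) (rule I_measurable, use assms in auto)
  then have "gen_events P x0 \<union> past_events P BU s \<union> null_sets P \<subseteq> sets P"
    by (intro Un_least gen_x0_sets) auto
  then show ?thesis unfolding raw_past_def by (rule sets.sigma_sets_subset)
qed

lemma Fil_sets: "sets (Fil s) = sigma_sets (space P) (\<Inter>r\<in>{s<..}. raw_past P x0 BU (min r T))"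
  and space_Fil: "space (Fil s) = space P"
  if "s \<in> {0..T}"
proof -
  have "raw_past P x0 BU (min (s + 1) T) \<subseteq> sets P" using that by (intro raw_past_sets) auto
  moreover have "(\<Inter>r\<in>{s<..}. raw_past P x0 BU (min r T)) \<subseteq> raw_past P x0 BU (min (s + 1) T)"
    by (rule INT_lower) simp
  ultimately have "(\<Inter>r\<in>{s<..}. raw_past P x0 BU (min r T)) \<subseteq> sets P" by simp
  also have "sets P \<subseteq> Pow (space P)" by (rule sets.space_closed)
  finally have *: "(\<Inter>r\<in>{s<..}. raw_past P x0 BU (min r T)) \<subseteq> Pow (space P)" .
  show "sets (Fil s) = sigma_sets (space P) (\<Inter>r\<in>{s<..}. raw_past P x0 BU (min r T))"
    unfolding Fil_def usual_augmentation_def raw_past_def[symmetric] by (rule sets_measure_of[OF *])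
  show "space (Fil s) = space P"
    unfolding Fil_def usual_augmentation_def raw_past_def[symmetric] by (rule space_measure_of[OF *])
qed

lemma Fil_subset_raw:
  assumes "s \<in> {0..T}" "s < r" shows "sets (Fil s) \<subseteq> raw_past P x0 BU (min r T)"
proof -
  have "(\<Inter>r\<in>{s<..}. raw_past P x0 BU (min r T)) \<subseteq> raw_past P x0 BU (min r T)"
    by (rule INT_lower) (use assms in simp)
  then show ?thesis unfolding Fil_sets[OF assms(1)] raw_past_def by (rule sigma_sets_mono)
qed

lemma Fil_subalgebra: "s \<in> {0..T} \<Longrightarrow> subalgebra P (Fil s)"
  using Fil_subset_raw[of s "s + 1"] raw_past_sets[of "min (s + 1) T"] space_Fil[of s]
  by (auto simp: subalgebra_def)

lemma raw_past_mono: "s \<le> r \<Longrightarrow> raw_past P x0 BU s \<subseteq> raw_past P x0 BU r"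
  unfolding raw_past_def past_events_def by (intro sigma_sets_mono' Un_mono UN_mono) auto

lemma raw_subset_Fil:
  assumes "s \<in> {0..T}" shows "raw_past P x0 BU s \<subseteq> sets (Fil s)"
proof -
  have "raw_past P x0 BU s \<subseteq> (\<Inter>r\<in>{s<..}. raw_past P x0 BU (min r T))"
    by (rule INT_greatest, rule raw_past_mono) (use assms in auto)
  also have "\<dots> \<subseteq> sets (Fil s)" unfolding Fil_sets[OF assms] by (rule sigma_sets_superset_generator)
  finally show ?thesis .
qed

lemma Fil_mono:
  assumes "s \<in> {0..T}" "r \<in> {0..T}" "s \<le> r"
  shows "sets (Fil s) \<subseteq> sets (Fil r)"
proof (cases "s = r")
  case False
  then have "sets (Fil s) \<subseteq> raw_past P x0 BU (min r T)" using assms by (intro Fil_subset_raw) auto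
  also have "min r T = r" using assms by simp
  also have "raw_past P x0 BU r \<subseteq> sets (Fil r)" using assms by (intro raw_subset_Fil) auto
  finally show ?thesis .
qed simp

lemma null_sets_Fil: "s \<in> {0..T} \<Longrightarrow> null_sets P \<subseteq> sets (Fil s)"
proof -
  assume s: "s \<in> {0..T}"
  have "null_sets P \<subseteq> raw_past P x0 BU s" unfolding raw_past_def by (auto intro: sigma_sets.Basic)
  also have "\<dots> \<subseteq> sets (Fil s)" by (rule raw_subset_Fil[OF s])
  finally show ?thesis .
qed

text \<open>The kernel \<open>K u\<close> vanishes after \<open>u \<le> s\<close>, while the increment integrates over \<open>(s, r]\<close> only; with \<open>B\<close> it has
  no component in common.\<close>

lemma increment_orthogonal_past:
  assumes s: "0 \<le> s" "s \<le> r" "r \<le> T" and u: "u \<in> {0..s}"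
  shows "(\<integral>\<omega>. (\<Sum>j\<in>UNIV. l j * (VU r \<omega> $ j - VU s \<omega> $ j)) * BU u \<omega> $ k \<partial>P) = 0"
proof -
  have uT: "u \<in> {0..T}" "s \<in> {0..T}" "r \<in> {0..T}" using s u by auto
  note w = wiener_VU_increment[OF uT(2,3), of l]
  show ?thesis
  proof (cases k)
    case (Inl j)
    then show ?thesis using wiener_orthogonal_B[OF w uT(1), of j] by (simp add: BU_component)
  next
    case (Inr j)
    from U.wiener_inner[OF w U.wiener_process[OF uT(1), of j]]
    have "(\<integral>\<omega>. (\<Sum>j\<in>UNIV. l j * (VU r \<omega> $ j - VU s \<omega> $ j)) * U u \<omega> $ j \<partial>P) =
       (\<integral>x. (indicat_real {s<..r} x *\<^sub>R (\<chi> j. l j)) \<bullet> (K u x *\<^sub>R axis j 1) \<partial>leb T)"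
      using increment_kernel[OF s(1,2), of l] by simp
    also have "\<dots> = (\<integral>x. 0 \<partial>leb T)"
    proof (rule Bochner_Integration.integral_cong)
      fix x assume "x \<in> space (leb T)"
      then have "K u x = 0" if "s < x" using kernel_zero[OF uT(1), of x] u that by (auto simp: space_leb)
      then show "(indicat_real {s<..r} x *\<^sub>R (\<chi> j. l j)) \<bullet> (K u x *\<^sub>R axis j 1) = 0"
        by (auto simp: indicator_def)
    qed simp
    finally show ?thesis using Inr by (simp add: BU_component)
  qed
qed

lemma increment_variance:
  assumes s: "0 \<le> s" "s \<le> r" "r \<le> T"
  shows "(\<integral>\<omega>. (\<Sum>j\<in>UNIV. l j * (VU r \<omega> $ j - VU s \<omega> $ j))\<^sup>2 \<partial>P) = (\<Sum>j\<in>UNIV. (l j)\<^sup>2) * (r - s)"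
proof -
  have uT: "s \<in> {0..T}" "r \<in> {0..T}" using s by auto
  note w = wiener_VU_increment[OF uT, of l]
  have "(\<integral>\<omega>. (\<Sum>j\<in>UNIV. l j * (VU r \<omega> $ j - VU s \<omega> $ j))\<^sup>2 \<partial>P) =
     (\<integral>x. (indicat_real {s<..r} x *\<^sub>R (\<chi> j. l j)) \<bullet> (indicat_real {s<..r} x *\<^sub>R (\<chi> j. l j)) \<partial>leb T)"
    using U.wiener_inner[OF w w] increment_kernel[OF s(1,2), of l] by (simp add: power2_eq_square)
  also have "\<dots> = (\<integral>x. indicat_real {s<..r} x * (\<Sum>j\<in>UNIV. (l j)\<^sup>2) \<partial>lborel)"
    unfolding integral_leb using s
    by (intro Bochner_Integration.integral_cong) (auto simp: indicator_def inner_vec_def power2_eq_square)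
  also have "\<dots> = (\<Sum>j\<in>UNIV. (l j)\<^sup>2) * (r - s)" using s by simp
  finally show ?thesis .
qed

text \<open>\<open>Fil s\<close> is a right limit, so it is contained in the past at each later time only. For an increment starting
  strictly after \<open>s\<close> independence is known; let the starting time decrease to \<open>s\<close> and use that \<open>VU\<close> is continuous.\<close>

lemma increment_char:
  assumes s: "0 \<le> s" "s < r" "r \<le> T" and A: "A \<in> sets (Fil s)"
  shows "sint P A (\<lambda>\<omega>. iexp (\<Sum>j\<in>UNIV. l j * (VU r \<omega> $ j - VU s \<omega> $ j))) =
     prob A * complex_of_real (exp (- ((\<Sum>j\<in>UNIV. (l j)\<^sup>2) * (r - s) / 2)))"
proof -
  have AM[measurable]: "A \<in> sets P" using A Fil_subalgebra[of s] s by (auto simp: subalgebra_def)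
  define \<sigma> where "\<sigma> n = s + (r - s) / real (n + 2)" for n
  have \<sigma>: "s < \<sigma> n" "\<sigma> n < r" for n
  proof -
    have "0 < (r - s) / real (n + 2)" using s by simp
    moreover have "(r - s) / real (n + 2) < (r - s) / 1" using s by (intro divide_strict_left_mono) auto
    ultimately show "s < \<sigma> n" "\<sigma> n < r" by (simp_all add: \<sigma>_def)
  qed
  define D where "D u \<omega> = (\<Sum>j\<in>UNIV. l j * (VU r \<omega> $ j - VU u \<omega> $ j))" for u \<omega>
  have Dm: "D u \<in> borel_measurable P" if "u \<in> {0..T}" for u
    unfolding D_def using that s by (intro borel_measurable_sum borel_measurable_times borel_measurable_diff measurable_component VU_measurable) auto
  have e: "sint P A (\<lambda>\<omega>. iexp (D (\<sigma> n) \<omega>)) =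
     prob A * complex_of_real (exp (- ((\<Sum>j\<in>UNIV. (l j)\<^sup>2) * (r - \<sigma> n) / 2)))" for n
  proof -
    have b: "0 \<le> \<sigma> n" "\<sigma> n \<le> r" "r \<le> T" "\<sigma> n \<in> {0..T}" "r \<in> {0..T}" using \<sigma>[of n] s by auto
    have ch: "D (\<sigma> n) \<in> first_chaos P T BU"
      unfolding D_def by (rule wiener_chaos[OF wiener_VU_increment[OF b(4,5)]])
    have "A \<in> raw_past P x0 BU (min (\<sigma> n) T)" using Fil_subset_raw[of s "\<sigma> n"] A s \<sigma>[of n] by auto
    then have Ar: "A \<in> raw_past P x0 BU (\<sigma> n)" using b by simp
    have "sint P A (\<lambda>\<omega>. iexp (D (\<sigma> n) \<omega>)) = prob A * (\<integral>\<omega>. iexp (D (\<sigma> n) \<omega>) \<partial>P)"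
      by (rule chaos_indep_past[OF ch b(4) _ Ar]) (unfold D_def, rule increment_orthogonal_past[OF b(1-3)])
    also have "(\<integral>\<omega>. iexp (D (\<sigma> n) \<omega>) \<partial>P) = exp (- ((\<Sum>j\<in>UNIV. (l j)\<^sup>2) * (r - \<sigma> n) / 2))"
      unfolding chaos_char[OF ch] unfolding D_def increment_variance[OF b(1-3)] ..
    finally show ?thesis .
  qed
  have \<sigma>lim: "\<sigma> \<longlonglongrightarrow> s"
  proof -
    have "(\<lambda>n. s + (r - s) / real (n + 2)) \<longlonglongrightarrow> s + 0"
      by (intro tendsto_add tendsto_const LIMSEQ_ignore_initial_segment[OF lim_const_over_n])
    then show ?thesis by (simp add: \<sigma>_def[abs_def])
  qed
  have "(\<lambda>n. sint P A (\<lambda>\<omega>. iexp (D (\<sigma> n) \<omega>))) \<longlonglongrightarrow> sint P A (\<lambda>\<omega>. iexp (D s \<omega>))"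
  proof (rule integral_dominated_convergence[where w = "\<lambda>_. 1"])
    have [measurable]: "D s \<in> borel_measurable P" using Dm[of s] s by simp
    have [measurable]: "D (\<sigma> n) \<in> borel_measurable P" for n using Dm[of "\<sigma> n"] s \<sigma>[of n] by simp
    show "(\<lambda>\<omega>. indicat_real A \<omega> *\<^sub>R iexp (D s \<omega>)) \<in> borel_measurable P" by measurable
    show "(\<lambda>\<omega>. indicat_real A \<omega> *\<^sub>R iexp (D (\<sigma> n) \<omega>)) \<in> borel_measurable P" for n by measurable
    show "AE \<omega> in P. (\<lambda>n. indicat_real A \<omega> *\<^sub>R iexp (D (\<sigma> n) \<omega>)) \<longlonglongrightarrow> indicat_real A \<omega> *\<^sub>R iexp (D s \<omega>)"
    proof (rule AE_I2)
      fix \<omega> assume "\<omega> \<in> space P"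
      have "(\<lambda>n. VU (\<sigma> n) \<omega>) \<longlonglongrightarrow> VU s \<omega>"
      proof (rule continuous_on_tendsto_compose[OF VU_continuous[OF \<open>\<omega> \<in> space P\<close>] \<sigma>lim])
        have "\<sigma> n \<in> {0..T}" for n using \<sigma>[of n] s by auto
        then show "\<forall>\<^sub>F n in sequentially. \<sigma> n \<in> {0..T}" by simp
      qed (use s in auto)
      then show "(\<lambda>n. indicat_real A \<omega> *\<^sub>R iexp (D (\<sigma> n) \<omega>)) \<longlonglongrightarrow> indicat_real A \<omega> *\<^sub>R iexp (D s \<omega>)"
        unfolding D_def by (intro tendsto_intros)
    qed
    show "AE \<omega> in P. norm (indicat_real A \<omega> *\<^sub>R iexp (D (\<sigma> n) \<omega>)) \<le> 1" for n
      by (simp add: indicator_def)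
  qed simp
  moreover have "(\<lambda>n. sint P A (\<lambda>\<omega>. iexp (D (\<sigma> n) \<omega>))) \<longlonglongrightarrow> prob A * complex_of_real (exp (- ((\<Sum>j\<in>UNIV. (l j)\<^sup>2) * (r - s) / 2)))"
    unfolding e by (intro tendsto_intros \<sigma>lim) simp
  ultimately have "sint P A (\<lambda>\<omega>. iexp (D s \<omega>)) = prob A * complex_of_real (exp (- ((\<Sum>j\<in>UNIV. (l j)\<^sup>2) * (r - s) / 2)))"
    by (rule LIMSEQ_unique)
  then show ?thesis by (simp only: D_def)
qed

text \<open>\<open>VU\<close> is adapted: it agrees almost surely with the last components of a Brownian motion associated
  to \<open>(B, U)\<close> that generates the same completed filtration as \<open>(B, U)\<close>.\<close>

lemma VU_completed_past:
  assumes r: "r \<in> {0..T}"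
  shows "VU r \<in> borel_measurable (completed_past P BU r)"
proof (rule measurable_vec)
  fix k
  obtain V where V: "associated_bm P T K BU V" "\<And>t. t \<in> {0..T} \<Longrightarrow> sets (completed_past P V t) = sets (completed_past P BU t)"
    using filt unfolding cond_Filt_def by blast
  have Vm: "\<And>s. s \<in> {0..r} \<Longrightarrow> V s \<in> borel_measurable P" using V(1) r by (simp add: associated_bm_def)
  have BUm: "\<And>s. s \<in> {0..r} \<Longrightarrow> BU s \<in> borel_measurable P" using I_measurable r by simp
  have e: "(\<lambda>u. emb (ind_upto k r u)) = ind_upto (Inr k) r"
    by (rule ext) (simp add: ind_upto_def linear_cmul[OF linear_emb] emb_axis)
  have ae: "AE \<omega> in P. VU r \<omega> $ k = V r \<omega> $ Inr k"
    by (rule joint.wiener_unique[OF wiener_emb[OF wiener_VU[OF r, of k], unfolded e] joint.wiener_associated_bm[OF V(1) r]])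
  have "V r \<in> borel_measurable (completed_past P V r)" by (rule completed_past_measurable[OF Vm]) (use r in auto)
  then have "V r \<in> borel_measurable (completed_past P BU r)" using V(2)[OF r] by (simp cong: measurable_cong_sets)
  then have VG: "(\<lambda>\<omega>. V r \<omega> $ Inr k) \<in> borel_measurable (completed_past P BU r)" by (rule measurable_component)
  have sub: "subalgebra P (completed_past P BU r)" by (rule sets_completed_past(4)) (rule BUm)
  have "sets (completed_past P BU r) = sigma_sets (space P) (past_events P BU r \<union> null_sets P)"
    by (rule sets_completed_past(2)) (rule BUm)
  then have null: "null_sets P \<subseteq> sets (completed_past P BU r)" by (auto intro: sigma_sets.Basic)
  show "(\<lambda>\<omega>. VU r \<omega> $ k) \<in> borel_measurable (completed_past P BU r)"
    by (rule measurable_AE_modification[OF sub null measurable_component[OF VU_measurable[OF r]] VG ae])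
qed

lemma VU_Fil:
  assumes r: "r \<in> {0..T}" shows "VU r \<in> borel_measurable (Fil r)"
proof -
  have BUm: "\<And>s. s \<in> {0..r} \<Longrightarrow> BU s \<in> borel_measurable P" using I_measurable r by simp
  have 1: "sets (completed_past P BU r) = sigma_sets (space P) (past_events P BU r \<union> null_sets P)"
    "space (completed_past P BU r) = space P"
    by (rule sets_completed_past, rule BUm, assumption)+
  have "sets (completed_past P BU r) \<subseteq> raw_past P x0 BU r"
    unfolding 1 raw_past_def by (rule sigma_sets_mono') auto
  also have "\<dots> \<subseteq> sets (Fil r)" by (rule raw_subset_Fil[OF r])
  finally have "subalgebra (Fil r) (completed_past P BU r)"
    using 1(2) space_Fil[OF r] by (simp add: subalgebra_def)
  then show ?thesis using VU_completed_past[OF r] by (rule measurable_from_subalg)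
qed

end

section \<open>Complex exponential martingales along a partition\<close>

lemma partition_facts:
  assumes "partition_of a b us"
  shows "us ! 0 = a" and "us ! (length us - 1) = b"
    and "\<And>i k. i < k \<Longrightarrow> k < length us \<Longrightarrow> us ! i < us ! k"
    and "\<And>i. i < length us \<Longrightarrow> us ! i \<in> {a..b}"
proof -
  have ne: "us \<noteq> []" and hd: "hd us = a" and la: "last us = b" and so: "sorted_wrt (<) us"
    using assms by (auto simp: partition_of_def)
  show 0: "us ! 0 = a" using hd ne by (simp add: hd_conv_nth)
  show n: "us ! (length us - 1) = b" using la ne by (simp add: last_conv_nth)
  show lt: "us ! i < us ! k" if "i < k" "k < length us" for i k
    using so that by (simp add: sorted_wrt_iff_nth_less)
  show "us ! i \<in> {a..b}" if "i < length us" for i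
    using lt[of 0 i] lt[of i "length us - 1"] 0 n that
    by (cases "i = 0"; cases "i = length us - 1") (auto intro: less_imp_le)
qed

context observation begin

abbreviation inc :: "real \<Rightarrow> real \<Rightarrow> 'y \<Rightarrow> 'w \<Rightarrow> real" where
  "inc s r j \<omega> \<equiv> VU r \<omega> $ j - VU s \<omega> $ j"

lemma inc_measurable:
  assumes "s \<in> {0..T}" "r \<in> {0..T}"
  shows "inc s r j \<in> borel_measurable P"
  using assms by (intro borel_measurable_diff measurable_component VU_measurable)

text \<open>The past at time \<open>s\<close> enlarged by some components of the increment over \<open>[s, r]\<close>.\<close>

definition Fil_inc :: "real \<Rightarrow> real \<Rightarrow> 'y set \<Rightarrow> 'w measure" where
  "Fil_inc s r S = sigma (space P) (sets (Fil s) \<union>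
     sigma_sets (space P) ((\<Union>j\<in>S. {inc s r j -` C \<inter> space P | C. C \<in> sets borel}) \<union> null_sets P))"

lemma inc_events:
  assumes "s \<in> {0..T}" "r \<in> {0..T}"
  shows "sigma_sets (space P) ((\<Union>j\<in>S. {inc s r j -` C \<inter> space P | C. C \<in> sets borel}) \<union> null_sets P) \<subseteq> sets P"
proof (rule sets.sigma_sets_subset, rule Un_least, rule UN_least)
  fix j show "{inc s r j -` C \<inter> space P | C. C \<in> sets borel} \<subseteq> sets P"
  proof
    fix x assume "x \<in> {inc s r j -` C \<inter> space P | C. C \<in> sets borel}"
    then obtain C where "C \<in> sets borel" "x = inc s r j -` C \<inter> space P" by blast
    then show "x \<in> sets P" using inc_measurable[OF assms, of j] by (simp only: measurable_sets)
  qed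
qed auto

lemma Fil_inc_sets:
  assumes "s \<in> {0..T}" "r \<in> {0..T}"
  shows "sets (Fil_inc s r S) = sigma_sets (space P) (sets (Fil s) \<union>
     sigma_sets (space P) ((\<Union>j\<in>S. {inc s r j -` C \<inter> space P | C. C \<in> sets borel}) \<union> null_sets P))"
    and "space (Fil_inc s r S) = space P" and "subalgebra P (Fil_inc s r S)"
proof -
  let ?E = "sets (Fil s) \<union>
     sigma_sets (space P) ((\<Union>j\<in>S. {inc s r j -` C \<inter> space P | C. C \<in> sets borel}) \<union> null_sets P)"
  have E: "?E \<subseteq> sets P"
    using inc_events[OF assms] Fil_subalgebra[OF assms(1)] by (intro Un_least) (auto simp: subalgebra_def)
  then have EP: "?E \<subseteq> Pow (space P)" using sets.space_closed by (rule order_trans)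
  show 1: "sets (Fil_inc s r S) = sigma_sets (space P) ?E" unfolding Fil_inc_def by (rule sets_measure_of[OF EP])
  show 2: "space (Fil_inc s r S) = space P" unfolding Fil_inc_def by (rule space_measure_of[OF EP])
  show "subalgebra P (Fil_inc s r S)" unfolding subalgebra_def 1 2 using sets.sigma_sets_subset[OF E] by simp
qed

lemma Fil_le_Fil_inc:
  assumes "s \<in> {0..T}" "r \<in> {0..T}"
  shows "subalgebra (Fil_inc s r S) (Fil s)"
proof -
  have "sets (Fil s) \<subseteq> sets (Fil_inc s r S)" unfolding Fil_inc_sets[OF assms]
    by (rule order_trans[OF Un_upper1 sigma_sets_superset_generator])
  then show ?thesis using space_Fil[OF assms(1)] Fil_inc_sets(2)[OF assms] by (simp add: subalgebra_def)
qed

lemma inc_measurable_Fil_inc: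
  assumes "s \<in> {0..T}" "r \<in> {0..T}" "j \<in> S"
  shows "inc s r j \<in> borel_measurable (Fil_inc s r S)"
proof (rule measurableI)
  fix C :: "real set" assume C: "C \<in> sets borel"
  let ?E = "(\<Union>j\<in>S. {inc s r j -` C \<inter> space P | C. C \<in> sets borel}) \<union> null_sets P"
  have "inc s r j -` C \<inter> space P \<in> {inc s r j -` C \<inter> space P | C. C \<in> sets borel}"
    by (intro CollectI exI[of _ C] conjI refl C)
  then have "inc s r j -` C \<inter> space P \<in> ?E" by (intro UnI1 UN_I[OF assms(3)])
  then have "inc s r j -` C \<inter> space P \<in> sets (Fil_inc s r S)"
    unfolding Fil_inc_sets(1)[OF assms(1,2)] by (rule sigma_sets.Basic[OF UnI2[OF sigma_sets.Basic]])
  then show "inc s r j -` C \<inter> space (Fil_inc s r S) \<in> sets (Fil_inc s r S)"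
    unfolding Fil_inc_sets(2)[OF assms(1,2)] .
qed simp

text \<open>The components of an increment are conditionally independent given the past, so a further
  component is still Gaussian after the others have been added to the past.\<close>

lemma increment_component_char:
  assumes s: "0 \<le> s" "s < r" "r \<le> T" and k: "k \<notin> S" and A: "A \<in> sets (Fil_inc s r S)"
  shows "sint P A (\<lambda>\<omega>. iexp (l * inc s r k \<omega>)) = prob A *\<^sub>R complex_of_real (exp (- (l\<^sup>2 * (r - s) / 2)))"
proof -
  have uT: "s \<in> {0..T}" "r \<in> {0..T}" using s by auto
  note im[measurable] = inc_measurable[OF uT]
  define c where "c = exp (- (l\<^sup>2 * (r - s) / 2))"
  define g where "g = (\<lambda>\<omega>. iexp (l * inc s r k \<omega>) - complex_of_real c)"
  have ie: "integrable P (\<lambda>\<omega>. iexp (l * inc s r k \<omega>))"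
    by (rule integrable_const_bound[of _ 1], simp) measurable
  have gi: "integrable P g" unfolding g_def using ie by simp
  have FM: "sets (Fil s) \<subseteq> sets P" using Fil_subalgebra[OF uT(1)] by (simp add: subalgebra_def)
  let ?E = "(\<Union>j\<in>S. {inc s r j -` C \<inter> space P | C. C \<in> sets borel}) \<union> null_sets P"
  let ?L = "{\<lambda>\<omega>. \<Sum>j\<in>UNIV. m j * inc s r j \<omega> | m. \<forall>j. j \<notin> S \<longrightarrow> m j = 0}"
  have main: "sint P (B \<inter> C) g = 0" if B: "B \<in> sets (Fil s)" and C: "C \<in> sigma_sets (space P) ?E" for B C
  proof -
    have BM[measurable]: "B \<in> sets P" using B FM by blast
    define gB where "gB = (\<lambda>\<omega>. indicat_real B \<omega> *\<^sub>R g \<omega>)"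
    have gBi: "integrable P gB" unfolding gB_def by (rule integrable_indicator_scale[OF gi BM])
    have "sint P C gB = 0"
    proof (rule fourier_zero[where I = S and X = "\<lambda>j. inc s r j" and L = ?L, OF gBi im _ _ _ _ C])
      show "V \<in> borel_measurable P" if V: "V \<in> ?L" for V
      proof -
        obtain m where "V = (\<lambda>\<omega>. \<Sum>j\<in>UNIV. m j * inc s r j \<omega>)" using V by blast
        then show ?thesis by simp
      qed
      show "(\<lambda>\<omega>. 0) \<in> ?L" by (intro CollectI exI[of _ "\<lambda>_. 0"]) simp
      show "(\<lambda>\<omega>. V \<omega> + c * inc s r i \<omega>) \<in> ?L" if V: "V \<in> ?L" and i: "i \<in> S" for V i c
      proof -
        obtain m where m: "V = (\<lambda>\<omega>. \<Sum>j\<in>UNIV. m j * inc s r j \<omega>)" "\<forall>j. j \<notin> S \<longrightarrow> m j = 0" using V by blast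
        have "(\<lambda>\<omega>. V \<omega> + c * inc s r i \<omega>) = (\<lambda>\<omega>. \<Sum>j\<in>UNIV. (m(i := m i + c)) j * inc s r j \<omega>)"
          unfolding m(1) by (rule ext) (simp add: sum.remove[of UNIV i] distrib_right)
        then show ?thesis using m(2) i by (intro CollectI exI[of _ "m(i := m i + c)"]) auto
      qed
      fix V assume "V \<in> ?L"
      then obtain m where m: "V = (\<lambda>\<omega>. \<Sum>j\<in>UNIV. m j * inc s r j \<omega>)" "\<forall>j. j \<notin> S \<longrightarrow> m j = 0" by blast
      have mk: "m k = 0" using m(2) k by simp
      have V: "V = (\<lambda>\<omega>. \<Sum>j\<in>UNIV. m j * inc s r j \<omega>)" by (rule m(1))
      have Vm[measurable]: "V \<in> borel_measurable P" unfolding V by simp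
      have V': "l * inc s r k \<omega> + V \<omega> = (\<Sum>j\<in>UNIV. (m(k := l)) j * inc s r j \<omega>)" for \<omega>
        unfolding V by (simp add: sum.remove[of UNIV k] mk)
      have m2: "(\<Sum>j\<in>UNIV. ((m(k := l)) j)\<^sup>2) = l\<^sup>2 + (\<Sum>j\<in>UNIV. (m j)\<^sup>2)"
        by (simp add: sum.remove[of UNIV k] mk)
      have i1: "integrable P (\<lambda>\<omega>. iexp (l * inc s r k \<omega> + V \<omega>))" "integrable P (\<lambda>\<omega>. iexp (V \<omega>))"
        by (rule integrable_const_bound[of _ 1], simp, measurable)+
      have e1: "sint P B (\<lambda>\<omega>. iexp (l * inc s r k \<omega> + V \<omega>)) =
          prob B * complex_of_real (exp (- ((l\<^sup>2 + (\<Sum>j\<in>UNIV. (m j)\<^sup>2)) * (r - s) / 2)))"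
        unfolding V' increment_char[OF s B] m2 ..
      have e2: "sint P B (\<lambda>\<omega>. iexp (V \<omega>)) = prob B * complex_of_real (exp (- ((\<Sum>j\<in>UNIV. (m j)\<^sup>2) * (r - s) / 2)))"
        unfolding V by (rule increment_char[OF s B])
      have "(\<integral>\<omega>. gB \<omega> * iexp (V \<omega>) \<partial>P) = (\<integral>\<omega>. indicat_real B \<omega> *\<^sub>R iexp (l * inc s r k \<omega> + V \<omega>) - c * (indicat_real B \<omega> *\<^sub>R iexp (V \<omega>)) \<partial>P)"
        by (intro Bochner_Integration.integral_cong)
           (auto simp: gB_def g_def left_diff_distrib scaleR_diff_right distrib_left mult_exp_exp)
      also have "\<dots> = sint P B (\<lambda>\<omega>. iexp (l * inc s r k \<omega> + V \<omega>)) - c * sint P B (\<lambda>\<omega>. iexp (V \<omega>))"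
        using i1[THEN integrable_indicator_scale[OF _ BM]]
        by (subst Bochner_Integration.integral_diff) (simp_all only: integral_mult_right_zero integrable_mult_right)
      also have "\<dots> = 0"
        unfolding e1 e2 c_def by (simp add: distrib_right add_divide_distrib mult_exp_exp flip: of_real_mult)
      finally show "(\<integral>\<omega>. gB \<omega> * iexp (V \<omega>) \<partial>P) = 0" .
    qed
    moreover have "sint P (B \<inter> C) g = sint P C gB"
      by (intro Bochner_Integration.integral_cong) (auto simp: gB_def indicator_def)
    ultimately show ?thesis by simp
  qed
  have "sint P A g = 0"
  proof (rule dynkin_zero_joint[OF gi _ FM _ _ inc_events[OF uT] _ main A[unfolded Fil_inc_sets[OF uT]]])
    show "Int_stable (sets (Fil s))" by (auto simp: Int_stable_def)
    show "space P \<in> sets (Fil s)" by (metis space_Fil[OF uT(1)] sets.top)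
    have EP: "?E \<subseteq> Pow (space P)"
      by (rule order_trans[OF order_trans[OF sigma_sets_superset_generator inc_events[OF uT]] sets.space_closed])
    interpret sa: sigma_algebra "space P" "sigma_sets (space P) ?E" by (rule sigma_algebra_sigma_sets[OF EP])
    show "Int_stable (sigma_sets (space P) ?E)" unfolding Int_stable_def by (intro ballI sa.Int)
    show "space P \<in> sigma_sets (space P) ?E" by (rule sigma_sets_top)
  qed
  moreover have AM[measurable]: "A \<in> sets P" using A Fil_inc_sets(3)[OF uT] by (auto simp: subalgebra_def)
  moreover have "sint P A g = sint P A (\<lambda>\<omega>. iexp (l * inc s r k \<omega>)) - prob A * c"
  proof -
    have "sint P A g = (\<integral>\<omega>. indicat_real A \<omega> *\<^sub>R iexp (l * inc s r k \<omega>) - indicat_real A \<omega> *\<^sub>R complex_of_real c \<partial>P)"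
      by (simp add: g_def scaleR_diff_right)
    also have "\<dots> = sint P A (\<lambda>\<omega>. iexp (l * inc s r k \<omega>)) - (\<integral>\<omega>. indicat_real A \<omega> *\<^sub>R complex_of_real c \<partial>P)"
      using integrable_indicator_scale[OF ie AM] integrable_indicator_scale[of P "\<lambda>_. complex_of_real c", OF _ AM]
      by (intro Bochner_Integration.integral_diff) simp_all
    also have "(\<integral>\<omega>. indicat_real A \<omega> *\<^sub>R complex_of_real c \<partial>P) = prob A * c" by (simp add: scaleR_conv_of_real)
    finally show ?thesis .
  qed
  ultimately show ?thesis by (simp add: c_def scaleR_conv_of_real)
qed

text \<open>The stochastic exponential of \<open>\<zeta>\<close> over the single step \<open>[s, r]\<close>, restricted to the components in \<open>S\<close>.\<close>

definition exp_step :: "real \<Rightarrow> real \<Rightarrow> ('y \<Rightarrow> 'w \<Rightarrow> complex) \<Rightarrow> 'y set \<Rightarrow> 'w \<Rightarrow> complex" where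
  "exp_step s r \<zeta> S \<omega> = (\<Prod>j\<in>S. exp (\<zeta> j \<omega> * inc s r j \<omega> - (\<zeta> j \<omega>)\<^sup>2 * (r - s) / 2))"

text \<open>Integrate out one component at a time, the others having been added to the past.\<close>

lemma exp_step_integral:
  assumes s: "0 \<le> s" "s < r" "r \<le> T" and Z: "Z \<in> borel_measurable (Fil s)" "integrable P Z"
    and \<zeta>: "\<And>j. \<zeta> j \<in> borel_measurable (Fil s)" "\<And>j \<omega>. \<omega> \<in> space P \<Longrightarrow> norm (\<zeta> j \<omega>) \<le> c"
  shows "integrable P (\<lambda>\<omega>. Z \<omega> * exp_step s r \<zeta> S \<omega>) \<and> (\<integral>\<omega>. Z \<omega> * exp_step s r \<zeta> S \<omega> \<partial>P) = (\<integral>\<omega>. Z \<omega> \<partial>P)"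
proof (induction S rule: infinite_finite_induct)
  case (insert k S)
  have uT: "s \<in> {0..T}" "r \<in> {0..T}" using s by auto
  let ?Z = "\<lambda>\<omega>. Z \<omega> * exp_step s r \<zeta> S \<omega>"
  have sub: "subalgebra (Fil_inc s r S) (Fil s)" by (rule Fil_le_Fil_inc[OF uT])
  have \<zeta>m: "\<zeta> j \<in> borel_measurable (Fil_inc s r S)" for j by (rule measurable_from_subalg[OF sub \<zeta>(1)])
  have [measurable]: "Z \<in> borel_measurable (Fil_inc s r S)" by (rule measurable_from_subalg[OF sub Z(1)])
  have "exp_step s r \<zeta> S \<in> borel_measurable (Fil_inc s r S)"
    unfolding exp_step_def
  proof (rule borel_measurable_prod)
    fix j assume j: "j \<in> S"
    have [measurable]: "inc s r j \<in> borel_measurable (Fil_inc s r S)" by (rule inc_measurable_Fil_inc[OF uT j])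
    have [measurable]: "\<zeta> j \<in> borel_measurable (Fil_inc s r S)" by (rule \<zeta>m)
    show "(\<lambda>\<omega>. exp (\<zeta> j \<omega> * inc s r j \<omega> - (\<zeta> j \<omega>)\<^sup>2 * (r - s) / 2)) \<in> borel_measurable (Fil_inc s r S)" by measurable
  qed
  then have Zm: "?Z \<in> borel_measurable (Fil_inc s r S)" by measurable
  have 1: "integrable P ?Z" "(\<integral>\<omega>. ?Z \<omega> \<partial>P) = (\<integral>\<omega>. Z \<omega> \<partial>P)" using insert.IH by auto
  have e: "Z \<omega> * exp_step s r \<zeta> (insert k S) \<omega> = ?Z \<omega> * exp (\<zeta> k \<omega> * inc s r k \<omega> - (\<zeta> k \<omega>)\<^sup>2 * (r - s) / 2)" for \<omega>
    using insert.hyps by (simp add: exp_step_def mult_ac)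
  have \<tau>: "0 < r - s" using s by simp
  note st = gauss_exp_step[OF prob_space_axioms Fil_inc_sets(3)[OF uT] inc_measurable[OF uT] \<tau>
     increment_component_char[OF s insert.hyps(2)] Zm 1(1) \<zeta>m \<zeta>(2)]
  show ?case unfolding e using st 1(2) by simp
qed (use Z in \<open>simp_all add: exp_step_def\<close>)

text \<open>The martingale property along a partition, one step at a time.\<close>

lemma exp_chain:
  assumes us: "partition_of 0 T us" and pm: "p \<le> m" "m < length us"
    and Z: "Z \<in> borel_measurable (Fil (us ! p))" "integrable P Z"
    and \<zeta>: "\<And>i j. Suc i < length us \<Longrightarrow> \<zeta> i j \<in> borel_measurable (Fil (us ! i))"
      "\<And>i j \<omega>. Suc i < length us \<Longrightarrow> \<omega> \<in> space P \<Longrightarrow> norm (\<zeta> i j \<omega>) \<le> c i"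
  defines "E \<equiv> \<lambda>m \<omega>. Z \<omega> * (\<Prod>i=p..<m. exp_step (us ! i) (us ! Suc i) (\<zeta> i) UNIV \<omega>)"
  shows "E m \<in> borel_measurable (Fil (us ! m)) \<and> integrable P (E m) \<and> (\<integral>\<omega>. E m \<omega> \<partial>P) = (\<integral>\<omega>. Z \<omega> \<partial>P)"
  using pm
proof (induction m rule: dec_induct)
  case base
  then show ?case using Z by (simp add: E_def)
next
  case (step m)
  note pf = partition_facts[OF us]
  have m: "Suc m < length us" using step by simp
  have s: "0 \<le> us ! m" "us ! m < us ! Suc m" "us ! Suc m \<le> T" and uT: "us ! m \<in> {0..T}" "us ! Suc m \<in> {0..T}"
    using pf(4)[of m] pf(4)[of "Suc m"] pf(3)[of m "Suc m"] m by auto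
  have IH: "E m \<in> borel_measurable (Fil (us ! m))" "integrable P (E m)" "(\<integral>\<omega>. E m \<omega> \<partial>P) = (\<integral>\<omega>. Z \<omega> \<partial>P)"
    using step by auto
  have e: "E (Suc m) = (\<lambda>\<omega>. E m \<omega> * exp_step (us ! m) (us ! Suc m) (\<zeta> m) UNIV \<omega>)"
    using step(1) by (auto simp: E_def mult.assoc)
  have sub: "subalgebra (Fil (us ! Suc m)) (Fil (us ! m))"
    using Fil_mono[OF uT] space_Fil[OF uT(1)] space_Fil[OF uT(2)] s by (simp add: subalgebra_def)
  have Vm: "(\<lambda>\<omega>. VU (us ! Suc m) \<omega> $ j) \<in> borel_measurable (Fil (us ! Suc m))"
    "(\<lambda>\<omega>. VU (us ! m) \<omega> $ j) \<in> borel_measurable (Fil (us ! Suc m))" for j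
    by (rule measurable_component[OF VU_Fil[OF uT(2)]], rule measurable_component[OF measurable_from_subalg[OF sub VU_Fil[OF uT(1)]]])
  have \<zeta>m: "\<zeta> m j \<in> borel_measurable (Fil (us ! Suc m))" for j
    by (rule measurable_from_subalg[OF sub \<zeta>(1)[OF m]])
  have Em: "E m \<in> borel_measurable (Fil (us ! Suc m))" by (rule measurable_from_subalg[OF sub IH(1)])
  have "exp_step (us ! m) (us ! Suc m) (\<zeta> m) UNIV \<in> borel_measurable (Fil (us ! Suc m))"
    unfolding exp_step_def
  proof (rule borel_measurable_prod)
    fix j
    note [measurable] = Vm[of j] \<zeta>m[of j]
    show "(\<lambda>\<omega>. exp (\<zeta> m j \<omega> * inc (us ! m) (us ! Suc m) j \<omega> - (\<zeta> m j \<omega>)\<^sup>2 * (us ! Suc m - us ! m) / 2)) \<in> borel_measurable (Fil (us ! Suc m))"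
      by measurable
  qed
  then have "E (Suc m) \<in> borel_measurable (Fil (us ! Suc m))" unfolding e using Em by measurable
  moreover have "integrable P (E (Suc m)) \<and> (\<integral>\<omega>. E (Suc m) \<omega> \<partial>P) = (\<integral>\<omega>. E m \<omega> \<partial>P)"
    unfolding e by (rule exp_step_integral[OF s IH(1,2) \<zeta>(1)[OF m] \<zeta>(2)[OF m]])
  ultimately show ?case using IH(3) by simp
qed

text \<open>Girsanov's formula for an integrand constant along a partition. With \<open>\<zeta> = i \<gamma> - \<xi>\<close> in place of
  \<open>- \<xi>\<close>, the exponential martingale acquires exactly the Fourier factor of \<open>\<integral> \<gamma> d(V + \<integral> \<xi>)\<close> times the
  constant \<open>exp (\<integral> \<gamma>\<^sup>2 / 2)\<close>; both martingales have the same expectation given the time from which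
  \<open>\<gamma>\<close> is supported.\<close>

lemma girsanov_discrete:
  fixes \<xi> :: "nat \<Rightarrow> 'y \<Rightarrow> 'w \<Rightarrow> real" and \<gamma> :: "nat \<Rightarrow> 'y \<Rightarrow> real"
  assumes us: "partition_of 0 T us" and p: "p < length us" and A: "A \<in> sets (Fil (us ! p))"
    and \<xi>: "\<And>i j. Suc i < length us \<Longrightarrow> \<xi> i j \<in> borel_measurable (Fil (us ! i))"
      "\<And>i j \<omega>. Suc i < length us \<Longrightarrow> \<omega> \<in> space P \<Longrightarrow> \<bar>\<xi> i j \<omega>\<bar> \<le> c i"
    and \<gamma>: "\<And>i j. i < p \<Longrightarrow> \<gamma> i j = 0"
  defines "n \<equiv> length us - 1" and "d \<equiv> \<lambda>i. us ! Suc i - us ! i"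
    and "\<delta> \<equiv> \<lambda>i j. inc (us ! i) (us ! Suc i) j"
  defines "lD \<equiv> \<lambda>\<omega>. \<Sum>i<n. \<Sum>j\<in>UNIV. - \<xi> i j \<omega> * \<delta> i j \<omega> - (\<xi> i j \<omega>)\<^sup>2 * d i / 2"
    and "N \<equiv> \<lambda>\<omega>. \<Sum>i<n. \<Sum>j\<in>UNIV. \<gamma> i j * (\<delta> i j \<omega> + \<xi> i j \<omega> * d i)"
    and "v \<equiv> \<Sum>i<n. \<Sum>j\<in>UNIV. (\<gamma> i j)\<^sup>2 * d i"
  shows "integrable P (\<lambda>\<omega>. exp (lD \<omega>))" and "(\<integral>\<omega>. exp (lD \<omega>) \<partial>P) = 1"
    and "sint P A (\<lambda>\<omega>. complex_of_real (exp (lD \<omega>)) * iexp (N \<omega>)) =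
      complex_of_real (exp (- v / 2)) * sint P A (\<lambda>\<omega>. complex_of_real (exp (lD \<omega>)))"
proof -
  note pf = partition_facts[OF us]
  have n: "n < length us" and pn: "p \<le> n" using p by (auto simp: n_def)
  \<comment> \<open>\<open>\<zeta>0\<close> produces the density and \<open>\<zeta>1\<close> its product with the Fourier factor; they agree before step \<open>p\<close>.\<close>
  define \<zeta>0 where "\<zeta>0 i j \<omega> = - complex_of_real (\<xi> i j \<omega>)" for i j \<omega>
  define \<zeta>1 where "\<zeta>1 i j \<omega> = \<i> * complex_of_real (\<gamma> i j) - complex_of_real (\<xi> i j \<omega>)" for i j \<omega>
  define c1 where "c1 i = c i + (\<Sum>j\<in>UNIV. \<bar>\<gamma> i j\<bar>)" for i
  have \<zeta>0m: "\<zeta>0 i j \<in> borel_measurable (Fil (us ! i))" and \<zeta>1m: "\<zeta>1 i j \<in> borel_measurable (Fil (us ! i))"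
    if "Suc i < length us" for i j
    using \<xi>(1)[OF that] unfolding \<zeta>0_def[abs_def] \<zeta>1_def[abs_def] by measurable
  have \<zeta>0b: "norm (\<zeta>0 i j \<omega>) \<le> c i" if "Suc i < length us" "\<omega> \<in> space P" for i j \<omega>
    using \<xi>(2)[OF that] by (simp add: \<zeta>0_def)
  have \<zeta>1b: "norm (\<zeta>1 i j \<omega>) \<le> c1 i" if "Suc i < length us" "\<omega> \<in> space P" for i j \<omega>
  proof -
    have "norm (\<zeta>1 i j \<omega>) \<le> norm (\<i> * complex_of_real (\<gamma> i j)) + norm (complex_of_real (\<xi> i j \<omega>))"
      unfolding \<zeta>1_def by (rule norm_triangle_ineq4)
    also have "\<dots> = \<bar>\<gamma> i j\<bar> + \<bar>\<xi> i j \<omega>\<bar>" by (simp add: norm_mult)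
    also have "\<bar>\<gamma> i j\<bar> \<le> (\<Sum>j\<in>UNIV. \<bar>\<gamma> i j\<bar>)" by (rule member_le_sum) auto
    finally show ?thesis using \<xi>(2)[OF that, of j] by (simp add: c1_def)
  qed
  have prod_exp: "(\<Prod>i=a..<b. exp_step (us ! i) (us ! Suc i) (\<zeta> i) UNIV \<omega>) =
      exp (\<Sum>i=a..<b. \<Sum>j\<in>UNIV. \<zeta> i j \<omega> * \<delta> i j \<omega> - (\<zeta> i j \<omega>)\<^sup>2 * d i / 2)" for a b \<zeta> \<omega>
    by (simp add: exp_step_def exp_sum \<delta>_def d_def)
  have E0: "(\<Sum>i=0..<n. \<Sum>j\<in>UNIV. \<zeta>0 i j \<omega> * \<delta> i j \<omega> - (\<zeta>0 i j \<omega>)\<^sup>2 * d i / 2) = complex_of_real (lD \<omega>)" for \<omega>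
    by (simp add: lD_def \<zeta>0_def atLeast0LessThan)
  have E1: "(\<Sum>i=0..<n. \<Sum>j\<in>UNIV. \<zeta>1 i j \<omega> * \<delta> i j \<omega> - (\<zeta>1 i j \<omega>)\<^sup>2 * d i / 2) =
      complex_of_real (lD \<omega>) + \<i> * complex_of_real (N \<omega>) + complex_of_real (v / 2)" for \<omega>
  proof -
    have "\<zeta>1 i j \<omega> * \<delta> i j \<omega> - (\<zeta>1 i j \<omega>)\<^sup>2 * d i / 2 =
        complex_of_real (- \<xi> i j \<omega> * \<delta> i j \<omega> - (\<xi> i j \<omega>)\<^sup>2 * d i / 2) +
        \<i> * complex_of_real (\<gamma> i j * (\<delta> i j \<omega> + \<xi> i j \<omega> * d i)) + complex_of_real ((\<gamma> i j)\<^sup>2 * d i / 2)" for i j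
      by (simp add: \<zeta>1_def complex_eq_iff power2_eq_square algebra_simps) (simp add: field_simps)
    then show ?thesis
      by (simp only: lD_def N_def v_def sum.distrib sum_distrib_left sum_divide_distrib of_real_sum atLeast0LessThan)
  qed
  have one: "integrable P (\<lambda>\<omega>. 1 :: complex)" by simp
  have full0: "integrable P (\<lambda>\<omega>. complex_of_real (exp (lD \<omega>)))" "(\<integral>\<omega>. complex_of_real (exp (lD \<omega>)) \<partial>P) = 1"
  proof -
    have "integrable P (\<lambda>\<omega>. 1 * (\<Prod>i=0..<n. exp_step (us ! i) (us ! Suc i) (\<zeta>0 i) UNIV \<omega>)) \<and>
       (\<integral>\<omega>. 1 * (\<Prod>i=0..<n. exp_step (us ! i) (us ! Suc i) (\<zeta>0 i) UNIV \<omega>) \<partial>P) = (\<integral>\<omega>. 1 \<partial>P)"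
      using exp_chain[OF us le0 n _ one \<zeta>0m \<zeta>0b] by simp
    then show "integrable P (\<lambda>\<omega>. complex_of_real (exp (lD \<omega>)))" "(\<integral>\<omega>. complex_of_real (exp (lD \<omega>)) \<partial>P) = 1"
      unfolding prod_exp E0 by (simp_all add: exp_of_real prob_space)
  qed
  show "integrable P (\<lambda>\<omega>. exp (lD \<omega>))"
    using full0(1) by (simp only: complex_of_real_integrable_eq)
  show "(\<integral>\<omega>. exp (lD \<omega>) \<partial>P) = 1"
    using full0(2) unfolding integral_complex_of_real by (simp only: of_real_eq_1_iff)
  have AM: "A \<in> sets P" using A pf(4)[OF p] Fil_subalgebra by (auto simp: subalgebra_def)
  define Z where "Z \<omega> = indicat_real A \<omega> *\<^sub>R (\<Prod>i=0..<p. exp_step (us ! i) (us ! Suc i) (\<zeta>0 i) UNIV \<omega>)" for \<omega>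
  have Z: "Z \<in> borel_measurable (Fil (us ! p))" "integrable P Z"
  proof -
    have c: "(\<lambda>\<omega>. 1 * (\<Prod>i=0..<p. exp_step (us ! i) (us ! Suc i) (\<zeta>0 i) UNIV \<omega>)) \<in> borel_measurable (Fil (us ! p)) \<and>
       integrable P (\<lambda>\<omega>. 1 * (\<Prod>i=0..<p. exp_step (us ! i) (us ! Suc i) (\<zeta>0 i) UNIV \<omega>))"
      using exp_chain[OF us le0 p _ one \<zeta>0m \<zeta>0b] by simp
    show "integrable P Z" unfolding Z_def[abs_def] using c by (intro integrable_indicator_scale AM) simp
    have "indicat_real A \<in> borel_measurable (Fil (us ! p))" using A by simp
    from borel_measurable_scaleR[OF this conjunct1[OF c]]
    show "Z \<in> borel_measurable (Fil (us ! p))" unfolding Z_def[abs_def] by simp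
  qed
  have split: "(\<Prod>i=0..<n. h i) = (\<Prod>i=0..<p. h i) * (\<Prod>i=p..<n. h i)" for h :: "nat \<Rightarrow> complex"
    using prod.atLeastLessThan_concat[OF le0 pn, of h] by simp
  have low: "(\<Prod>i=0..<p. exp_step (us ! i) (us ! Suc i) (\<zeta>0 i) UNIV \<omega>) = (\<Prod>i=0..<p. exp_step (us ! i) (us ! Suc i) (\<zeta>1 i) UNIV \<omega>)" for \<omega>
    by (rule prod.cong) (auto simp: exp_step_def \<zeta>0_def \<zeta>1_def \<gamma>)
  have Z0: "Z \<omega> * (\<Prod>i=p..<n. exp_step (us ! i) (us ! Suc i) (\<zeta>0 i) UNIV \<omega>) = indicat_real A \<omega> *\<^sub>R complex_of_real (exp (lD \<omega>))" for \<omega>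
    unfolding Z_def using split[of "\<lambda>i. exp_step (us ! i) (us ! Suc i) (\<zeta>0 i) UNIV \<omega>"]
    unfolding prod_exp E0 by (simp add: exp_of_real)
  have Z1: "Z \<omega> * (\<Prod>i=p..<n. exp_step (us ! i) (us ! Suc i) (\<zeta>1 i) UNIV \<omega>) =
      complex_of_real (exp (v / 2)) * (indicat_real A \<omega> *\<^sub>R (complex_of_real (exp (lD \<omega>)) * iexp (N \<omega>)))" for \<omega>
  proof -
    have "Z \<omega> * (\<Prod>i=p..<n. exp_step (us ! i) (us ! Suc i) (\<zeta>1 i) UNIV \<omega>) =
       indicat_real A \<omega> *\<^sub>R (\<Prod>i=0..<n. exp_step (us ! i) (us ! Suc i) (\<zeta>1 i) UNIV \<omega>)"
      unfolding Z_def low split by simp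
    then show ?thesis unfolding prod_exp E1 by (simp add: exp_add exp_of_real[symmetric])
  qed
  have "(\<integral>\<omega>. Z \<omega> * (\<Prod>i=p..<n. exp_step (us ! i) (us ! Suc i) (\<zeta>1 i) UNIV \<omega>) \<partial>P) = (\<integral>\<omega>. Z \<omega> \<partial>P)"
    using exp_chain[where \<zeta> = \<zeta>1 and c = c1, OF us pn n Z \<zeta>1m \<zeta>1b] by simp
  moreover have "(\<integral>\<omega>. Z \<omega> * (\<Prod>i=p..<n. exp_step (us ! i) (us ! Suc i) (\<zeta>0 i) UNIV \<omega>) \<partial>P) = (\<integral>\<omega>. Z \<omega> \<partial>P)"
    using exp_chain[where \<zeta> = \<zeta>0 and c = c, OF us pn n Z \<zeta>0m \<zeta>0b] by simp
  ultimately have "complex_of_real (exp (v / 2)) * sint P A (\<lambda>\<omega>. complex_of_real (exp (lD \<omega>)) * iexp (N \<omega>)) = sint P A (\<lambda>\<omega>. complex_of_real (exp (lD \<omega>)))"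
    unfolding Z0 Z1 by (simp only: integral_mult_right_zero)
  then have "complex_of_real (exp (- v / 2)) * (complex_of_real (exp (v / 2)) * sint P A (\<lambda>\<omega>. complex_of_real (exp (lD \<omega>)) * iexp (N \<omega>))) = complex_of_real (exp (- v / 2)) * sint P A (\<lambda>\<omega>. complex_of_real (exp (lD \<omega>)))"
    by simp
  moreover have "complex_of_real (exp (- v / 2)) * complex_of_real (exp (v / 2)) = 1"
    by (simp add: mult_exp_exp flip: of_real_mult)
  ultimately show "sint P A (\<lambda>\<omega>. complex_of_real (exp (lD \<omega>)) * iexp (N \<omega>)) =
      complex_of_real (exp (- v / 2)) * sint P A (\<lambda>\<omega>. complex_of_real (exp (lD \<omega>)))"
    by (simp only: mult.assoc[symmetric] mult_1)
qed

end

section \<open>Step functions along a partition\<close>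

lemma partition_less_iff:
  assumes "partition_of a b us" "i < length us" "k < length us"
  shows "us ! i < us ! k \<longleftrightarrow> i < k" and "us ! i \<le> us ! k \<longleftrightarrow> i \<le> k"
proof -
  have 1: "us ! i < us ! k" if "i < k" by (rule partition_facts(3)[OF assms(1) that assms(3)])
  have 2: "us ! k < us ! i" if "k < i" by (rule partition_facts(3)[OF assms(1) that assms(2)])
  show "us ! i < us ! k \<longleftrightarrow> i < k" using 1 2 by (cases i k rule: linorder_cases) auto
  show "us ! i \<le> us ! k \<longleftrightarrow> i \<le> k" using 1 2 by (cases i k rule: linorder_cases) auto
qed

lemma partition_of_sorted_list:
  assumes "finite S" "S \<subseteq> {a..b}" "a \<in> S" "b \<in> S"
  shows "partition_of a b (sorted_list_of_set S)"
proof -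
  let ?us = "sorted_list_of_set S"
  have s: "set ?us = S" "sorted_wrt (<) ?us" using assms(1) by auto
  have ne: "?us \<noteq> []" using s(1) assms(3) by auto
  have lt: "?us ! i \<le> ?us ! k" if "i \<le> k" "k < length ?us" for i k
    using s(2) that by (cases "i = k") (auto simp: sorted_wrt_iff_nth_less intro: less_imp_le)
  have inS: "?us ! i \<in> {a..b}" if "i < length ?us" for i using nth_mem[OF that] s(1) assms(2) by auto
  obtain i where i: "i < length ?us" "?us ! i = a" using assms(3) s(1) by (metis in_set_conv_nth)
  obtain k where k: "k < length ?us" "?us ! k = b" using assms(4) s(1) by (metis in_set_conv_nth)
  have "?us ! 0 = a" using lt[of 0 i] i inS[of 0] by auto
  moreover have "?us ! (length ?us - 1) = b"
    using lt[of k "length ?us - 1"] k inS[of "length ?us - 1"] by fastforce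
  ultimately show ?thesis using ne s(2) by (simp add: partition_of_def hd_conv_nth last_conv_nth)
qed

text \<open>Intervals are open on the left, so the value on a step is the one at its right end, as for the
  integrands of simple processes.\<close>

definition stepfun :: "real list \<Rightarrow> (real \<Rightarrow> real) \<Rightarrow> bool" where
  "stepfun us h \<longleftrightarrow> (\<forall>i. Suc i < length us \<longrightarrow> (\<forall>s\<in>{us ! i<..us ! Suc i}. h s = h (us ! Suc i)))"

lemma stepfun_const: "stepfun us (\<lambda>s. c)"
  by (simp add: stepfun_def)

lemma stepfun_mult: "stepfun us g \<Longrightarrow> stepfun us h \<Longrightarrow> stepfun us (\<lambda>s. g s * h s)"
  unfolding stepfun_def by (intro allI impI ballI arg_cong2[where f = "(*)"]) blast+

lemma stepfun_sum: "(\<And>x. x \<in> A \<Longrightarrow> stepfun us (g x)) \<Longrightarrow> stepfun us (\<lambda>s. \<Sum>x\<in>A. g x s)"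
  unfolding stepfun_def by (intro allI impI ballI sum.cong refl) (blast dest: bspec)

lemma partition_gap:
  assumes us: "partition_of a b us" and i: "Suc i < length us" and c: "c \<in> set us"
    and s: "s \<in> {us ! i<..us ! Suc i}"
  shows "c < s \<longleftrightarrow> c < us ! Suc i" and "s \<le> c \<longleftrightarrow> us ! Suc i \<le> c"
proof -
  obtain p where p: "p < length us" "us ! p = c" using c by (metis in_set_conv_nth)
  have "c \<le> us ! i \<or> us ! Suc i \<le> c"
    using partition_less_iff(2)[OF us p(1), of i] partition_less_iff(2)[OF us i p(1)] i p by auto
  then show "c < s \<longleftrightarrow> c < us ! Suc i" "s \<le> c \<longleftrightarrow> us ! Suc i \<le> c"
    using s partition_less_iff(1)[OF us _ i, of i] i by auto
qed

lemma stepfun_indicator: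
  assumes us: "partition_of a b us" and "c \<in> set us" "d \<in> set us"
  shows "stepfun us (indicat_real {c<..d})"
  unfolding stepfun_def
proof (intro allI impI ballI)
  fix i s assume i: "Suc i < length us" and s: "s \<in> {us ! i<..us ! Suc i}"
  have "s \<in> {c<..d} \<longleftrightarrow> us ! Suc i \<in> {c<..d}"
    using partition_gap(1)[OF us i assms(2) s] partition_gap(2)[OF us i assms(3) s] by simp
  then show "indicat_real {c<..d} s = indicat_real {c<..d} (us ! Suc i)" by (simp add: indicator_def)
qed

lemma partition_telescope:
  fixes W :: "real \<Rightarrow> real"
  assumes us: "partition_of a b us" and "c \<in> set us" "d \<in> set us" "c \<le> d"
  shows "W d - W c = (\<Sum>i<length us - 1. indicat_real {c<..d} (us ! Suc i) * (W (us ! Suc i) - W (us ! i)))"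
proof -
  obtain p where p: "p < length us" "us ! p = c" using assms(2) by (metis in_set_conv_nth)
  obtain q where q: "q < length us" "us ! q = d" using assms(3) by (metis in_set_conv_nth)
  have pq: "p \<le> q" using partition_less_iff(2)[OF us p(1) q(1)] p q assms(4) by simp
  have ind: "indicat_real {c<..d} (us ! Suc i) = (if i \<in> {p..<q} then 1 else 0)" if "i < length us - 1" for i
    using that partition_less_iff(1)[OF us p(1), of "Suc i"] partition_less_iff(2)[OF us _ q(1), of "Suc i"] p q
    by (auto simp: indicator_def)
  have "(\<Sum>i<length us - 1. indicat_real {c<..d} (us ! Suc i) * (W (us ! Suc i) - W (us ! i))) =
     (\<Sum>i<length us - 1. if i \<in> {p..<q} then W (us ! Suc i) - W (us ! i) else 0)"
    by (intro sum.cong refl) (simp add: ind)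
  also have "\<dots> = (\<Sum>i\<in>{..<length us - 1} \<inter> {p..<q}. W (us ! Suc i) - W (us ! i))"
    by (subst sum.inter_restrict) auto
  also have "{..<length us - 1} \<inter> {p..<q} = {p..<q}" using q by auto
  also have "(\<Sum>i\<in>{p..<q}. W (us ! Suc i) - W (us ! i)) = W (us ! q) - W (us ! p)"
    by (rule sum_Suc_diff'[OF pq])
  finally show ?thesis using p q by simp
qed

lemma step_integral:
  assumes us: "partition_of 0 T us" and h: "stepfun us h" and f: "integrable (leb T) (f :: real \<Rightarrow> real)"
  shows "integrable (leb T) (\<lambda>s. h s * f s)"
    and "(\<integral>s. h s * f s \<partial>leb T) =
      (\<Sum>i<length us - 1. h (us ! Suc i) * (\<integral>s. indicat_real {us ! i<..us ! Suc i} s * f s \<partial>leb T))"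
proof -
  note pf = partition_facts[OF us]
  define k where "k s = (\<Sum>i<length us - 1. h (us ! Suc i) * (indicat_real {us ! i<..us ! Suc i} s * f s))" for s
  have fi: "integrable (leb T) (\<lambda>s. indicat_real {us ! i<..us ! Suc i} s * f s)" for i
  proof -
    have "{us ! i<..us ! Suc i} \<inter> {0..T} \<in> sets (leb T)" by (auto simp: sets_restrict_space)
    from integrable_mult_indicator[OF this f]
    have "integrable (leb T) (\<lambda>s. indicat_real ({us ! i<..us ! Suc i} \<inter> {0..T}) s * f s)" by simp
    then show ?thesis
      by (rule Bochner_Integration.integrable_cong[THEN iffD1, OF refl, rotated]) (auto simp: space_leb indicator_def)
  qed
  have ki: "integrable (leb T) k" unfolding k_def using fi by auto
  have eq: "h s * f s = k s" if s: "s \<in> {0<..T}" for s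
  proof -
    have len: "0 < length us" using us by (auto simp: partition_of_def)
    have "k s = (\<Sum>i<length us - 1. h s * f s * indicat_real {us ! i<..us ! Suc i} s)"
      unfolding k_def
    proof (rule sum.cong[OF refl])
      fix i assume "i \<in> {..<length us - 1}"
      then have "h s = h (us ! Suc i)" if "s \<in> {us ! i<..us ! Suc i}"
        using h that unfolding stepfun_def by simp
      then show "h (us ! Suc i) * (indicat_real {us ! i<..us ! Suc i} s * f s) = h s * f s * indicat_real {us ! i<..us ! Suc i} s"
        by (auto simp: indicator_def)
    qed
    also have "\<dots> = h s * f s * (\<Sum>i<length us - 1. indicat_real {us ! i<..us ! Suc i} s)"
      by (simp add: sum_distrib_left)
    also have "(\<Sum>i<length us - 1. indicat_real {us ! i<..us ! Suc i} s) =
       (\<Sum>i<length us - 1. indicat_real {s..} (us ! Suc i) - indicat_real {s..} (us ! i))"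
    proof (rule sum.cong[OF refl])
      fix i assume "i \<in> {..<length us - 1}"
      then have "us ! i < us ! Suc i" using pf(3)[of i "Suc i"] by auto
      then show "indicat_real {us ! i<..us ! Suc i} s = indicat_real {s..} (us ! Suc i) - indicat_real {s..} (us ! i)"
        by (simp add: indicator_def)
    qed
    also have "\<dots> = indicat_real {s..} (us ! (length us - 1)) - indicat_real {s..} (us ! 0)"
      by (rule sum_lessThan_telescope)
    also have "\<dots> = 1" using pf(1,2) s by (simp add: indicator_def)
    finally show ?thesis by simp
  qed
  have n0: "AE s in leb T. s \<noteq> 0"
    using AE_lborel_singleton[of "0 :: real"] by (subst AE_restrict_space_iff) auto
  have ae: "AE s in leb T. k s = h s * f s"
    using n0 AE_space[of "leb T"] by eventually_elim (use eq in \<open>auto simp: space_leb\<close>)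
  have km: "k \<in> borel_measurable (leb T)" using ki by simp
  show hi: "integrable (leb T) (\<lambda>s. h s * f s)"
  proof (rule Bochner_Integration.integrable_cong_AE_imp[OF ki _ ae])
    have "(\<lambda>s. if s = 0 then h 0 * f 0 else k s) \<in> borel_measurable (leb T)"
    proof (rule measurable_If[OF borel_measurable_const km])
      have "(\<lambda>s. s) \<in> borel_measurable (leb T)" by (rule measurable_restrict_space1) simp
      then show "{s \<in> space (leb T). s = 0} \<in> sets (leb T)" by measurable
    qed
    then show "(\<lambda>s. h s * f s) \<in> borel_measurable (leb T)"
      by (rule measurable_cong[THEN iffD1, rotated]) (use eq in \<open>auto simp: space_leb\<close>)
  qed
  have "(\<integral>s. h s * f s \<partial>leb T) = (\<integral>s. k s \<partial>leb T)"
    by (rule integral_cong_AE) (use hi km ae in auto)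
  also have "\<dots> = (\<Sum>i<length us - 1. h (us ! Suc i) * (\<integral>s. indicat_real {us ! i<..us ! Suc i} s * f s \<partial>leb T))"
    unfolding k_def using fi by (subst Bochner_Integration.integral_sum) auto
  finally show "(\<integral>s. h s * f s \<partial>leb T) =
      (\<Sum>i<length us - 1. h (us ! Suc i) * (\<integral>s. indicat_real {us ! i<..us ! Suc i} s * f s \<partial>leb T))" .
qed

lemma leb_interval:
  assumes "0 \<le> a" "a \<le> b" "b \<le> T"
  shows "(\<integral>s. indicat_real {a<..b} s * 1 \<partial>leb T) = b - a"
proof -
  have "(\<integral>s. indicat_real {a<..b} s * 1 \<partial>leb T) = (\<integral>s. indicat_real {a<..b} s \<partial>lborel)"
    unfolding integral_leb using assms by (intro Bochner_Integration.integral_cong) (auto simp: indicator_def)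
  then show ?thesis using assms by simp
qed

lemma step_integral_length:
  assumes us: "partition_of 0 T us" and h: "stepfun us h"
  shows "integrable (leb T) h"
    and "(\<integral>s. h s \<partial>leb T) = (\<Sum>i<length us - 1. h (us ! Suc i) * (us ! Suc i - us ! i))"
proof -
  interpret finite_measure "leb T" by (rule finite_measure_leb)
  note si = step_integral[OF us h, of "\<lambda>_. 1"]
  show "integrable (leb T) h" using si(1) by simp
  have "(\<integral>s. h s \<partial>leb T) = (\<Sum>i<length us - 1. h (us ! Suc i) * (\<integral>s. indicat_real {us ! i<..us ! Suc i} s * 1 \<partial>leb T))"
    using si(2) by simp
  also have "\<dots> = (\<Sum>i<length us - 1. h (us ! Suc i) * (us ! Suc i - us ! i))"
  proof (rule sum.cong[OF refl])
    fix i assume "i \<in> {..<length us - 1}"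
    then have i: "Suc i < length us" by auto
    have "0 \<le> us ! i" "us ! i \<le> us ! Suc i" "us ! Suc i \<le> T"
      using partition_facts(4)[OF us, of i] partition_facts(4)[OF us i] partition_facts(3)[OF us _ i, of i] i by auto
    then show "h (us ! Suc i) * (\<integral>s. indicat_real {us ! i<..us ! Suc i} s * 1 \<partial>leb T) = h (us ! Suc i) * (us ! Suc i - us ! i)"
      by (simp only: leb_interval)
  qed
  finally show "(\<integral>s. h s \<partial>leb T) = (\<Sum>i<length us - 1. h (us ! Suc i) * (us ! Suc i - us ! i))" .
qed

lemma stepfun_simple_value:
  assumes us: "partition_of 0 T us" and ts: "set ts \<subseteq> set us"
  shows "stepfun us (\<lambda>s. simple_value ts \<xi> s \<omega>)"
  unfolding simple_value_def
proof (intro stepfun_sum stepfun_mult stepfun_const)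
  fix l assume "l \<in> {..<length ts - 1}"
  then have l: "l < length ts" "Suc l < length ts" by auto
  have "ts ! l \<in> set us" "ts ! Suc l \<in> set us"
    using subsetD[OF ts nth_mem[OF l(1)]] subsetD[OF ts nth_mem[OF l(2)]] .
  then show "stepfun us (indicat_real {ts ! l<..ts ! Suc l})" by (rule stepfun_indicator[OF us])
qed

text \<open>Refining the partition leaves a simple integral unchanged, by telescoping over each old interval.\<close>

lemma simple_integral_refine:
  assumes us: "partition_of 0 T us" and ts: "partition_of 0 T ts" "set ts \<subseteq> set us"
  shows "simple_integral ts \<xi> W T \<omega> =
    (\<Sum>i<length us - 1. simple_value ts \<xi> (us ! Suc i) \<omega> * (W (us ! Suc i) \<omega> - W (us ! i) \<omega>))"
proof -
  have "simple_integral ts \<xi> W T \<omega> = (\<Sum>l<length ts - 1. \<xi> l \<omega> * (W (ts ! Suc l) \<omega> - W (ts ! l) \<omega>))"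
    unfolding simple_integral_def
  proof (rule sum.cong[OF refl])
    fix l assume "l \<in> {..<length ts - 1}"
    then have l: "l < length ts" "Suc l < length ts" by auto
    have "ts ! l \<le> T" "ts ! Suc l \<le> T"
      using partition_facts(4)[OF ts(1) l(1)] partition_facts(4)[OF ts(1) l(2)] by simp_all
    then show "\<xi> l \<omega> * (W (min T (ts ! Suc l)) \<omega> - W (min T (ts ! l)) \<omega>) = \<xi> l \<omega> * (W (ts ! Suc l) \<omega> - W (ts ! l) \<omega>)"
      by (simp add: min_absorb2)
  qed
  also have "\<dots> = (\<Sum>l<length ts - 1. \<Sum>i<length us - 1. \<xi> l \<omega> * (indicat_real {ts ! l<..ts ! Suc l} (us ! Suc i) * (W (us ! Suc i) \<omega> - W (us ! i) \<omega>)))"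
  proof (rule sum.cong[OF refl])
    fix l assume "l \<in> {..<length ts - 1}"
    then have l: "l < length ts" "Suc l < length ts" by auto
    have "ts ! l \<in> set us" "ts ! Suc l \<in> set us"
      using subsetD[OF ts(2) nth_mem[OF l(1)]] subsetD[OF ts(2) nth_mem[OF l(2)]] .
    moreover have "ts ! l \<le> ts ! Suc l" using partition_facts(3)[OF ts(1) _ l(2), of l] by simp
    ultimately have "ts ! l \<in> set us" "ts ! Suc l \<in> set us" "ts ! l \<le> ts ! Suc l" .
    from partition_telescope[OF us this, of "\<lambda>u. W u \<omega>"]
    show "\<xi> l \<omega> * (W (ts ! Suc l) \<omega> - W (ts ! l) \<omega>) =
      (\<Sum>i<length us - 1. \<xi> l \<omega> * (indicat_real {ts ! l<..ts ! Suc l} (us ! Suc i) * (W (us ! Suc i) \<omega> - W (us ! i) \<omega>)))"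
      by (simp only: sum_distrib_left[symmetric])
  qed
  also have "\<dots> = (\<Sum>i<length us - 1. \<Sum>l<length ts - 1. \<xi> l \<omega> * (indicat_real {ts ! l<..ts ! Suc l} (us ! Suc i) * (W (us ! Suc i) \<omega> - W (us ! i) \<omega>)))"
    by (rule sum.swap)
  also have "\<dots> = (\<Sum>i<length us - 1. simple_value ts \<xi> (us ! Suc i) \<omega> * (W (us ! Suc i) \<omega> - W (us ! i) \<omega>))"
    unfolding simple_value_def by (simp only: sum_distrib_right mult.assoc)
  finally show ?thesis .
qed

section \<open>Subsequences and path integrals\<close>

text \<open>Choose the indices so that all terms together exceed \<open>1 / (m + 1)\<close> with probability at most \<open>2\<^sup>-\<^sup>m\<close> and apply
  the Borel--Cantelli lemma; finitely many sequences can share the subsequence.\<close>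

lemma (in prob_space) tends_in_prob0_subseq:
  fixes D :: "'i \<Rightarrow> nat \<Rightarrow> 'a \<Rightarrow> ennreal"
  assumes "finite I" and D: "\<And>i. i \<in> I \<Longrightarrow> tends_in_prob0 M (D i)"
  obtains r where "strict_mono r" "AE \<omega> in M. \<forall>i\<in>I. (\<lambda>n. D i (r n) \<omega>) \<longlonglongrightarrow> 0"
proof -
  define good where "good i m A \<longleftrightarrow>
    (\<forall>n. A n \<in> sets M \<and> {\<omega>\<in>space M. ennreal (1 / Suc m) < D i n \<omega>} \<subseteq> A n) \<and> (\<lambda>n. prob (A n)) \<longlonglongrightarrow> 0" for i m A
  have ex_good: "\<exists>A. good i m A" if "i \<in> I" for i m
    using D[OF that, unfolded tends_in_prob0_def, rule_format, of "1 / Suc m"] by (simp add: good_def)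
  define A where "A i m = (SOME A. good i m A)" for i m
  have A': "good i m (A i m)" if "i \<in> I" for i m
    unfolding A_def by (rule someI_ex[OF ex_good[OF that]])
  have A: "\<And>i m n. i \<in> I \<Longrightarrow> A i m n \<in> sets M"
    "\<And>i m n. i \<in> I \<Longrightarrow> {\<omega>\<in>space M. ennreal (1 / Suc m) < D i n \<omega>} \<subseteq> A i m n"
    "\<And>i m. i \<in> I \<Longrightarrow> (\<lambda>n. prob (A i m n)) \<longlonglongrightarrow> 0"
    using A' unfolding good_def by simp_all
  have lim: "(\<lambda>n. \<Sum>i\<in>I. prob (A i m n)) \<longlonglongrightarrow> 0" for m
    using tendsto_sum[of I "\<lambda>i n. prob (A i m n)" "\<lambda>_. 0"] A(3) by simp
  have ex: "\<exists>n>k. (\<Sum>i\<in>I. prob (A i m n)) < (1/2) ^ m" for m k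
  proof -
    have "\<forall>\<^sub>F n in sequentially. (\<Sum>i\<in>I. prob (A i m n)) < (1/2) ^ m"
      by (rule order_tendstoD(2)[OF lim]) simp
    moreover have "\<forall>\<^sub>F n in sequentially. k < n" by (rule eventually_gt_at_top)
    ultimately have "\<forall>\<^sub>F n in sequentially. k < n \<and> (\<Sum>i\<in>I. prob (A i m n)) < (1/2) ^ m"
      by (rule eventually_conj[rotated])
    from eventually_happens[OF this] show ?thesis by auto
  qed
  have "\<exists>r. \<forall>m. (\<Sum>i\<in>I. prob (A i m (r m))) < (1/2) ^ m \<and> r m < r (Suc m)"
    by (rule dependent_nat_choice) (use ex in blast)+
  then obtain r where r: "\<And>m. (\<Sum>i\<in>I. prob (A i m (r m))) < (1/2) ^ m" "\<And>m. r m < r (Suc m)" by blast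
  have rm: "strict_mono r" using r(2) by (simp add: strict_mono_Suc_iff)
  define B where "B m = (\<Union>i\<in>I. A i m (r m))" for m
  have Bm: "B m \<in> sets M" for m unfolding B_def using A(1) assms(1) by (intro sets.finite_UN) auto
  have "prob (B m) \<le> (1/2) ^ m" for m
  proof -
    have "prob (B m) \<le> (\<Sum>i\<in>I. prob (A i m (r m)))"
      unfolding B_def using A(1) assms(1) by (intro finite_measure_subadditive_finite) auto
    then show ?thesis using r(1)[of m] by simp
  qed
  then have "summable (\<lambda>m. prob (B m))"
    by (intro summable_comparison_test[OF _ summable_geometric[of "1/2 :: real"]]) auto
  then have "AE \<omega> in M. eventually (\<lambda>m. \<omega> \<in> space M - B m) sequentially"
    by (intro borel_cantelli_AE1 Bm) (auto simp: less_top[symmetric])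
  then have "AE \<omega> in M. \<forall>i\<in>I. (\<lambda>n. D i (r n) \<omega>) \<longlonglongrightarrow> 0"
  proof eventually_elim
    fix \<omega> assume ev: "eventually (\<lambda>m. \<omega> \<in> space M - B m) sequentially"
    show "\<forall>i\<in>I. (\<lambda>n. D i (r n) \<omega>) \<longlonglongrightarrow> 0"
    proof
      fix i assume i: "i \<in> I"
      have "\<forall>\<^sub>F m in sequentially. D i (r m) \<omega> \<le> ennreal (1 / Suc m)"
        using ev
      proof eventually_elim
        fix m assume "\<omega> \<in> space M - B m"
        then have "\<omega> \<in> space M" "\<omega> \<notin> A i m (r m)" using i by (auto simp: B_def)
        then have "\<omega> \<notin> {\<omega>\<in>space M. ennreal (1 / Suc m) < D i (r m) \<omega>}" using A(2)[OF i, of m "r m"] by blast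
        then show "D i (r m) \<omega> \<le> ennreal (1 / Suc m)" using \<open>\<omega> \<in> space M\<close> by (simp add: not_less)
      qed
      moreover have "(\<lambda>m. ennreal (1 / Suc m)) \<longlonglongrightarrow> ennreal 0"
        by (intro tendsto_ennrealI LIMSEQ_inverse_real_of_nat[unfolded inverse_eq_divide])
      ultimately show "(\<lambda>n. D i (r n) \<omega>) \<longlonglongrightarrow> 0"
        by (intro tendsto_sandwich[of "\<lambda>_. 0" "\<lambda>n. D i (r n) \<omega>" sequentially "\<lambda>m. ennreal (1 / Suc m)"]) simp_all
    qed
  qed
  with rm that show ?thesis by blast
qed

text \<open>The integral of a continuous path depends measurably on the path: it is the limit of the
  integrals of the paths evaluated at the last point of a grid.\<close>

lemma path_integral_measurable:
  fixes z :: "real \<Rightarrow> 'w \<Rightarrow> real"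
  assumes r: "0 \<le> r" and m: "\<And>s. s \<in> {0..r} \<Longrightarrow> z s \<in> borel_measurable G"
    and c: "\<And>\<omega>. \<omega> \<in> space G \<Longrightarrow> continuous_on {0..r} (\<lambda>s. z s \<omega>)"
  shows "(\<lambda>\<omega>. \<integral>s. z s \<omega> \<partial>leb r) \<in> borel_measurable G"
proof -
  interpret leb: finite_measure "leb r" by (rule finite_measure_leb)
  define g where "g n s = max 0 (min r (real_of_int \<lfloor>s * Suc n\<rfloor> / Suc n))" for n :: nat and s :: real
  have g01: "g n s \<in> {0..r}" for n s using r by (auto simp: g_def)
  have glim: "(\<lambda>n. g n s) \<longlonglongrightarrow> s" if s: "s \<in> {0..r}" for s
  proof -
    have "\<bar>real_of_int \<lfloor>s * Suc n\<rfloor> / Suc n - s\<bar> \<le> 1 / Suc n" for n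
    proof -
      have "\<bar>real_of_int \<lfloor>s * Suc n\<rfloor> - s * Suc n\<bar> \<le> 1"
        using floor_correct[of "s * Suc n"] by linarith
      moreover have "\<bar>real_of_int \<lfloor>s * Suc n\<rfloor> / Suc n - s\<bar> = \<bar>real_of_int \<lfloor>s * Suc n\<rfloor> - s * Suc n\<bar> / Suc n"
        by (simp add: field_simps abs_divide[symmetric] del: abs_divide)
      ultimately show ?thesis by (simp add: divide_right_mono)
    qed
    then have "(\<lambda>n. real_of_int \<lfloor>s * Suc n\<rfloor> / Suc n - s) \<longlonglongrightarrow> 0"
      by (intro Lim_null_comparison[OF _ LIMSEQ_inverse_real_of_nat[unfolded inverse_eq_divide]] always_eventually) auto
    then have "(\<lambda>n. real_of_int \<lfloor>s * Suc n\<rfloor> / Suc n) \<longlonglongrightarrow> s" by (rule LIM_zero_cancel)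
    then have "(\<lambda>n. g n s) \<longlonglongrightarrow> max 0 (min r s)" unfolding g_def by (intro tendsto_intros)
    then show ?thesis using s by simp
  qed
  have gm: "(\<lambda>\<omega>. \<integral>s. z (g n s) \<omega> \<partial>leb r) \<in> borel_measurable G" for n
  proof -
    have "(\<lambda>p. (\<lambda>i p. z (max 0 (min r (real_of_int i / Suc n))) (fst p)) \<lfloor>snd p * Suc n\<rfloor> p) \<in> borel_measurable (G \<Otimes>\<^sub>M leb r)"
    proof (rule measurable_compose_countable[where f = "\<lambda>i p. z (max 0 (min r (real_of_int i / Suc n))) (fst p)"
          and g = "\<lambda>p. \<lfloor>snd p * real (Suc n)\<rfloor>"])
      fix i :: int
      have "z (max 0 (min r (real_of_int i / Suc n))) \<in> borel_measurable G" using r by (intro m) auto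
      then show "(\<lambda>p. z (max 0 (min r (real_of_int i / Suc n))) (fst p)) \<in> borel_measurable (G \<Otimes>\<^sub>M leb r)"
        by (rule measurable_compose[OF measurable_fst])
    next
      have "(\<lambda>s. \<lfloor>s * Suc n\<rfloor>) \<in> measurable (leb r) (count_space UNIV)"
        by (rule measurable_restrict_space1) simp
      then show "(\<lambda>p. \<lfloor>snd p * Suc n\<rfloor>) \<in> measurable (G \<Otimes>\<^sub>M leb r) (count_space UNIV)"
        by (rule measurable_compose[OF measurable_snd])
    qed
    then have "(\<lambda>(\<omega>, s). z (g n s) \<omega>) \<in> borel_measurable (G \<Otimes>\<^sub>M leb r)" by (simp add: g_def case_prod_unfold)
    then show ?thesis by (rule leb.borel_measurable_lebesgue_integral)
  qed
  show ?thesis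
  proof (rule borel_measurable_LIMSEQ_real[OF _ gm])
    fix \<omega> assume \<omega>: "\<omega> \<in> space G"
    have "bounded ((\<lambda>s. z s \<omega>) ` {0..r})"
      by (intro compact_imp_bounded compact_continuous_image c \<omega> compact_Icc)
    then obtain b where "\<forall>x\<in>(\<lambda>s. z s \<omega>) ` {0..r}. norm x \<le> b" unfolding bounded_iff ..
    then have b: "norm (z s \<omega>) \<le> b" if "s \<in> {0..r}" for s using that by simp
    have zm: "(\<lambda>s. z s \<omega>) \<in> borel_measurable (leb r)"
      using c[OF \<omega>] by (subst measurable_cong_sets[OF sets_restrict_space_cong[OF sets_lborel] refl])
        (rule borel_measurable_continuous_on_restrict)
    show "(\<lambda>n. \<integral>s. z (g n s) \<omega> \<partial>leb r) \<longlonglongrightarrow> (\<integral>s. z s \<omega> \<partial>leb r)"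
    proof (rule integral_dominated_convergence[where w = "\<lambda>_. b"])
      show "(\<lambda>s. z (g n s) \<omega>) \<in> borel_measurable (leb r)" for n
      proof -
        have "(\<lambda>s. (\<lambda>i s. z (max 0 (min r (real_of_int i / Suc n))) \<omega>) \<lfloor>s * Suc n\<rfloor> s) \<in> borel_measurable (leb r)"
          by (rule measurable_compose_countable[where f = "\<lambda>i s. z (max 0 (min r (real_of_int i / Suc n))) \<omega>"
            and g = "\<lambda>s. \<lfloor>s * real (Suc n)\<rfloor>"]) (auto intro: measurable_restrict_space1)
        then show ?thesis by (simp add: g_def)
      qed
      show "AE s in leb r. (\<lambda>n. z (g n s) \<omega>) \<longlonglongrightarrow> z s \<omega>"
      proof (rule AE_I2)
        fix s assume "s \<in> space (leb r)"
        then have s: "s \<in> {0..r}" by (simp add: space_leb)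
        show "(\<lambda>n. z (g n s) \<omega>) \<longlonglongrightarrow> z s \<omega>"
          by (rule continuous_on_tendsto_compose[OF c[OF \<omega>] glim[OF s] s]) (use g01 in simp)
      qed
      show "AE s in leb r. norm (z (g n s) \<omega>) \<le> b" for n using b[OF g01] by simp
    qed (use zm in auto)
  qed
qed

section \<open>The observation Brownian motion and Girsanov's theorem\<close>

locale filtering = observation P T K B U x0 VU
  for P :: "'w measure" and T and K :: "real \<Rightarrow> real \<Rightarrow> real" and B :: "real \<Rightarrow> 'w \<Rightarrow> real^'b::finite"
    and U :: "real \<Rightarrow> 'w \<Rightarrow> real^'y::finite" and x0 :: "'w \<Rightarrow> real^'x::finite"
    and VU :: "real \<Rightarrow> 'w \<Rightarrow> real^'y" +
  fixes X :: "real \<Rightarrow> 'w \<Rightarrow> real^'x" and Y :: "real \<Rightarrow> 'w \<Rightarrow> real^'y"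
    and f :: "(real^'x) \<times> (real^'y) \<Rightarrow> real^'y" and J :: "'y \<Rightarrow> real \<Rightarrow> 'w \<Rightarrow> real"
  assumes f_Cb: "Cb 2 f"
    and X_Fil: "\<And>s. s \<in> {0..T} \<Longrightarrow> X s \<in> borel_measurable (Fil s)"
    and Y_Fil: "\<And>s. s \<in> {0..T} \<Longrightarrow> Y s \<in> borel_measurable (Fil s)"
    and X_cont: "\<And>\<omega>. \<omega> \<in> space P \<Longrightarrow> continuous_on {0..T} (\<lambda>s. X s \<omega>)"
    and Y_cont: "\<And>\<omega>. \<omega> \<in> space P \<Longrightarrow> continuous_on {0..T} (\<lambda>s. Y s \<omega>)"
    and signal: "AE \<omega> in P. \<forall>t\<in>{0..T}. Y t \<omega> = volterra_op K (\<lambda>s. f (X s \<omega>, Y s \<omega>)) t + U t \<omega>"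
    and ito: "\<And>j. ito_integral P Fil T (\<lambda>s \<omega>. f (X s \<omega>, Y s \<omega>) $ j) (\<lambda>s \<omega>. observation_bm f X Y VU s \<omega> $ j) (J j)"
begin

abbreviation W :: "real \<Rightarrow> 'w \<Rightarrow> real^'y" where "W \<equiv> observation_bm f X Y VU"

abbreviation drift :: "'y \<Rightarrow> real \<Rightarrow> 'w \<Rightarrow> real" where "drift j s \<omega> \<equiv> f (X s \<omega>, Y s \<omega>) $ j"

lemma f_cont: "continuous_on UNIV f" and f_bounded: "bounded (range f)"
  using f_Cb by (simp_all add: numeral_2_eq_2)

lemma path_cont: "\<omega> \<in> space P \<Longrightarrow> continuous_on {0..T} (\<lambda>s. f (X s \<omega>, Y s \<omega>))"
  by (rule continuous_on_compose2[OF f_cont continuous_on_Pair[OF X_cont Y_cont]]) auto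

lemma drift_cont: "\<omega> \<in> space P \<Longrightarrow> continuous_on {0..T} (\<lambda>s. drift j s \<omega>)"
  by (intro continuous_intros path_cont)

lemma path_Fil: "s \<in> {0..T} \<Longrightarrow> (\<lambda>\<omega>. f (X s \<omega>, Y s \<omega>)) \<in> borel_measurable (Fil s)"
  by (rule borel_measurable_continuous_on[OF f_cont borel_measurable_Pair[OF X_Fil Y_Fil]])

lemma Fil_Fil: "s \<in> {0..T} \<Longrightarrow> r \<in> {0..T} \<Longrightarrow> s \<le> r \<Longrightarrow> subalgebra (Fil r) (Fil s)"
  using Fil_mono space_Fil by (simp add: subalgebra_def)

lemma cont_integrable:
  fixes g :: "real \<Rightarrow> 'c::euclidean_space"
  assumes "continuous_on {0..r} g" shows "integrable (leb r) g"
  using borel_integrable_compact[OF compact_Icc assms]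
  by (subst integrable_restrict_space) (auto simp: set_integrable_def)

lemma drift_integrable: "\<omega> \<in> space P \<Longrightarrow> integrable (leb T) (\<lambda>s. drift j s \<omega>)"
  by (rule cont_integrable[OF drift_cont])

lemma cont_sub: "\<omega> \<in> space P \<Longrightarrow> r \<in> {0..T} \<Longrightarrow> continuous_on {0..r} (\<lambda>s. f (X s \<omega>, Y s \<omega>))"
  by (rule continuous_on_subset[OF path_cont]) auto

lemma W_component:
  assumes \<omega>: "\<omega> \<in> space P" and r: "r \<in> {0..T}"
  shows "W r \<omega> $ j = VU r \<omega> $ j + (\<integral>u. drift j u \<omega> \<partial>leb r)"
proof -
  have "(LINT s:{0..r}|lborel. f (X s \<omega>, Y s \<omega>)) $ j = (\<integral>u. f (X u \<omega>, Y u \<omega>) \<partial>leb r) \<bullet> axis j 1"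
    by (simp add: set_lebesgue_integral_def integral_leb inner_axis)
  also have "\<dots> = (\<integral>u. f (X u \<omega>, Y u \<omega>) \<bullet> axis j 1 \<partial>leb r)"
    by (rule integral_inner_left[symmetric]) (rule cont_integrable[OF cont_sub[OF \<omega> r]])
  finally show ?thesis by (simp add: observation_bm_def inner_axis)
qed

lemma leb_restrict:
  assumes r: "r \<in> {0..T}"
  shows "(\<integral>u. g u \<partial>leb r) = (\<integral>u. indicat_real {0..r} u * (g u :: real) \<partial>leb T)"
  unfolding integral_leb using r by (intro Bochner_Integration.integral_cong) (auto simp: indicator_def)

lemma indicator_drift_integrable:
  assumes "\<omega> \<in> space P" shows "integrable (leb T) (\<lambda>u. indicat_real {a..b} u * drift j u \<omega>)"
proof -
  have "{a..b} \<inter> {0..T} \<in> sets (leb T)" by (auto simp: sets_restrict_space)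
  from integrable_mult_indicator[OF this drift_integrable[OF assms]]
  have "integrable (leb T) (\<lambda>u. indicat_real ({a..b} \<inter> {0..T}) u * drift j u \<omega>)" by simp
  then show ?thesis
    by (rule Bochner_Integration.integrable_cong[THEN iffD1, OF refl, rotated]) (auto simp: space_leb indicator_def)
qed

lemma W_increment:
  assumes \<omega>: "\<omega> \<in> space P" and ab: "0 \<le> a" "a \<le> b" "b \<le> T"
  shows "W b \<omega> $ j - W a \<omega> $ j = inc a b j \<omega> + (\<integral>u. indicat_real {a<..b} u * drift j u \<omega> \<partial>leb T)"
proof -
  have r: "a \<in> {0..T}" "b \<in> {0..T}" using ab by auto
  have "(\<integral>u. indicat_real {a<..b} u * drift j u \<omega> \<partial>leb T) =
      (\<integral>u. indicat_real {0..b} u * drift j u \<omega> - indicat_real {0..a} u * drift j u \<omega> \<partial>leb T)"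
    using ab by (intro Bochner_Integration.integral_cong) (auto simp: indicator_def space_leb)
  also have "\<dots> = (\<integral>u. indicat_real {0..b} u * drift j u \<omega> \<partial>leb T) - (\<integral>u. indicat_real {0..a} u * drift j u \<omega> \<partial>leb T)"
    using indicator_drift_integrable[OF \<omega>] by (intro Bochner_Integration.integral_diff)
  finally show ?thesis
    unfolding W_component[OF \<omega> r(1)] W_component[OF \<omega> r(2)] leb_restrict[OF r(1)] leb_restrict[OF r(2)] by simp
qed

lemma W_Fil:
  assumes r: "r \<in> {0..T}" shows "W r \<in> borel_measurable (Fil r)"
proof (rule measurable_vec)
  fix j
  have "(\<lambda>\<omega>. \<integral>u. drift j u \<omega> \<partial>leb r) \<in> borel_measurable (Fil r)"
  proof (rule path_integral_measurable)
    show "0 \<le> r" using r by simp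
    fix s assume s: "s \<in> {0..r}"
    then have "s \<in> {0..T}" "s \<le> r" using r by auto
    then show "(\<lambda>\<omega>. drift j s \<omega>) \<in> borel_measurable (Fil r)"
      by (intro measurable_component measurable_from_subalg[OF Fil_Fil[OF _ r] path_Fil])
  next
    fix \<omega> assume "\<omega> \<in> space (Fil r)"
    then have "\<omega> \<in> space P" using space_Fil[OF r] by simp
    then show "continuous_on {0..r} (\<lambda>s. drift j s \<omega>)"
      using continuous_on_subset[OF drift_cont, of \<omega> "{0..r}"] r by auto
  qed
  then have "(\<lambda>\<omega>. VU r \<omega> $ j + (\<integral>u. drift j u \<omega> \<partial>leb r)) \<in> borel_measurable (Fil r)"
    by (intro borel_measurable_add measurable_component VU_Fil r)
  then show "(\<lambda>\<omega>. W r \<omega> $ j) \<in> borel_measurable (Fil r)"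
    by (rule measurable_cong[THEN iffD1, rotated]) (use W_component[OF _ r] space_Fil[OF r] in auto)
qed

text \<open>Linear functionals of the increments of \<open>W\<close> after time \<open>t\<close>, their integrands with respect to \<open>dW\<close>, and the
  coefficients for which these are supported after \<open>t\<close>.\<close>

definition W_after :: "real \<Rightarrow> 'y step \<Rightarrow> 'w \<Rightarrow> real" where
  "W_after t v \<omega> = step_apply (\<lambda>r \<omega>. W r \<omega> - W t \<omega>) v \<omega>"

definition ind_after :: "real \<Rightarrow> 'y step \<Rightarrow> real \<Rightarrow> real^'y" where
  "ind_after t v s = lin (\<lambda>(k, r). ind_upto k r s - ind_upto k t s) v"

definition steps_after :: "real \<Rightarrow> 'y step set" where
  "steps_after t = {v. Poly_Mapping.keys v \<subseteq> UNIV \<times> {t..T}}"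

lemma ind_after_component:
  assumes t: "t \<in> {0..T}" and v: "v \<in> steps_after t"
  shows "ind_after t v s $ j = (\<Sum>x\<in>Poly_Mapping.keys v. if fst x = j then Poly_Mapping.lookup v x * indicat_real {t<..snd x} s else 0)"
proof -
  have "ind_after t v s $ j = (\<Sum>x\<in>Poly_Mapping.keys v. Poly_Mapping.lookup v x * (ind_upto (fst x) (snd x) s - ind_upto (fst x) t s) $ j)"
    by (simp add: ind_after_def lin_def case_prod_unfold)
  also have "\<dots> = (\<Sum>x\<in>Poly_Mapping.keys v. if fst x = j then Poly_Mapping.lookup v x * indicat_real {t<..snd x} s else 0)"
  proof (rule sum.cong[OF refl])
    fix x assume "x \<in> Poly_Mapping.keys v"
    then have "t \<le> snd x" using v by (auto simp: steps_after_def)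
    then show "Poly_Mapping.lookup v x * (ind_upto (fst x) (snd x) s - ind_upto (fst x) t s) $ j =
        (if fst x = j then Poly_Mapping.lookup v x * indicat_real {t<..snd x} s else 0)"
      using t by (auto simp: ind_upto_def indicator_def axis_def)
  qed
  finally show ?thesis .
qed

lemma stepfun_ind_after:
  assumes t: "t \<in> {0..T}" and v: "v \<in> steps_after t" and us: "partition_of 0 T us" and tu: "t \<in> set us"
    and vu: "snd ` Poly_Mapping.keys v \<subseteq> set us"
  shows "stepfun us (\<lambda>s. ind_after t v s $ j)"
  unfolding ind_after_component[OF t v]
proof (rule stepfun_sum)
  fix x assume x: "x \<in> Poly_Mapping.keys v"
  then have "stepfun us (indicat_real {t<..snd x})" using vu by (intro stepfun_indicator[OF us tu]) auto
  then have "stepfun us (\<lambda>s. Poly_Mapping.lookup v x * indicat_real {t<..snd x} s)"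
    by (intro stepfun_mult stepfun_const)
  then show "stepfun us (\<lambda>s. if fst x = j then Poly_Mapping.lookup v x * indicat_real {t<..snd x} s else 0)"
    using stepfun_const[of us 0] by (cases "fst x = j") auto
qed

lemma W_after_refine:
  assumes t: "t \<in> {0..T}" and v: "v \<in> steps_after t" and us: "partition_of 0 T us" and tu: "t \<in> set us"
    and vu: "snd ` Poly_Mapping.keys v \<subseteq> set us"
  shows "W_after t v \<omega> = (\<Sum>j\<in>UNIV. \<Sum>i<length us - 1. ind_after t v (us ! Suc i) $ j * (W (us ! Suc i) \<omega> $ j - W (us ! i) \<omega> $ j))"
proof -
  let ?l = "Poly_Mapping.lookup v"
  have "W_after t v \<omega> = (\<Sum>x\<in>Poly_Mapping.keys v. ?l x * (W (snd x) \<omega> $ fst x - W t \<omega> $ fst x))"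
    by (simp add: W_after_def step_apply_lin lin_def case_prod_unfold)
  also have "\<dots> = (\<Sum>x\<in>Poly_Mapping.keys v. \<Sum>i<length us - 1. ?l x * (indicat_real {t<..snd x} (us ! Suc i) * (W (us ! Suc i) \<omega> $ fst x - W (us ! i) \<omega> $ fst x)))"
  proof (rule sum.cong[OF refl])
    fix x assume x: "x \<in> Poly_Mapping.keys v"
    then have a: "snd x \<in> set us" "t \<le> snd x" using vu v by (auto simp: steps_after_def)
    from partition_telescope[OF us tu a, of "\<lambda>u. W u \<omega> $ fst x"]
    show "?l x * (W (snd x) \<omega> $ fst x - W t \<omega> $ fst x) = (\<Sum>i<length us - 1. ?l x * (indicat_real {t<..snd x} (us ! Suc i) * (W (us ! Suc i) \<omega> $ fst x - W (us ! i) \<omega> $ fst x)))"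
      by (simp only: sum_distrib_left[symmetric])
  qed
  also have "\<dots> = (\<Sum>x\<in>Poly_Mapping.keys v. \<Sum>i<length us - 1. \<Sum>j\<in>UNIV. (if fst x = j then ?l x * indicat_real {t<..snd x} (us ! Suc i) else 0) * (W (us ! Suc i) \<omega> $ j - W (us ! i) \<omega> $ j))"
  proof (intro sum.cong[OF refl])
    fix x i
    have "(\<Sum>j\<in>UNIV. (if fst x = j then ?l x * indicat_real {t<..snd x} (us ! Suc i) else 0) * (W (us ! Suc i) \<omega> $ j - W (us ! i) \<omega> $ j)) =
      (\<Sum>j\<in>UNIV. if fst x = j then ?l x * indicat_real {t<..snd x} (us ! Suc i) * (W (us ! Suc i) \<omega> $ j - W (us ! i) \<omega> $ j) else 0)"
      by (intro sum.cong[OF refl]) (simp only: if_distrib[of "\<lambda>a. a * _"] mult_zero_left)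
    also have "\<dots> = ?l x * indicat_real {t<..snd x} (us ! Suc i) * (W (us ! Suc i) \<omega> $ fst x - W (us ! i) \<omega> $ fst x)"
      by (subst sum.delta') auto
    finally show "?l x * (indicat_real {t<..snd x} (us ! Suc i) * (W (us ! Suc i) \<omega> $ fst x - W (us ! i) \<omega> $ fst x)) =
      (\<Sum>j\<in>UNIV. (if fst x = j then ?l x * indicat_real {t<..snd x} (us ! Suc i) else 0) * (W (us ! Suc i) \<omega> $ j - W (us ! i) \<omega> $ j))"
      by (simp only: mult.assoc)
  qed
  also have "\<dots> = (\<Sum>i<length us - 1. \<Sum>j\<in>UNIV. \<Sum>x\<in>Poly_Mapping.keys v. (if fst x = j then ?l x * indicat_real {t<..snd x} (us ! Suc i) else 0) * (W (us ! Suc i) \<omega> $ j - W (us ! i) \<omega> $ j))"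
    by (subst sum.swap, intro sum.cong[OF refl], rule sum.swap)
  also have "\<dots> = (\<Sum>j\<in>UNIV. \<Sum>i<length us - 1. \<Sum>x\<in>Poly_Mapping.keys v. (if fst x = j then ?l x * indicat_real {t<..snd x} (us ! Suc i) else 0) * (W (us ! Suc i) \<omega> $ j - W (us ! i) \<omega> $ j))"
    by (rule sum.swap)
  finally show ?thesis unfolding ind_after_component[OF t v] sum_distrib_right .
qed

lemma simple_value_Fil:
  assumes sp: "simple_process Fil T ts \<xi>" and us: "partition_of 0 T us" and tu: "set ts \<subseteq> set us" and i: "Suc i < length us"
  shows "simple_value ts \<xi> (us ! Suc i) \<in> borel_measurable (Fil (us ! i))"
    and "\<exists>c. \<forall>\<omega>\<in>space P. \<bar>simple_value ts \<xi> (us ! Suc i) \<omega>\<bar> \<le> c"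
proof -
  have ts: "partition_of 0 T ts" using sp by (simp add: simple_process_def)
  have ui: "us ! i \<in> {0..T}" using partition_facts(4)[OF us, of i] i by auto
  have tT: "ts ! l \<in> {0..T}" if "l < length ts - 1" for l using partition_facts(4)[OF ts, of l] that by auto
  have "(\<lambda>\<omega>. \<Sum>l<length ts - 1. \<xi> l \<omega> * indicat_real {ts ! l<..ts ! Suc l} (us ! Suc i)) \<in> borel_measurable (Fil (us ! i))"
  proof (rule borel_measurable_sum)
    fix l assume "l \<in> {..<length ts - 1}"
    then have l: "l < length ts - 1" by simp
    show "(\<lambda>\<omega>. \<xi> l \<omega> * indicat_real {ts ! l<..ts ! Suc l} (us ! Suc i)) \<in> borel_measurable (Fil (us ! i))"
    proof (cases "us ! Suc i \<in> {ts ! l<..ts ! Suc l}")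
      case True
      have "ts ! l \<in> set us" using l by (intro subsetD[OF tu] nth_mem) simp
      then obtain p where p: "p < length us" "us ! p = ts ! l" by (metis in_set_conv_nth)
      have "ts ! l \<le> us ! i"
        using True p partition_less_iff(1)[OF us p(1) i] partition_less_iff(2)[OF us p(1), of i] i by auto
      moreover have "\<xi> l \<in> borel_measurable (Fil (ts ! l))" using sp l by (simp add: simple_process_def)
      ultimately have "\<xi> l \<in> borel_measurable (Fil (us ! i))"
        using measurable_from_subalg[OF Fil_Fil[OF tT[OF l] ui]] by blast
      then show ?thesis using True by simp
    next
      case False then show ?thesis by simp
    qed
  qed
  then show "simple_value ts \<xi> (us ! Suc i) \<in> borel_measurable (Fil (us ! i))"
    by (simp add: simple_value_def[abs_def])
  have "\<exists>c. \<forall>\<omega>\<in>space P. \<bar>\<xi> l \<omega>\<bar> \<le> c" if l: "l < length ts - 1" for l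
  proof -
    have "bounded (\<xi> l ` space (Fil (ts ! l)))" using sp l by (simp add: simple_process_def)
    then show ?thesis unfolding space_Fil[OF tT[OF l]] bounded_iff by auto
  qed
  then have "\<forall>l. \<exists>c. l < length ts - 1 \<longrightarrow> (\<forall>\<omega>\<in>space P. \<bar>\<xi> l \<omega>\<bar> \<le> c)" by blast
  from choice[OF this] obtain c where c: "\<And>l \<omega>. l < length ts - 1 \<Longrightarrow> \<omega> \<in> space P \<Longrightarrow> \<bar>\<xi> l \<omega>\<bar> \<le> c l" by blast
  have "\<bar>simple_value ts \<xi> (us ! Suc i) \<omega>\<bar> \<le> (\<Sum>l<length ts - 1. c l)" if "\<omega> \<in> space P" for \<omega>
  proof -
    have "\<bar>simple_value ts \<xi> (us ! Suc i) \<omega>\<bar> \<le> (\<Sum>l<length ts - 1. \<bar>\<xi> l \<omega> * indicat_real {ts ! l<..ts ! Suc l} (us ! Suc i)\<bar>)"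
      unfolding simple_value_def by (rule sum_abs)
    also have "\<dots> \<le> (\<Sum>l<length ts - 1. c l)"
    proof (rule sum_mono)
      fix l assume "l \<in> {..<length ts - 1}"
      then have "\<bar>\<xi> l \<omega>\<bar> \<le> c l" using c that by simp
      then show "\<bar>\<xi> l \<omega> * indicat_real {ts ! l<..ts ! Suc l} (us ! Suc i)\<bar> \<le> c l"
        by (cases "us ! Suc i \<in> {ts ! l<..ts ! Suc l}") (auto intro: order_trans[OF abs_ge_zero])
    qed
    finally show ?thesis .
  qed
  then show "\<exists>c. \<forall>\<omega>\<in>space P. \<bar>simple_value ts \<xi> (us ! Suc i) \<omega>\<bar> \<le> c" by blast
qed

text \<open>Girsanov's formula for simple integrands, one for each component, by passing to a common
  refinement of their partitions. The density built from \<open>h\<close> in place of the drift turns \<open>VU + \<integral> h\<close> into a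
  Brownian motion, not \<open>W\<close>; hence the correction by \<open>\<integral> (h - drift)\<close> in the Gaussian functional \<open>N\<close>.\<close>

lemma girsanov_simple:
  assumes t: "t \<in> {0..T}" and A: "A \<in> sets (Fil t)" and v: "v \<in> steps_after t"
    and sp: "\<And>j. simple_process Fil T (ts j) (\<xi> j)"
  defines "h \<equiv> \<lambda>j s \<omega>. simple_value (ts j) (\<xi> j) s \<omega>"
  defines "lD \<equiv> \<lambda>\<omega>. \<Sum>j\<in>UNIV. - (simple_integral (ts j) (\<xi> j) (\<lambda>s \<omega>. W s \<omega> $ j) T \<omega> - (\<integral>s. h j s \<omega> * drift j s \<omega> \<partial>leb T))
      - (\<integral>s. (h j s \<omega>)\<^sup>2 \<partial>leb T) / 2"
    and "N \<equiv> \<lambda>\<omega>. W_after t v \<omega> + (\<Sum>j\<in>UNIV. \<integral>s. ind_after t v s $ j * (h j s \<omega> - drift j s \<omega>) \<partial>leb T)"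
  shows "integrable P (\<lambda>\<omega>. exp (lD \<omega>))" and "(\<integral>\<omega>. exp (lD \<omega>) \<partial>P) = 1" and "N \<in> borel_measurable P"
    and "sint P A (\<lambda>\<omega>. complex_of_real (exp (lD \<omega>)) * iexp (N \<omega>)) =
      complex_of_real (exp (- (\<integral>s. (norm (ind_after t v s))\<^sup>2 \<partial>leb T) / 2)) * sint P A (\<lambda>\<omega>. complex_of_real (exp (lD \<omega>)))"
    and "\<And>j \<omega>. \<omega> \<in> space P \<Longrightarrow> integrable (leb T) (\<lambda>s. (h j s \<omega>)\<^sup>2) \<and> integrable (leb T) (\<lambda>s. h j s \<omega> * drift j s \<omega>) \<and> integrable (leb T) (\<lambda>s. h j s \<omega>)"
    and "\<And>j. square_integrable (leb T) (\<lambda>s. ind_after t v s $ j)"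
proof -
  define S where "S = {0, t, T} \<union> (\<Union>j. set (ts j)) \<union> snd ` Poly_Mapping.keys v"
  define us where "us = sorted_list_of_set S"
  have tp: "partition_of 0 T (ts j)" for j using sp[of j] by (simp add: simple_process_def)
  have "set (ts j) \<subseteq> {0..T}" for j
  proof
    fix x assume "x \<in> set (ts j)"
    then obtain l where "l < length (ts j)" "ts j ! l = x" by (metis in_set_conv_nth)
    then show "x \<in> {0..T}" using partition_facts(4)[OF tp[of j]] by blast
  qed
  moreover have "snd ` Poly_Mapping.keys v \<subseteq> {0..T}" using v t by (force simp: steps_after_def)
  ultimately have S: "finite S" "S \<subseteq> {0..T}" "0 \<in> S" "T \<in> S" using t T_pos by (auto simp: S_def)
  have us: "partition_of 0 T us" unfolding us_def by (rule partition_of_sorted_list[OF S])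
  have sus: "set us = S" using S(1) by (simp add: us_def)
  have tu: "t \<in> set us" and tsu: "set (ts j) \<subseteq> set us" and vu: "snd ` Poly_Mapping.keys v \<subseteq> set us" for j
    unfolding sus by (auto simp: S_def)
  obtain p where p: "p < length us" "us ! p = t" using tu by (metis in_set_conv_nth)
  define n where "n = length us - 1"
  define d where "d i = us ! Suc i - us ! i" for i
  define \<zeta> where "\<zeta> i j \<omega> = h j (us ! Suc i) \<omega>" for i j \<omega>
  define \<gamma> where "\<gamma> i j = (if i < n then ind_after t v (us ! Suc i) $ j else 0)" for i j
  have \<zeta>m: "\<zeta> i j \<in> borel_measurable (Fil (us ! i))" if "Suc i < length us" for i j
    using simple_value_Fil(1)[OF sp us tsu that, of j] by (simp add: \<zeta>_def[abs_def] h_def)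
  have "\<forall>i. \<exists>c. Suc i < length us \<longrightarrow> (\<forall>j. \<forall>\<omega>\<in>space P. \<bar>\<zeta> i j \<omega>\<bar> \<le> c)"
  proof (intro allI)
    fix i
    show "\<exists>c. Suc i < length us \<longrightarrow> (\<forall>j. \<forall>\<omega>\<in>space P. \<bar>\<zeta> i j \<omega>\<bar> \<le> c)"
    proof (cases "Suc i < length us")
      case True
      have "\<forall>j. \<exists>c. \<forall>\<omega>\<in>space P. \<bar>\<zeta> i j \<omega>\<bar> \<le> c" unfolding \<zeta>_def h_def using simple_value_Fil(2)[OF sp us tsu True] by blast
      from choice[OF this] obtain c where c: "\<And>j \<omega>. \<omega> \<in> space P \<Longrightarrow> \<bar>\<zeta> i j \<omega>\<bar> \<le> c j" by blast
      have "\<bar>\<zeta> i j \<omega>\<bar> \<le> (\<Sum>j\<in>UNIV. \<bar>c j\<bar>)" if "\<omega> \<in> space P" for j \<omega>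
      proof -
        have "\<bar>\<zeta> i j \<omega>\<bar> \<le> \<bar>c j\<bar>" using c[OF that, of j] by simp
        also have "\<dots> \<le> (\<Sum>j\<in>UNIV. \<bar>c j\<bar>)" by (rule member_le_sum) auto
        finally show ?thesis .
      qed
      then show ?thesis by blast
    qed simp
  qed
  from choice[OF this] obtain c where c: "\<And>i j \<omega>. Suc i < length us \<Longrightarrow> \<omega> \<in> space P \<Longrightarrow> \<bar>\<zeta> i j \<omega>\<bar> \<le> c i" by blast
  have \<gamma>0: "\<gamma> i j = 0" if "i < p" for i j
  proof -
    have "us ! Suc i \<le> t" using partition_less_iff(2)[OF us _ p(1), of "Suc i"] that p by simp
    then have "ind_after t v (us ! Suc i) $ j = 0"
      unfolding ind_after_component[OF t v] by (intro sum.neutral ballI) simp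
    then show ?thesis by (simp add: \<gamma>_def)
  qed
  have Ap: "A \<in> sets (Fil (us ! p))" using A p by simp
  note G = girsanov_discrete[where \<xi> = \<zeta> and \<gamma> = \<gamma> and c = c, OF us p(1) Ap \<zeta>m c \<gamma>0, folded n_def d_def]
  have ord: "0 \<le> us ! i" "us ! i \<le> us ! Suc i" "us ! Suc i \<le> T" if "i < n" for i
  proof -
    have i: "Suc i < length us" using that by (simp add: n_def)
    show "0 \<le> us ! i" "us ! i \<le> us ! Suc i" "us ! Suc i \<le> T"
      using partition_facts(4)[OF us, of i] partition_facts(4)[OF us i] partition_facts(3)[OF us _ i, of i] i by auto
  qed
  have hs: "stepfun us (\<lambda>s. h j s \<omega>)" for j \<omega>
    unfolding h_def by (rule stepfun_simple_value[OF us tsu])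
  have gs: "stepfun us (\<lambda>s. ind_after t v s $ j)" for j by (rule stepfun_ind_after[OF t v us tu vu])
  have h2: "integrable (leb T) (\<lambda>s. (h j s \<omega>)\<^sup>2)" "(\<integral>s. (h j s \<omega>)\<^sup>2 \<partial>leb T) = (\<Sum>i<n. (\<zeta> i j \<omega>)\<^sup>2 * d i)" for j \<omega>
    using step_integral_length[OF us stepfun_mult[OF hs hs], of j \<omega> j \<omega>] by (simp_all add: power2_eq_square n_def \<zeta>_def d_def)
  have gg: "integrable (leb T) (\<lambda>s. (ind_after t v s $ j)\<^sup>2)"
     "(\<integral>s. (ind_after t v s $ j)\<^sup>2 \<partial>leb T) = (\<Sum>i<n. (\<gamma> i j)\<^sup>2 * d i)" for j
    using step_integral_length[OF us stepfun_mult[OF gs gs], of j j] by (simp_all add: power2_eq_square n_def \<gamma>_def d_def)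
  have gh: "integrable (leb T) (\<lambda>s. ind_after t v s $ j * h j s \<omega>)"
     "(\<integral>s. ind_after t v s $ j * h j s \<omega> \<partial>leb T) = (\<Sum>i<n. \<gamma> i j * \<zeta> i j \<omega> * d i)" for j \<omega>
    using step_integral_length[OF us stepfun_mult[OF gs hs], of j j \<omega>] by (simp_all add: n_def \<gamma>_def \<zeta>_def d_def)
  have hf: "integrable (leb T) (\<lambda>s. h j s \<omega> * drift j s \<omega>)"
     "(\<integral>s. h j s \<omega> * drift j s \<omega> \<partial>leb T) = (\<Sum>i<n. \<zeta> i j \<omega> * (\<integral>s. indicat_real {us ! i<..us ! Suc i} s * drift j s \<omega> \<partial>leb T))"
    if "\<omega> \<in> space P" for j \<omega>
    using step_integral[OF us hs drift_integrable[OF that], of j \<omega> j] by (simp_all add: n_def \<zeta>_def)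
  have gf: "integrable (leb T) (\<lambda>s. ind_after t v s $ j * drift j s \<omega>)"
     "(\<integral>s. ind_after t v s $ j * drift j s \<omega> \<partial>leb T) = (\<Sum>i<n. \<gamma> i j * (\<integral>s. indicat_real {us ! i<..us ! Suc i} s * drift j s \<omega> \<partial>leb T))"
    if "\<omega> \<in> space P" for j \<omega>
    using step_integral[OF us gs drift_integrable[OF that], of j j] by (simp_all add: n_def \<gamma>_def)
  have hi: "integrable (leb T) (\<lambda>s. h j s \<omega>)" for j \<omega> using step_integral_length(1)[OF us hs] .
  have Winc: "W (us ! Suc i) \<omega> $ j - W (us ! i) \<omega> $ j = inc (us ! i) (us ! Suc i) j \<omega> + (\<integral>s. indicat_real {us ! i<..us ! Suc i} s * drift j s \<omega> \<partial>leb T)"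
    if "\<omega> \<in> space P" "i < n" for i j \<omega>
    by (rule W_increment[OF that(1) ord[OF that(2)]])
  let ?lD = "\<lambda>\<omega>. \<Sum>i<n. \<Sum>j\<in>UNIV. - \<zeta> i j \<omega> * inc (us ! i) (us ! Suc i) j \<omega> - (\<zeta> i j \<omega>)\<^sup>2 * d i / 2"
  let ?N = "\<lambda>\<omega>. \<Sum>i<n. \<Sum>j\<in>UNIV. \<gamma> i j * (inc (us ! i) (us ! Suc i) j \<omega> + \<zeta> i j \<omega> * d i)"
  have SI: "simple_integral (ts j) (\<xi> j) (\<lambda>s \<omega>. W s \<omega> $ j) T \<omega> - (\<integral>s. h j s \<omega> * drift j s \<omega> \<partial>leb T) =
      (\<Sum>i<n. \<zeta> i j \<omega> * inc (us ! i) (us ! Suc i) j \<omega>)" if \<omega>: "\<omega> \<in> space P" for j \<omega>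
  proof -
    have "simple_integral (ts j) (\<xi> j) (\<lambda>s \<omega>. W s \<omega> $ j) T \<omega> = (\<Sum>i<n. \<zeta> i j \<omega> * (W (us ! Suc i) \<omega> $ j - W (us ! i) \<omega> $ j))"
      using simple_integral_refine[OF us tp tsu, of j "\<xi> j" "\<lambda>s \<omega>. W s \<omega> $ j" \<omega>] by (simp add: n_def \<zeta>_def h_def)
    also have "\<dots> = (\<Sum>i<n. \<zeta> i j \<omega> * (inc (us ! i) (us ! Suc i) j \<omega> + (\<integral>s. indicat_real {us ! i<..us ! Suc i} s * drift j s \<omega> \<partial>leb T)))"
      by (intro sum.cong[OF refl]) (simp add: Winc[OF \<omega>])
    finally show ?thesis unfolding hf(2)[OF \<omega>] by (simp add: sum_subtractf[symmetric] algebra_simps)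
  qed
  have lDeq: "lD \<omega> = ?lD \<omega>" if \<omega>: "\<omega> \<in> space P" for \<omega>
  proof -
    have "lD \<omega> = (\<Sum>j\<in>UNIV. \<Sum>i<n. - \<zeta> i j \<omega> * inc (us ! i) (us ! Suc i) j \<omega> - (\<zeta> i j \<omega>)\<^sup>2 * d i / 2)"
      unfolding lD_def SI[OF \<omega>] h2(2) by (simp add: sum_subtractf sum_negf sum_divide_distrib)
    also have "\<dots> = ?lD \<omega>" by (rule sum.swap)
    finally show ?thesis .
  qed
  have Neq: "N \<omega> = ?N \<omega>" if \<omega>: "\<omega> \<in> space P" for \<omega>
  proof -
    have "(\<integral>s. ind_after t v s $ j * (h j s \<omega> - drift j s \<omega>) \<partial>leb T) =
        (\<Sum>i<n. \<gamma> i j * \<zeta> i j \<omega> * d i) - (\<Sum>i<n. \<gamma> i j * (\<integral>s. indicat_real {us ! i<..us ! Suc i} s * drift j s \<omega> \<partial>leb T))" for j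
      unfolding right_diff_distrib gh(2)[symmetric] gf(2)[OF \<omega>, symmetric]
      by (rule Bochner_Integration.integral_diff[OF gh(1) gf(1)[OF \<omega>]])
    moreover have "W_after t v \<omega> = (\<Sum>j\<in>UNIV. \<Sum>i<n. \<gamma> i j * (inc (us ! i) (us ! Suc i) j \<omega> + (\<integral>s. indicat_real {us ! i<..us ! Suc i} s * drift j s \<omega> \<partial>leb T)))"
      unfolding W_after_refine[OF t v us tu vu] n_def[symmetric]
      by (intro sum.cong[OF refl]) (simp add: \<gamma>_def Winc[OF \<omega>])
    ultimately have "N \<omega> = (\<Sum>j\<in>UNIV. \<Sum>i<n. \<gamma> i j * (inc (us ! i) (us ! Suc i) j \<omega> + \<zeta> i j \<omega> * d i))"
      unfolding N_def by (simp add: sum.distrib[symmetric] sum_subtractf[symmetric] algebra_simps)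
    also have "\<dots> = ?N \<omega>" by (rule sum.swap)
    finally show ?thesis .
  qed
  have veq: "(\<integral>s. (norm (ind_after t v s))\<^sup>2 \<partial>leb T) = (\<Sum>i<n. \<Sum>j\<in>UNIV. (\<gamma> i j)\<^sup>2 * d i)"
  proof -
    have "(norm (ind_after t v s))\<^sup>2 = (\<Sum>j\<in>UNIV. (ind_after t v s $ j)\<^sup>2)" for s
      unfolding power2_norm_eq_inner inner_vec_def by (simp add: power2_eq_square)
    then have "(\<integral>s. (norm (ind_after t v s))\<^sup>2 \<partial>leb T) = (\<Sum>j\<in>UNIV. \<Sum>i<n. (\<gamma> i j)\<^sup>2 * d i)"
      using gg by simp
    then show ?thesis by (simp add: sum.swap[of _ "{..<n}"])
  qed
  show "integrable P (\<lambda>\<omega>. exp (lD \<omega>))"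
    by (rule Bochner_Integration.integrable_cong[THEN iffD1, OF refl _ G(1)]) (simp add: lDeq)
  have "(\<integral>\<omega>. exp (lD \<omega>) \<partial>P) = (\<integral>\<omega>. exp (?lD \<omega>) \<partial>P)" by (rule Bochner_Integration.integral_cong[OF refl]) (simp add: lDeq)
  then show "(\<integral>\<omega>. exp (lD \<omega>) \<partial>P) = 1" using G(2) by simp
  have AM: "A \<in> sets P" using A Fil_subalgebra[OF t] by (auto simp: subalgebra_def)
  have "sint P A (\<lambda>\<omega>. complex_of_real (exp (lD \<omega>)) * iexp (N \<omega>)) = sint P A (\<lambda>\<omega>. complex_of_real (exp (?lD \<omega>)) * iexp (?N \<omega>))"
    by (rule Bochner_Integration.integral_cong[OF refl]) (simp only: lDeq Neq)
  moreover have "sint P A (\<lambda>\<omega>. complex_of_real (exp (lD \<omega>))) = sint P A (\<lambda>\<omega>. complex_of_real (exp (?lD \<omega>)))"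
    by (rule Bochner_Integration.integral_cong[OF refl]) (simp only: lDeq)
  ultimately show "sint P A (\<lambda>\<omega>. complex_of_real (exp (lD \<omega>)) * iexp (N \<omega>)) =
      complex_of_real (exp (- (\<integral>s. (norm (ind_after t v s))\<^sup>2 \<partial>leb T) / 2)) * sint P A (\<lambda>\<omega>. complex_of_real (exp (lD \<omega>)))"
    unfolding veq using G(3) by (simp only:)
  show "N \<in> borel_measurable P"
  proof (rule measurable_cong[THEN iffD1])
    show "?N \<in> borel_measurable P"
    proof (intro borel_measurable_sum borel_measurable_times borel_measurable_add borel_measurable_const)
      fix i j assume "i \<in> {..<n}"
      then have i: "i < n" "Suc i < length us" by (auto simp: n_def)
      show "inc (us ! i) (us ! Suc i) j \<in> borel_measurable P" using ord[OF i(1)] by (intro inc_measurable) auto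
      show "\<zeta> i j \<in> borel_measurable P"
        using ord[OF i(1)] by (intro measurable_from_subalg[OF Fil_subalgebra \<zeta>m[OF i(2)]]) auto
    qed
  qed (simp add: Neq)
  show "\<And>j \<omega>. \<omega> \<in> space P \<Longrightarrow> integrable (leb T) (\<lambda>s. (h j s \<omega>)\<^sup>2) \<and> integrable (leb T) (\<lambda>s. h j s \<omega> * drift j s \<omega>) \<and> integrable (leb T) (\<lambda>s. h j s \<omega>)"
    using h2 hf hi by blast
  show "square_integrable (leb T) (\<lambda>s. ind_after t v s $ j)" for j
    using gg(1)[of j] step_integral_length(1)[OF us gs[of j]] by (simp add: square_integrable_def)
qed

text \<open>The density of the reference measure with respect to \<open>P\<close> on \<open>Fil T\<close>, written in terms of the Ito integrals so
  that it makes sense before the reference measure is introduced.\<close>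

definition inv_likelihood :: "'w \<Rightarrow> real" where
  "inv_likelihood \<omega> = exp (\<Sum>j\<in>UNIV. (\<integral>s. (drift j s \<omega>)\<^sup>2 \<partial>leb T) / 2 - J j T \<omega>)"

lemma square_integrable_drift:
  assumes "\<omega> \<in> space P" shows "square_integrable (leb T) (\<lambda>s. drift j s \<omega>)"
proof -
  have "integrable (leb T) (\<lambda>s. (drift j s \<omega>)\<^sup>2)"
    by (rule cont_integrable) (intro continuous_intros drift_cont assms)
  then show ?thesis using drift_integrable[OF assms, of j] by (simp add: square_integrable_def)
qed

text \<open>Passage to the limit. Convergence of the Ito approximations in probability gives almost sure
  convergence of the densities along a subsequence; as all of them, and the limit, have mass one,
  Scheffe's lemma upgrades this to convergence in \<open>L\<^sup>1\<close>.\<close>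

lemma girsanov:
  assumes t: "t \<in> {0..T}" and A: "A \<in> sets (Fil t)" and v: "v \<in> steps_after t"
    and mass: "integrable P inv_likelihood" "(\<integral>\<omega>. inv_likelihood \<omega> \<partial>P) = 1"
  shows "sint P A (\<lambda>\<omega>. complex_of_real (inv_likelihood \<omega>) * iexp (W_after t v \<omega>)) =
     complex_of_real (exp (- (\<integral>s. (norm (ind_after t v s))\<^sup>2 \<partial>leb T) / 2)) * sint P A (\<lambda>\<omega>. complex_of_real (inv_likelihood \<omega>))"
proof -
  define Q where "Q j ts \<xi> n \<omega> = (\<integral>\<^sup>+s\<in>{0..T}. ennreal ((simple_value (ts n) (\<xi> n) s \<omega> - drift j s \<omega>)\<^sup>2) \<partial>lborel)"
    for j and ts :: "nat \<Rightarrow> real list" and \<xi> :: "nat \<Rightarrow> nat \<Rightarrow> 'w \<Rightarrow> real" and n \<omega>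
  define SI where "SI j ts \<xi> n \<omega> = simple_integral (ts n) (\<xi> n) (\<lambda>s \<omega>. W s \<omega> $ j) T \<omega>"
    for j and ts :: "nat \<Rightarrow> real list" and \<xi> :: "nat \<Rightarrow> nat \<Rightarrow> 'w \<Rightarrow> real" and n \<omega>
  have TT: "T \<in> {0..T}" using T_pos by simp
  have "\<forall>j. \<exists>ts \<xi>. (\<forall>n. simple_process Fil T (ts n) (\<xi> n)) \<and> tends_in_prob0 P (Q j ts \<xi>) \<and>
      tends_in_prob0 P (\<lambda>n \<omega>. ennreal \<bar>SI j ts \<xi> n \<omega> - J j T \<omega>\<bar>)"
    using ito TT unfolding ito_integral_def Q_def[abs_def] SI_def by blast
  then obtain ts where "\<forall>j. \<exists>\<xi>. (\<forall>n. simple_process Fil T (ts j n) (\<xi> n)) \<and> tends_in_prob0 P (Q j (ts j) \<xi>) \<and>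
      tends_in_prob0 P (\<lambda>n \<omega>. ennreal \<bar>SI j (ts j) \<xi> n \<omega> - J j T \<omega>\<bar>)"
    using choice[of "\<lambda>j ts. \<exists>\<xi>. (\<forall>n. simple_process Fil T (ts n) (\<xi> n)) \<and> tends_in_prob0 P (Q j ts \<xi>) \<and>
      tends_in_prob0 P (\<lambda>n \<omega>. ennreal \<bar>SI j ts \<xi> n \<omega> - J j T \<omega>\<bar>)"] by blast
  from choice[OF this] obtain \<xi> where sp: "\<And>j n. simple_process Fil T (ts j n) (\<xi> j n)"
    and tq: "\<And>j. tends_in_prob0 P (Q j (ts j) (\<xi> j))"
    and ti: "\<And>j. tends_in_prob0 P (\<lambda>n \<omega>. ennreal \<bar>SI j (ts j) (\<xi> j) n \<omega> - J j T \<omega>\<bar>)"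
    by blast
  define D where "D i = (case i of Inl j \<Rightarrow> Q j (ts j) (\<xi> j) | Inr j \<Rightarrow> (\<lambda>n \<omega>. ennreal \<bar>SI j (ts j) (\<xi> j) n \<omega> - J j T \<omega>\<bar>))" for i
  have "tends_in_prob0 P (D i)" for i using tq ti by (cases i) (simp_all add: D_def)
  then obtain r where r: "strict_mono r" and lim: "AE \<omega> in P. \<forall>i\<in>UNIV. (\<lambda>n. D i (r n) \<omega>) \<longlonglongrightarrow> 0"
    using tends_in_prob0_subseq[of UNIV D] finite_code by blast
  define h where "h j n s \<omega> = simple_value (ts j (r n)) (\<xi> j (r n)) s \<omega>" for j n s \<omega>
  define g where "g s = ind_after t v s" for s
  define lD where "lD n \<omega> = (\<Sum>j\<in>UNIV. - (SI j (ts j) (\<xi> j) (r n) \<omega> - (\<integral>s. h j n s \<omega> * drift j s \<omega> \<partial>leb T))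
      - (\<integral>s. (h j n s \<omega>)\<^sup>2 \<partial>leb T) / 2)" for n \<omega>
  define N where "N n \<omega> = W_after t v \<omega> + (\<Sum>j\<in>UNIV. \<integral>s. g s $ j * (h j n s \<omega> - drift j s \<omega>) \<partial>leb T)" for n \<omega>
  have sp': "simple_process Fil T (ts j (r n)) (\<xi> j (r n))" for j n by (rule sp)
  note G = girsanov_simple[where ts = "\<lambda>j. ts j (r n)" and \<xi> = "\<lambda>j. \<xi> j (r n)" for n, OF t A v sp']
  have Gn: "integrable P (\<lambda>\<omega>. exp (lD n \<omega>))" "(\<integral>\<omega>. exp (lD n \<omega>) \<partial>P) = 1" "N n \<in> borel_measurable P"
    "sint P A (\<lambda>\<omega>. complex_of_real (exp (lD n \<omega>)) * iexp (N n \<omega>)) =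
      complex_of_real (exp (- (\<integral>s. (norm (g s))\<^sup>2 \<partial>leb T) / 2)) * sint P A (\<lambda>\<omega>. complex_of_real (exp (lD n \<omega>)))" for n
    unfolding lD_def N_def[abs_def] h_def SI_def g_def by (rule G)+
  have hint: "integrable (leb T) (\<lambda>s. (h j n s \<omega>)\<^sup>2)" "integrable (leb T) (\<lambda>s. h j n s \<omega> * drift j s \<omega>)"
      "integrable (leb T) (\<lambda>s. h j n s \<omega>)" if "\<omega> \<in> space P" for j n \<omega>
    using G(5)[OF that] unfolding h_def by auto
  have gs: "square_integrable (leb T) (\<lambda>s. g s $ j)" for j using G(6) unfolding g_def .
  define q where "q j n \<omega> = (\<integral>s. (h j n s \<omega> - drift j s \<omega>)\<^sup>2 \<partial>leb T)" for j n \<omega>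
  have qQ: "Q j (ts j) (\<xi> j) (r n) \<omega> = ennreal (q j n \<omega>)"
    and qexp: "q j n \<omega> = (\<integral>s. (h j n s \<omega>)\<^sup>2 \<partial>leb T) - 2 * (\<integral>s. h j n s \<omega> * drift j s \<omega> \<partial>leb T) + (\<integral>s. (drift j s \<omega>)\<^sup>2 \<partial>leb T)"
    and hsq: "square_integrable (leb T) (\<lambda>s. h j n s \<omega> - drift j s \<omega>)"
    if \<omega>: "\<omega> \<in> space P" for j n \<omega>
  proof -
    have f2: "integrable (leb T) (\<lambda>s. (drift j s \<omega>)\<^sup>2)" using square_integrable_drift[OF \<omega>, of j] by (simp add: square_integrable_def)
    have e: "(h j n s \<omega> - drift j s \<omega>)\<^sup>2 = (h j n s \<omega>)\<^sup>2 - 2 * (h j n s \<omega> * drift j s \<omega>) + (drift j s \<omega>)\<^sup>2" for s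
      by (simp add: power2_diff)
    have i: "integrable (leb T) (\<lambda>s. (h j n s \<omega> - drift j s \<omega>)\<^sup>2)" unfolding e using hint[OF \<omega>] f2 by simp
    show "q j n \<omega> = (\<integral>s. (h j n s \<omega>)\<^sup>2 \<partial>leb T) - 2 * (\<integral>s. h j n s \<omega> * drift j s \<omega> \<partial>leb T) + (\<integral>s. (drift j s \<omega>)\<^sup>2 \<partial>leb T)"
      unfolding q_def e using hint[OF \<omega>] f2 by simp
    show "square_integrable (leb T) (\<lambda>s. h j n s \<omega> - drift j s \<omega>)"
      using i borel_measurable_integrable[OF hint(3)[OF \<omega>]] borel_measurable_integrable[OF drift_integrable[OF \<omega>]]
      by (simp add: square_integrable_def)
    have "Q j (ts j) (\<xi> j) (r n) \<omega> = (\<integral>\<^sup>+s. ennreal ((h j n s \<omega> - drift j s \<omega>)\<^sup>2) \<partial>leb T)"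
      unfolding Q_def h_def by (subst nn_integral_restrict_space) auto
    also have "\<dots> = ennreal (q j n \<omega>)" unfolding q_def by (rule nn_integral_eq_integral[OF i]) simp
    finally show "Q j (ts j) (\<xi> j) (r n) \<omega> = ennreal (q j n \<omega>)" .
  qed
  have conv: "AE \<omega> in P. (\<lambda>n. lD n \<omega>) \<longlonglongrightarrow> (\<Sum>j\<in>UNIV. (\<integral>s. (drift j s \<omega>)\<^sup>2 \<partial>leb T) / 2 - J j T \<omega>) \<and> (\<lambda>n. N n \<omega>) \<longlonglongrightarrow> W_after t v \<omega>"
    using lim AE_space
  proof eventually_elim
    fix \<omega> assume l: "\<forall>i\<in>UNIV. (\<lambda>n. D i (r n) \<omega>) \<longlonglongrightarrow> 0" and \<omega>: "\<omega> \<in> space P"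
    have q0: "(\<lambda>n. q j n \<omega>) \<longlonglongrightarrow> 0" for j
    proof -
      have "(\<lambda>n. ennreal (q j n \<omega>)) \<longlonglongrightarrow> 0" using l[rule_format, of "Inl j"] by (simp add: D_def qQ[OF \<omega>])
      then show ?thesis by (rule ennreal_tendsto_0_iff[THEN iffD1, rotated]) (simp add: q_def)
    qed
    have s0: "(\<lambda>n. SI j (ts j) (\<xi> j) (r n) \<omega>) \<longlonglongrightarrow> J j T \<omega>" for j
    proof -
      have "(\<lambda>n. ennreal \<bar>SI j (ts j) (\<xi> j) (r n) \<omega> - J j T \<omega>\<bar>) \<longlonglongrightarrow> 0" using l[rule_format, of "Inr j"] by (simp add: D_def)
      then have "(\<lambda>n. \<bar>SI j (ts j) (\<xi> j) (r n) \<omega> - J j T \<omega>\<bar>) \<longlonglongrightarrow> 0"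
        by (rule ennreal_tendsto_0_iff[THEN iffD1, rotated]) simp
      then have "(\<lambda>n. SI j (ts j) (\<xi> j) (r n) \<omega> - J j T \<omega>) \<longlonglongrightarrow> 0" by (rule tendsto_rabs_zero_cancel)
      then show ?thesis by (rule LIM_zero_cancel)
    qed
    \<comment> \<open>Completing the square: the log-density depends on the approximation only through its Ito integral
      and its \<open>L\<^sup>2\<close> distance from the drift.\<close>
    have "lD n \<omega> = (\<Sum>j\<in>UNIV. (\<integral>s. (drift j s \<omega>)\<^sup>2 \<partial>leb T) / 2 - SI j (ts j) (\<xi> j) (r n) \<omega> - q j n \<omega> / 2)" for n
      unfolding lD_def by (intro sum.cong[OF refl]) (simp add: qexp[OF \<omega>] field_simps)
    moreover have "(\<lambda>n. \<Sum>j\<in>UNIV. (\<integral>s. (drift j s \<omega>)\<^sup>2 \<partial>leb T) / 2 - SI j (ts j) (\<xi> j) (r n) \<omega> - q j n \<omega> / 2) \<longlonglongrightarrow>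
        (\<Sum>j\<in>UNIV. (\<integral>s. (drift j s \<omega>)\<^sup>2 \<partial>leb T) / 2 - J j T \<omega> - 0 / 2)"
      by (intro tendsto_sum tendsto_diff tendsto_divide tendsto_const s0 q0) simp_all
    ultimately have 1: "(\<lambda>n. lD n \<omega>) \<longlonglongrightarrow> (\<Sum>j\<in>UNIV. (\<integral>s. (drift j s \<omega>)\<^sup>2 \<partial>leb T) / 2 - J j T \<omega>)" by simp
    have g0: "(\<lambda>n. \<integral>s. g s $ j * (h j n s \<omega> - drift j s \<omega>) \<partial>leb T) \<longlonglongrightarrow> 0" for j
    proof (rule Lim_null_comparison)
      have "norm (\<integral>s. g s $ j * (h j n s \<omega> - drift j s \<omega>) \<partial>leb T) \<le> l2 (leb T) (\<lambda>s. g s $ j) * sqrt (q j n \<omega>)" for n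
        using l2_cauchy_schwarz[OF gs[of j] hsq[OF \<omega>, of j n]] by (simp add: q_def l2_def)
      then show "\<forall>\<^sub>F n in sequentially. norm (\<integral>s. g s $ j * (h j n s \<omega> - drift j s \<omega>) \<partial>leb T) \<le> l2 (leb T) (\<lambda>s. g s $ j) * sqrt (q j n \<omega>)"
        by simp
      have "(\<lambda>n. l2 (leb T) (\<lambda>s. g s $ j) * sqrt (q j n \<omega>)) \<longlonglongrightarrow> l2 (leb T) (\<lambda>s. g s $ j) * sqrt 0"
        by (intro tendsto_mult tendsto_const tendsto_real_sqrt q0)
      then show "(\<lambda>n. l2 (leb T) (\<lambda>s. g s $ j) * sqrt (q j n \<omega>)) \<longlonglongrightarrow> 0" by simp
    qed
    have "(\<lambda>n. N n \<omega>) \<longlonglongrightarrow> W_after t v \<omega> + (\<Sum>j\<in>(UNIV :: 'y set). 0)"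
      unfolding N_def by (rule tendsto_add[OF tendsto_const tendsto_sum[OF g0]])
    with 1 show "(\<lambda>n. lD n \<omega>) \<longlonglongrightarrow> (\<Sum>j\<in>UNIV. (\<integral>s. (drift j s \<omega>)\<^sup>2 \<partial>leb T) / 2 - J j T \<omega>) \<and> (\<lambda>n. N n \<omega>) \<longlonglongrightarrow> W_after t v \<omega>"
      by simp
  qed
  have AM[measurable]: "A \<in> sets P" using A Fil_subalgebra[OF t] by (auto simp: subalgebra_def)
  have Nm[measurable]: "N n \<in> borel_measurable P" for n by (rule Gn(3))
  have Wm[measurable]: "W_after t v \<in> borel_measurable P"
  proof -
    have "(\<lambda>\<omega>. W r \<omega> - W t \<omega>) \<in> borel_measurable P" if "r \<in> {0..T}" for r
      using measurable_from_subalg[OF Fil_subalgebra W_Fil] that t by (intro borel_measurable_diff) auto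
    moreover have "v \<in> steps T" using v t by (force simp: steps_after_def steps_def)
    ultimately show ?thesis unfolding W_after_def[abs_def] by (intro step_apply_measurable[where t = T]) auto
  qed
  define L where "L = inv_likelihood"
  have Lpos: "0 < L \<omega>" for \<omega> by (simp add: L_def inv_likelihood_def)
  have Li: "integrable P L" "(\<integral>\<omega>. L \<omega> \<partial>P) = 1" using mass by (simp_all add: L_def)
  have Llim: "AE \<omega> in P. (\<lambda>n. exp (lD n \<omega>)) \<longlonglongrightarrow> L \<omega>"
    using conv unfolding L_def inv_likelihood_def by eventually_elim (intro tendsto_intros, simp)
  have L1: "(\<lambda>n. \<integral>\<^sup>+\<omega>. norm (exp (lD n \<omega>) - L \<omega>) \<partial>P) \<longlonglongrightarrow> 0"
  proof (rule Scheffe_lemma2[OF _ Li(1) Llim])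
    show "(\<lambda>\<omega>. exp (lD n \<omega>)) \<in> borel_measurable P" for n using Gn(1) by simp
    have "(\<integral>\<^sup>+\<omega>. norm (exp (lD n \<omega>)) \<partial>P) = 1" for n
      using nn_integral_eq_integral[OF Gn(1)[of n]] Gn(2)[of n] by simp
    moreover have "(\<integral>\<^sup>+\<omega>. norm (L \<omega>) \<partial>P) = 1"
    proof -
      have "(\<integral>\<^sup>+\<omega>. norm (L \<omega>) \<partial>P) = (\<integral>\<^sup>+\<omega>. L \<omega> \<partial>P)" using Lpos by (intro nn_integral_cong) (simp add: less_imp_le)
      also have "\<dots> = ennreal (\<integral>\<omega>. L \<omega> \<partial>P)" using Lpos by (intro nn_integral_eq_integral[OF Li(1)]) (simp add: less_imp_le)
      finally show ?thesis using Li(2) by simp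
    qed
    ultimately show "(\<integral>\<^sup>+\<omega>. norm (exp (lD n \<omega>)) \<partial>P) \<le> (\<integral>\<^sup>+\<omega>. norm (L \<omega>) \<partial>P)" for n by simp
  qed
  have di: "integrable P (\<lambda>\<omega>. \<bar>exp (lD n \<omega>) - L \<omega>\<bar>)" for n using Gn(1)[of n] Li(1) by simp
  have L1': "(\<lambda>n. \<integral>\<omega>. \<bar>exp (lD n \<omega>) - L \<omega>\<bar> \<partial>P) \<longlonglongrightarrow> 0"
  proof -
    have "(\<integral>\<^sup>+\<omega>. norm (exp (lD n \<omega>) - L \<omega>) \<partial>P) = ennreal (\<integral>\<omega>. \<bar>exp (lD n \<omega>) - L \<omega>\<bar> \<partial>P)" for n
      using nn_integral_eq_integral[OF di[of n]] by simp
    then show ?thesis using L1 by (simp add: ennreal_tendsto_0_iff)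
  qed
  have key: "(\<lambda>n. sint P A (\<lambda>\<omega>. complex_of_real (exp (lD n \<omega>)) * iexp (M n \<omega>))) \<longlonglongrightarrow> sint P A (\<lambda>\<omega>. complex_of_real (L \<omega>) * iexp (M' \<omega>))"
    if M: "\<And>n. M n \<in> borel_measurable P" "M' \<in> borel_measurable P" "AE \<omega> in P. (\<lambda>n. M n \<omega>) \<longlonglongrightarrow> M' \<omega>" for M M'
  proof -
    note [measurable] = M(1,2)
    have i1: "integrable P (\<lambda>\<omega>. indicat_real A \<omega> *\<^sub>R (complex_of_real (exp (lD n \<omega>)) * iexp (M k \<omega>)))" for n k
      using Gn(1)[of n] by (intro integrable_indicator_scale integrable_unimodular AM) simp_all
    have i2: "integrable P (\<lambda>\<omega>. indicat_real A \<omega> *\<^sub>R (complex_of_real (L \<omega>) * iexp (M k \<omega>)))" for k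
      using Li(1) by (intro integrable_indicator_scale integrable_unimodular AM) simp_all
    have a: "(\<lambda>n. sint P A (\<lambda>\<omega>. complex_of_real (L \<omega>) * iexp (M n \<omega>))) \<longlonglongrightarrow> sint P A (\<lambda>\<omega>. complex_of_real (L \<omega>) * iexp (M' \<omega>))"
    proof (rule integral_dominated_convergence[where w = L])
      have [measurable]: "L \<in> borel_measurable P" using Li(1) by simp
      show "(\<lambda>\<omega>. indicat_real A \<omega> *\<^sub>R (complex_of_real (L \<omega>) * iexp (M' \<omega>))) \<in> borel_measurable P" by measurable
      show "(\<lambda>\<omega>. indicat_real A \<omega> *\<^sub>R (complex_of_real (L \<omega>) * iexp (M n \<omega>))) \<in> borel_measurable P" for n by measurable
      show "AE \<omega> in P. (\<lambda>n. indicat_real A \<omega> *\<^sub>R (complex_of_real (L \<omega>) * iexp (M n \<omega>))) \<longlonglongrightarrow> indicat_real A \<omega> *\<^sub>R (complex_of_real (L \<omega>) * iexp (M' \<omega>))"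
        using M(3) by eventually_elim (intro tendsto_intros)
      show "AE \<omega> in P. norm (indicat_real A \<omega> *\<^sub>R (complex_of_real (L \<omega>) * iexp (M n \<omega>))) \<le> L \<omega>" for n
        using Lpos by (simp add: norm_mult indicator_def less_imp_le)
    qed (rule Li(1))
    have b: "(\<lambda>n. sint P A (\<lambda>\<omega>. complex_of_real (exp (lD n \<omega>)) * iexp (M n \<omega>)) - sint P A (\<lambda>\<omega>. complex_of_real (L \<omega>) * iexp (M n \<omega>))) \<longlonglongrightarrow> 0"
    proof (rule Lim_null_comparison[OF always_eventually L1'], rule allI)
      fix n
      have "sint P A (\<lambda>\<omega>. complex_of_real (exp (lD n \<omega>)) * iexp (M n \<omega>)) - sint P A (\<lambda>\<omega>. complex_of_real (L \<omega>) * iexp (M n \<omega>)) =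
         (\<integral>\<omega>. indicat_real A \<omega> *\<^sub>R (complex_of_real (exp (lD n \<omega>)) * iexp (M n \<omega>)) - indicat_real A \<omega> *\<^sub>R (complex_of_real (L \<omega>) * iexp (M n \<omega>)) \<partial>P)"
        by (rule Bochner_Integration.integral_diff[OF i1 i2, symmetric])
      also have "norm \<dots> \<le> (\<integral>\<omega>. norm (indicat_real A \<omega> *\<^sub>R (complex_of_real (exp (lD n \<omega>)) * iexp (M n \<omega>)) - indicat_real A \<omega> *\<^sub>R (complex_of_real (L \<omega>) * iexp (M n \<omega>))) \<partial>P)"
        by (rule integral_norm_bound)
      also have "\<dots> \<le> (\<integral>\<omega>. \<bar>exp (lD n \<omega>) - L \<omega>\<bar> \<partial>P)"
      proof (rule integral_mono[OF _ di])
        show "integrable P (\<lambda>\<omega>. norm (indicat_real A \<omega> *\<^sub>R (complex_of_real (exp (lD n \<omega>)) * iexp (M n \<omega>)) - indicat_real A \<omega> *\<^sub>R (complex_of_real (L \<omega>) * iexp (M n \<omega>))))"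
          using i1 i2 by (intro integrable_norm Bochner_Integration.integrable_diff)
        fix \<omega>
        have "indicat_real A \<omega> *\<^sub>R (complex_of_real (exp (lD n \<omega>)) * iexp (M n \<omega>)) - indicat_real A \<omega> *\<^sub>R (complex_of_real (L \<omega>) * iexp (M n \<omega>)) =
            indicat_real A \<omega> *\<^sub>R (complex_of_real (exp (lD n \<omega>) - L \<omega>) * iexp (M n \<omega>))"
          by (simp only: scaleR_diff_right[symmetric] left_diff_distrib[symmetric] of_real_diff[symmetric])
        also have "norm \<dots> \<le> \<bar>exp (lD n \<omega>) - L \<omega>\<bar>"
          unfolding norm_scaleR norm_mult norm_of_real by (simp add: indicator_def)
        finally show "norm (indicat_real A \<omega> *\<^sub>R (complex_of_real (exp (lD n \<omega>)) * iexp (M n \<omega>)) - indicat_real A \<omega> *\<^sub>R (complex_of_real (L \<omega>) * iexp (M n \<omega>))) \<le> \<bar>exp (lD n \<omega>) - L \<omega>\<bar>" .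
      qed
      finally show "norm (sint P A (\<lambda>\<omega>. complex_of_real (exp (lD n \<omega>)) * iexp (M n \<omega>)) - sint P A (\<lambda>\<omega>. complex_of_real (L \<omega>) * iexp (M n \<omega>))) \<le> (\<integral>\<omega>. \<bar>exp (lD n \<omega>) - L \<omega>\<bar> \<partial>P)" .
    qed
    show ?thesis using tendsto_add[OF b a] by simp
  qed
  have Nl: "AE \<omega> in P. (\<lambda>n. N n \<omega>) \<longlonglongrightarrow> W_after t v \<omega>" using conv by eventually_elim simp
  have k1: "(\<lambda>n. sint P A (\<lambda>\<omega>. complex_of_real (exp (lD n \<omega>)) * iexp (N n \<omega>))) \<longlonglongrightarrow> sint P A (\<lambda>\<omega>. complex_of_real (L \<omega>) * iexp (W_after t v \<omega>))"
    by (rule key[OF Nm Wm Nl])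
  have "(\<lambda>n. sint P A (\<lambda>\<omega>. complex_of_real (exp (lD n \<omega>)))) \<longlonglongrightarrow> sint P A (\<lambda>\<omega>. complex_of_real (L \<omega>))"
    using key[of "\<lambda>_ _. 0" "\<lambda>_. 0"] by simp
  then have "(\<lambda>n. complex_of_real (exp (- (\<integral>s. (norm (g s))\<^sup>2 \<partial>leb T) / 2)) * sint P A (\<lambda>\<omega>. complex_of_real (exp (lD n \<omega>)))) \<longlonglongrightarrow>
     complex_of_real (exp (- (\<integral>s. (norm (g s))\<^sup>2 \<partial>leb T) / 2)) * sint P A (\<lambda>\<omega>. complex_of_real (L \<omega>))"
    by (rule tendsto_mult_left)
  then show ?thesis using LIMSEQ_unique[OF k1] unfolding Gn(4) g_def L_def by blast
qed

end

section \<open>The reference measure\<close>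

lemma null_sets_equivalent:
  assumes "sets Q = sets P" "absolutely_continuous P Q" "absolutely_continuous Q P"
  shows "null_sets Q = null_sets P"
  using assms by (auto simp: absolutely_continuous_def)

locale reference_measure = filtering P T K B U x0 VU X Y f J
  for P :: "'w measure" and T and K :: "real \<Rightarrow> real \<Rightarrow> real" and B :: "real \<Rightarrow> 'w \<Rightarrow> real^'b::finite"
    and U :: "real \<Rightarrow> 'w \<Rightarrow> real^'y::finite" and x0 :: "'w \<Rightarrow> real^'x::finite"
    and VU :: "real \<Rightarrow> 'w \<Rightarrow> real^'y" and X :: "real \<Rightarrow> 'w \<Rightarrow> real^'x" and Y :: "real \<Rightarrow> 'w \<Rightarrow> real^'y"
    and f :: "(real^'x) \<times> (real^'y) \<Rightarrow> real^'y" and J :: "'y \<Rightarrow> real \<Rightarrow> 'w \<Rightarrow> real" +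
  fixes Q :: "'w measure"
  assumes Q_prob: "prob_space Q" and sets_Q: "sets Q = sets P" and null_Q: "null_sets Q = null_sets P"
    and density_Q: "\<And>s. s \<in> {0..T} \<Longrightarrow>
       density (restr_to_subalg Q (Fil s)) (\<lambda>\<omega>. ennreal (likelihood f X Y J s \<omega>)) = restr_to_subalg P (Fil s)"
begin

sublocale Q: prob_space Q by (rule Q_prob)

abbreviation Lik :: "real \<Rightarrow> 'w \<Rightarrow> real" where "Lik \<equiv> likelihood f X Y J"

lemma space_Q: "space Q = space P"
  by (rule sets_eq_imp_space_eq[OF sets_Q])

lemma measurable_Q: "measurable Q N = measurable P N"
  by (rule measurable_cong_sets[OF sets_Q refl])

lemma Fil_subalgebra_Q: "s \<in> {0..T} \<Longrightarrow> subalgebra Q (Fil s)"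
  using Fil_subalgebra[of s] by (simp add: subalgebra_def sets_Q space_Q)

lemma AE_Q: "(AE \<omega> in P. R \<omega>) \<Longrightarrow> (AE \<omega> in Q. R \<omega>)"
  unfolding eventually_ae_filter null_Q space_Q .

lemma Lik_pos: "0 < Lik s \<omega>"
  by (simp add: likelihood_def)

lemma Lik_Fil:
  assumes s: "s \<in> {0..T}" shows "Lik s \<in> borel_measurable (Fil s)"
proof -
  have J: "J j s \<in> borel_measurable (Fil s)" for j using ito[of j] s by (simp add: ito_integral_def)
  have "(\<lambda>\<omega>. \<integral>u. (drift j u \<omega>)\<^sup>2 \<partial>leb s) \<in> borel_measurable (Fil s)" for j
  proof (rule path_integral_measurable)
    show "0 \<le> s" using s by simp
    fix u assume u: "u \<in> {0..s}"
    then have "u \<in> {0..T}" "u \<le> s" using s by auto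
    then have "(\<lambda>\<omega>. drift j u \<omega>) \<in> borel_measurable (Fil s)"
      by (intro measurable_component measurable_from_subalg[OF Fil_Fil[OF _ s] path_Fil])
    then show "(\<lambda>\<omega>. (drift j u \<omega>)\<^sup>2) \<in> borel_measurable (Fil s)" by (rule borel_measurable_power)
  next
    fix \<omega> assume "\<omega> \<in> space (Fil s)"
    then have "\<omega> \<in> space P" using space_Fil[OF s] by simp
    then show "continuous_on {0..s} (\<lambda>u. (drift j u \<omega>)\<^sup>2)"
      using s by (intro continuous_intros continuous_on_subset[OF path_cont]) auto
  qed
  then have "(\<lambda>\<omega>. exp ((\<Sum>j\<in>UNIV. J j s \<omega>) - 1 / 2 * (\<Sum>j\<in>UNIV. \<integral>u. (drift j u \<omega>)\<^sup>2 \<partial>leb s))) \<in> borel_measurable (Fil s)"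
    using J by measurable
  then show ?thesis by (simp add: likelihood_def[abs_def] set_lebesgue_integral_def integral_leb)
qed

lemma change_of_measure:
  fixes g :: "'w \<Rightarrow> 'c::{banach, second_countable_topology}"
  assumes s: "s \<in> {0..T}" and g: "g \<in> borel_measurable (Fil s)"
  shows "integrable P g \<longleftrightarrow> integrable Q (\<lambda>\<omega>. Lik s \<omega> *\<^sub>R g \<omega>)" and "(\<integral>\<omega>. g \<omega> \<partial>P) = (\<integral>\<omega>. Lik s \<omega> *\<^sub>R g \<omega> \<partial>Q)"
proof -
  note sP = Fil_subalgebra[OF s] and sQ = Fil_subalgebra_Q[OF s]
  have m: "g \<in> borel_measurable (restr_to_subalg Q (Fil s))" "Lik s \<in> borel_measurable (restr_to_subalg Q (Fil s))"
    using g Lik_Fil[OF s] by (auto intro: measurable_in_subalg[OF sQ])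
  have nn: "AE \<omega> in restr_to_subalg Q (Fil s). 0 \<le> Lik s \<omega>" using Lik_pos by (simp add: less_imp_le)
  have Lg: "(\<lambda>\<omega>. Lik s \<omega> *\<^sub>R g \<omega>) \<in> borel_measurable (Fil s)" using g Lik_Fil[OF s] by measurable
  have "integrable P g \<longleftrightarrow> integrable (restr_to_subalg P (Fil s)) g"
    using integrable_from_subalg[OF sP] integrable_in_subalg[OF sP g] by blast
  also have "\<dots> \<longleftrightarrow> integrable (restr_to_subalg Q (Fil s)) (\<lambda>\<omega>. Lik s \<omega> *\<^sub>R g \<omega>)"
    unfolding density_Q[OF s, symmetric] by (rule integrable_density[OF m nn])
  also have "\<dots> \<longleftrightarrow> integrable Q (\<lambda>\<omega>. Lik s \<omega> *\<^sub>R g \<omega>)"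
    using integrable_from_subalg[OF sQ] integrable_in_subalg[OF sQ Lg] by blast
  finally show "integrable P g \<longleftrightarrow> integrable Q (\<lambda>\<omega>. Lik s \<omega> *\<^sub>R g \<omega>)" .
  have "(\<integral>\<omega>. g \<omega> \<partial>P) = (\<integral>\<omega>. g \<omega> \<partial>restr_to_subalg P (Fil s))" by (rule integral_subalgebra2[OF sP g, symmetric])
  also have "\<dots> = (\<integral>\<omega>. Lik s \<omega> *\<^sub>R g \<omega> \<partial>restr_to_subalg Q (Fil s))"
    unfolding density_Q[OF s, symmetric] by (rule integral_density[OF m nn])
  also have "\<dots> = (\<integral>\<omega>. Lik s \<omega> *\<^sub>R g \<omega> \<partial>Q)" by (rule integral_subalgebra2[OF sQ Lg])
  finally show "(\<integral>\<omega>. g \<omega> \<partial>P) = (\<integral>\<omega>. Lik s \<omega> *\<^sub>R g \<omega> \<partial>Q)" .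
qed

lemma T_in: "T \<in> {0..T}" using T_pos by simp

lemma inv_likelihood_eq: "inv_likelihood \<omega> = 1 / Lik T \<omega>"
proof -
  have "(\<Sum>j\<in>UNIV. (\<integral>s. (drift j s \<omega>)\<^sup>2 \<partial>leb T) / 2 - J j T \<omega>) =
      - ((\<Sum>j\<in>UNIV. J j T \<omega>) - 1 / 2 * (\<Sum>j\<in>UNIV. \<integral>s. (drift j s \<omega>)\<^sup>2 \<partial>leb T))"
    by (simp add: sum_subtractf sum_divide_distrib)
  then have "inv_likelihood \<omega> = exp (- ((\<Sum>j\<in>UNIV. J j T \<omega>) - 1 / 2 * (\<Sum>j\<in>UNIV. \<integral>s. (drift j s \<omega>)\<^sup>2 \<partial>leb T)))"
    by (simp only: inv_likelihood_def)
  also have "(\<Sum>j\<in>UNIV. J j T \<omega>) - 1 / 2 * (\<Sum>j\<in>UNIV. \<integral>s. (drift j s \<omega>)\<^sup>2 \<partial>leb T) = ln (Lik T \<omega>)"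
    by (simp add: likelihood_def set_lebesgue_integral_def integral_leb)
  finally show ?thesis using Lik_pos[of T \<omega>] by (simp only: exp_minus exp_ln inverse_eq_divide)
qed

lemma inv_likelihood_Fil: "inv_likelihood \<in> borel_measurable (Fil T)"
  unfolding inv_likelihood_eq[abs_def] using Lik_Fil[OF T_in] by measurable

text \<open>The inverse likelihood has mass one because it is the density of a probability measure.\<close>

lemma inv_likelihood_mass: "integrable P inv_likelihood" "(\<integral>\<omega>. inv_likelihood \<omega> \<partial>P) = 1"
proof -
  have 1: "Lik T \<omega> *\<^sub>R inv_likelihood \<omega> = 1" for \<omega> using Lik_pos[of T \<omega>] by (simp add: inv_likelihood_eq)
  show "integrable P inv_likelihood" unfolding change_of_measure(1)[OF T_in inv_likelihood_Fil] 1 by simp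
  show "(\<integral>\<omega>. inv_likelihood \<omega> \<partial>P) = 1" unfolding change_of_measure(2)[OF T_in inv_likelihood_Fil] 1
    by (simp add: Q.prob_space)
qed

lemma W_after_Fil:
  assumes t: "t \<in> {0..T}" and v: "v \<in> steps_after t" shows "W_after t v \<in> borel_measurable (Fil T)"
proof -
  have W: "W r \<in> borel_measurable (Fil T)" if "r \<in> {0..T}" for r
    using that by (intro measurable_from_subalg[OF Fil_Fil[OF that T_in] W_Fil]) auto
  have "(\<lambda>\<omega>. W r \<omega> - W t \<omega>) \<in> borel_measurable (Fil T)" if "r \<in> {0..T}" for r
    using W that t by (intro borel_measurable_diff)
  moreover have "v \<in> steps T" using v t by (force simp: steps_after_def steps_def)
  ultimately show ?thesis unfolding W_after_def[abs_def] by (intro step_apply_measurable[where t = T]) auto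
qed

text \<open>Under the reference measure the increments of \<open>W\<close> after \<open>t\<close> are Gaussian and independent of the
  past of the driving noise.\<close>

lemma girsanov_Q:
  assumes t: "t \<in> {0..T}" and A: "A \<in> sets (Fil t)" and v: "v \<in> steps_after t"
  shows "sint Q A (\<lambda>\<omega>. iexp (W_after t v \<omega>)) = complex_of_real (exp (- (\<integral>s. (norm (ind_after t v s))\<^sup>2 \<partial>leb T) / 2)) * Q.prob A"
proof -
  have AT: "A \<in> sets (Fil T)" using A Fil_mono[OF t T_in] t by auto
  have AQ: "A \<in> sets Q" using AT Fil_subalgebra_Q[OF T_in] by (auto simp: subalgebra_def)
  have L: "sint P A (\<lambda>\<omega>. complex_of_real (inv_likelihood \<omega>) * g \<omega>) = sint Q A g" if g: "g \<in> borel_measurable (Fil T)" for g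
  proof -
    have i: "indicat_real A \<in> borel_measurable (Fil T)" using AT by simp
    have "(\<lambda>\<omega>. indicat_real A \<omega> *\<^sub>R (complex_of_real (inv_likelihood \<omega>) * g \<omega>)) \<in> borel_measurable (Fil T)"
      using i g inv_likelihood_Fil by measurable
    then have "sint P A (\<lambda>\<omega>. complex_of_real (inv_likelihood \<omega>) * g \<omega>) =
       (\<integral>\<omega>. Lik T \<omega> *\<^sub>R (indicat_real A \<omega> *\<^sub>R (complex_of_real (inv_likelihood \<omega>) * g \<omega>)) \<partial>Q)"
      by (rule change_of_measure(2)[OF T_in])
    also have "\<dots> = sint Q A g"
      using Lik_pos by (intro Bochner_Integration.integral_cong) (auto simp: inv_likelihood_eq scaleR_conv_of_real less_imp_neq[THEN not_sym])
    finally show ?thesis .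
  qed
  have "(\<lambda>\<omega>. iexp (W_after t v \<omega>)) \<in> borel_measurable (Fil T)" using W_after_Fil[OF t v] by measurable
  from L[OF this] have 1: "sint P A (\<lambda>\<omega>. complex_of_real (inv_likelihood \<omega>) * iexp (W_after t v \<omega>)) = sint Q A (\<lambda>\<omega>. iexp (W_after t v \<omega>))" .
  have "sint P A (\<lambda>\<omega>. complex_of_real (inv_likelihood \<omega>)) = sint Q A (\<lambda>\<omega>. 1)"
    using L[of "\<lambda>_. 1"] by simp
  also have "\<dots> = Q.prob A" using AQ by (simp add: scaleR_conv_of_real)
  finally show ?thesis using girsanov[OF t A v inv_likelihood_mass] 1 by simp
qed

section \<open>Functionals of the observation\<close>

text \<open>\<open>obs g S\<close> says that \<open>S\<close> is the integral of \<open>g\<close> against \<open>W\<close>. The martingale part is a Wiener integral under \<open>P\<close>,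
  the drift is integrated pathwise, so the relation can be handled without stochastic integration under
  the reference measure.\<close>

definition obs :: "(real \<Rightarrow> real^'y) \<Rightarrow> ('w \<Rightarrow> real) \<Rightarrow> bool" where
  "obs g S \<longleftrightarrow> S \<in> borel_measurable P \<and>
     (\<exists>Z. U.wiener g Z \<and> (AE \<omega> in P. S \<omega> = Z \<omega> + (\<integral>s. g s \<bullet> f (X s \<omega>, Y s \<omega>) \<partial>leb T)))"

lemma square_integrable_path:
  assumes "\<omega> \<in> space P" shows "square_integrable (leb T) (\<lambda>s. f (X s \<omega>, Y s \<omega>))"
proof -
  have "integrable (leb T) (\<lambda>s. (norm (f (X s \<omega>, Y s \<omega>)))\<^sup>2)"
    by (rule cont_integrable) (intro continuous_intros path_cont assms)
  then show ?thesis using cont_integrable[OF path_cont[OF assms]] by (simp add: square_integrable_def)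
qed

lemma obs_lincomb:
  assumes "obs g S" "obs h R"
  shows "obs (\<lambda>r. x *\<^sub>R g r + y *\<^sub>R h r) (\<lambda>\<omega>. x * S \<omega> + y * R \<omega>)"
proof -
  obtain Z where Z: "U.wiener g Z" "AE \<omega> in P. S \<omega> = Z \<omega> + (\<integral>s. g s \<bullet> f (X s \<omega>, Y s \<omega>) \<partial>leb T)"
    and S: "S \<in> borel_measurable P" using assms(1) unfolding obs_def by blast
  obtain V where V: "U.wiener h V" "AE \<omega> in P. R \<omega> = V \<omega> + (\<integral>s. h s \<bullet> f (X s \<omega>, Y s \<omega>) \<partial>leb T)"
    and R: "R \<in> borel_measurable P" using assms(2) unfolding obs_def by blast
  have "AE \<omega> in P. x * S \<omega> + y * R \<omega> = (x * Z \<omega> + y * V \<omega>) + (\<integral>s. (x *\<^sub>R g s + y *\<^sub>R h s) \<bullet> f (X s \<omega>, Y s \<omega>) \<partial>leb T)"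
    using Z(2) V(2) AE_space
  proof eventually_elim
    fix \<omega> assume e: "S \<omega> = Z \<omega> + (\<integral>s. g s \<bullet> f (X s \<omega>, Y s \<omega>) \<partial>leb T)" "R \<omega> = V \<omega> + (\<integral>s. h s \<bullet> f (X s \<omega>, Y s \<omega>) \<partial>leb T)"
      and \<omega>: "\<omega> \<in> space P"
    have i: "integrable (leb T) (\<lambda>s. g s \<bullet> f (X s \<omega>, Y s \<omega>))" "integrable (leb T) (\<lambda>s. h s \<bullet> f (X s \<omega>, Y s \<omega>))"
      by (rule sqi_inner[OF U.wiener_sqi(1)[OF Z(1)] square_integrable_path[OF \<omega>]],
          rule sqi_inner[OF U.wiener_sqi(1)[OF V(1)] square_integrable_path[OF \<omega>]])
    show "x * S \<omega> + y * R \<omega> = (x * Z \<omega> + y * V \<omega>) + (\<integral>s. (x *\<^sub>R g s + y *\<^sub>R h s) \<bullet> f (X s \<omega>, Y s \<omega>) \<partial>leb T)"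
      using i by (simp add: e inner_add_left algebra_simps)
  qed
  moreover have "(\<lambda>\<omega>. x * S \<omega> + y * R \<omega>) \<in> borel_measurable P" using S R by simp
  ultimately show ?thesis unfolding obs_def using U.wiener_lincomb[OF Z(1) V(1), of x y] by blast
qed

lemma obs_zero: "obs (\<lambda>r. 0) (\<lambda>\<omega>. 0)"
  unfolding obs_def using U.wiener_zero by (intro conjI exI[of _ "\<lambda>\<omega>. 0"]) auto

lemma obs_lin:
  assumes "\<And>x. x \<in> Poly_Mapping.keys a \<Longrightarrow> obs (\<phi> x) (\<Phi> x)"
  shows "obs (\<lambda>r. lin (\<lambda>x. \<phi> x r) a) (\<lambda>\<omega>. lin (\<lambda>x. \<Phi> x \<omega>) a)"
proof -
  have "obs (\<lambda>r. \<Sum>x\<in>A. Poly_Mapping.lookup a x *\<^sub>R \<phi> x r) (\<lambda>\<omega>. \<Sum>x\<in>A. Poly_Mapping.lookup a x * \<Phi> x \<omega>)"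
    if "A \<subseteq> Poly_Mapping.keys a" for A
    using finite_subset[OF that finite_keys] that
  proof (induction A rule: finite_induct)
    case empty then show ?case using obs_zero by simp
  next
    case (insert x A)
    have "obs (\<lambda>r. Poly_Mapping.lookup a x *\<^sub>R \<phi> x r + 1 *\<^sub>R (\<Sum>x\<in>A. Poly_Mapping.lookup a x *\<^sub>R \<phi> x r))
       (\<lambda>\<omega>. Poly_Mapping.lookup a x * \<Phi> x \<omega> + 1 * (\<Sum>x\<in>A. Poly_Mapping.lookup a x * \<Phi> x \<omega>))"
      using insert assms by (intro obs_lincomb) auto
    then show ?case using insert.hyps by simp
  qed
  from this[OF order_refl] show ?thesis by (simp add: lin_def)
qed

lemma Y_measurable: "s \<in> {0..T} \<Longrightarrow> Y s \<in> borel_measurable P"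
  by (rule measurable_from_subalg[OF Fil_subalgebra Y_Fil])

text \<open>The Volterra drift in the equation for \<open>Y\<close> is the pathwise integral of the kernel against the drift of \<open>W\<close>.\<close>

lemma obs_Y:
  assumes t: "t \<in> {0..T}" shows "obs (\<lambda>r. K t r *\<^sub>R axis k 1) (\<lambda>\<omega>. Y t \<omega> $ k)"
proof -
  have "AE \<omega> in P. Y t \<omega> $ k = U t \<omega> $ k + (\<integral>s. (K t s *\<^sub>R axis k 1) \<bullet> f (X s \<omega>, Y s \<omega>) \<partial>leb T)"
    using signal AE_space
  proof eventually_elim
    fix \<omega> assume e: "\<forall>t\<in>{0..T}. Y t \<omega> = volterra_op K (\<lambda>s. f (X s \<omega>, Y s \<omega>)) t + U t \<omega>" and \<omega>: "\<omega> \<in> space P"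
    have sq: "square_integrable (leb T) (\<lambda>s. f (X s \<omega>, Y s \<omega>))" by (rule square_integrable_path[OF \<omega>])
    have i: "integrable (leb T) (\<lambda>s. K t s *\<^sub>R f (X s \<omega>, Y s \<omega>))"
    proof (rule Bochner_Integration.integrable_bound)
      have "square_integrable (leb T) (\<lambda>s. norm (f (X s \<omega>, Y s \<omega>)))" "square_integrable (leb T) (\<lambda>s. \<bar>K t s\<bar>)"
        using sq joint.kernel_sqi[OF t] measurable_compose[OF sqi_measurable[OF sq] borel_measurable_norm]
          measurable_compose[OF sqi_measurable[OF joint.kernel_sqi[OF t]] borel_measurable_norm]
        by (simp_all add: square_integrable_def)
      from sqi_inner[OF this(2,1)] show "integrable (leb T) (\<lambda>s. \<bar>K t s\<bar> * norm (f (X s \<omega>, Y s \<omega>)))" by simp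
      show "(\<lambda>s. K t s *\<^sub>R f (X s \<omega>, Y s \<omega>)) \<in> borel_measurable (leb T)"
        using sq joint.kernel_sqi[OF t] by (intro borel_measurable_scaleR) (simp_all add: square_integrable_def)
    qed simp
    have "volterra_op K (\<lambda>s. f (X s \<omega>, Y s \<omega>)) t = (\<integral>s. K t s *\<^sub>R f (X s \<omega>, Y s \<omega>) \<partial>leb T)"
      unfolding volterra_op_def set_lebesgue_integral_def integral_leb
    proof (rule Bochner_Integration.integral_cong[OF refl])
      fix s
      show "indicat_real {0..t} s *\<^sub>R K t s *\<^sub>R f (X s \<omega>, Y s \<omega>) = indicat_real {0..T} s *\<^sub>R K t s *\<^sub>R f (X s \<omega>, Y s \<omega>)"
        using kernel_zero[OF t, of s] t by (cases "s \<in> {0..T}"; cases "s \<le> t") (auto simp: indicator_def)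
    qed
    then have "volterra_op K (\<lambda>s. f (X s \<omega>, Y s \<omega>)) t $ k = (\<integral>s. K t s *\<^sub>R f (X s \<omega>, Y s \<omega>) \<partial>leb T) \<bullet> axis k 1"
      by (simp add: inner_axis)
    also have "\<dots> = (\<integral>s. (K t s *\<^sub>R f (X s \<omega>, Y s \<omega>)) \<bullet> axis k 1 \<partial>leb T)"
      by (rule integral_inner_left[symmetric]) (rule i)
    also have "\<dots> = (\<integral>s. (K t s *\<^sub>R axis k 1) \<bullet> f (X s \<omega>, Y s \<omega>) \<partial>leb T)" by (simp add: inner_commute)
    finally show "Y t \<omega> $ k = U t \<omega> $ k + (\<integral>s. (K t s *\<^sub>R axis k 1) \<bullet> f (X s \<omega>, Y s \<omega>) \<partial>leb T)"
      using e t by simp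
  qed
  then show ?thesis unfolding obs_def
    using U.wiener_process[OF t, of k] measurable_component[OF Y_measurable[OF t], of k] by blast
qed

lemma obs_step:
  assumes "a \<in> steps T" shows "obs (Kstar_step K a) (step_apply Y a)"
proof -
  have "obs (\<lambda>r. lin (\<lambda>x. K (snd x) r *\<^sub>R axis (fst x) 1) a) (\<lambda>\<omega>. lin (\<lambda>x. Y (snd x) \<omega> $ fst x) a)"
    by (rule obs_lin) (rule obs_Y[OF keys_time[OF assms]])
  then show ?thesis by (simp add: Kstar_step_lin[abs_def] step_apply_lin[abs_def] case_prod_unfold)
qed

lemma W_measurable: "r \<in> {0..T} \<Longrightarrow> W r \<in> borel_measurable P"
  by (rule measurable_from_subalg[OF Fil_subalgebra W_Fil])

lemma obs_W:
  assumes r: "r \<in> {0..T}" shows "obs (ind_upto k r) (\<lambda>\<omega>. W r \<omega> $ k)"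
proof -
  have "AE \<omega> in P. W r \<omega> $ k = VU r \<omega> $ k + (\<integral>s. ind_upto k r s \<bullet> f (X s \<omega>, Y s \<omega>) \<partial>leb T)"
  proof (rule AE_I2)
    fix \<omega> assume \<omega>: "\<omega> \<in> space P"
    have "ind_upto k r s \<bullet> f (X s \<omega>, Y s \<omega>) = indicat_real {0..r} s * drift k s \<omega>" for s
      by (simp add: ind_upto_def inner_axis')
    then show "W r \<omega> $ k = VU r \<omega> $ k + (\<integral>s. ind_upto k r s \<bullet> f (X s \<omega>, Y s \<omega>) \<partial>leb T)"
      using W_component[OF \<omega> r, of k] leb_restrict[OF r, of "\<lambda>s. drift k s \<omega>"] by simp
  qed
  then show ?thesis unfolding obs_def
    using wiener_VU[OF r, of k] measurable_component[OF W_measurable[OF r], of k] by blast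
qed

lemma obs_after:
  assumes t: "t \<in> {0..T}" and v: "v \<in> steps_after t"
  shows "obs (ind_after t v) (W_after t v)"
proof -
  have "obs (\<lambda>r. lin (\<lambda>x. ind_upto (fst x) (snd x) r - ind_upto (fst x) t r) v) (\<lambda>\<omega>. lin (\<lambda>x. W (snd x) \<omega> $ fst x - W t \<omega> $ fst x) v)"
  proof (rule obs_lin)
    fix x assume "x \<in> Poly_Mapping.keys v"
    then have "snd x \<in> {0..T}" using v t by (auto simp: steps_after_def)
    from obs_lincomb[OF obs_W[OF this, of "fst x"] obs_W[OF t, of "fst x"], of 1 "-1"]
    show "obs (\<lambda>r. ind_upto (fst x) (snd x) r - ind_upto (fst x) t r) (\<lambda>\<omega>. W (snd x) \<omega> $ fst x - W t \<omega> $ fst x)" by simp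
  qed
  then show ?thesis by (simp add: ind_after_def[abs_def] W_after_def[abs_def] step_apply_lin case_prod_unfold)
qed

text \<open>Since the drift is bounded, integration against \<open>W\<close> is continuous from \<open>L\<^sup>2\<close> into \<open>L\<^sup>1\<close>.\<close>

lemma obs_L1:
  obtains C where "\<And>g S. obs g S \<Longrightarrow> integrable P S \<and> (\<integral>\<omega>. \<bar>S \<omega>\<bar> \<partial>P) \<le> C * l2 (leb T) g"
proof -
  obtain Mf where "\<forall>y\<in>range f. norm y \<le> Mf" using f_bounded unfolding bounded_iff ..
  then have Mf: "norm (f z) \<le> Mf" for z by blast
  have Mf0: "0 \<le> Mf" using order_trans[OF norm_ge_zero Mf] .
  have mT: "measure (leb T) (space (leb T)) = T" using T_pos
    by (simp add: space_leb measure_restrict_space)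
  interpret leb: finite_measure "leb T" by (rule finite_measure_leb)
  define c where "c = sqrt (Mf\<^sup>2 * T)"
  have fl: "l2 (leb T) (\<lambda>s. f (X s \<omega>, Y s \<omega>)) \<le> c" if \<omega>: "\<omega> \<in> space P" for \<omega>
    unfolding l2_def c_def
  proof (rule real_sqrt_le_mono)
    have "(\<integral>s. (norm (f (X s \<omega>, Y s \<omega>)))\<^sup>2 \<partial>leb T) \<le> (\<integral>s. Mf\<^sup>2 \<partial>leb T)"
      using square_integrable_path[OF \<omega>] Mf
      by (intro integral_mono power_mono) (auto simp: square_integrable_def)
    also have "\<dots> = Mf\<^sup>2 * T" using mT by simp
    finally show "(\<integral>s. (norm (f (X s \<omega>, Y s \<omega>)))\<^sup>2 \<partial>leb T) \<le> Mf\<^sup>2 * T" .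
  qed
  have "integrable P S \<and> (\<integral>\<omega>. \<bar>S \<omega>\<bar> \<partial>P) \<le> (1 + c) * l2 (leb T) g" if o: "obs g S" for g S
  proof -
    obtain Z where Z: "U.wiener g Z" "AE \<omega> in P. S \<omega> = Z \<omega> + (\<integral>s. g s \<bullet> f (X s \<omega>, Y s \<omega>) \<partial>leb T)"
      and S: "S \<in> borel_measurable P" using o unfolding obs_def by blast
    have Zi: "integrable P Z" by (rule sqi_integrable[OF U.wiener_sqi(2)[OF Z(1)]])
    have b: "AE \<omega> in P. \<bar>S \<omega>\<bar> \<le> \<bar>Z \<omega>\<bar> + l2 (leb T) g * c"
      using Z(2) AE_space
    proof eventually_elim
      fix \<omega> assume e: "S \<omega> = Z \<omega> + (\<integral>s. g s \<bullet> f (X s \<omega>, Y s \<omega>) \<partial>leb T)" and \<omega>: "\<omega> \<in> space P"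
      have "\<bar>\<integral>s. g s \<bullet> f (X s \<omega>, Y s \<omega>) \<partial>leb T\<bar> \<le> l2 (leb T) g * l2 (leb T) (\<lambda>s. f (X s \<omega>, Y s \<omega>))"
        by (rule l2_cauchy_schwarz[OF U.wiener_sqi(1)[OF Z(1)] square_integrable_path[OF \<omega>]])
      also have "\<dots> \<le> l2 (leb T) g * c" by (rule mult_left_mono[OF fl[OF \<omega>]]) simp
      finally show "\<bar>S \<omega>\<bar> \<le> \<bar>Z \<omega>\<bar> + l2 (leb T) g * c" unfolding e by linarith
    qed
    have ib: "integrable P (\<lambda>\<omega>. \<bar>Z \<omega>\<bar> + l2 (leb T) g * c)" using Zi by simp
    have Si: "integrable P S"
      by (rule Bochner_Integration.integrable_bound[OF ib S]) (use b in \<open>eventually_elim, auto\<close>)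
    have "(\<integral>\<omega>. \<bar>S \<omega>\<bar> \<partial>P) \<le> (\<integral>\<omega>. \<bar>Z \<omega>\<bar> + l2 (leb T) g * c \<partial>P)"
      by (rule integral_mono_AE[OF _ ib b]) (use Si in simp)
    also have "\<dots> = (\<integral>\<omega>. norm (Z \<omega>) \<partial>P) + l2 (leb T) g * c" using Zi by (simp add: prob_space)
    also have "(\<integral>\<omega>. norm (Z \<omega>) \<partial>P) \<le> l2 P Z" using l1_le_l2[OF U.wiener_sqi(2)[OF Z(1)]] by (simp add: prob_space)
    finally show ?thesis using Si unfolding U.wiener_l2[OF Z(1)] by (simp add: algebra_simps)
  qed
  with that show ?thesis by blast
qed

section \<open>Approximating observation functionals\<close>

text \<open>The Wiener integral of \<open>1\<^bsub>[0,r]\<^esub>\<close> lies in the closed span of \<open>U\<close> up to time \<open>r\<close>. Its residual after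
  projection is Gaussian and orthogonal to the driving path up to \<open>r\<close>, hence independent of the
  past, but it is also measurable with respect to that past, hence it vanishes.\<close>

lemma VU_adapted_approx:
  fixes k :: 'y
  assumes r: "r \<in> {0..T}"
  obtains b where "\<And>n. b n \<in> steps r" "L2_tendsto (leb T) (\<lambda>n. Kstar_step K (b n)) (ind_upto k r)"
proof -
  let ?V = "\<lambda>\<omega>. VU r \<omega> $ k"
  let ?C = "{step_apply U b | b. b \<in> (steps r :: 'y step set)}"
  have sub: "steps r \<subseteq> (steps T :: 'y step set)" using r by (intro steps_mono) simp
  have Vs: "square_integrable P ?V" by (rule U.wiener_sqi(2)[OF wiener_VU[OF r]])
  have Cs: "square_integrable P c" if c: "c \<in> ?C" for c
  proof -
    obtain b where b: "b \<in> steps r" "c = step_apply U b" using c by blast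
    show ?thesis unfolding b(2) by (rule U.step_sqi[OF subsetD[OF sub b(1)]])
  qed
  have ne: "?C \<noteq> {}"
  proof -
    have "step_apply U 0 \<in> ?C" by (intro CollectI exI[of _ 0] conjI refl steps_zero)
    then show ?thesis by blast
  qed
  have Cl: "(\<lambda>\<omega>. x *\<^sub>R c \<omega> + y *\<^sub>R d \<omega>) \<in> ?C" if cd: "c \<in> ?C" "d \<in> ?C" for c d x y
  proof -
    obtain a b where ab: "a \<in> steps r" "c = step_apply U a" "b \<in> steps r" "d = step_apply U b" using cd by blast
    have "(\<lambda>\<omega>. x *\<^sub>R c \<omega> + y *\<^sub>R d \<omega>) = step_apply U (pm_scale x a + pm_scale y b)"
      by (rule ext) (simp add: ab step_apply_add step_apply_scale)
    moreover have "pm_scale x a + pm_scale y b \<in> steps r" using ab by (intro steps_add steps_scale)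
    ultimately show ?thesis by blast
  qed
  obtain c p where c: "\<And>n. c n \<in> ?C" "L2_tendsto P c p" and orth: "\<And>d. d \<in> ?C \<Longrightarrow> (\<integral>\<omega>. (?V \<omega> - p \<omega>) \<bullet> d \<omega> \<partial>P) = 0"
    using L2_projection[OF Vs Cs ne Cl] by blast
  have "\<forall>n. \<exists>b. b \<in> steps r \<and> c n = step_apply U b" using c(1) by blast
  from choice[OF this] obtain b where b: "\<And>n. b n \<in> steps r" "\<And>n. c n = step_apply U (b n)" by blast
  have bT: "b n \<in> steps T" for n using b(1) sub by blast
  have ceq: "c = (\<lambda>n. step_apply U (b n))" by (rule ext) (rule b(2))
  have cp: "L2_tendsto P (\<lambda>n. step_apply U (b n)) p" using c(2) unfolding ceq .
  have ps: "square_integrable P p" using cp by (simp add: L2_tendsto_def)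
  define \<rho> where "\<rho> \<omega> = ?V \<omega> - p \<omega>" for \<omega>
  have \<rho>s: "square_integrable P \<rho>" unfolding \<rho>_def[abs_def] by (rule sqi_diff[OF Vs ps])
  have pch: "p \<in> first_chaos P T BU"
  proof -
    have "\<forall>n. \<exists>d. d \<in> steps T \<and> step_apply BU d = step_apply U (b n)"
    proof
      fix n obtain d where "d \<in> steps T" "step_apply BU d = step_apply U (b n)" by (rule step_U_as_BU[OF bT])
      then show "\<exists>d. d \<in> steps T \<and> step_apply BU d = step_apply U (b n)" by blast
    qed
    from choice[OF this] obtain d where d: "\<And>n. d n \<in> steps T" "\<And>n. step_apply BU (d n) = step_apply U (b n)" by blast
    have "L2_tendsto P (\<lambda>n. step_apply BU (d n)) p" using cp by (simp add: d(2))
    with d(1) show ?thesis unfolding first_chaos_def by blast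
  qed
  have \<rho>ch: "\<rho> \<in> first_chaos P T BU"
    using chaos_lincomb[OF wiener_chaos[OF wiener_VU[OF r, of k]] pch, of 1 "-1"] by (simp add: \<rho>_def[abs_def])
  have \<rho>o: "(\<integral>\<omega>. \<rho> \<omega> * BU u \<omega> $ i \<partial>P) = 0" if u: "u \<in> {0..r}" for u i
  proof -
    have uT: "u \<in> {0..T}" using u r by auto
    show ?thesis
    proof (cases i)
      case (Inr j)
      have "step_apply U (Poly_Mapping.single (j, u) 1) = (\<lambda>\<omega>. U u \<omega> $ j)" by (rule ext) simp
      moreover have "step_apply U (Poly_Mapping.single (j, u) 1) \<in> ?C"
        by (intro CollectI exI[of _ "Poly_Mapping.single (j, u) 1"] conjI refl steps_single u)
      ultimately show ?thesis using orth[of "\<lambda>\<omega>. U u \<omega> $ j"] Inr by (simp add: \<rho>_def BU_component)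
    next
      case (Inl j)
      have Bs: "square_integrable P (\<lambda>\<omega>. B u \<omega> $ j)" using component_sqi[OF uT, of "Inl j"] by (simp add: BU_component)
      have "(\<lambda>n. \<integral>\<omega>. step_apply U (b n) \<omega> * B u \<omega> $ j \<partial>P) \<longlonglongrightarrow> (\<integral>\<omega>. p \<omega> * B u \<omega> $ j \<partial>P)"
        using L2_tendsto_inner[OF cp L2_tendsto_const[OF Bs]] by simp
      moreover have "(\<integral>\<omega>. step_apply U (b n) \<omega> * B u \<omega> $ j \<partial>P) = 0" for n
        by (rule wiener_orthogonal_B[OF U.wiener_step[OF bT] uT])
      ultimately have "(\<integral>\<omega>. p \<omega> * B u \<omega> $ j \<partial>P) = 0" by (simp add: LIMSEQ_const_iff)
      moreover have "(\<integral>\<omega>. ?V \<omega> * B u \<omega> $ j \<partial>P) = 0" by (rule wiener_orthogonal_B[OF wiener_VU[OF r] uT])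
      moreover have "(\<integral>\<omega>. \<rho> \<omega> * B u \<omega> $ j \<partial>P) = (\<integral>\<omega>. ?V \<omega> * B u \<omega> $ j \<partial>P) - (\<integral>\<omega>. p \<omega> * B u \<omega> $ j \<partial>P)"
        unfolding \<rho>_def left_diff_distrib
        using sqi_inner[OF Vs Bs] sqi_inner[OF ps Bs] by (intro Bochner_Integration.integral_diff) simp_all
      ultimately show ?thesis using Inl by (simp add: BU_component)
    qed
  qed
  define c0 where "c0 = exp (- ((\<integral>\<omega>. (\<rho> \<omega>)\<^sup>2 \<partial>P) / 2))"
  have c\<rho>: "(\<integral>\<omega>. iexp (\<rho> \<omega>) \<partial>P) = complex_of_real c0" unfolding c0_def by (rule chaos_char[OF \<rho>ch])
  have \<rho>m[measurable]: "\<rho> \<in> borel_measurable P" using \<rho>s by (rule sqi_measurable)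
  define g where "g \<omega> = iexp (\<rho> \<omega>) - complex_of_real c0" for \<omega>
  have gm: "g \<in> borel_measurable P" unfolding g_def[abs_def] by measurable
  have ie: "integrable P (\<lambda>\<omega>. iexp (\<rho> \<omega>))" by (rule integrable_const_bound[of _ 1], simp) measurable
  have gi: "integrable P g" unfolding g_def[abs_def] using ie by simp
  have gb: "norm (g \<omega>) \<le> 2" for \<omega>
  proof -
    have "norm (g \<omega>) \<le> norm (iexp (\<rho> \<omega>)) + norm (complex_of_real c0)" unfolding g_def by (rule norm_triangle_ineq4)
    also have "norm (complex_of_real c0) \<le> 1" by (simp add: c0_def)
    finally show ?thesis by simp
  qed
  define G where "G = completed_past P BU r"
  have BUm: "\<And>s. s \<in> {0..r} \<Longrightarrow> BU s \<in> borel_measurable P" using I_measurable r by simp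
  have Gs: "sets G = sigma_sets (space P) (past_events P BU r \<union> null_sets P)" and Gsub: "subalgebra P G"
    unfolding G_def by (rule sets_completed_past(2), rule BUm, assumption) (rule sets_completed_past(4), rule BUm)
  have gz: "sint P A g = 0" if A: "A \<in> sets G" for A
  proof -
    have "sets G \<subseteq> raw_past P x0 BU r" unfolding Gs raw_past_def by (rule sigma_sets_mono') auto
    then have Ar: "A \<in> raw_past P x0 BU r" using A by blast
    have AM: "A \<in> sets P" using A Gsub by (auto simp: subalgebra_def)
    have "sint P A (\<lambda>\<omega>. iexp (\<rho> \<omega>)) = prob A * (\<integral>\<omega>. iexp (\<rho> \<omega>) \<partial>P)"
      by (rule chaos_indep_past[OF \<rho>ch r \<rho>o Ar])
    moreover have "sint P A g = sint P A (\<lambda>\<omega>. iexp (\<rho> \<omega>)) - prob A * c0"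
    proof -
      have "sint P A g = (\<integral>\<omega>. indicat_real A \<omega> *\<^sub>R iexp (\<rho> \<omega>) - indicat_real A \<omega> *\<^sub>R complex_of_real c0 \<partial>P)"
        by (simp add: g_def scaleR_diff_right)
      also have "\<dots> = sint P A (\<lambda>\<omega>. iexp (\<rho> \<omega>)) - (\<integral>\<omega>. indicat_real A \<omega> *\<^sub>R complex_of_real c0 \<partial>P)"
        using integrable_indicator_scale[OF ie AM] integrable_indicator_scale[of P "\<lambda>_. complex_of_real c0", OF _ AM]
        by (intro Bochner_Integration.integral_diff) simp_all
      also have "(\<integral>\<omega>. indicat_real A \<omega> *\<^sub>R complex_of_real c0 \<partial>P) = prob A * c0" using AM by (simp add: scaleR_conv_of_real)
      finally show ?thesis .
    qed
    ultimately show ?thesis using c\<rho> by simp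
  qed
  have BUG: "BU s \<in> borel_measurable G" if "s \<in> {0..r}" for s
    unfolding G_def by (rule completed_past_measurable) (rule BUm, assumption, rule that)
  have FG: "(\<lambda>\<omega>. step_apply U (b n) \<omega> - ?V \<omega>) \<in> borel_measurable G" for n
  proof -
    obtain d where d: "d \<in> steps r" "step_apply BU d = step_apply U (b n)" by (rule step_U_as_BU[OF b(1)])
    have "step_apply U (b n) \<in> borel_measurable G" unfolding d(2)[symmetric] by (rule step_apply_measurable[OF BUG d(1)])
    moreover have "?V \<in> borel_measurable G" unfolding G_def by (rule measurable_component[OF VU_completed_past[OF r]])
    ultimately show ?thesis by simp
  qed
  have "(\<integral>\<omega>. g \<omega> * iexp (step_apply U (b n) \<omega> - ?V \<omega>) \<partial>P) = 0" for n
  proof -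
    have m: "(\<lambda>\<omega>. step_apply U (b n) \<omega> - ?V \<omega>) \<in> borel_measurable P" by (rule measurable_from_subalg[OF Gsub FG])
    have "(\<integral>\<omega>. iexp (step_apply U (b n) \<omega> - ?V \<omega>) * g \<omega> \<partial>P) = 0"
    proof (rule zero_on_subalgebra[OF finite_measure_axioms Gsub gi gz])
      show "(\<lambda>\<omega>. iexp (step_apply U (b n) \<omega> - ?V \<omega>)) \<in> borel_measurable G" using FG[of n] by measurable
      show "integrable P (\<lambda>\<omega>. iexp (step_apply U (b n) \<omega> - ?V \<omega>) * g \<omega>)"
        using integrable_unimodular[OF gi m] by (simp only: mult.commute)
    qed
    then show ?thesis by (simp only: mult.commute)
  qed
  moreover have "(\<lambda>n. \<integral>\<omega>. g \<omega> * iexp (step_apply U (b n) \<omega> - ?V \<omega>) \<partial>P) \<longlonglongrightarrow> (\<integral>\<omega>. g \<omega> * iexp (p \<omega> - ?V \<omega>) \<partial>P)"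
  proof (rule iexp_L2_tendsto[OF _ gm gb])
    show "L2_tendsto P (\<lambda>n \<omega>. step_apply U (b n) \<omega> - ?V \<omega>) (\<lambda>\<omega>. p \<omega> - ?V \<omega>)"
      using L2_tendsto_add[OF cp L2_tendsto_scale[OF L2_tendsto_const[OF Vs], of "-1"]] by simp
  qed
  ultimately have "(\<integral>\<omega>. g \<omega> * iexp (p \<omega> - ?V \<omega>) \<partial>P) = 0" by (simp add: LIMSEQ_const_iff)
  \<comment> \<open>A Gaussian variable independent of itself: testing \<open>g\<close> against the conjugate of \<open>e\<^sup>i\<^sup>\<rho>\<close> gives \<open>c0\<^sup>2 = 1\<close>,
    so the variance of \<open>\<rho>\<close> vanishes.\<close>
  moreover have "g \<omega> * iexp (p \<omega> - ?V \<omega>) = 1 - complex_of_real c0 * cnj (iexp (\<rho> \<omega>))" for \<omega>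
  proof -
    have "iexp (p \<omega> - ?V \<omega>) = cnj (iexp (\<rho> \<omega>))" by (simp add: exp_cnj \<rho>_def algebra_simps)
    moreover have "iexp (\<rho> \<omega>) * cnj (iexp (\<rho> \<omega>)) = 1" by (simp add: exp_cnj mult_exp_exp)
    ultimately show ?thesis by (simp add: g_def left_diff_distrib)
  qed
  moreover have "(\<integral>\<omega>. 1 - complex_of_real c0 * cnj (iexp (\<rho> \<omega>)) \<partial>P) = 1 - complex_of_real c0 * cnj (\<integral>\<omega>. iexp (\<rho> \<omega>) \<partial>P)"
    using ie by (simp add: prob_space)
  ultimately have "1 - complex_of_real c0 * complex_of_real c0 = 0" unfolding c\<rho> by simp
  then have "c0 * c0 = 1" by (simp flip: of_real_mult)
  then have "exp (- (\<integral>\<omega>. (\<rho> \<omega>)\<^sup>2 \<partial>P)) = 1" by (simp add: c0_def mult_exp_exp)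
  then have \<rho>0: "l2 P \<rho> = 0" by (simp add: l2_def)
  have le: "l2 (leb T) (\<lambda>s. Kstar_step K (b n) s - ind_upto k r s) \<le> l2 P (\<lambda>\<omega>. step_apply U (b n) \<omega> - p \<omega>)" for n
  proof -
    have "U.wiener (\<lambda>s. Kstar_step K (b n) s - ind_upto k r s) (\<lambda>\<omega>. step_apply U (b n) \<omega> - ?V \<omega>)"
      using U.wiener_lincomb[OF U.wiener_step[OF bT] wiener_VU[OF r], of 1 n "-1" k] by simp
    from U.wiener_l2[OF this]
    have "l2 (leb T) (\<lambda>s. Kstar_step K (b n) s - ind_upto k r s) = l2 P (\<lambda>\<omega>. step_apply U (b n) \<omega> - ?V \<omega>)" ..
    also have "\<dots> \<le> l2 P (\<lambda>\<omega>. step_apply U (b n) \<omega> - p \<omega>) + l2 P (\<lambda>\<omega>. p \<omega> - ?V \<omega>)"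
      by (rule l2_triangle_diff[OF U.step_sqi[OF bT] ps Vs])
    also have "l2 P (\<lambda>\<omega>. p \<omega> - ?V \<omega>) = 0" using \<rho>0 l2_minus_commute[of P p ?V] by (simp add: \<rho>_def[abs_def])
    finally show ?thesis by simp
  qed
  have lim: "(\<lambda>n. l2 P (\<lambda>\<omega>. step_apply U (b n) \<omega> - p \<omega>)) \<longlonglongrightarrow> 0" using cp by (simp add: L2_tendsto_iff)
  have "(\<lambda>n. l2 (leb T) (\<lambda>s. Kstar_step K (b n) s - ind_upto k r s)) \<longlonglongrightarrow> 0"
  proof (rule tendsto_sandwich[OF _ _ tendsto_const lim])
    show "\<forall>\<^sub>F n in sequentially. l2 (leb T) (\<lambda>s. Kstar_step K (b n) s - ind_upto k r s) \<le> l2 P (\<lambda>\<omega>. step_apply U (b n) \<omega> - p \<omega>)"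
      by (rule always_eventually) (rule allI, rule le)
  qed simp
  then have "L2_tendsto (leb T) (\<lambda>n. Kstar_step K (b n)) (ind_upto k r)"
    using U.Kstar_step_sqi[OF bT] U.wiener_sqi(1)[OF wiener_VU[OF r]] by (simp add: L2_tendsto_iff)
  then show ?thesis by (rule that[OF b(1)])
qed

text \<open>The intervals \<open>[0, r]\<close> are stable under intersection and generate the Borel sets of \<open>[0, T]\<close>, so each
  component of \<open>h\<close> integrates to zero over every Borel set.\<close>

lemma orthogonal_indicators_zero:
  fixes h :: "real \<Rightarrow> real^'y"
  assumes h: "square_integrable (leb T) h" and o: "\<And>r k. r \<in> {0..T} \<Longrightarrow> (\<integral>s. h s \<bullet> ind_upto k r s \<partial>leb T) = 0"
  shows "l2 (leb T) h = 0"
proof -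
  interpret leb: finite_measure "leb T" by (rule finite_measure_leb)
  have hk: "square_integrable (leb T) (\<lambda>s. h s $ k)" for k
  proof -
    have "(\<lambda>s. h s $ k) \<in> borel_measurable (leb T)" by (rule measurable_component[OF sqi_measurable[OF h]])
    moreover have "integrable (leb T) (\<lambda>s. (h s $ k)\<^sup>2)"
    proof (rule Bochner_Integration.integrable_bound)
      show "integrable (leb T) (\<lambda>s. (norm (h s))\<^sup>2)" using h by (simp add: square_integrable_def)
      show "(\<lambda>s. (h s $ k)\<^sup>2) \<in> borel_measurable (leb T)" using calculation by simp
      have "(h s $ k)\<^sup>2 \<le> (norm (h s))\<^sup>2" for s
        using abs_le_square_iff[of "h s $ k" "norm (h s)"] component_le_norm_cart[of "h s" k] by simp
      then show "AE s in leb T. norm ((h s $ k)\<^sup>2) \<le> norm ((norm (h s))\<^sup>2)" by simp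
    qed
    ultimately show ?thesis by (simp add: square_integrable_def)
  qed
  have zero: "(\<integral>s. h s $ k * h s $ k \<partial>leb T) = 0" for k
  proof -
    define hc where "hc s = complex_of_real (h s $ k)" for s
    have hci: "integrable (leb T) hc" unfolding hc_def[abs_def] using leb.sqi_integrable[OF hk] by simp
    let ?E = "(\<lambda>r. {0..r}) ` {0..T}"
    have base: "sint (leb T) {0..r} hc = 0" if r: "r \<in> {0..T}" for r
    proof -
      have "h s \<bullet> ind_upto k r s = indicat_real {0..r} s * h s $ k" for s
        by (simp add: ind_upto_def inner_axis)
      then have "(\<integral>s. indicat_real {0..r} s * h s $ k \<partial>leb T) = 0" using o[OF r, of k] by simp
      then have "complex_of_real (\<integral>s. indicat_real {0..r} s * h s $ k \<partial>leb T) = 0" by simp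
      then show ?thesis unfolding integral_complex_of_real[symmetric] by (simp add: hc_def scaleR_conv_of_real)
    qed
    have E: "?E \<subseteq> sets (leb T)" by (auto simp: sets_restrict_space intro!: image_eqI[of _ _ "{0.._}"])
    have dyn: "sint (leb T) A hc = 0" if A: "A \<in> sets (leb T)" for A
    proof (rule dynkin_zero[OF hci _ E])
      show "Int_stable ?E"
      proof (rule Int_stableI)
        fix a b assume "a \<in> ?E" "b \<in> ?E"
        then obtain x y where xy: "x \<in> {0..T}" "y \<in> {0..T}" "a = {0..x}" "b = {0..y}" by blast
        then have "a \<inter> b = {0..min x y}" "min x y \<in> {0..T}" by auto
        then show "a \<inter> b \<in> ?E" by blast
      qed
      show "\<And>A. A \<in> ?E \<Longrightarrow> sint (leb T) A hc = 0" using base by blast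
      have "sint (leb T) {0..T} hc = (\<integral>s. hc s \<partial>leb T)"
        by (intro Bochner_Integration.integral_cong) (auto simp: space_leb)
      then show "(\<integral>s. hc s \<partial>leb T) = 0" using base[of T] T_pos by simp
      have EP: "?E \<subseteq> Pow (space (leb T))" by (auto simp: space_leb)
      let ?S = "sigma (space (leb T)) ?E"
      have sS: "sets ?S = sigma_sets (space (leb T)) ?E" "space ?S = space (leb T)"
        by (rule sets_measure_of[OF EP], rule space_measure_of[OF EP])
      have spS: "space ?S = {0..T}" unfolding sS(2) by (rule space_leb)
      have idm: "(\<lambda>s. s) \<in> borel_measurable ?S"
      proof (subst borel_measurable_iff_le, rule allI)
        fix a :: real
        show "{s \<in> space ?S. s \<le> a} \<in> sets ?S"
        proof (cases "a < 0")
          case True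
          then have "{s \<in> space ?S. s \<le> a} = {}" unfolding spS by auto
          then show ?thesis by (simp only: sets.empty_sets)
        next
          case False
          then have "{s \<in> space ?S. s \<le> a} = {0..min a T}" "min a T \<in> {0..T}"
            unfolding spS using T_pos by auto
          then have "{s \<in> space ?S. s \<le> a} \<in> ?E" by blast
          then show ?thesis unfolding sS(1) by (rule sigma_sets.Basic)
        qed
      qed
      obtain B where "B \<in> sets borel" "A = {0..T} \<inter> B" using A by (auto simp: sets_restrict_space)
      then have "A = (\<lambda>s. s) -` B \<inter> space ?S" "B \<in> sets borel" unfolding spS by auto
      then have "A \<in> sets ?S" using measurable_sets[OF idm, of B] by simp
      then show "A \<in> sigma_sets (space (leb T)) ?E" unfolding sS(1) .
    qed
    have ii: "integrable (leb T) (\<lambda>s. hc s * hc s)"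
    proof -
      have "integrable (leb T) (\<lambda>s. complex_of_real (h s $ k * h s $ k))"
        using hk[of k] by (simp add: square_integrable_def power2_eq_square del: of_real_mult)
      then show ?thesis by (simp add: hc_def)
    qed
    have "(\<integral>s. hc s * hc s \<partial>leb T) = 0"
      by (rule zero_on_subalgebra[OF leb.finite_measure_axioms _ hci dyn _ ii])
        (use hci in \<open>auto simp: subalgebra_def\<close>)
    then have "complex_of_real (\<integral>s. h s $ k * h s $ k \<partial>leb T) = 0"
      unfolding integral_complex_of_real[symmetric] by (simp add: hc_def)
    then show ?thesis by simp
  qed
  have "(norm (h s))\<^sup>2 = (\<Sum>k\<in>UNIV. h s $ k * h s $ k)" for s
    unfolding power2_norm_eq_inner inner_vec_def by simp
  then have "(\<integral>s. (norm (h s))\<^sup>2 \<partial>leb T) = (\<Sum>k\<in>UNIV. \<integral>s. h s $ k * h s $ k \<partial>leb T)"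
    using hk by (simp add: square_integrable_def power2_eq_square)
  then show ?thesis using zero by (simp add: l2_def)
qed

lemma steps_after_lincomb:
  assumes "v \<in> steps_after t" "w \<in> steps_after t"
  shows "pm_scale x v + pm_scale y w \<in> steps_after t"
proof -
  have keys: "Poly_Mapping.keys (pm_scale c u) \<subseteq> Poly_Mapping.keys u" for c :: real and u :: "'y step"
    by (auto simp: in_keys_iff)
  have "Poly_Mapping.keys (pm_scale x v + pm_scale y w) \<subseteq> Poly_Mapping.keys v \<union> Poly_Mapping.keys w"
    by (rule order_trans[OF Poly_Mapping.keys_add Un_mono[OF keys keys]])
  also have "\<dots> \<subseteq> UNIV \<times> {t..T}" using assms unfolding steps_after_def by (intro Un_least) simp_all
  finally show ?thesis unfolding steps_after_def by simp
qed

lemma ind_after_lincomb: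
  "ind_after t (pm_scale x v + pm_scale y w) s = x *\<^sub>R ind_after t v s + y *\<^sub>R ind_after t w s"
  by (simp add: ind_after_def lin_add lin_scale)

text \<open>The kernel of any observation functional is a limit of kernels of the observation before \<open>t\<close> plus
  step functions living after \<open>t\<close>: the residual of the projection onto these is orthogonal to all
  indicators.\<close>

lemma kernel_split_approx:
  assumes t: "t \<in> {0..T}" and a: "a \<in> (steps T :: 'y step set)"
  obtains b v where "\<forall>n. b n \<in> steps t" "\<forall>n. v n \<in> steps_after t"
    "(\<lambda>n. l2 (leb T) (\<lambda>s. Kstar_step K a s - (Kstar_step K (b n) s + ind_after t (v n) s))) \<longlonglongrightarrow> 0"
proof -
  interpret leb: finite_measure "leb T" by (rule finite_measure_leb)
  let ?C = "{\<lambda>s. Kstar_step K b s + ind_after t v s | b v. b \<in> (steps t :: 'y step set) \<and> v \<in> steps_after t}"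
  have sub: "steps t \<subseteq> (steps T :: 'y step set)" using t by (intro steps_mono) simp
  have gs: "square_integrable (leb T) (Kstar_step K a)" by (rule U.Kstar_step_sqi[OF a])
  have os: "square_integrable (leb T) g" if "obs g S" for g S using that U.wiener_sqi(1) by (auto simp: obs_def)
  have Cs: "square_integrable (leb T) c" if c: "c \<in> ?C" for c
  proof -
    obtain b v where bv: "c = (\<lambda>s. Kstar_step K b s + ind_after t v s)" "b \<in> steps t" "v \<in> steps_after t" using c by blast
    show ?thesis unfolding bv(1)
      by (intro sqi_add U.Kstar_step_sqi subsetD[OF sub bv(2)] os[OF obs_after[OF t bv(3)]])
  qed
  have z: "(0 :: 'y step) \<in> steps_after t" by (simp add: steps_after_def)
  have inC: "(\<lambda>s. Kstar_step K b s + ind_after t v s) \<in> ?C" if "b \<in> steps t" "v \<in> steps_after t" for b v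
    using that by (intro CollectI exI[of _ b] exI[of _ v] conjI refl)
  have ne: "?C \<noteq> {}" using inC[OF steps_zero z] by blast
  have Cl: "(\<lambda>s. x *\<^sub>R c s + y *\<^sub>R d s) \<in> ?C" if cd: "c \<in> ?C" "d \<in> ?C" for c d x y
  proof -
    obtain b v where bv: "c = (\<lambda>s. Kstar_step K b s + ind_after t v s)" "b \<in> steps t" "v \<in> steps_after t" using cd(1) by blast
    obtain b' v' where bv': "d = (\<lambda>s. Kstar_step K b' s + ind_after t v' s)" "b' \<in> steps t" "v' \<in> steps_after t" using cd(2) by blast
    have "(\<lambda>s. x *\<^sub>R c s + y *\<^sub>R d s) = (\<lambda>s. Kstar_step K (pm_scale x b + pm_scale y b') s + ind_after t (pm_scale x v + pm_scale y v') s)"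
      by (rule ext) (simp add: bv(1) bv'(1) Kstar_step_add Kstar_step_scale ind_after_lincomb scaleR_add_right)
    moreover have "\<dots> \<in> ?C" using bv bv' by (intro inC steps_add steps_scale steps_after_lincomb)
    ultimately show ?thesis by (simp only:)
  qed
  obtain c p where c: "\<And>n. c n \<in> ?C" "L2_tendsto (leb T) c p"
    and orth: "\<And>d. d \<in> ?C \<Longrightarrow> (\<integral>s. (Kstar_step K a s - p s) \<bullet> d s \<partial>leb T) = 0"
    using leb.L2_projection[OF gs Cs ne Cl] by blast
  have ps: "square_integrable (leb T) p" using c(2) by (simp add: L2_tendsto_def)
  define h where "h s = Kstar_step K a s - p s" for s
  have hs: "square_integrable (leb T) h" unfolding h_def[abs_def] by (rule sqi_diff[OF gs ps])
  have early: "(\<integral>s. h s \<bullet> ind_upto k r s \<partial>leb T) = 0" if r: "r \<in> {0..t}" for r k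
  proof -
    have rT: "r \<in> {0..T}" using r t by auto
    obtain b where b: "\<And>n. b n \<in> steps r" "L2_tendsto (leb T) (\<lambda>n. Kstar_step K (b n)) (ind_upto k r)"
      using VU_adapted_approx[OF rT, of k] by blast
    have "(\<integral>s. h s \<bullet> Kstar_step K (b n) s \<partial>leb T) = 0" for n
    proof -
      have "b n \<in> steps t" using b(1)[of n] steps_mono[of r t] r by auto
      from orth[OF inC[OF this z]] show ?thesis by (simp add: h_def ind_after_def)
    qed
    moreover have "(\<lambda>n. \<integral>s. h s \<bullet> Kstar_step K (b n) s \<partial>leb T) \<longlonglongrightarrow> (\<integral>s. h s \<bullet> ind_upto k r s \<partial>leb T)"
      by (rule L2_tendsto_inner[OF L2_tendsto_const[OF hs] b(2)])
    ultimately show ?thesis by (simp add: LIMSEQ_const_iff)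
  qed
  have "(\<integral>s. h s \<bullet> ind_upto k r s \<partial>leb T) = 0" if r: "r \<in> {0..T}" for r k
  proof (cases "r \<le> t")
    case True then show ?thesis using early r by simp
  next
    case False
    have v: "Poly_Mapping.single (k, r) 1 \<in> steps_after t" using False r by (simp add: steps_after_def)
    have e: "ind_after t (Poly_Mapping.single (k, r) 1) s = ind_upto k r s - ind_upto k t s" for s
      by (simp add: ind_after_def)
    have "(\<integral>s. h s \<bullet> (ind_upto k r s - ind_upto k t s) \<partial>leb T) = 0"
      using orth[OF inC[OF steps_zero v]] by (simp add: h_def e Kstar_step_lin)
    moreover have "(\<integral>s. h s \<bullet> (ind_upto k r s - ind_upto k t s) \<partial>leb T) =
        (\<integral>s. h s \<bullet> ind_upto k r s \<partial>leb T) - (\<integral>s. h s \<bullet> ind_upto k t s \<partial>leb T)"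
      unfolding inner_diff_right
      by (intro Bochner_Integration.integral_diff sqi_inner[OF hs] os[OF obs_W] r t)
    ultimately show ?thesis using early[of t k] t by simp
  qed
  then have h0: "l2 (leb T) h = 0" by (rule orthogonal_indicators_zero[OF hs])
  have "\<forall>n. \<exists>b. \<exists>v. c n = (\<lambda>s. Kstar_step K b s + ind_after t v s) \<and> b \<in> steps t \<and> v \<in> steps_after t" using c(1) by blast
  from choice[OF this] obtain b where "\<forall>n. \<exists>v. c n = (\<lambda>s. Kstar_step K (b n) s + ind_after t v s) \<and> b n \<in> steps t \<and> v \<in> steps_after t" ..
  from choice[OF this] obtain v where bv: "\<And>n. c n = (\<lambda>s. Kstar_step K (b n) s + ind_after t (v n) s)"
    "\<And>n. b n \<in> steps t" "\<And>n. v n \<in> steps_after t" by blast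
  have "(\<lambda>n. l2 (leb T) (\<lambda>s. Kstar_step K a s - c n s)) \<longlonglongrightarrow> 0"
  proof (rule tendsto_sandwich[OF always_eventually always_eventually tendsto_const])
    show "(\<lambda>n. l2 (leb T) (\<lambda>s. c n s - p s)) \<longlonglongrightarrow> 0" using c(2) by (simp add: L2_tendsto_iff)
    show "\<forall>n. l2 (leb T) (\<lambda>s. Kstar_step K a s - c n s) \<le> l2 (leb T) (\<lambda>s. c n s - p s)"
    proof
      fix n
      have "l2 (leb T) (\<lambda>s. Kstar_step K a s - c n s) \<le> l2 (leb T) (\<lambda>s. Kstar_step K a s - p s) + l2 (leb T) (\<lambda>s. p s - c n s)"
        by (rule l2_triangle_diff[OF gs ps Cs[OF c(1)]])
      then show "l2 (leb T) (\<lambda>s. Kstar_step K a s - c n s) \<le> l2 (leb T) (\<lambda>s. c n s - p s)"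
        using h0 l2_minus_commute[of "leb T" p "c n"] by (simp add: h_def[abs_def])
    qed
  qed simp
  then have "(\<lambda>n. l2 (leb T) (\<lambda>s. Kstar_step K a s - (Kstar_step K (b n) s + ind_after t (v n) s))) \<longlonglongrightarrow> 0"
    unfolding bv(1) .
  then show ?thesis using bv(2,3) by (intro that[of b v] allI)
qed

section \<open>Later observations carry no further information\<close>

lemma completed_past_Y:
  assumes t: "t \<in> {0..T}"
  shows "sets (completed_past P Y t) = sigma_sets (space P) (past_events P Y t \<union> null_sets P)"
    and "space (completed_past P Y t) = space P"
    and "subalgebra P (completed_past P Y t)" and "subalgebra Q (completed_past P Y t)"
    and "subalgebra (Fil t) (completed_past P Y t)" and "\<And>s. s \<in> {0..t} \<Longrightarrow> Y s \<in> borel_measurable (completed_past P Y t)"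
proof -
  have Ym: "\<And>s. s \<in> {0..t} \<Longrightarrow> Y s \<in> borel_measurable P" using Y_measurable t by simp
  show 1: "sets (completed_past P Y t) = sigma_sets (space P) (past_events P Y t \<union> null_sets P)"
    by (rule sets_completed_past(2)) (rule Ym)
  show 2: "space (completed_past P Y t) = space P" by (rule sets_completed_past(3)) (rule Ym)
  show 3: "subalgebra P (completed_past P Y t)" by (rule sets_completed_past(4)) (rule Ym)
  then show "subalgebra Q (completed_past P Y t)" by (simp add: subalgebra_def sets_Q space_Q)
  have "past_events P Y t \<subseteq> sets (Fil t)"
  proof
    fix A assume "A \<in> past_events P Y t"
    then obtain s C where s: "s \<in> {0..t}" "C \<in> sets borel" "A = Y s -` C \<inter> space P"
      unfolding past_events_def gen_events_def by blast
    then have sT: "s \<in> {0..T}" "s \<le> t" using t by auto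
    have "Y s \<in> borel_measurable (Fil t)" by (rule measurable_from_subalg[OF Fil_Fil[OF sT(1) t sT(2)] Y_Fil[OF sT(1)]])
    from measurable_sets[OF this s(2)] show "A \<in> sets (Fil t)" unfolding s(3) space_Fil[OF t] .
  qed
  then have "past_events P Y t \<union> null_sets P \<subseteq> sets (Fil t)" using null_sets_Fil[OF t] by (rule Un_least)
  then have "sigma_sets (space (Fil t)) (past_events P Y t \<union> null_sets P) \<subseteq> sets (Fil t)" by (rule sets.sigma_sets_subset)
  then show "subalgebra (Fil t) (completed_past P Y t)" unfolding subalgebra_def 1 2 space_Fil[OF t] by simp
  show "Y s \<in> borel_measurable (completed_past P Y t)" if "s \<in> {0..t}" for s
    by (rule completed_past_measurable) (rule Ym, assumption, rule that)
qed

text \<open>An observation functional splits, up to a small error, into a functional of the observation up to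
  \<open>t\<close> and one of the increments of \<open>W\<close> after \<open>t\<close>; the second is independent of everything known at
  \<open>t\<close>, the first is seen by the conditioning.\<close>

lemma exp_observation_orthogonal:
  fixes Z :: "'w \<Rightarrow> complex"
  assumes t: "t \<in> {0..T}" and Z: "Z \<in> borel_measurable (Fil t)" "integrable Q Z"
    and z: "\<And>A. A \<in> sets (completed_past P Y t) \<Longrightarrow> sint Q A Z = 0" and a: "a \<in> steps T"
  shows "(\<integral>\<omega>. Z \<omega> * iexp (step_apply Y a \<omega>) \<partial>Q) = 0"
proof -
  note cp = completed_past_Y[OF t]
  obtain b v where bv: "\<forall>n. b n \<in> steps t" "\<forall>n. v n \<in> steps_after t"
    and lim: "(\<lambda>n. l2 (leb T) (\<lambda>s. Kstar_step K a s - (Kstar_step K (b n) s + ind_after t (v n) s))) \<longlonglongrightarrow> 0"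
    by (rule kernel_split_approx[OF t a])
  have b: "b n \<in> steps t" and v: "v n \<in> steps_after t" for n using bv by simp_all
  have bT: "b n \<in> steps T" for n using b[of n] steps_mono[of t T] t by auto
  define S where "S n \<omega> = step_apply Y (b n) \<omega> + W_after t (v n) \<omega>" for n \<omega>
  define D where "D n \<omega> = step_apply Y a \<omega> - S n \<omega>" for n \<omega>
  have oD: "obs (\<lambda>s. Kstar_step K a s - (Kstar_step K (b n) s + ind_after t (v n) s)) (D n)" for n
  proof -
    have o1: "obs (\<lambda>s. 1 *\<^sub>R Kstar_step K (b n) s + 1 *\<^sub>R ind_after t (v n) s) (\<lambda>\<omega>. 1 * step_apply Y (b n) \<omega> + 1 * W_after t (v n) \<omega>)"
      by (rule obs_lincomb[OF obs_step[OF bT] obs_after[OF t v]])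
    from obs_lincomb[OF obs_step[OF a] o1, of 1 "-1"] show ?thesis
      by (simp add: D_def[abs_def] S_def algebra_simps)
  qed
  obtain C where C: "\<And>g S. obs g S \<Longrightarrow> integrable P S \<and> (\<integral>\<omega>. \<bar>S \<omega>\<bar> \<partial>P) \<le> C * l2 (leb T) g"
    using obs_L1 by blast
  have Di: "integrable P (D n)" for n using C[OF oD] by simp
  have Dlim: "(\<lambda>n. \<integral>\<omega>. norm (D n \<omega>) \<partial>P) \<longlonglongrightarrow> 0"
  proof (rule tendsto_sandwich[OF _ _ tendsto_const])
    show "\<forall>\<^sub>F n in sequentially. (\<integral>\<omega>. norm (D n \<omega>) \<partial>P) \<le> C * l2 (leb T) (\<lambda>s. Kstar_step K a s - (Kstar_step K (b n) s + ind_after t (v n) s))"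
      using C[OF oD] by simp
    show "(\<lambda>n. C * l2 (leb T) (\<lambda>s. Kstar_step K a s - (Kstar_step K (b n) s + ind_after t (v n) s))) \<longlonglongrightarrow> 0"
      using tendsto_mult_right_zero[OF lim] by simp
  qed simp
  obtain r where r: "strict_mono r" "AE \<omega> in P. (\<lambda>n. D (r n) \<omega>) \<longlonglongrightarrow> 0"
    using tendsto_L1_AE_subseq[OF Di Dlim] by blast
  have YQ: "step_apply Y d \<in> borel_measurable Q" if "d \<in> steps T" for d
    unfolding measurable_Q by (rule step_apply_measurable[OF Y_measurable that])
  have WQ: "W_after t (v n) \<in> borel_measurable Q" for n
    by (rule measurable_from_subalg[OF Fil_subalgebra_Q[OF T_in] W_after_Fil[OF t v]])
  have Sm: "S n \<in> borel_measurable Q" for n unfolding S_def[abs_def] using YQ[OF bT] WQ by simp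
  have zero: "(\<integral>\<omega>. Z \<omega> * iexp (S n \<omega>) \<partial>Q) = 0" for n
  proof -
    define cW where "cW = complex_of_real (exp (- (\<integral>s. (norm (ind_after t (v n) s))\<^sup>2 \<partial>leb T) / 2))"
    define g where "g \<omega> = iexp (W_after t (v n) \<omega>) - cW" for \<omega>
    note [measurable] = WQ[of n]
    have ie: "integrable Q (\<lambda>\<omega>. iexp (W_after t (v n) \<omega>))" by (rule Q.integrable_const_bound[of _ 1], simp) measurable
    have gi: "integrable Q g" unfolding g_def[abs_def] using ie by simp
    have gz: "sint Q A g = 0" if A: "A \<in> sets (Fil t)" for A
    proof -
      have AQ: "A \<in> sets Q" using A Fil_subalgebra_Q[OF t] by (auto simp: subalgebra_def)
      have "sint Q A g = (\<integral>\<omega>. indicat_real A \<omega> *\<^sub>R iexp (W_after t (v n) \<omega>) - indicat_real A \<omega> *\<^sub>R cW \<partial>Q)"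
        by (simp add: g_def scaleR_diff_right)
      also have "\<dots> = sint Q A (\<lambda>\<omega>. iexp (W_after t (v n) \<omega>)) - (\<integral>\<omega>. indicat_real A \<omega> *\<^sub>R cW \<partial>Q)"
        using integrable_indicator_scale[OF ie AQ] integrable_indicator_scale[of Q "\<lambda>_. cW", OF _ AQ]
        by (intro Bochner_Integration.integral_diff) simp_all
      also have "(\<integral>\<omega>. indicat_real A \<omega> *\<^sub>R cW \<partial>Q) = Q.prob A * cW" using AQ by (simp add: scaleR_conv_of_real)
      also have "sint Q A (\<lambda>\<omega>. iexp (W_after t (v n) \<omega>)) = cW * Q.prob A" unfolding cW_def by (rule girsanov_Q[OF t A v])
      finally show ?thesis by simp
    qed
    let ?Z = "\<lambda>\<omega>. Z \<omega> * iexp (step_apply Y (b n) \<omega>)"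
    have Yb: "step_apply Y (b n) \<in> borel_measurable (completed_past P Y t)" by (rule step_apply_measurable[OF cp(6) b])
    have Yb': "step_apply Y (b n) \<in> borel_measurable (Fil t)" by (rule measurable_from_subalg[OF cp(5) Yb])
    have Zm: "?Z \<in> borel_measurable (Fil t)" using Z(1) Yb' by measurable
    have Zi: "integrable Q ?Z" by (rule integrable_unimodular[OF Z(2) YQ[OF bT]])
    have i1: "integrable Q (\<lambda>\<omega>. ?Z \<omega> * iexp (W_after t (v n) \<omega>))" by (rule integrable_unimodular[OF Zi WQ])
    have e: "?Z \<omega> * g \<omega> = ?Z \<omega> * iexp (W_after t (v n) \<omega>) - ?Z \<omega> * cW" for \<omega> by (simp add: g_def right_diff_distrib)
    have i2: "integrable Q (\<lambda>\<omega>. ?Z \<omega> * g \<omega>)" unfolding e using i1 Zi by (intro Bochner_Integration.integrable_diff integrable_mult_left)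
    have "(\<integral>\<omega>. ?Z \<omega> * g \<omega> \<partial>Q) = 0"
      by (rule zero_on_subalgebra[OF Q.finite_measure_axioms Fil_subalgebra_Q[OF t] gi gz Zm i2])
    moreover have "(\<integral>\<omega>. ?Z \<omega> * g \<omega> \<partial>Q) = (\<integral>\<omega>. ?Z \<omega> * iexp (W_after t (v n) \<omega>) \<partial>Q) - (\<integral>\<omega>. ?Z \<omega> \<partial>Q) * cW"
    proof -
      have "(\<integral>\<omega>. ?Z \<omega> * g \<omega> \<partial>Q) = (\<integral>\<omega>. ?Z \<omega> * iexp (W_after t (v n) \<omega>) \<partial>Q) - (\<integral>\<omega>. ?Z \<omega> * cW \<partial>Q)"
        unfolding e by (intro Bochner_Integration.integral_diff i1 integrable_mult_left Zi)
      then show ?thesis by simp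
    qed
    moreover have "(\<integral>\<omega>. ?Z \<omega> \<partial>Q) = 0"
    proof -
      have "(\<integral>\<omega>. iexp (step_apply Y (b n) \<omega>) * Z \<omega> \<partial>Q) = 0"
      proof (rule zero_on_subalgebra[OF Q.finite_measure_axioms cp(4) Z(2) z])
        show "(\<lambda>\<omega>. iexp (step_apply Y (b n) \<omega>)) \<in> borel_measurable (completed_past P Y t)" using Yb by measurable
        show "integrable Q (\<lambda>\<omega>. iexp (step_apply Y (b n) \<omega>) * Z \<omega>)" using Zi by (simp only: mult.commute)
      qed
      then show ?thesis by (simp only: mult.commute)
    qed
    moreover have "?Z \<omega> * iexp (W_after t (v n) \<omega>) = Z \<omega> * iexp (S n \<omega>)" for \<omega>
      by (simp add: S_def distrib_left exp_add)
    ultimately show ?thesis by simp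
  qed
  have "(\<lambda>n. \<integral>\<omega>. Z \<omega> * iexp (S (r n) \<omega>) \<partial>Q) \<longlonglongrightarrow> (\<integral>\<omega>. Z \<omega> * iexp (step_apply Y a \<omega>) \<partial>Q)"
  proof (rule integral_dominated_convergence[where w = "\<lambda>\<omega>. norm (Z \<omega>)"])
    have [measurable]: "Z \<in> borel_measurable Q" using Z(2) by simp
    note [measurable] = Sm YQ[OF a]
    show "(\<lambda>\<omega>. Z \<omega> * iexp (step_apply Y a \<omega>)) \<in> borel_measurable Q" by measurable
    show "(\<lambda>\<omega>. Z \<omega> * iexp (S (r n) \<omega>)) \<in> borel_measurable Q" for n by measurable
    show "AE \<omega> in Q. (\<lambda>n. Z \<omega> * iexp (S (r n) \<omega>)) \<longlonglongrightarrow> Z \<omega> * iexp (step_apply Y a \<omega>)"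
      using AE_Q[OF r(2)]
    proof eventually_elim
      fix \<omega> assume "(\<lambda>n. D (r n) \<omega>) \<longlonglongrightarrow> 0"
      then have "(\<lambda>n. step_apply Y a \<omega> - D (r n) \<omega>) \<longlonglongrightarrow> step_apply Y a \<omega> - 0" by (intro tendsto_diff tendsto_const)
      then have "(\<lambda>n. S (r n) \<omega>) \<longlonglongrightarrow> step_apply Y a \<omega>" by (simp add: D_def)
      then show "(\<lambda>n. Z \<omega> * iexp (S (r n) \<omega>)) \<longlonglongrightarrow> Z \<omega> * iexp (step_apply Y a \<omega>)" by (intro tendsto_intros)
    qed
    show "AE \<omega> in Q. norm (Z \<omega> * iexp (S (r n) \<omega>)) \<le> norm (Z \<omega>)" for n by (simp add: norm_mult)
  qed (use Z(2) in simp)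
  then show ?thesis by (simp add: zero LIMSEQ_const_iff)
qed

text \<open>The step functionals of \<open>Y\<close> form a class of exponents that is stable under adding multiples of components of \<open>Y\<close>,
  so orthogonality to their exponentials is orthogonality to the whole observation.\<close>

lemma orthogonal_to_observations:
  fixes Z :: "'w \<Rightarrow> complex"
  assumes t: "t \<in> {0..T}" and Z: "Z \<in> borel_measurable (Fil t)" "integrable Q Z"
    and z: "\<And>A. A \<in> sets (completed_past P Y t) \<Longrightarrow> sint Q A Z = 0" and A: "A \<in> sets (completed_past P Y T)"
  shows "sint Q A Z = 0"
proof (rule fourier_zero[where I = "UNIV \<times> {0..T}" and X = "\<lambda>i \<omega>. Y (snd i) \<omega> $ fst i"
      and L = "{step_apply Y a | a. a \<in> steps T}", OF Z(2)])
  show "(\<lambda>\<omega>. Y (snd i) \<omega> $ fst i) \<in> borel_measurable Q" if "i \<in> UNIV \<times> {0..T}" for i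
    unfolding measurable_Q using that by (intro measurable_component Y_measurable) auto
  show "S \<in> borel_measurable Q" if S: "S \<in> {step_apply Y a | a. a \<in> steps T}" for S
  proof -
    obtain a where "a \<in> steps T" "S = step_apply Y a" using S by blast
    then show ?thesis unfolding measurable_Q using step_apply_measurable[OF Y_measurable] by simp
  qed
  show "(\<lambda>\<omega>. 0) \<in> {step_apply Y a | a. a \<in> steps T}" using steps_zero by (intro CollectI exI[of _ 0]) auto
  show "(\<lambda>\<omega>. S \<omega> + c * (Y (snd i) \<omega> $ fst i)) \<in> {step_apply Y a | a. a \<in> steps T}"
    if S: "S \<in> {step_apply Y a | a. a \<in> steps T}" and i: "i \<in> UNIV \<times> {0..T}" for S i c
  proof -
    obtain a where a: "a \<in> steps T" "S = step_apply Y a" using S by blast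
    have "a + Poly_Mapping.single (fst i, snd i) c \<in> steps T" using i by (intro steps_add a steps_single) auto
    moreover have "(\<lambda>\<omega>. S \<omega> + c * (Y (snd i) \<omega> $ fst i)) = step_apply Y (a + Poly_Mapping.single (fst i, snd i) c)"
      unfolding a(2) by (rule ext) (simp only: step_apply_add step_apply_single)
    ultimately show ?thesis by blast
  qed
  show "(\<integral>\<omega>. Z \<omega> * iexp (S \<omega>) \<partial>Q) = 0" if S: "S \<in> {step_apply Y a | a. a \<in> steps T}" for S
  proof -
    obtain a where a: "a \<in> steps T" "S = step_apply Y a" using S by blast
    show ?thesis unfolding a(2) by (rule exp_observation_orthogonal[OF t Z z a(1)])
  qed
  show "A \<in> sigma_sets (space Q) ((\<Union>i\<in>UNIV \<times> {0..T}. {(\<lambda>\<omega>. Y (snd i) \<omega> $ fst i) -` C \<inter> space Q | C. C \<in> sets borel}) \<union> null_sets Q)"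
    unfolding space_Q null_Q
    by (rule subsetD[OF past_events_components]) (use A completed_past_Y(1)[OF T_in] in simp)
qed

lemma cond_subalgebra:
  assumes "prob_space M" "subalgebra M G" shows "sigma_finite_subalgebra M G"
proof -
  have "finite_measure_subalgebra M G"
    using assms by (simp add: finite_measure_subalgebra_def finite_measure_subalgebra_axioms_def prob_space_def)
  then show ?thesis by (rule finite_measure_subalgebra_is_sigma_finite)
qed

text \<open>The residual \<open>H - E[H | Y up to t]\<close> is orthogonal to the observation up to \<open>t\<close>, hence to the whole observation.\<close>

lemma cond_exp_no_future:
  fixes H :: "'w \<Rightarrow> real"
  assumes t: "t \<in> {0..T}" and H: "H \<in> borel_measurable (Fil t)" "integrable Q H"
  shows "AE \<omega> in Q. real_cond_exp Q (completed_past P Y T) H \<omega> = real_cond_exp Q (completed_past P Y t) H \<omega>"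
proof -
  note cpt = completed_past_Y[OF t] and cpT = completed_past_Y[OF T_in]
  interpret ct: sigma_finite_subalgebra Q "completed_past P Y t" by (rule cond_subalgebra[OF Q_prob cpt(4)])
  interpret cT: sigma_finite_subalgebra Q "completed_past P Y T" by (rule cond_subalgebra[OF Q_prob cpT(4)])
  define G where "G = real_cond_exp Q (completed_past P Y t) H"
  have Gi: "integrable Q G" unfolding G_def by (rule ct.real_cond_exp_int(1)[OF H(2)])
  have Gm: "G \<in> borel_measurable (completed_past P Y t)" unfolding G_def by (rule borel_measurable_cond_exp)
  define Z where "Z \<omega> = complex_of_real (H \<omega> - G \<omega>)" for \<omega>
  have Zm: "Z \<in> borel_measurable (Fil t)"
    unfolding Z_def[abs_def] using H(1) measurable_from_subalg[OF cpt(5) Gm] by measurable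
  have Zi: "integrable Q Z" unfolding Z_def[abs_def] using H(2) Gi by simp
  have split: "sint Q A Z = complex_of_real ((\<integral>\<omega>. indicat_real A \<omega> * H \<omega> \<partial>Q) - (\<integral>\<omega>. indicat_real A \<omega> * G \<omega> \<partial>Q))"
    if A: "A \<in> sets Q" for A
  proof -
    have "sint Q A Z = (\<integral>\<omega>. complex_of_real (indicat_real A \<omega> * H \<omega> - indicat_real A \<omega> * G \<omega>) \<partial>Q)"
      by (intro Bochner_Integration.integral_cong) (auto simp: Z_def scaleR_conv_of_real algebra_simps)
    also have "\<dots> = complex_of_real (\<integral>\<omega>. indicat_real A \<omega> * H \<omega> - indicat_real A \<omega> * G \<omega> \<partial>Q)"
      by (rule integral_complex_of_real)
    also have "(\<integral>\<omega>. indicat_real A \<omega> * H \<omega> - indicat_real A \<omega> * G \<omega> \<partial>Q) = (\<integral>\<omega>. indicat_real A \<omega> * H \<omega> \<partial>Q) - (\<integral>\<omega>. indicat_real A \<omega> * G \<omega> \<partial>Q)"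
      using integrable_mult_indicator[OF A H(2)] integrable_mult_indicator[OF A Gi] by simp
    finally show ?thesis .
  qed
  have z: "sint Q A Z = 0" if A: "A \<in> sets (completed_past P Y t)" for A
  proof -
    have AQ: "A \<in> sets Q" using A cpt(4) by (auto simp: subalgebra_def)
    have "(\<integral>\<omega>\<in>A. H \<omega> \<partial>Q) = (\<integral>\<omega>\<in>A. G \<omega> \<partial>Q)" unfolding G_def by (rule ct.real_cond_exp_intA[OF H(2) A])
    then show ?thesis unfolding split[OF AQ] by (simp add: set_lebesgue_integral_def)
  qed
  have "AE \<omega> in Q. real_cond_exp Q (completed_past P Y T) H \<omega> = G \<omega>"
  proof (rule cT.real_cond_exp_charact[OF _ H(2) Gi])
    fix A assume A: "A \<in> sets (completed_past P Y T)"
    have AQ: "A \<in> sets Q" using A cpT(4) by (auto simp: subalgebra_def)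
    have "sint Q A Z = 0" by (rule orthogonal_to_observations[OF t Zm Zi z A])
    then have "(\<integral>\<omega>. indicat_real A \<omega> * H \<omega> \<partial>Q) = (\<integral>\<omega>. indicat_real A \<omega> * G \<omega> \<partial>Q)" unfolding split[OF AQ] by simp
    then show "(\<integral>\<omega>\<in>A. H \<omega> \<partial>Q) = (\<integral>\<omega>\<in>A. G \<omega> \<partial>Q)" by (simp add: set_lebesgue_integral_def)
  next
    have "past_events P Y t \<union> null_sets P \<subseteq> past_events P Y T \<union> null_sets P"
      unfolding past_events_def using t by (intro Un_mono UN_mono) auto
    then have "subalgebra (completed_past P Y T) (completed_past P Y t)"
      unfolding subalgebra_def cpt(1,2) cpT(1,2) by (simp add: sigma_sets_mono')
    then show "G \<in> borel_measurable (completed_past P Y T)" using Gm by (rule measurable_from_subalg)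
  qed
  then show ?thesis unfolding G_def .
qed

text \<open>Bayes' formula at the level of the observation up to \<open>t\<close>, then conditioning on the whole
  observation under the reference measure.\<close>

lemma kallianpur_striebel:
  fixes H :: "'w \<Rightarrow> real"
  assumes t: "t \<in> {0..T}" and H: "H \<in> borel_measurable (Fil t)" "integrable P H"
  shows "AE \<omega> in Q. real_cond_exp P (completed_past P Y t) H \<omega> =
     real_cond_exp Q (completed_past P Y T) (\<lambda>\<omega>. H \<omega> * Lik t \<omega>) \<omega> / real_cond_exp Q (completed_past P Y T) (Lik t) \<omega>"
proof -
  note cp = completed_past_Y[OF t]
  let ?G = "completed_past P Y t"
  interpret cP: sigma_finite_subalgebra P ?G by (rule cond_subalgebra[OF prob_space_axioms cp(3)])
  interpret cQ: sigma_finite_subalgebra Q ?G by (rule cond_subalgebra[OF Q_prob cp(4)])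
  define \<pi> where "\<pi> = real_cond_exp P ?G H"
  have \<pi>i: "integrable P \<pi>" unfolding \<pi>_def by (rule cP.real_cond_exp_int(1)[OF H(2)])
  have \<pi>G: "\<pi> \<in> borel_measurable ?G" unfolding \<pi>_def by (rule borel_measurable_cond_exp)
  have \<pi>F: "\<pi> \<in> borel_measurable (Fil t)" by (rule measurable_from_subalg[OF cp(5) \<pi>G])
  have HL: "integrable Q (\<lambda>\<omega>. H \<omega> * Lik t \<omega>)"
    using change_of_measure(1)[OF t H(1)] H(2) by (simp add: mult.commute)
  have \<pi>L: "integrable Q (\<lambda>\<omega>. \<pi> \<omega> * Lik t \<omega>)"
    using change_of_measure(1)[OF t \<pi>F] \<pi>i by (simp add: mult.commute)
  have Li: "integrable Q (Lik t)"
    using change_of_measure(1)[OF t borel_measurable_const[of "1 :: real"]] by simp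
  have Lm: "Lik t \<in> borel_measurable Q" using Li by simp
  define N where "N = real_cond_exp Q ?G (\<lambda>\<omega>. H \<omega> * Lik t \<omega>)"
  define D where "D = real_cond_exp Q ?G (Lik t)"
  have transfer: "(\<integral>\<omega>\<in>A. h \<omega> \<partial>P) = (\<integral>\<omega>\<in>A. h \<omega> * Lik t \<omega> \<partial>Q)"
    if A: "A \<in> sets ?G" and h: "h \<in> borel_measurable (Fil t)" for A and h :: "'w \<Rightarrow> real"
  proof -
    have "A \<in> sets (Fil t)" using A cp(5) by (auto simp: subalgebra_def)
    then have "(\<lambda>\<omega>. indicat_real A \<omega> * h \<omega>) \<in> borel_measurable (Fil t)" using h by simp
    from change_of_measure(2)[OF t this] show ?thesis by (simp add: set_lebesgue_integral_def mult_ac)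
  qed
  have "AE \<omega> in Q. real_cond_exp Q ?G (\<lambda>\<omega>. \<pi> \<omega> * Lik t \<omega>) \<omega> = N \<omega>"
  proof (rule cQ.real_cond_exp_charact[OF _ \<pi>L])
    show "integrable Q N" unfolding N_def by (rule cQ.real_cond_exp_int(1)[OF HL])
    show "N \<in> borel_measurable ?G" unfolding N_def by (rule borel_measurable_cond_exp)
    fix A assume A: "A \<in> sets ?G"
    have "(\<integral>\<omega>\<in>A. \<pi> \<omega> * Lik t \<omega> \<partial>Q) = (\<integral>\<omega>\<in>A. \<pi> \<omega> \<partial>P)" by (rule transfer[OF A \<pi>F, symmetric])
    also have "\<dots> = (\<integral>\<omega>\<in>A. H \<omega> \<partial>P)" unfolding \<pi>_def by (rule cP.real_cond_exp_intA[OF H(2) A, symmetric])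
    also have "\<dots> = (\<integral>\<omega>\<in>A. H \<omega> * Lik t \<omega> \<partial>Q)" by (rule transfer[OF A H(1)])
    also have "\<dots> = (\<integral>\<omega>\<in>A. N \<omega> \<partial>Q)" unfolding N_def by (rule cQ.real_cond_exp_intA[OF HL A])
    finally show "(\<integral>\<omega>\<in>A. \<pi> \<omega> * Lik t \<omega> \<partial>Q) = (\<integral>\<omega>\<in>A. N \<omega> \<partial>Q)" .
  qed
  moreover have "AE \<omega> in Q. real_cond_exp Q ?G (\<lambda>\<omega>. \<pi> \<omega> * Lik t \<omega>) \<omega> = \<pi> \<omega> * D \<omega>"
    unfolding D_def by (rule cQ.real_cond_exp_mult[OF \<pi>G Lm \<pi>L])
  moreover have "AE \<omega> in Q. D \<omega> > 0"
    unfolding D_def by (rule cQ.real_cond_exp_gr_c[OF Li]) (simp add: Lik_pos)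
  moreover have "AE \<omega> in Q. real_cond_exp Q (completed_past P Y T) (\<lambda>\<omega>. H \<omega> * Lik t \<omega>) \<omega> = N \<omega>"
    unfolding N_def using H(1) Lik_Fil[OF t] by (intro cond_exp_no_future[OF t _ HL]) simp
  moreover have "AE \<omega> in Q. real_cond_exp Q (completed_past P Y T) (Lik t) \<omega> = D \<omega>"
    unfolding D_def by (rule cond_exp_no_future[OF t Lik_Fil[OF t] Li])
  ultimately have "AE \<omega> in Q. \<pi> \<omega> = real_cond_exp Q (completed_past P Y T) (\<lambda>\<omega>. H \<omega> * Lik t \<omega>) \<omega> / real_cond_exp Q (completed_past P Y T) (Lik t) \<omega>"
    by eventually_elim (simp add: eq_divide_eq)
  then show ?thesis unfolding \<pi>_def .
qed

end

section \<open>The filtering formula\<close>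

theorem proposition4p1:
  fixes P Q :: "'w measure"
    and T p q c :: real
    and K :: "real \<Rightarrow> real \<Rightarrow> real"
    and B :: "real \<Rightarrow> 'w \<Rightarrow> real^'b"
    and U VU W Y :: "real \<Rightarrow> 'w \<Rightarrow> real^'y"
    and R :: "'w \<Rightarrow> ('b + 'y) tensor_path"
    and x0 :: "'w \<Rightarrow> real^'x"
    and X :: "real \<Rightarrow> 'w \<Rightarrow> real^'x"
    and f :: "(real^'x) \<times> (real^'y) \<Rightarrow> real^'y"
    and \<sigma> :: "(real^'x) \<times> (real^'y) \<Rightarrow> real^'b^'x"
    and F :: "real \<Rightarrow> 'w measure"
    and J :: "'y \<Rightarrow> real \<Rightarrow> 'w \<Rightarrow> real"
    and \<Lambda> :: "real \<Rightarrow> 'w \<Rightarrow> real"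
    and \<phi> :: "real^'x \<Rightarrow> real"
    and t :: real
  assumes "prob_space P"
    and "T > 0"
    and "volterra_kernel T K"
    and "volterra_gaussian P T K (joint_process B U)"
    and cov: "cond_Cov P T K (joint_process B U) p R"
    and cm: "cond_CM P T (joint_process B U) p q c"
    and filt: "cond_Filt P T K (joint_process B U)"
    and "Cb 2 f"
    and "Cb (nat \<lfloor>p\<rfloor> + 1) \<sigma>"
    and "x0 \<in> borel_measurable P"
    and "\<And>r. r \<ge> 1 \<Longrightarrow> integrable P (\<lambda>\<omega>. norm (x0 \<omega>) powr r)"
    and "prob_space.indep_set P (sigma_sets (space P) (gen_events P x0))
           (sigma_sets (space P) (past_events P (joint_process B U) T))"
    and F: "F = usual_augmentation P T x0 (joint_process B U)"
    and "\<And>s. s \<in> {0..T} \<Longrightarrow> X s \<in> borel_measurable (F s)"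
    and "\<And>s. s \<in> {0..T} \<Longrightarrow> Y s \<in> borel_measurable (F s)"
    and "\<And>\<omega>. \<omega> \<in> space P \<Longrightarrow> continuous_on {0..T} (\<lambda>s. X s \<omega>)"
    and "\<And>\<omega>. \<omega> \<in> space P \<Longrightarrow> continuous_on {0..T} (\<lambda>s. Y s \<omega>)"
    and "AE \<omega> in P. rde_solution T K p q f \<sigma> (R \<omega>) (\<lambda>s. U s \<omega>) (x0 \<omega>) (\<lambda>s. X s \<omega>) (\<lambda>s. Y s \<omega>)"
    and "associated_bm P T K U VU"
    and W: "W = observation_bm f X Y VU"
    and "\<And>j. ito_integral P F T (\<lambda>s \<omega>. f (X s \<omega>, Y s \<omega>) $ j) (\<lambda>s \<omega>. W s \<omega> $ j) (J j)"
    and \<Lambda>: "\<Lambda> = likelihood f X Y J"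
    and "prob_space Q"
    and "sets Q = sets P"
    and "absolutely_continuous P Q"
    and "absolutely_continuous Q P"
    and "\<And>s. s \<in> {0..T} \<Longrightarrow>
           density (restr_to_subalg Q (F s)) (\<lambda>\<omega>. ennreal (\<Lambda> s \<omega>)) = restr_to_subalg P (F s)"
    and "\<phi> \<in> borel_measurable borel"
    and "bounded (range \<phi>)"
    and "t \<in> {0..T}"
  shows "AE \<omega> in Q.
     real_cond_exp P (completed_past P Y t) (\<lambda>\<omega>. \<phi> (X t \<omega>)) \<omega> =
       real_cond_exp Q (completed_past P Y T) (\<lambda>\<omega>. \<phi> (X t \<omega>) * \<Lambda> t \<omega>) \<omega>
       / real_cond_exp Q (completed_past P Y T) (\<Lambda> t) \<omega>"
proof -
  have ob: "observation P T K B U x0 VU"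
    by (intro observation.intro observation_axioms.intro volterra_process.intro volterra_process_axioms.intro
      gaussian_driver.intro gaussian_driver_axioms.intro gaussian_process.intro gaussian_process_axioms.intro assms)
  interpret ob: observation P T K B U x0 VU by (rule ob)
  have Fil: "F = ob.Fil" unfolding F ob.Fil_def ..
  have signal: "AE \<omega> in P. \<forall>t\<in>{0..T}. Y t \<omega> = volterra_op K (\<lambda>s. f (X s \<omega>, Y s \<omega>)) t + U t \<omega>"
    using assms(18) by eventually_elim (simp add: rde_solution_def Let_def)
  note hyps = assms(8,14-17) signal assms(21) assms(23,24) null_sets_equivalent[OF assms(24-26)] assms(27)
  note hyps' = hyps[unfolded Fil W \<Lambda>]
  interpret rf: reference_measure P T K B U x0 VU X Y f J Q
    by (intro reference_measure.intro reference_measure_axioms.intro filtering.intro filtering_axioms.intro ob)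
      (rule hyps'; assumption)+
  have m: "(\<lambda>\<omega>. \<phi> (X t \<omega>)) \<in> borel_measurable (ob.Fil t)"
    using measurable_compose[OF rf.X_Fil[OF assms(30)] assms(28)] .
  obtain c where "\<forall>y\<in>range \<phi>. norm y \<le> c" using assms(29) unfolding bounded_iff ..
  then have "integrable P (\<lambda>\<omega>. \<phi> (X t \<omega>))"
    using measurable_from_subalg[OF ob.Fil_subalgebra[OF assms(30)] m]
    by (intro ob.integrable_const_bound[of _ c]) auto
  from rf.kallianpur_striebel[OF assms(30) m this] show ?thesis unfolding \<Lambda> .
qed

end
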